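(* Let $1<p<\infty$. (a) The operator $\mathcal{L}_+g=(\mathcal{M}_{\ell+1}g)^\vee-\nabla_\sigma g$ is an isomorphism of $W^{1,p}(\mathbb{S})$ onto $\bm{L}^p_+(\mathbb{S})$. (b) For $g\in W^{1,p}(\mathbb{S})$ and $x\in\mathbb{B}$, $P(\mathcal{L}_+g)(x)=[2x\cdot\nabla(Pg)(x)+Pg(x)]\,x-|x|^2\nabla(Pg)(x)$. (c) $\bm{f}\in\bm{L}^p_+(\mathbb{S})$ if and only if there exists $g\in W^{1,p}(\mathbb{S})$ such that $\bm{f}(\eta)=\lim_{r\to1^-}\big([2r\eta\cdot\nabla(Pg)(r\eta)+Pg(r\eta)]r\eta-r^2\nabla(Pg)(r\eta)\big)$ for $\sigma$-a.e. $\eta\in\mathbb{S}$.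
   Context: $\mathbb{B}$ the open unit ball of $\mathbb{R}^3$, $\mathbb{S}$ the unit sphere, $\sigma$ surface measure. $P(x,\eta)=\frac{1}{4\pi}\frac{1-|x|^2}{|x-\eta|^3}$, $Pf(x)=\int_{\mathbb{S}}P(x,\eta)f(\eta)d\sigma(\eta)$ (componentwise on vector fields). $\{Y_{\ell,m}\}$ is an orthonormal basis of $L^2(\mathbb{S})$ of real spherical harmonics of degree $\ell$. Zonal multiplier: $\mathcal{M}_{\beta_\ell}(\sum a_{\ell,m}Y_{\ell,m})=\sum\beta_\ell a_{\ell,m}Y_{\ell,m}$ on distributions; $\mathcal{M}_{\ell+1}$ corresponds to $\beta_\ell=\ell+1$; $(-\Delta_\sigma)^{1/2}=\mathcal{M}_{\sqrt{\ell(\ell+1)}}$. $W^{1,p}(\mathbb{S})=\{f\in L^p:(-\Delta_\sigma)^{1/2}f\in L^p\}$ with norm $\|f\|_p+\|(-\Delta_\sigma)^{1/2}f\|_p$; for $f\in W^{1,p}$, $\nabla_\sigma f\in\bm{L}^p(\mathbb{S})$ is the $\bm{L}^p$-limit of spherical gradients of smooth approximants. $\bm{f}^\vee(\eta)=f(\eta)\eta$. $\bm{E}^+_{\ell,m}=(\ell+1)\bm{Y}^\vee_{\ell,m}-\nabla_\sigma Y_{\ell,m}$; $\bm{\pi}_+$ is the orthogonal projection of $\bm{L}^2(\mathbb{S})$ onto the closed span of $\{\bm{E}^+_{\ell,m}\}_{\ell\ge0,|m|\le\ell}$, which extends to a bounded projection on $\bm{L}^p(\mathbb{S})$, and $\bm{L}^p_+(\mathbb{S})=\bm{\pi}_+(\bm{L}^p(\mathbb{S}))$.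 *)

theory Defs
  imports "HOL-Analysis.Analysis"
begin

type_synonym R3 = "real^3"

text \<open>Surface measure sigma on S = sphere 0 1, realised as 3 times the push-forward of
Lebesgue measure on the punctured unit ball under radial projection (the cone measure),
then completed.  sigma(A) = 3 * vol {t x. 0<t<=1, x in A}; total mass 4 pi.\<close>

definition sigmaS :: "R3 measure" where
  "sigmaS = completion (density
      (distr (restrict_space lborel (ball 0 1 - {0})) (restrict_space lborel (sphere 0 1))
             (\<lambda>x. x /\<^sub>R norm x))
      (\<lambda>_. 3))"

definition Lp :: "real \<Rightarrow> (R3 \<Rightarrow> real) \<Rightarrow> bool" where
  "Lp p f \<longleftrightarrow> f \<in> borel_measurable sigmaS \<and> integrable sigmaS (\<lambda>x. \<bar>f x\<bar> powr p)"

definition Lp_norm :: "real \<Rightarrow> (R3 \<Rightarrow> real) \<Rightarrow> real" where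
  "Lp_norm p f = (\<integral>x. \<bar>f x\<bar> powr p \<partial>sigmaS) powr (1/p)"

definition Lpv :: "real \<Rightarrow> (R3 \<Rightarrow> R3) \<Rightarrow> bool" where
  "Lpv p F \<longleftrightarrow> F \<in> borel_measurable sigmaS \<and> integrable sigmaS (\<lambda>x. norm (F x) powr p)"

definition Lpv_norm :: "real \<Rightarrow> (R3 \<Rightarrow> R3) \<Rightarrow> real" where
  "Lpv_norm p F = (\<integral>x. norm (F x) powr p \<partial>sigmaS) powr (1/p)"

definition hpoly :: "nat \<Rightarrow> (nat \<Rightarrow> nat \<Rightarrow> nat \<Rightarrow> real) \<Rightarrow> R3 \<Rightarrow> real" where
  "hpoly l c x = (\<Sum>i\<le>l. \<Sum>j\<le>l - i. c i j (l - i - j) * (x$1)^i * (x$2)^j * (x$3)^(l - i - j))"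

text \<open>The Laplacian of hpoly l c vanishes identically (coefficientwise).\<close>

definition harmonic_coeffs :: "nat \<Rightarrow> (nat \<Rightarrow> nat \<Rightarrow> nat \<Rightarrow> real) \<Rightarrow> bool" where
  "harmonic_coeffs l c \<longleftrightarrow>
     (\<forall>a b d. a + b + d + 2 = l \<longrightarrow>
        real ((a+2)*(a+1)) * c (a+2) b d + real ((b+2)*(b+1)) * c a (b+2) d
        + real ((d+2)*(d+1)) * c a b (d+2) = 0)"

text \<open>The space H_l of (real) spherical harmonics of degree l: restrictions to the sphere
of homogeneous harmonic polynomials of degree l (functions are only ever used on S).\<close>

definition sph_harm :: "nat \<Rightarrow> (R3 \<Rightarrow> real) set" where
  "sph_harm l = {Y. \<exists>c. harmonic_coeffs l c \<and> Y = hpoly l c}"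

text \<open>mult_rel beta f h: h = M_beta f, i.e. the coefficient of h against every spherical
harmonic Y of degree l is beta l times that of f.  This is independent of the choice of
orthonormal basis {Y_lm}.\<close>

definition mult_rel :: "(nat \<Rightarrow> real) \<Rightarrow> (R3 \<Rightarrow> real) \<Rightarrow> (R3 \<Rightarrow> real) \<Rightarrow> bool" where
  "mult_rel beta f h \<longleftrightarrow> integrable sigmaS f \<and> integrable sigmaS h \<and>
     (\<forall>l. \<forall>Y\<in>sph_harm l.
        (\<integral>x. h x * Y x \<partial>sigmaS) = beta l * (\<integral>x. f x * Y x \<partial>sigmaS))"

definition sqrtLap :: "nat \<Rightarrow> real" where
  "sqrtLap l = sqrt (real l * (real l + 1))"

definition W1p :: "real \<Rightarrow> (R3 \<Rightarrow> real) set" where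
  "W1p p = {f. Lp p f \<and> (\<exists>h. Lp p h \<and> mult_rel sqrtLap f h)}"

definition W1p_norm :: "real \<Rightarrow> (R3 \<Rightarrow> real) \<Rightarrow> real" where
  "W1p_norm p f = Lp_norm p f + Lp_norm p (SOME h. Lp p h \<and> mult_rel sqrtLap f h)"

definition grad :: "(R3 \<Rightarrow> real) \<Rightarrow> R3 \<Rightarrow> R3" where
  "grad f x = (THE D. (f has_derivative (\<lambda>h. D \<bullet> h)) (at x))"

definition sgrad :: "(R3 \<Rightarrow> real) \<Rightarrow> R3 \<Rightarrow> R3" where
  "sgrad f x = grad f x - (x \<bullet> grad f x) *\<^sub>R x"

definition partial :: "3 \<Rightarrow> (R3 \<Rightarrow> real) \<Rightarrow> R3 \<Rightarrow> real" where
  "partial i f x = (THE d. ((\<lambda>t. f (x + t *\<^sub>R axis i 1)) has_real_derivative d) (at 0))"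

definition iter_partial :: "3 list \<Rightarrow> (R3 \<Rightarrow> real) \<Rightarrow> R3 \<Rightarrow> real" where
  "iter_partial is f = foldr partial is f"

text \<open>C^infinity functions on R^3 (smooth functions on S are exactly restrictions of these).\<close>

definition smooth :: "(R3 \<Rightarrow> real) \<Rightarrow> bool" where
  "smooth f \<longleftrightarrow> (\<forall>is. continuous_on UNIV (iter_partial is f) \<and>
      (\<forall>i x. (\<lambda>t. iter_partial is f (x + t *\<^sub>R axis i 1)) differentiable (at 0)))"

definition sgrad_rel :: "real \<Rightarrow> (R3 \<Rightarrow> real) \<Rightarrow> (R3 \<Rightarrow> R3) \<Rightarrow> bool" where
  "sgrad_rel p f G \<longleftrightarrow> Lpv p G \<and>
     (\<exists>phi. (\<forall>n. smooth (phi n)) \<and>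
        (\<lambda>n. W1p_norm p (\<lambda>x. phi n x - f x)) \<longlonglongrightarrow> 0 \<and>
        (\<lambda>n. Lpv_norm p (\<lambda>x. sgrad (phi n) x - G x)) \<longlonglongrightarrow> 0)"

definition Eplus :: "nat \<Rightarrow> (R3 \<Rightarrow> real) \<Rightarrow> R3 \<Rightarrow> R3" where
  "Eplus l Y x = (real l + 1) *\<^sub>R (Y x *\<^sub>R x) - sgrad Y x"

text \<open>Finite linear combinations of the E^+_{l,m} (H_l is a vector space, so these are
exactly sums over l<N of Eplus l Y_l with Y_l in H_l).\<close>

definition Eplus_span :: "(R3 \<Rightarrow> R3) set" where
  "Eplus_span = {F. \<exists>N Ys. (\<forall>l<N. Ys l \<in> sph_harm l) \<and>
                         F = (\<lambda>x. \<Sum>l<N. Eplus l (Ys l) x)}"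

definition proj_plus :: "(R3 \<Rightarrow> R3) \<Rightarrow> (R3 \<Rightarrow> R3) \<Rightarrow> bool" where
  "proj_plus f F \<longleftrightarrow> Lpv 2 f \<and> Lpv 2 F \<and>
     (\<exists>Fs. (\<forall>n. Fs n \<in> Eplus_span) \<and> (\<lambda>n. Lpv_norm 2 (\<lambda>x. Fs n x - F x)) \<longlonglongrightarrow> 0) \<and>
     (\<forall>l. \<forall>Y\<in>sph_harm l. (\<integral>x. (f x - F x) \<bullet> Eplus l Y x \<partial>sigmaS) = 0)"

text \<open>L^p_+ = range of the bounded extension of pi_+ to L^p (extension by continuity from
L^2 \<inter> L^p).\<close>

definition Lp_plus :: "real \<Rightarrow> (R3 \<Rightarrow> R3) set" where
  "Lp_plus p = {F. Lpv p F \<and> (\<exists>h hs Fs. Lpv p h \<and> (\<forall>n. Lpv p (hs n) \<and> Lpv 2 (hs n)) \<and>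
        (\<lambda>n. Lpv_norm p (\<lambda>x. hs n x - h x)) \<longlonglongrightarrow> 0 \<and>
        (\<forall>n. proj_plus (hs n) (Fs n)) \<and>
        (\<lambda>n. Lpv_norm p (\<lambda>x. Fs n x - F x)) \<longlonglongrightarrow> 0)}"

definition Lplus_rel :: "real \<Rightarrow> (R3 \<Rightarrow> real) \<Rightarrow> (R3 \<Rightarrow> R3) \<Rightarrow> bool" where
  "Lplus_rel p g F \<longleftrightarrow> (\<exists>h G. Lp p h \<and> mult_rel (\<lambda>l. real l + 1) g h \<and> sgrad_rel p g G \<and>
        F = (\<lambda>x. h x *\<^sub>R x - G x))"

definition Pker :: "R3 \<Rightarrow> R3 \<Rightarrow> real" where
  "Pker x y = (1 / (4 * pi)) * (1 - (norm x)^2) / (norm (x - y))^3"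

definition Poisson :: "(R3 \<Rightarrow> real) \<Rightarrow> R3 \<Rightarrow> real" where
  "Poisson f x = (\<integral>y. Pker x y * f y \<partial>sigmaS)"

definition PoissonV :: "(R3 \<Rightarrow> R3) \<Rightarrow> R3 \<Rightarrow> R3" where
  "PoissonV F x = (\<integral>y. Pker x y *\<^sub>R F y \<partial>sigmaS)"

end

(* A field F in L^p_+ is determined by its normal component h: its tangential part is -sgrad (T h),
where T has the multiplier 1/(l+1).  So everything reduces to two L^p estimates: g is in W^{1,p}
if and only if M_{l+1} g is in L^p, and sgrad T is bounded on L^p.

For the first, l+1 - sqrt(l(l+1)) is a function of 1/(l+1) given by a power series with nonnegative
coefficients of sum 1, and T is a contraction: 1/(l+1) = lim (1-s)/(1-s^{l+1}) for s -> 1-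
is a limit of averages of Poisson means.  For the second, sgrad T q = sgrad S (2q - Tq), where
S = M_{1/(2l+1)} is the Newtonian single layer potential; the kernel of sgrad S is odd along great
circles, so averaging over rotations reduces it to M. Riesz' theorem for the conjugate function on
the circle, which follows from |Im z|^p <= A (Re z)^p - B Re z^p and the mean value property.

The projection pi_+ is given by L^2 orthogonality; that F . x is in L^p for p > 2 follows by
duality from the estimate of sgrad S for the conjugate exponent. *)
theory Submission
  imports Defs "HOL-Complex_Analysis.Cauchy_Integral_Formula"
begin

text \<open>No basis is ever chosen: a multiplier is a relation between two integrable functions,
  tested on whole spaces of harmonics. That such a relation determines its value almost everywhere
  rests on radial limits: vanishing coefficients force a vanishing Poisson integral. The
  approximants behind \<open>sgrad_rel\<close> are existential, so linearity and uniqueness of the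
  gradient go through a weak gradient tested on polynomials. Bounds are proved for finite sums of
  harmonics, where multipliers act algebraically, and carried to L^p by density; a polynomial is
  such a sum on the sphere because multiplication by a coordinate sends harmonics of degree l to
  harmonics of degrees l - 1 and l + 1. The symbol 1/(2l+1) comes from the identity P = 2 x . grad N
  + N between Poisson and Newton kernels: 2r d/dr + 1 acts as 2l + 1 on homogeneous functions of
  degree l. The axes of the great circles through a fixed x form a null set of the sphere, so the
  rotation argument smears the axes by an approximate identity and removes the smearing by Fatou's
  lemma.\<close>

notation scaleR (infixr "*R" 75)

section \<open>Lebesgue norms\<close>

lemmas LINT_cong = Bochner_Integration.integral_cong
 and LINT_sum = Bochner_Integration.integral_sum
 and LINT_diff = Bochner_Integration.integral_diff
 and LINT_bound = Bochner_Integration.integrable_bound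
 and LINT_integrable_diff = Bochner_Integration.integrable_diff
 and LINT_integrable_cong = Bochner_Integration.integrable_cong

text \<open>Stated over an arbitrary measure and for Banach-valued functions, so that scalar
  functions on the sphere, vector fields and functions on the circle share all lemmas;
  \<open>Lp_eqs\<close> identifies it with the four notions of the statement.\<close>

definition in_Lp :: "'a measure => real => ('a => 'b::{banach,second_countable_topology}) => bool" where
 "in_Lp M p f \<longleftrightarrow> f \<in> borel_measurable M & integrable M (%x. norm (f x) powr p)"

definition Lp_nm :: "'a measure => real => ('a => 'b::{banach,second_countable_topology}) => real" where
 "Lp_nm M p f = (\<integral>x. norm (f x) powr p \<partial>M) powr (1/p)"

lemma Lp_nm_nonneg [simp]: "0 <= Lp_nm M p f"
 by (simp add: Lp_nm_def)

lemma Lp_nm_powr: "0 < p ==> Lp_nm M p f powr p = (\<integral>x. norm (f x) powr p \<partial>M)"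
 by (simp add: Lp_nm_def powr_powr)

lemma Lp_nm_le_iff:
 assumes "0 < p" "0 <= B"
 shows "Lp_nm M p f <= B \<longleftrightarrow> (\<integral>x. norm (f x) powr p \<partial>M) <= B powr p"
 using assms Lp_nm_powr[of p M f] powr_mono2[of p "Lp_nm M p f" B]
 by (metis Lp_nm_nonneg less_eq_real_def linorder_not_le powr_less_mono2)

text \<open>Young's inequality for \<open>a\<close> and \<open>b powr (p - 1)\<close> with exponents
  p and p/(p-1) is exactly the supporting line of t^p at b. It takes the place of second derivatives
  in the proofs of convexity and of Jensen's inequality.\<close>

lemma powr_tangent:
 fixes a b p :: real
 assumes "1 <= p" "0 <= a" "0 <= b"
 shows "b powr p + p * b powr (p - 1) * (a - b) <= a powr p"
proof (cases "p = 1 \<or> b = 0")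
 case True
 then show ?thesis using assms by (cases "b = 0") auto
next
 case False
 then have p: "1 < p" and b: "0 < b" using assms by auto
 have "a * b powr (p - 1) <= a powr p / p + (b powr (p-1)) powr (p/(p-1)) / (p/(p-1))"
  by (rule Youngs_inequality) (use p assms in \<open>auto simp: field_simps\<close>)
 also have "(b powr (p-1)) powr (p/(p-1)) = b powr p"
  using p by (simp add: powr_powr)
 finally have "p * (a * b powr (p - 1)) <= a powr p + (p - 1) * b powr p"
  using p by (simp add: field_simps)
 moreover have "b powr p = b * b powr (p - 1)"
  using b by (simp add: powr_diff)
 ultimately show ?thesis by (simp add: algebra_simps)
qed

lemma powr_convex_comb:
 fixes a b p l :: real
 assumes "1 <= p" "0 <= a" "0 <= b" "0 <= l" "l <= 1"
 shows "(l * a + (1 - l) * b) powr p <= l * a powr p + (1 - l) * b powr p"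
proof -
 define c where "c = l * a + (1 - l) * b"
 have c: "0 <= c" using assms by (simp add: c_def)
 have "l * (c powr p + p * c powr (p - 1) * (a - c)) <= l * a powr p"
  "(1 - l) * (c powr p + p * c powr (p - 1) * (b - c)) <= (1 - l) * b powr p"
  using powr_tangent[OF assms(1,2) c] powr_tangent[OF assms(1,3) c] assms
  by (auto intro!: mult_left_mono)
 moreover have "l * (c powr p + p * c powr (p - 1) * (a - c)) + (1 - l) * (c powr p + p * c powr (p - 1) * (b - c))
   = c powr p + p * c powr (p - 1) * (l * a + (1 - l) * b - c)"
  by (simp add: algebra_simps)
 moreover have "l * a + (1 - l) * b - c = 0" by (simp add: c_def)
 ultimately show ?thesis unfolding c_def[symmetric] by simp
qed

lemma powr_add_le:
 fixes a b p :: real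
 assumes "1 <= p" "0 <= a" "0 <= b"
 shows "(a + b) powr p <= 2 powr p * (a powr p + b powr p)"
proof -
 have "(a + b) powr p = 2 powr p * ((1/2) * a + (1 - 1/2) * b) powr p"
  using assms by (subst powr_mult[symmetric]) auto
 also have "... <= 2 powr p * ((1/2) * a powr p + (1 - 1/2) * b powr p)"
  using powr_convex_comb[OF assms, of "1/2"] by (intro mult_left_mono) auto
 also have "... <= 2 powr p * (a powr p + b powr p)"
 proof (rule mult_left_mono)
  have "(1/2) * u + (1 - 1/2) * v <= u + v" if "0 <= u" "0 <= v" for u v :: real
   using that by simp
  from this[OF powr_ge_zero powr_ge_zero]
  show "(1/2) * a powr p + (1 - 1/2) * b powr p <= a powr p + b powr p" .
 qed simp
 finally show ?thesis .
qed

lemma in_Lp_measurable: "in_Lp M p f ==> f \<in> borel_measurable M"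
 by (simp add: in_Lp_def)

lemma in_Lp_bound:
 assumes "in_Lp M p g" "f \<in> borel_measurable M" "0 <= p" "AE x in M. norm (f x) <= norm (g x)"
 shows "in_Lp M p f"
 unfolding in_Lp_def
proof
 have [measurable]: "f \<in> borel_measurable M" by fact
 show "integrable M (%x. norm (f x) powr p)"
  by (rule LINT_bound[of M "%x. norm (g x) powr p"])
   (use assms in \<open>auto simp: in_Lp_def intro!: powr_mono2 elim!: eventually_mono\<close>)
qed fact

lemma Lp_nm_mono:
 assumes "in_Lp M p g" "f \<in> borel_measurable M" "0 <= p" "AE x in M. norm (f x) <= norm (g x)"
 shows "Lp_nm M p f <= Lp_nm M p g"
 unfolding Lp_nm_def
proof (rule powr_mono2)
 show "(\<integral>x. norm (f x) powr p \<partial>M) <= (\<integral>x. norm (g x) powr p \<partial>M)"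
  by (rule integral_mono_AE) (use assms in_Lp_bound[OF assms] in \<open>auto simp: in_Lp_def intro!: powr_mono2 elim!: eventually_mono\<close>)
qed (use assms in auto)

lemma Lp_nm_cong_AE:
 assumes "f \<in> borel_measurable M" "g \<in> borel_measurable M" "AE x in M. f x = g x"
 shows "Lp_nm M p f = Lp_nm M p g"
proof -
 have [measurable]: "f \<in> borel_measurable M" "g \<in> borel_measurable M" by fact+
 have "(\<integral>x. norm (f x) powr p \<partial>M) = (\<integral>x. norm (g x) powr p \<partial>M)"
  by (rule integral_cong_AE) (use assms(3) in \<open>auto elim!: eventually_mono\<close>)
 then show ?thesis by (simp add: Lp_nm_def)
qed

lemma in_Lp_cong_AE:
 assumes "in_Lp M p f" "g \<in> borel_measurable M" "AE x in M. f x = g x"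
 shows "in_Lp M p g"
proof -
 have [measurable]: "f \<in> borel_measurable M" "g \<in> borel_measurable M" using assms by (auto simp: in_Lp_def)
 have "integrable M (%x. norm (g x) powr p) \<longleftrightarrow> integrable M (%x. norm (f x) powr p)"
  by (rule integrable_cong_AE) (use assms(3) in \<open>auto elim!: eventually_mono\<close>)
 then show ?thesis using assms by (simp add: in_Lp_def)
qed

lemma in_Lp_zero [simp]: "in_Lp M p (%x. 0)" by (simp add: in_Lp_def)

lemma Lp_nm_zero [simp]: "Lp_nm M p (%x. 0) = 0" by (simp add: Lp_nm_def)

lemma in_Lp_scaleR:
 assumes "in_Lp M p f" shows "in_Lp M p (%x. c *R f x)"
 using assms by (auto simp: in_Lp_def powr_mult)

lemma Lp_nm_scaleR:
 assumes "0 < p" shows "Lp_nm M p (%x. c *R f x) = \<bar>c\<bar> * Lp_nm M p f"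
proof -
 have "Lp_nm M p (%x. c *R f x) = (\<bar>c\<bar> powr p * (\<integral>x. norm (f x) powr p \<partial>M)) powr (1/p)"
  by (simp add: Lp_nm_def powr_mult)
 also have "... = \<bar>c\<bar> * Lp_nm M p f"
  unfolding Lp_nm_def using assms
  by (subst powr_mult) (auto simp: powr_powr)
 finally show ?thesis .
qed

lemma in_Lp_add:
 assumes f: "in_Lp M p f" and g: "in_Lp M p g" and p: "1 <= p"
 shows "in_Lp M p (%x. f x + g x)"
proof -
 have [measurable]: "f \<in> borel_measurable M" "g \<in> borel_measurable M" using assms by (auto simp: in_Lp_def)
 have "integrable M (%x. norm (f x + g x) powr p)"
 proof (rule LINT_bound)
  show "integrable M (%x. 2 powr p * (norm (f x) powr p + norm (g x) powr p))"
   using f g by (auto simp: in_Lp_def)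
  show "AE x in M. norm (norm (f x + g x) powr p) <= norm (2 powr p * (norm (f x) powr p + norm (g x) powr p))"
  proof (rule AE_I2)
   fix x
   have "norm (f x + g x) powr p <= (norm (f x) + norm (g x)) powr p"
    using p by (intro powr_mono2 norm_triangle_ineq) auto
   also have "... <= 2 powr p * (norm (f x) powr p + norm (g x) powr p)"
    using p by (intro powr_add_le) auto
   finally show "norm (norm (f x + g x) powr p) <= norm (2 powr p * (norm (f x) powr p + norm (g x) powr p))" by simp
  qed
 qed measurable
 then show ?thesis by (simp add: in_Lp_def)
qed

lemma in_Lp_uminus: "in_Lp M p f ==> in_Lp M p (%x. - f x)"
 by (auto simp: in_Lp_def)

lemma in_Lp_diff:
 assumes "in_Lp M p f" "in_Lp M p g" "1 <= p"
 shows "in_Lp M p (%x. f x - g x)"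
 using in_Lp_add[OF assms(1) in_Lp_uminus[OF assms(2)] assms(3)] by simp

lemma in_Lp_sum:
 assumes "!!i. i \<in> I ==> in_Lp M p (f i)" "1 <= p"
 shows "in_Lp M p (%x. \<Sum>i\<in>I. f i x)"
 using assms by (induction I rule: infinite_finite_induct) (auto intro: in_Lp_add)

text \<open>After scaling f by a and g by b, convexity of t^p with weights a/(a+b) and b/(a+b)
  integrates to the bound (a+b)^p. The margin e/2 in a and b keeps them positive when a norm
  vanishes.\<close>

theorem Lp_nm_triangle:
 assumes f: "in_Lp M p f" and g: "in_Lp M p g" and p: "1 <= p"
 shows "Lp_nm M p (%x. f x + g x) <= Lp_nm M p f + Lp_nm M p g"
proof (rule field_le_epsilon)
 fix e :: real assume e: "0 < e"
 define a where "a = Lp_nm M p f + e/2"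
 define b where "b = Lp_nm M p g + e/2"
 have ab: "0 < a" "0 < b" "Lp_nm M p f <= a" "Lp_nm M p g <= b"
  using e Lp_nm_nonneg[of M p f] Lp_nm_nonneg[of M p g] by (auto simp: a_def b_def simp del: Lp_nm_nonneg)
 define l where "l = a / (a + b)"
 have l: "0 <= l" "l <= 1" "1 - l = b / (a + b)" using ab by (auto simp: l_def field_simps)
 have pt: "norm (f x + g x) powr p <= (a + b) powr p * (l * (norm (f x) powr p / a powr p) + (1 - l) * (norm (g x) powr p / b powr p))" for x
 proof -
  have "norm (f x + g x) powr p <= (norm (f x) + norm (g x)) powr p"
   using p by (intro powr_mono2 norm_triangle_ineq) auto
  also have "norm (f x) + norm (g x) = (a + b) * (l * (norm (f x) / a) + (1 - l) * (norm (g x) / b))"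
   proof -
   have "(a + b) * l = a" "(a + b) * (1 - l) = b" unfolding l(3) using ab by (auto simp: l_def)
   then have "(a + b) * (l * (norm (f x) / a) + (1 - l) * (norm (g x) / b)) = a * (norm (f x) / a) + b * (norm (g x) / b)"
    by (metis distrib_left mult.assoc)
   then show ?thesis using ab by simp
  qed
  also have "... powr p = (a + b) powr p * (l * (norm (f x) / a) + (1 - l) * (norm (g x) / b)) powr p"
   using ab l by (intro powr_mult)
  also have "... <= (a + b) powr p * (l * (norm (f x) / a) powr p + (1 - l) * (norm (g x) / b) powr p)"
   using ab l p by (intro mult_left_mono powr_convex_comb) auto
  finally show ?thesis using ab by (simp add: powr_divide)
 qed
 have "(\<integral>x. norm (f x + g x) powr p \<partial>M) <= (\<integral>x. (a + b) powr p * (l * (norm (f x) powr p / a powr p) + (1 - l) * (norm (g x) powr p / b powr p)) \<partial>M)"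
  by (rule integral_mono) (use f g in_Lp_add[OF f g p] pt in \<open>auto simp: in_Lp_def\<close>)
 also have "... = (a + b) powr p * (l * ((\<integral>x. norm (f x) powr p \<partial>M) / a powr p) + (1 - l) * ((\<integral>x. norm (g x) powr p \<partial>M) / b powr p))"
  using f g by (simp add: in_Lp_def)
 also have "... <= (a + b) powr p * (l * 1 + (1 - l) * 1)"
 proof (intro mult_left_mono add_mono)
  show "(\<integral>x. norm (f x) powr p \<partial>M) / a powr p <= 1" "(\<integral>x. norm (g x) powr p \<partial>M) / b powr p <= 1"
   using ab p Lp_nm_le_iff[of p a M f] Lp_nm_le_iff[of p b M g] by auto
 qed (use l in auto)
 finally have "(\<integral>x. norm (f x + g x) powr p \<partial>M) <= (a + b) powr p" by simp
 then have "Lp_nm M p (%x. f x + g x) <= a + b"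
  using ab p by (subst Lp_nm_le_iff) auto
 then show "Lp_nm M p (%x. f x + g x) <= Lp_nm M p f + Lp_nm M p g + e" by (simp add: a_def b_def)
qed

lemma Lp_nm_uminus [simp]: "Lp_nm M p (%x. - f x) = Lp_nm M p f"
 by (simp add: Lp_nm_def)

lemma Lp_nm_minus_commute: "Lp_nm M p (%x. f x - g x) = Lp_nm M p (%x. g x - f x)"
 by (simp add: Lp_nm_def norm_minus_commute)

lemma Lp_nm_triangle_diff:
 assumes "in_Lp M p f" "in_Lp M p g" "1 <= p"
 shows "Lp_nm M p (%x. f x - g x) <= Lp_nm M p f + Lp_nm M p g"
 using Lp_nm_triangle[OF assms(1) in_Lp_uminus[OF assms(2)] assms(3)] by simp

lemma Lp_nm_le_add_diff:
 assumes "in_Lp M p f" "in_Lp M p g" "1 <= p"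
 shows "Lp_nm M p f <= Lp_nm M p g + Lp_nm M p (%x. f x - g x)"
 using Lp_nm_triangle[OF assms(2) in_Lp_diff[OF assms(1,2,3)] assms(3)] by simp

lemma Lp_nm_tendsto:
 assumes "!!n. in_Lp M p (f n)" "in_Lp M p g" "1 <= p"
  "(%n. Lp_nm M p (%x. f n x - g x)) \<longlonglongrightarrow> 0"
 shows "(%n. Lp_nm M p (f n)) \<longlonglongrightarrow> Lp_nm M p g"
proof (rule LIM_zero_cancel, rule tendsto_0_le[OF assms(4), where K=1], intro always_eventually allI)
 fix n
 have "Lp_nm M p (f n) <= Lp_nm M p g + Lp_nm M p (%x. f n x - g x)"
  "Lp_nm M p g <= Lp_nm M p (f n) + Lp_nm M p (%x. g x - f n x)"
  using assms by (auto intro: Lp_nm_le_add_diff)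
 then show "norm (Lp_nm M p (f n) - Lp_nm M p g) <= norm (Lp_nm M p (%x. f n x - g x)) * 1"
  using Lp_nm_minus_commute[of M p "f n" g] by (simp add: abs_le_iff)
qed

lemma Lp_nm_sum_le:
 assumes "!!i. i \<in> I ==> in_Lp M p (f i)" "1 <= p"
 shows "Lp_nm M p (%x. \<Sum>i\<in>I. f i x) <= (\<Sum>i\<in>I. Lp_nm M p (f i))"
 using assms
proof (induction I rule: infinite_finite_induct)
 case (insert i I)
 have "Lp_nm M p (%x. f i x + (\<Sum>i\<in>I. f i x)) <= Lp_nm M p (f i) + Lp_nm M p (%x. \<Sum>i\<in>I. f i x)"
  using insert.prems by (intro Lp_nm_triangle in_Lp_sum) auto
 then show ?case using insert by force
qed auto

lemma Lp_nm_zero_imp_AE: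
 assumes f: "in_Lp M p f" and p: "0 < p" and 0: "Lp_nm M p f = 0"
 shows "AE x in M. f x = 0"
proof -
 have "(\<integral>x. norm (f x) powr p \<partial>M) = 0" using Lp_nm_powr[OF p, of M f] 0 p by simp
 then have "AE x in M. norm (f x) powr p = 0"
  using f by (subst (asm) integral_nonneg_eq_0_iff_AE) (auto simp: in_Lp_def)
 then show ?thesis by (auto elim!: eventually_mono)
qed

lemma Lp_limit_unique:
 assumes "!!n. in_Lp M p (f n)" "in_Lp M p g" "in_Lp M p h" "1 <= p"
  "(%n. Lp_nm M p (%x. f n x - g x)) \<longlonglongrightarrow> 0" "(%n. Lp_nm M p (%x. f n x - h x)) \<longlonglongrightarrow> 0"
 shows "AE x in M. g x = h x"
proof -
 have le: "Lp_nm M p (%x. g x - h x) <= Lp_nm M p (%x. f n x - g x) + Lp_nm M p (%x. f n x - h x)" for n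
  using Lp_nm_triangle_diff[of M p "%x. f n x - h x" "%x. f n x - g x"] assms by (auto simp: in_Lp_diff)
 have "(%n. Lp_nm M p (%x. f n x - g x) + Lp_nm M p (%x. f n x - h x)) \<longlonglongrightarrow> 0"
  using tendsto_add[OF assms(5,6)] by simp
 then have "Lp_nm M p (%x. g x - h x) <= 0" using le
  by (intro LIMSEQ_le[OF tendsto_const]) auto
 then have "Lp_nm M p (%x. g x - h x) = 0" using Lp_nm_nonneg by (meson antisym)
 then have "AE x in M. g x - h x = 0"
  using assms by (intro Lp_nm_zero_imp_AE[of M p]) (auto intro!: in_Lp_diff)
 then show ?thesis by simp
qed

text \<open>Carries a uniform norm bound through convergence almost everywhere. The passage to
  radius 1, the removal of the smeared axes and the duality argument by truncation all rest on
  it.\<close>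

lemma Lp_fatou:
 fixes f :: "nat => 'a => 'b::{banach,second_countable_topology}"
 assumes f: "!!n. in_Lp M p (f n)" and B: "!!n. Lp_nm M p (f n) <= B" and p: "0 < p"
  and g[measurable]: "g \<in> borel_measurable M"
  and lim: "AE x in M. (%n. f n x) \<longlonglongrightarrow> g x"
 shows "in_Lp M p g" "Lp_nm M p g <= B"
proof -
 have [measurable]: "f n \<in> borel_measurable M" for n using f[of n] by (simp add: in_Lp_def)
 have B0: "0 <= B" using B[of 0] Lp_nm_nonneg order_trans by blast
 have "(\<integral>\<^sup>+x. ennreal (norm (g x) powr p) \<partial>M) = (\<integral>\<^sup>+x. liminf (%n. ennreal (norm (f n x) powr p)) \<partial>M)"
 proof (rule nn_integral_cong_AE)
  show "AE x in M. ennreal (norm (g x) powr p) = liminf (%n. ennreal (norm (f n x) powr p))"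
   using lim
  proof eventually_elim
   case (elim x)
   have "(%n. ennreal (norm (f n x) powr p)) \<longlonglongrightarrow> ennreal (norm (g x) powr p)"
    using p by (intro tendsto_intros tendsto_powr' elim) auto
   then show ?case using lim_imp_Liminf[OF sequentially_bot] by metis
  qed
 qed
 also have "... <= liminf (%n. (\<integral>\<^sup>+x. ennreal (norm (f n x) powr p) \<partial>M))"
  by (rule nn_integral_liminf) auto
 also have "... <= ennreal (B powr p)"
 proof (rule Liminf_le[OF sequentially_bot always_eventually], intro allI)
  fix n
  have "(\<integral>\<^sup>+x. ennreal (norm (f n x) powr p) \<partial>M) = ennreal (\<integral>x. norm (f n x) powr p \<partial>M)"
   using f[of n] by (intro nn_integral_eq_integral) (auto simp: in_Lp_def)
  also have "... <= ennreal (B powr p)"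
   using Lp_nm_le_iff[OF p B0, of M "f n"] B[of n] by (intro ennreal_leI) auto
  finally show "(\<integral>\<^sup>+x. ennreal (norm (f n x) powr p) \<partial>M) <= ennreal (B powr p)" .
 qed
 finally have le: "(\<integral>\<^sup>+x. ennreal (norm (g x) powr p) \<partial>M) <= ennreal (B powr p)" .
 then have int: "integrable M (%x. norm (g x) powr p)"
  by (intro integrableI_bounded) (auto intro: le_less_trans)
 then show "in_Lp M p g" by (simp add: in_Lp_def)
 have "ennreal (\<integral>x. norm (g x) powr p \<partial>M) <= ennreal (B powr p)"
  using le int by (subst nn_integral_eq_integral[symmetric]) auto
 then show "Lp_nm M p g <= B"
  using Lp_nm_le_iff[OF p B0, of M g] by (simp add: ennreal_le_iff)
qed

theorem Lp_complete:
 fixes f :: "nat => 'a => 'b::{banach,second_countable_topology}"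
 assumes f: "!!n. in_Lp M p (f n)" and p: "1 <= p"
  and cauchy: "!!e. 0 < e ==> EX N. ALL m>=N. ALL n>=N. Lp_nm M p (%x. f m x - f n x) < e"
 obtains g where "in_Lp M p g" "(%n. Lp_nm M p (%x. f n x - g x)) \<longlonglongrightarrow> 0"
proof -
 have [measurable]: "f n \<in> borel_measurable M" for n using f[of n] by (simp add: in_Lp_def)
 have "ALL k. EX N. ALL m>=N. ALL n>=N. Lp_nm M p (%x. f m x - f n x) < (1/2)^k"
  using cauchy by simp
 then obtain N where N: "!!k m n. m >= N k ==> n >= N k ==> Lp_nm M p (%x. f m x - f n x) < (1/2)^k"
  by metis
 \<comment> \<open>Partial sums instead of N itself: they are nondecreasing and still dominate each
   \<open>N k\<close>.\<close>
 define s where "s k = (\<Sum>i\<le>k. N i)" for k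
 have sN: "s k >= N k" for k
  unfolding s_def by (rule member_le_sum) auto
 have smono: "s k <= s (Suc k)" for k by (simp add: s_def)
 define d where "d k x = norm (f (s (Suc k)) x - f (s k) x)" for k x
 have dL: "in_Lp M p (d k)" for k
  unfolding d_def using in_Lp_diff[OF f f p] by (auto simp: in_Lp_def)
 have dN: "Lp_nm M p (d k) <= (1/2)^k" for k
 proof -
  have "Lp_nm M p (d k) = Lp_nm M p (%x. f (s (Suc k)) x - f (s k) x)" by (simp add: d_def Lp_nm_def)
  also have "... <= (1/2)^k" using N[of k "s (Suc k)" "s k"] sN[of k] smono[of k] by linarith
  finally show ?thesis .
 qed
 \<comment> \<open>D collects the norms of the increments. Its p-norms stay below 2, so monotone
   convergence makes the series of increments absolutely convergent almost everywhere.\<close>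
 define D where "D n x = (\<Sum>k<n. d k x)" for n x
 have DL: "in_Lp M p (D n)" for n unfolding D_def using dL p by (intro in_Lp_sum) auto
 have DN: "Lp_nm M p (D n) <= 2" for n
 proof -
  have "Lp_nm M p (D n) <= (\<Sum>k<n. (1/2)^k)"
   unfolding D_def using dL dN p by (intro order_trans[OF Lp_nm_sum_le] sum_mono) auto
  also have "... <= 2" by (simp add: geometric_sum)
  finally show ?thesis .
 qed
 have [measurable]: "d k \<in> borel_measurable M" for k using dL[of k] by (simp add: in_Lp_def)
 have [measurable]: "D k \<in> borel_measurable M" for k using DL[of k] by (simp add: in_Lp_def)
 have "(\<integral>\<^sup>+x. (SUP n. ennreal (D n x powr p)) \<partial>M) = (SUP n. \<integral>\<^sup>+x. ennreal (D n x powr p) \<partial>M)"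
 proof (rule nn_integral_monotone_convergence_SUP)
  show "incseq (%n x. ennreal (D n x powr p))"
   using p by (auto simp: incseq_def le_fun_def D_def d_def intro!: ennreal_leI powr_mono2 sum_nonneg sum_mono2)
 qed auto
 also have "... <= ennreal (2 powr p)"
 proof (rule SUP_least)
  fix n
  have D0: "norm (D n x) = D n x" for x by (simp add: D_def d_def sum_nonneg)
  have "(\<integral>\<^sup>+x. ennreal (D n x powr p) \<partial>M) = ennreal (\<integral>x. norm (D n x) powr p \<partial>M)"
   using DL[of n] D0 by (subst nn_integral_eq_integral) (auto simp: in_Lp_def)
  also have "... <= ennreal (2 powr p)"
   using Lp_nm_le_iff[of p 2 M "D n"] DN[of n] p by (intro ennreal_leI) auto
  finally show "(\<integral>\<^sup>+x. ennreal (D n x powr p) \<partial>M) <= ennreal (2 powr p)" .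
 qed
 finally have "(\<integral>\<^sup>+x. (SUP n. ennreal (D n x powr p)) \<partial>M) ~= \<infinity>"
  by (auto simp: top_unique)
 then have "AE x in M. (SUP n. ennreal (D n x powr p)) ~= \<infinity>"
  by (intro nn_integral_PInf_AE) auto
 then have conv: "AE x in M. convergent (%k. f (s k) x)"
 proof eventually_elim
  case (elim x)
  then obtain c where c: "(SUP n. ennreal (D n x powr p)) = ennreal c" "0 <= c"
   by (metis ennreal_cases infinity_ennreal_def)
  have D0: "0 <= D n x" for n by (simp add: D_def d_def sum_nonneg)
  have bd: "D n x <= c powr (1/p)" for n
  proof -
   have "ennreal (D n x powr p) <= ennreal c"
    unfolding c(1)[symmetric] by (rule SUP_upper) auto
   then have "D n x powr p <= c" using c by (simp add: ennreal_le_iff)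
   then have "(D n x powr p) powr (1/p) <= c powr (1/p)"
    using p by (intro powr_mono2) auto
   then show ?thesis using p D0 by (simp add: powr_powr)
  qed
  have "summable (%k. d k x)"
   using bd[of "Suc _"] by (intro bounded_imp_summable[of _ "c powr (1/p)"]) (auto simp: D_def d_def lessThan_Suc_atMost)
  then have "summable (%k. f (s (Suc k)) x - f (s k) x)"
   unfolding d_def by (rule summable_norm_cancel)
  then have "convergent (%n. \<Sum>k<n. f (s (Suc k)) x - f (s k) x)"
   by (simp add: summable_iff_convergent)
  then have "convergent (%n. f (s n) x - f (s 0) x)"
   by (simp add: sum_lessThan_telescope[of "%k. f (s k) x"])
  then have "convergent (%n. (f (s n) x - f (s 0) x) + f (s 0) x)"
   by (intro convergent_add convergent_const)
  then show ?case by simp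
 qed
 define g where "g x = lim (%k. f (s k) x)" for x
 have [measurable]: "g \<in> borel_measurable M" unfolding g_def by measurable
 have lim: "AE x in M. (%k. f (s k) x) \<longlonglongrightarrow> g x"
  using conv by eventually_elim (simp add: g_def convergent_LIMSEQ_iff)
 \<comment> \<open>Fatou's lemma for \<open>f m - f (s (n + k))\<close> as n grows: the Cauchy bound
   survives in the limit, and for every late m, not only along the subsequence.\<close>
 have step: "in_Lp M p (%x. f m x - g x) & Lp_nm M p (%x. f m x - g x) <= (1/2)^k" if m: "m >= N k" for m k
 proof -
  have big: "N k <= s (n + k)" for n
  proof -
   have "s k <= s (n + k)" by (induction n) (use smono order_trans in auto)
   then show ?thesis using sN[of k] by simp
  qed
  have "AE x in M. (%n. f m x - f (s (n + k)) x) \<longlonglongrightarrow> f m x - g x"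
   using lim by eventually_elim (intro tendsto_intros LIMSEQ_ignore_initial_segment)
  moreover have "in_Lp M p (%x. f m x - f (s (n + k)) x)" for n by (rule in_Lp_diff[OF f f p])
  moreover have "Lp_nm M p (%x. f m x - f (s (n + k)) x) <= (1/2)^k" for n
   using N[OF m big[of n]] by simp
  ultimately show ?thesis
   using Lp_fatou[of M p "%n x. f m x - f (s (n + k)) x" "(1/2)^k" "%x. f m x - g x"] p by auto
 qed
 have "in_Lp M p (%x. f (N 0) x - (f (N 0) x - g x))"
  by (rule in_Lp_diff[OF f step[THEN conjunct1, OF order_refl] p])
 then have gL: "in_Lp M p g" by simp
 have "(%n. Lp_nm M p (%x. f n x - g x)) \<longlonglongrightarrow> 0"
 proof (rule LIMSEQ_I)
  fix e :: real assume "0 < e"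
  then obtain k where k: "(1/2)^k < e" using real_arch_pow_inv[of e "1/2"] by auto
  have "norm (Lp_nm M p (%x. f n x - g x) - 0) < e" if "n >= N k" for n
   using step[OF that] k by (simp add: less_le_trans le_less_trans)
  then show "EX no. ALL n>=no. norm (Lp_nm M p (%x. f n x - g x) - 0) < e" by blast
 qed
 with gL show ?thesis by (rule that)
qed

theorem Holder:
 fixes f :: "'a => real" and g :: "'a => real"
 assumes f: "in_Lp M p f" and g: "in_Lp M q g" and pq: "1 < p" "1 < q" "1/p + 1/q = 1"
 shows "integrable M (%x. f x * g x)" "(\<integral>x. \<bar>f x * g x\<bar> \<partial>M) <= Lp_nm M p f * Lp_nm M q g"
proof -
 have [measurable]: "f \<in> borel_measurable M" "g \<in> borel_measurable M" using assms by (auto simp: in_Lp_def)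
 \<comment> \<open>The parameters a and b stand for the two norms. They are taken larger by e, which
   tends to 0 at the end, so that vanishing norms need no separate case.\<close>
 have young: "\<bar>f x * g x\<bar> <= a * b * (\<bar>f x\<bar> powr p / (p * a powr p) + \<bar>g x\<bar> powr q / (q * b powr q))"
  if "0 < a" "0 < b" for a b x
 proof -
  have "(\<bar>f x\<bar> / a) * (\<bar>g x\<bar> / b) <= (\<bar>f x\<bar> / a) powr p / p + (\<bar>g x\<bar> / b) powr q / q"
   by (rule Youngs_inequality) (use pq that in auto)
  then have "a * b * ((\<bar>f x\<bar> / a) * (\<bar>g x\<bar> / b)) <= a * b * ((\<bar>f x\<bar> / a) powr p / p + (\<bar>g x\<bar> / b) powr q / q)"
   using that by (intro mult_left_mono) auto
  also have "a * b * ((\<bar>f x\<bar> / a) * (\<bar>g x\<bar> / b)) = \<bar>f x * g x\<bar>" using that by (simp add: abs_mult)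
  finally show ?thesis using that by (simp add: powr_divide mult.commute)
 qed
 have fi: "integrable M (%x. \<bar>f x\<bar> powr p)" and gi: "integrable M (%x. \<bar>g x\<bar> powr q)"
  using f g by (auto simp: in_Lp_def)
 show int: "integrable M (%x. f x * g x)"
 proof (rule LINT_bound)
  show "integrable M (%x. 1 * 1 * (\<bar>f x\<bar> powr p / (p * 1 powr p) + \<bar>g x\<bar> powr q / (q * 1 powr q)))"
   using fi gi by auto
  show "AE x in M. norm (f x * g x) <= norm (1 * 1 * (\<bar>f x\<bar> powr p / (p * 1 powr p) + \<bar>g x\<bar> powr q / (q * 1 powr q)))"
   using young[of 1 1] by (intro AE_I2) (auto intro!: order_trans[OF _ abs_ge_self])
 qed measurable
 show "(\<integral>x. \<bar>f x * g x\<bar> \<partial>M) <= Lp_nm M p f * Lp_nm M q g"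
 proof (rule tendsto_lowerbound)
  show "((%e. (Lp_nm M p f + e) * (Lp_nm M q g + e)) \<longlongrightarrow> Lp_nm M p f * Lp_nm M q g) (at_right 0)"
   by (auto intro!: tendsto_eq_intros)
  show "\<forall>\<^sub>F e in at_right 0. (\<integral>x. \<bar>f x * g x\<bar> \<partial>M) <= (Lp_nm M p f + e) * (Lp_nm M q g + e)"
   using eventually_at_right_less[of 0]
  proof eventually_elim
   case (elim e)
   define a where "a = Lp_nm M p f + e"
   define b where "b = Lp_nm M q g + e"
   have ab: "0 < a" "0 < b" "Lp_nm M p f <= a" "Lp_nm M q g <= b"
    using elim Lp_nm_nonneg[of M p f] Lp_nm_nonneg[of M q g] by (auto simp: a_def b_def simp del: Lp_nm_nonneg)
   have "(\<integral>x. \<bar>f x * g x\<bar> \<partial>M) <= (\<integral>x. a * b * (\<bar>f x\<bar> powr p / (p * a powr p) + \<bar>g x\<bar> powr q / (q * b powr q)) \<partial>M)"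
    by (rule integral_mono) (use int fi gi young[OF ab(1,2)] in auto)
   also have "... = a * b * ((\<integral>x. \<bar>f x\<bar> powr p \<partial>M) / a powr p * (1 / p) + (\<integral>x. \<bar>g x\<bar> powr q \<partial>M) / b powr q * (1/q))"
    using fi gi by (simp add: field_simps)
   also have "... <= a * b * (1 * (1/p) + 1 * (1/q))"
   proof (intro mult_left_mono add_mono mult_right_mono)
    show "(\<integral>x. \<bar>f x\<bar> powr p \<partial>M) / a powr p <= 1" "(\<integral>x. \<bar>g x\<bar> powr q \<partial>M) / b powr q <= 1"
     using ab pq Lp_nm_le_iff[of p a M f] Lp_nm_le_iff[of q b M g] by auto
   qed (use ab pq in auto)
   also have "... = a * b" using pq by simp
   finally show ?case by (simp add: a_def b_def)
  qed
 qed auto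
qed

lemma conjugate_exponent:
 fixes p :: real assumes "1 < p"
 defines "q \<equiv> p / (p - 1)"
 shows "1 < q" "1/p + 1/q = 1" "(p - 1) * q = p"
 using assms by (auto simp: field_simps)

lemma in_Lp_finite_mono:
 assumes "finite_measure M" "in_Lp M p f" "0 < q" "q <= p"
 shows "in_Lp M q f"
proof -
 interpret finite_measure M by fact
 have [measurable]: "f \<in> borel_measurable M" using assms by (auto simp: in_Lp_def)
 have "integrable M (%x. norm (f x) powr q)"
 proof (rule LINT_bound)
  show "integrable M (%x. 1 + norm (f x) powr p)" using assms by (auto simp: in_Lp_def)
  show "AE x in M. norm (norm (f x) powr q) <= norm (1 + norm (f x) powr p)"
  proof (rule AE_I2)
   fix x
   show "norm (norm (f x) powr q) <= norm (1 + norm (f x) powr p)"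
   proof (cases "norm (f x) <= 1")
    case True
    then have "norm (f x) powr q <= 1 powr q" using assms by (intro powr_mono2) auto
    then show ?thesis by (simp add: add_increasing2)
   next
    case False
    then have "norm (f x) powr q <= norm (f x) powr p" using assms by (intro powr_mono) auto
    then show ?thesis by simp
   qed
  qed
 qed measurable
 then show ?thesis using assms by (simp add: in_Lp_def)
qed

lemma in_L1_iff: "in_Lp M 1 f \<longleftrightarrow> integrable M f"
 by (auto simp: in_Lp_def integrable_norm_iff)

lemma in_Lp_integrable:
 assumes "finite_measure M" "in_Lp M p f" "1 <= p"
 shows "integrable M f"
 using in_Lp_finite_mono[OF assms(1,2), of 1] assms(3) by (simp add: in_L1_iff)

lemma L1_le_Lp:
 assumes M: "finite_measure M" and f: "in_Lp M p f" and p: "1 < p"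
 shows "(\<integral>x. norm (f x) \<partial>M) <= measure M (space M) powr (1 - 1/p) * Lp_nm M p f"
proof -
 interpret finite_measure M by fact
 define q where "q = p / (p - 1)"
 note q = conjugate_exponent[OF p, folded q_def]
 have "(\<integral>x. \<bar>norm (f x) * 1\<bar> \<partial>M) <= Lp_nm M p (%x. norm (f x)) * Lp_nm M q (%x. 1::real)"
  using f p q by (intro Holder(2)) (auto simp: in_Lp_def)
 also have "Lp_nm M q (%x. 1::real) = measure M (space M) powr (1/q)" by (simp add: Lp_nm_def)
 also have "1/q = 1 - 1/p" using q by simp
 finally show ?thesis by (simp add: Lp_nm_def mult.commute)
qed

lemma L1_tendsto:
 assumes M: "finite_measure M" and f: "!!n. in_Lp M p (f n)" and g: "in_Lp M p g" and p: "1 < p"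
  and lim: "(%n. Lp_nm M p (%x. f n x - g x)) \<longlonglongrightarrow> 0"
 shows "(%n. \<integral>x. norm (f n x - g x) \<partial>M) \<longlonglongrightarrow> 0"
proof (rule tendsto_0_le[OF lim, where K="measure M (space M) powr (1 - 1/p)"], intro always_eventually allI)
 fix n
 show "norm (\<integral>x. norm (f n x - g x) \<partial>M) <= norm (Lp_nm M p (%x. f n x - g x)) * measure M (space M) powr (1 - 1/p)"
  using L1_le_Lp[OF M in_Lp_diff[OF f[of n] g] p] p by (simp add: mult.commute)
qed

section \<open>Parameter integrals and the Schur test\<close>

lemma continuous_on_slice1:
 assumes "continuous_on (A \<times> B) (%(x,y). f x y)" "x \<in> A"
 shows "continuous_on B (f x)"
proof -
 have "continuous_on B (%y. (%(x,y). f x y) (x, y))"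
  by (rule continuous_on_compose2[OF assms(1)]) (use assms(2) in \<open>auto intro!: continuous_intros\<close>)
 then show ?thesis by simp
qed

lemma continuous_on_slice2:
 assumes "continuous_on (A \<times> B) (%(x,y). f x y)" "y \<in> B"
 shows "continuous_on A (%x. f x y)"
proof -
 have "continuous_on A (%x. (%(x,y). f x y) (x, y))"
  by (rule continuous_on_compose2[OF assms(1)]) (use assms(2) in \<open>auto intro!: continuous_intros\<close>)
 then show ?thesis by simp
qed

text \<open>Under these hypotheses continuous functions on the compact space are bounded, measurable
  and integrable. Measurability of the identity is asked for, rather than equality with the Borel
  sets, because \<open>sigmaS\<close> is completed.\<close>

locale cmeas = finite_measure M for M :: "'a::euclidean_space measure" +
 assumes compact_sp: "compact (space M)" and id_meas: "(%x. x) \<in> M \<rightarrow>\<^sub>M borel"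
begin

lemma cont_meas:
 fixes f :: "'a => 'b::topological_space"
 assumes "continuous_on (space M) f"
 shows "f \<in> borel_measurable M"
proof -
 have "(%x. x) \<in> M \<rightarrow>\<^sub>M restrict_space borel (space M)"
  by (intro measurable_restrict_space2 id_meas) auto
 moreover have "f \<in> borel_measurable (restrict_space borel (space M))"
  by (rule borel_measurable_continuous_on_restrict) fact
 ultimately have "(%x. f x) \<in> borel_measurable M" by (rule measurable_compose)
 then show ?thesis by simp
qed

lemma cont_bound:
 fixes f :: "'a => 'b::real_normed_vector"
 assumes "continuous_on (space M) f"
 obtains B where "0 < B" "!!x. x \<in> space M ==> norm (f x) <= B"
proof -
 have "bounded (f ` space M)" using compact_continuous_image[OF assms compact_sp] compact_imp_bounded by blast
 then show ?thesis using that unfolding bounded_pos by blast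
qed

lemma cont_int:
 fixes f :: "'a => 'b::{banach,second_countable_topology}"
 assumes "continuous_on (space M) f"
 shows "integrable M f"
proof -
 obtain B where B: "!!x. x \<in> space M ==> norm (f x) <= B" using cont_bound[OF assms] by blast
 show ?thesis
  by (rule integrable_const_bound[of _ B]) (use B cont_meas[OF assms] in auto)
qed

lemma cont_in_Lp:
 fixes f :: "'a => 'b::{banach,second_countable_topology}"
 assumes "continuous_on (space M) f" "0 <= p"
 shows "in_Lp M p f"
 unfolding in_Lp_def
proof
 obtain B where B: "!!x. x \<in> space M ==> norm (f x) <= B" using cont_bound[OF assms(1)] by blast
 have [measurable]: "f \<in> borel_measurable M" by (rule cont_meas) fact
 show "integrable M (%x. norm (f x) powr p)"
  by (rule integrable_const_bound[of _ "B powr p"]) (use B assms in \<open>auto intro!: powr_mono2\<close>)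
qed (rule cont_meas, fact)

lemma Lp_nm_uniform:
 fixes f :: "'a => 'b::{banach,second_countable_topology}"
 assumes "!!x. x \<in> space M ==> norm (f x) <= B" "f \<in> borel_measurable M" "0 < p" "0 <= B"
 shows "in_Lp M p f" "Lp_nm M p f <= B * measure M (space M) powr (1/p)"
proof -
 have B: "in_Lp M p (%_. B)" by (simp add: in_Lp_def)
 show "in_Lp M p f" by (rule in_Lp_bound[OF B]) (use assms in \<open>auto intro: order_trans\<close>)
 have "Lp_nm M p f <= Lp_nm M p (%_. B)"
  by (rule Lp_nm_mono[OF B]) (use assms in \<open>auto intro: order_trans\<close>)
 also have "... = B * measure M (space M) powr (1/p)"
  using assms by (simp add: Lp_nm_def powr_mult powr_powr mult.commute)
 finally show "Lp_nm M p f <= B * measure M (space M) powr (1/p)" .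
qed

text \<open>Sequential continuity by dominated convergence: a convergent sequence together with its
  limit is compact, so K is bounded there even when A is an open set such as the ball.\<close>

lemma int_param_cont:
 fixes K :: "'x::euclidean_space => 'a => 'b::{banach,second_countable_topology}" and g :: "'a => real"
 assumes K: "continuous_on (A \<times> space M) (%(x,y). K x y)" and g: "integrable M g"
 shows "continuous_on A (%x. \<integral>y. g y *R K x y \<partial>M)"
 unfolding continuous_on_sequentially
proof (intro ballI allI impI, elim conjE)
 fix X x assume x: "x \<in> A" and X: "ALL n. X n \<in> A" and lim: "X \<longlonglongrightarrow> x"
 have comp: "compact (insert x (range X))" by (rule compact_sequence_with_limit[OF lim])
 have sub: "insert x (range X) \<subseteq> A" using x X by auto
 have "compact ((%(x,y). K x y) ` (insert x (range X) \<times> space M))"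
  by (intro compact_continuous_image continuous_on_subset[OF K] compact_Times comp compact_sp) (use sub in auto)
 then obtain B where B: "!!z. z \<in> (%(x,y). K x y) ` (insert x (range X) \<times> space M) ==> norm z <= B"
  using compact_imp_bounded bounded_iff by metis
 have Kc: "continuous_on (space M) (K x)" if "x \<in> A" for x
  using continuous_on_slice1[OF K that] .
 have [measurable]: "K x \<in> borel_measurable M" "!!n. K (X n) \<in> borel_measurable M"
  using Kc x X by (auto intro: cont_meas)
 have [measurable]: "g \<in> borel_measurable M" using g by auto
 have "(%n. \<integral>y. g y *R K (X n) y \<partial>M) \<longlonglongrightarrow> (\<integral>y. g y *R K x y \<partial>M)"
 proof (rule integral_dominated_convergence[where w="%y. B * \<bar>g y\<bar>"])
  show "integrable M (%y. B * \<bar>g y\<bar>)" using g by auto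
  show "AE y in M. (%n. g y *R K (X n) y) \<longlonglongrightarrow> g y *R K x y"
  proof (rule AE_I2)
   fix y assume y: "y \<in> space M"
   have "(%n. K (X n) y) \<longlonglongrightarrow> K x y"
    using continuous_on_slice2[OF K y] x X lim unfolding continuous_on_sequentially by (auto simp: o_def)
   then show "(%n. g y *R K (X n) y) \<longlonglongrightarrow> g y *R K x y" by (intro tendsto_intros)
  qed
  show "AE y in M. norm (g y *R K (X n) y) <= B * \<bar>g y\<bar>" for n
  proof (rule AE_I2)
   fix y assume "y \<in> space M"
   then have "norm (K (X n) y) <= B" by (intro B) auto
   then show "norm (g y *R K (X n) y) <= B * \<bar>g y\<bar>"
    using mult_left_mono[of "norm (K (X n) y)" B "\<bar>g y\<bar>"] by (simp add: mult.commute[of B])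
  qed
 qed measurable
 then show "(((%x. \<integral>y. g y *R K x y \<partial>M) \<circ> X) \<longlonglongrightarrow> (\<integral>y. g y *R K x y \<partial>M))" by (simp add: o_def)
qed

lemma int_param_cont1:
 fixes K :: "'x::euclidean_space => 'a => 'b::{banach,second_countable_topology}"
 assumes "continuous_on (A \<times> space M) (%(x,y). K x y)"
 shows "continuous_on A (%x. \<integral>y. K x y \<partial>M)"
 using int_param_cont[OF assms, of "%_. 1"] by simp

lemma int_bdd_mult:
 fixes K :: "'a => 'b::{banach,second_countable_topology}" and g :: "'a => real"
 assumes K: "continuous_on (space M) K" and g: "integrable M g"
 shows "integrable M (%y. g y *R K y)"
proof -
 obtain B where B: "!!x. x \<in> space M ==> norm (K x) <= B" using cont_bound[OF K] by blast
 have [measurable]: "K \<in> borel_measurable M" "g \<in> borel_measurable M" using K g by (auto intro: cont_meas)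
 show ?thesis
 proof (rule LINT_bound)
  show "integrable M (%y. B * \<bar>g y\<bar>)" using g by auto
  show "AE y in M. norm (g y *R K y) <= norm (B * \<bar>g y\<bar>)"
  proof (rule AE_I2)
   fix y assume "y \<in> space M"
   then have "\<bar>g y\<bar> * norm (K y) <= \<bar>g y\<bar> * B" by (intro mult_left_mono B) auto
   then show "norm (g y *R K y) <= norm (B * \<bar>g y\<bar>)" by (simp add: mult.commute)
  qed
 qed measurable
qed

text \<open>Uniform continuity of K' on a compact neighbourhood makes the first order remainder
  small uniformly in y, so that it can be integrated against any integrable g.\<close>

lemma int_deriv:
 fixes K :: "'x::euclidean_space => 'a => real" and K' :: "'x => 'a => 'x" and g :: "'a => real"
 assumes U: "open U" "x0 \<in> U"
  and der: "!!x y. x \<in> U ==> y \<in> space M ==> ((%x. K x y) has_derivative (%h. K' x y \<bullet> h)) (at x)"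
  and cont: "continuous_on (U \<times> space M) (%(x,y). K' x y)"
  and contK: "!!x. x \<in> U ==> continuous_on (space M) (K x)"
  and g: "integrable M g"
 shows "((%x. \<integral>y. g y * K x y \<partial>M) has_derivative (%h. (\<integral>y. g y *R K' x0 y \<partial>M) \<bullet> h)) (at x0)"
proof -
 obtain \<rho> where \<rho>: "0 < \<rho>" "cball x0 \<rho> \<subseteq> U" using U open_contains_cball by blast
 have K'c: "continuous_on (space M) (K' x)" if "x \<in> U" for x
  using continuous_on_slice1[OF cont that] .
 have i1: "integrable M (%y. g y * K x y)" if "x \<in> U" for x
  using int_bdd_mult[OF contK[OF that] g] by simp
 have i2: "integrable M (%y. g y *R K' x0 y)" using int_bdd_mult[OF K'c[OF U(2)] g] .
 have uc: "uniformly_continuous_on (cball x0 \<rho> \<times> space M) (%(x,y). K' x y)"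
  by (intro compact_uniformly_continuous continuous_on_subset[OF cont] compact_Times compact_cball compact_sp) (use \<rho> in auto)
 define G where "G = (\<integral>y. \<bar>g y\<bar> \<partial>M)"
 have G: "0 <= G" by (simp add: G_def)
 show ?thesis
  unfolding has_derivative_at_alt
 proof (intro conjI allI impI)
  show "bounded_linear (%h. (\<integral>y. g y *R K' x0 y \<partial>M) \<bullet> h)" by (rule bounded_linear_inner_right)
  fix e :: real assume e: "0 < e"
  define e' where "e' = e / (G + 1)"
  have e': "0 < e'" "G * e' <= e" using e G by (auto simp: e'_def field_simps)
  obtain d where d: "0 < d" "!!z z'. z \<in> cball x0 \<rho> \<times> space M ==> z' \<in> cball x0 \<rho> \<times> space M ==> dist z' z < d ==>
    dist ((%(x,y). K' x y) z') ((%(x,y). K' x y) z) < e'"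
   using uc e' unfolding uniformly_continuous_on_def by metis
  define \<delta> where "\<delta> = min d \<rho>"
  show "EX d>0. ALL y. norm (y - x0) < d -->
     norm ((\<integral>ya. g ya * K y ya \<partial>M) - (\<integral>y. g y * K x0 y \<partial>M) - (\<integral>y. g y *R K' x0 y \<partial>M) \<bullet> (y - x0)) <= e * norm (y - x0)"
  proof (intro exI[of _ \<delta>] conjI allI impI)
   show "0 < \<delta>" using d \<rho> by (simp add: \<delta>_def)
   fix x assume x: "norm (x - x0) < \<delta>"
   have xU: "x \<in> U" using x \<rho> by (auto simp: \<delta>_def dist_norm norm_minus_commute subset_iff)
   \<comment> \<open>Mean value inequality for \<open>K x y - K' x0 y \<bullet> x\<close>, whose
     derivative is small near x0.\<close>
   have pt: "\<bar>K x y - K x0 y - K' x0 y \<bullet> (x - x0)\<bar> <= e' * norm (x - x0)" if y: "y \<in> space M" for y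
   proof -
    have "norm ((K x y - K' x0 y \<bullet> x) - (K x0 y - K' x0 y \<bullet> x0)) <= e' * norm (x - x0)"
    proof (rule differentiable_bound[of "ball x0 \<delta>" "%x. K x y - K' x0 y \<bullet> x" "%x h. K' x y \<bullet> h - K' x0 y \<bullet> h"])
     fix z assume z: "z \<in> ball x0 \<delta>"
     then have zU: "z \<in> U" and zr: "z \<in> cball x0 \<rho>" using \<rho> by (auto simp: \<delta>_def subset_iff)
     show "((%x. K x y - K' x0 y \<bullet> x) has_derivative (%h. K' z y \<bullet> h - K' x0 y \<bullet> h)) (at z within ball x0 \<delta>)"
      by (intro has_derivative_diff has_derivative_at_withinI[OF der] zU y
        has_derivative_inner_right has_derivative_ident)
     have "dist (K' z y) (K' x0 y) < e'"
      using d(2)[of "(x0,y)" "(z,y)"] zr z y \<rho> by (auto simp: \<delta>_def dist_Pair_Pair dist_commute)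
     then show "onorm (%h. K' z y \<bullet> h - K' x0 y \<bullet> h) <= e'"
      unfolding inner_diff_left[symmetric] by (intro onorm_le) (auto simp: dist_norm intro!: order_trans[OF Cauchy_Schwarz_ineq2] mult_right_mono)
    qed (use x \<open>0 < \<delta>\<close> in \<open>auto simp: dist_norm norm_minus_commute\<close>)
    then show ?thesis by (simp add: inner_diff_right algebra_simps)
   qed
   have i3: "integrable M (%y. g y * (K' x0 y \<bullet> (x - x0)))"
    using integrable_inner_left[of "x - x0" M "%y. g y *R K' x0 y"] i2 by simp
   then have i4: "integrable M (%y. g y * (K x y - K x0 y - K' x0 y \<bullet> (x - x0)))"
    using i1[OF xU] i1[OF U(2)] by (simp add: right_diff_distrib)
   have "(\<integral>y. g y * K x y \<partial>M) - (\<integral>y. g y * K x0 y \<partial>M) - (\<integral>y. g y *R K' x0 y \<partial>M) \<bullet> (x - x0)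
     = (\<integral>y. g y * (K x y - K x0 y - K' x0 y \<bullet> (x - x0)) \<partial>M)"
   proof -
    have "(\<integral>y. g y *R K' x0 y \<partial>M) \<bullet> (x - x0) = (\<integral>y. g y * (K' x0 y \<bullet> (x - x0)) \<partial>M)"
     using integral_inner_left[of "x - x0" M "%y. g y *R K' x0 y"] i2 by simp
    then show ?thesis
     using i1[OF xU] i1[OF U(2)] i3 by (simp add: right_diff_distrib)
   qed
   also have "norm ... <= (\<integral>y. norm (g y * (K x y - K x0 y - K' x0 y \<bullet> (x - x0))) \<partial>M)"
    by (rule integral_norm_bound)
   also have "... <= (\<integral>y. \<bar>g y\<bar> * (e' * norm (x - x0)) \<partial>M)"
   proof (rule integral_mono_AE)
    show "integrable M (%y. norm (g y * (K x y - K x0 y - K' x0 y \<bullet> (x - x0))))"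
     by (rule integrable_norm[OF i4])
    show "integrable M (%y. \<bar>g y\<bar> * (e' * norm (x - x0)))" using g by auto
    show "AE y in M. norm (g y * (K x y - K x0 y - K' x0 y \<bullet> (x - x0))) <= \<bar>g y\<bar> * (e' * norm (x - x0))"
     by (rule AE_I2) (auto simp: abs_mult intro!: mult_left_mono pt)
   qed
   also have "... = G * e' * norm (x - x0)" by (simp add: G_def)
   also have "... <= e * norm (x - x0)" using e' by (intro mult_right_mono) auto
   finally show "norm ((\<integral>ya. g ya * K x ya \<partial>M) - (\<integral>y. g y * K x0 y \<partial>M) - (\<integral>y. g y *R K' x0 y \<partial>M) \<bullet> (x - x0)) <= e * norm (x - x0)" .
  qed
 qed
qed

end

lemma cmeas_pair:
 assumes "cmeas M" "cmeas N" shows "cmeas (M \<Otimes>\<^sub>M N)"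
proof -
 interpret M: cmeas M by fact
 interpret N: cmeas N by fact
 interpret P: pair_sigma_finite M N ..
 show ?thesis
 proof (intro cmeas.intro finite_measureI cmeas_axioms.intro)
  show "emeasure (M \<Otimes>\<^sub>M N) (space (M \<Otimes>\<^sub>M N)) ~= \<infinity>"
   using M.emeasure_finite[of "space M"] N.emeasure_finite[of "space N"]
   by (simp add: space_pair_measure N.emeasure_pair_measure_Times ennreal_mult_eq_top_iff)
  show "compact (space (M \<Otimes>\<^sub>M N))"
   by (simp add: space_pair_measure compact_Times M.compact_sp N.compact_sp)
  have "(%z. (fst z, snd z)) \<in> (M \<Otimes>\<^sub>M N) \<rightarrow>\<^sub>M (borel \<Otimes>\<^sub>M borel)"
   by (intro measurable_Pair measurable_compose[OF measurable_fst M.id_meas] measurable_compose[OF measurable_snd N.id_meas])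
  then show "(%x. x) \<in> (M \<Otimes>\<^sub>M N) \<rightarrow>\<^sub>M borel" by (simp add: borel_prod)
 qed
qed

lemma cont_swap:
 fixes f :: "'a::euclidean_space => 'c::euclidean_space => 'b::{banach,second_countable_topology}"
 assumes M: "cmeas M" and N: "cmeas N" and f: "continuous_on (space M \<times> space N) (%(x,y). f x y)"
 shows "(\<integral>x. (\<integral>y. f x y \<partial>N) \<partial>M) = (\<integral>y. (\<integral>x. f x y \<partial>M) \<partial>N)"
proof -
 interpret M: cmeas M by fact
 interpret N: cmeas N by fact
 interpret P: pair_sigma_finite M N ..
 interpret MN: cmeas "M \<Otimes>\<^sub>M N" by (rule cmeas_pair) fact+
 show ?thesis
  by (rule P.Fubini_integral[symmetric], rule MN.cont_int) (simp add: space_pair_measure f)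
qed

text \<open>Integrate the tangent line of t^p at c = I/B, where I is the weighted integral of f. A
  mass below B does no harm, since the mass enters with the nonpositive factor 1 - p.\<close>

lemma Jensen_weighted:
 fixes w f :: "'a => real"
 assumes w: "!!y. y \<in> space M ==> 0 <= w y" "integrable M w" "(\<integral>y. w y \<partial>M) <= B" and B: "0 < B"
  and f: "!!y. y \<in> space M ==> 0 <= f y" "integrable M (%y. w y * f y)" "integrable M (%y. w y * f y powr p)"
  and p: "1 <= p"
 shows "(\<integral>y. w y * f y \<partial>M) powr p <= B powr (p - 1) * (\<integral>y. w y * f y powr p \<partial>M)"
proof -
 define I where "I = (\<integral>y. w y * f y \<partial>M)"
 define c where "c = I / B"
 have I: "0 <= I" unfolding I_def using w f by (auto intro!: integral_nonneg_AE)
 have c: "0 <= c" using I B by (simp add: c_def)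
 have "(\<integral>y. (1 - p) * c powr p * w y + p * c powr (p - 1) * (w y * f y) \<partial>M) <= (\<integral>y. w y * f y powr p \<partial>M)"
 proof (rule integral_mono)
  show "integrable M (%y. (1 - p) * c powr p * w y + p * c powr (p - 1) * (w y * f y))"
   using w f by auto
  fix y assume y: "y \<in> space M"
  have "c * c powr (p - 1) = c powr p"
   using c p by (cases "c = 0") (auto simp: powr_diff)
  then have "(1 - p) * c powr p + p * c powr (p - 1) * f y <= f y powr p"
   using powr_tangent[OF p f(1)[OF y] c] by (simp add: algebra_simps)
  from mult_left_mono[OF this w(1)[OF y]]
  show "(1 - p) * c powr p * w y + p * c powr (p - 1) * (w y * f y) <= w y * f y powr p"
   by (simp add: algebra_simps)
 qed (use f in auto)
 moreover have "(\<integral>y. (1 - p) * c powr p * w y + p * c powr (p - 1) * (w y * f y) \<partial>M)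
   = (1 - p) * c powr p * (\<integral>y. w y \<partial>M) + p * c powr (p - 1) * I"
  using w f by (simp add: I_def)
 moreover have "(1 - p) * c powr p * B <= (1 - p) * c powr p * (\<integral>y. w y \<partial>M)"
  using w p by (intro mult_left_mono_neg) (auto simp: mult_le_0_iff)
 moreover have "(1 - p) * c powr p * B + p * c powr (p - 1) * I = I powr p / B powr (p - 1)"
 proof (cases "I = 0")
  case False
  then have "0 < I" using I by simp
  then have cp: "0 < c" using B by (simp add: c_def)
  have IcB: "I = c * B" using B by (simp add: c_def)
  have "c powr (p - 1) * I = c powr p * B" using cp by (simp add: IcB powr_diff)
  then have "(1 - p) * c powr p * B + p * c powr (p - 1) * I = c powr p * B" by (simp add: algebra_simps)
  also have "... = I powr p / B powr (p - 1)" using B cp by (simp add: IcB powr_mult powr_diff)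
  finally show ?thesis .
 qed (use B in \<open>auto simp: c_def\<close>)
 ultimately have "I powr p / B powr (p - 1) <= (\<integral>y. w y * f y powr p \<partial>M)" by linarith
 then show ?thesis using B by (simp add: I_def field_simps)
qed

text \<open>Jensen in y for the weight |K x y| moves the power p inside, Fubini swaps the integrals,
  and the bound on the x-integrals of |K| supplies the last factor: B^(p-1) times B is B^p.\<close>

theorem Schur_test:
 fixes K :: "'a::euclidean_space => 'c::euclidean_space => real" and f :: "'c => real"
 assumes M: "cmeas M" and N: "cmeas N" and K: "continuous_on (space M \<times> space N) (%(x,y). K x y)"
  and B: "0 < B" "!!x. x \<in> space M ==> (\<integral>y. \<bar>K x y\<bar> \<partial>N) <= B" "!!y. y \<in> space N ==> (\<integral>x. \<bar>K x y\<bar> \<partial>M) <= B"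
  and f: "in_Lp N p f" and p: "1 <= p"
 shows "in_Lp M p (%x. \<integral>y. f y * K x y \<partial>N)" "Lp_nm M p (%x. \<integral>y. f y * K x y \<partial>N) <= B * Lp_nm N p f"
proof -
 interpret M: cmeas M by fact
 interpret N: cmeas N by fact
 interpret P: pair_sigma_finite M N ..
 interpret MN: cmeas "M \<Otimes>\<^sub>M N" by (rule cmeas_pair) fact+
 have fi: "integrable N f" using in_Lp_integrable[OF N.finite_measure_axioms f p] .
 have fp: "integrable N (%y. \<bar>f y\<bar> powr p)" using f by (simp add: in_Lp_def)
 have Kc: "continuous_on (space N) (K x)" if "x \<in> space M" for x
  using continuous_on_slice1[OF K that] .
 have Kc': "continuous_on (space M) (%x. K x y)" if "y \<in> space N" for y
  using continuous_on_slice2[OF K that] .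
 have Tc: "continuous_on (space M) (%x. \<integral>y. f y * K x y \<partial>N)"
  using N.int_param_cont[OF K fi] by simp
 show "in_Lp M p (%x. \<integral>y. f y * K x y \<partial>N)"
  using p by (intro M.cont_in_Lp Tc) auto
 have Kabs: "continuous_on (space M \<times> space N) (%(x,y). \<bar>K x y\<bar>)"
  using continuous_on_rabs[OF K] by (simp add: case_prod_unfold)
 define Q where "Q x = (\<integral>y. \<bar>f y\<bar> powr p * \<bar>K x y\<bar> \<partial>N)" for x
 have Qc: "continuous_on (space M) Q"
  unfolding Q_def using N.int_param_cont[OF Kabs fp] by simp
 have pt: "\<bar>\<integral>y. f y * K x y \<partial>N\<bar> powr p <= B powr (p - 1) * Q x" if x: "x \<in> space M" for x
 proof -
  have c: "continuous_on (space N) (%y. \<bar>K x y\<bar>)" by (intro continuous_intros Kc x)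
  have "\<bar>\<integral>y. f y * K x y \<partial>N\<bar> <= (\<integral>y. \<bar>K x y\<bar> * \<bar>f y\<bar> \<partial>N)"
   using integral_norm_bound[of N "%y. f y * K x y"] by (simp add: abs_mult mult.commute)
  then have "\<bar>\<integral>y. f y * K x y \<partial>N\<bar> powr p <= (\<integral>y. \<bar>K x y\<bar> * \<bar>f y\<bar> \<partial>N) powr p"
   using p by (intro powr_mono2) auto
  also have "... <= B powr (p - 1) * (\<integral>y. \<bar>K x y\<bar> * \<bar>f y\<bar> powr p \<partial>N)"
  proof (rule Jensen_weighted)
   show "integrable N (%y. \<bar>K x y\<bar> * \<bar>f y\<bar>)" "integrable N (%y. \<bar>K x y\<bar> * \<bar>f y\<bar> powr p)"
    using N.int_bdd_mult[OF c, of "%y. \<bar>f y\<bar>"] N.int_bdd_mult[OF c fp] fi by (auto simp: mult.commute)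
  qed (use B x p N.cont_int[OF c] in auto)
  finally show ?thesis by (simp add: Q_def mult.commute)
 qed
 have int2: "integrable (M \<Otimes>\<^sub>M N) (%(x,y). \<bar>f y\<bar> powr p * \<bar>K x y\<bar>)"
 proof (rule P.Fubini_integrable)
  have [measurable]: "f \<in> borel_measurable N" using f by (simp add: in_Lp_def)
  have [measurable]: "(%(x,y). \<bar>K x y\<bar>) \<in> borel_measurable (M \<Otimes>\<^sub>M N)"
   by (rule MN.cont_meas) (simp add: space_pair_measure Kabs)
  show "(%(x,y). \<bar>f y\<bar> powr p * \<bar>K x y\<bar>) \<in> borel_measurable (M \<Otimes>\<^sub>M N)" by measurable
  have "integrable M Q" by (rule M.cont_int[OF Qc])
  then show "integrable M (%x. \<integral>y. norm (case (x, y) of (x, y) => \<bar>f y\<bar> powr p * \<bar>K x y\<bar>) \<partial>N)"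
   by (simp add: Q_def[abs_def] abs_mult)
  show "AE x in M. integrable N (%y. case (x, y) of (x, y) => \<bar>f y\<bar> powr p * \<bar>K x y\<bar>)"
  proof (rule AE_I2)
   fix x assume x: "x \<in> space M"
   have "continuous_on (space N) (%y. \<bar>K x y\<bar>)" by (intro continuous_intros Kc x)
   from N.int_bdd_mult[OF this fp]
   show "integrable N (%y. case (x, y) of (x, y) => \<bar>f y\<bar> powr p * \<bar>K x y\<bar>)" by simp
  qed
 qed
 have "(\<integral>x. \<bar>\<integral>y. f y * K x y \<partial>N\<bar> powr p \<partial>M) <= (\<integral>x. B powr (p - 1) * Q x \<partial>M)"
 proof (rule integral_mono)
  show "integrable M (%x. \<bar>\<integral>y. f y * K x y \<partial>N\<bar> powr p)"
   using \<open>in_Lp M p (%x. \<integral>y. f y * K x y \<partial>N)\<close> by (simp add: in_Lp_def)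
  show "integrable M (%x. B powr (p - 1) * Q x)" using M.cont_int[OF Qc] by simp
 qed (rule pt)
 also have "... = B powr (p - 1) * (\<integral>x. Q x \<partial>M)" by simp
 also have "(\<integral>x. Q x \<partial>M) = (\<integral>y. \<integral>x. \<bar>f y\<bar> powr p * \<bar>K x y\<bar> \<partial>M \<partial>N)"
  unfolding Q_def by (rule P.Fubini_integral[symmetric, OF int2])
 also have "... = (\<integral>y. \<bar>f y\<bar> powr p * (\<integral>x. \<bar>K x y\<bar> \<partial>M) \<partial>N)" by simp
 also have "... <= (\<integral>y. \<bar>f y\<bar> powr p * B \<partial>N)"
 proof (rule integral_mono)
  show "integrable N (%y. \<bar>f y\<bar> powr p * B)" using fp by simp
  show "integrable N (%y. \<bar>f y\<bar> powr p * (\<integral>x. \<bar>K x y\<bar> \<partial>M))"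
   using P.integrable_snd[OF int2] by simp
  fix y assume "y \<in> space N"
  then show "\<bar>f y\<bar> powr p * (\<integral>x. \<bar>K x y\<bar> \<partial>M) <= \<bar>f y\<bar> powr p * B"
   using B by (intro mult_left_mono) auto
 qed
 also have "... = B * (\<integral>y. \<bar>f y\<bar> powr p \<partial>N)" by simp
 finally have "(\<integral>x. \<bar>\<integral>y. f y * K x y \<partial>N\<bar> powr p \<partial>M) <= B powr (p - 1) * (B * (\<integral>y. \<bar>f y\<bar> powr p \<partial>N))"
  using B by (simp add: mult_left_mono)
 also have "... = B powr p * (\<integral>y. \<bar>f y\<bar> powr p \<partial>N)"
  using B by (simp add: powr_diff)
 also have "... = (B * Lp_nm N p f) powr p"
  using B p Lp_nm_powr[of p N f] by (simp add: powr_mult)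
 finally show "Lp_nm M p (%x. \<integral>y. f y * K x y \<partial>N) <= B * Lp_nm N p f"
  using B p by (subst Lp_nm_le_iff) auto
qed

section \<open>Lebesgue measure on a compact interval\<close>

abbreviation Iv :: "real => real => real measure" where
 "Iv a b \<equiv> restrict_space lborel {a..b}"

lemma cmeas_Iv: "cmeas (Iv a b)"
proof (intro cmeas.intro finite_measureI cmeas_axioms.intro)
 show "emeasure (Iv a b) (space (Iv a b)) ~= \<infinity>"
  by (cases "a <= b") (auto simp: emeasure_restrict_space space_restrict_space)

 show "(%x. x) \<in> Iv a b \<rightarrow>\<^sub>M borel" by (intro measurable_restrict_space1) auto
qed (simp add: space_restrict_space)

lemma space_Iv [simp]: "space (Iv a b) = {a..b}" by (simp add: space_restrict_space)

lemma integral_Iv: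
 fixes f :: "real => 'b::euclidean_space"
 assumes "continuous_on {a..b} f"
 shows "(\<integral>x. f x \<partial>Iv a b) = integral {a..b} f"
proof -
 have "set_integrable lborel {a..b} f"
  unfolding set_integrable_def by (rule borel_integrable_compact) (use assms in auto)
 then have "integral {a..b} f = (LINT x:{a..b}|lborel. f x)"
  by (rule set_borel_integral_eq_integral(2)[symmetric])
 then show ?thesis by (simp add: integral_restrict_space set_lebesgue_integral_def)
qed

lemma integral_Iv_FTC:
 fixes f F :: "real => real"
 assumes "a <= b" "continuous_on {a..b} f"
  "!!x. a < x ==> x < b ==> (F has_real_derivative f x) (at x)" "continuous_on {a..b} F"
 shows "(\<integral>x. f x \<partial>Iv a b) = F b - F a"
 unfolding integral_Iv[OF assms(2)]
 by (rule integral_unique, rule fundamental_theorem_of_calculus_interior)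
  (use assms in \<open>auto simp: has_real_derivative_iff_has_vector_derivative[symmetric]\<close>)

text \<open>As a function of s the integral over the window from s - pi to s + pi has derivative f
  (s + pi) - f (s - pi), which is 0 by periodicity.\<close>

lemma integral_periodic_shift:
 fixes f :: "real => 'b::euclidean_space"
 assumes f: "continuous_on UNIV f" and per: "!!x. f (x + 2 * pi) = f x"
 shows "(\<integral>x. f (x + s) \<partial>Iv (-pi) pi) = (\<integral>x. f x \<partial>Iv (-pi) pi)"
proof -
 have c: "continuous_on A f" for A using f continuous_on_subset by blast
 define G where "G s = integral {s-pi..s+pi} f" for s
 define H where "H u = integral {-pi..u} f" for u
 have sh: "(\<integral>x. f (x + s) \<partial>Iv (-pi) pi) = G s" for s
 proof -
  have "(\<integral>x. f (x + s) \<partial>Iv (-pi) pi) = integral {-pi..pi} (%x. f (x + s))"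
   by (intro integral_Iv continuous_on_compose2[OF f] continuous_intros) auto
  also have "... = integral {-pi+s..pi+s} f"
    using integral_shift_Icc_real[of "-pi" pi f s] by (simp add: o_def add.commute)
  also have "... = G s" by (simp add: G_def add.commute)
  finally show ?thesis .
 qed
 have "(G has_vector_derivative 0) (at s)" for s
 proof -
  \<comment> \<open>The interval from -b to b must contain all windows for parameters within 1 of
    s.\<close>
  define b where "b = \<bar>s\<bar> + pi + 1"
  define H where "H u = integral {-b..u} f" for u
  have H: "(H has_vector_derivative f u) (at u)" if "-b < u" "u < b" for u
  proof -
   have "(H has_vector_derivative f u) (at u within {-b..b})"
    unfolding H_def by (rule integral_has_vector_derivative[OF c]) (use that in auto)
   then show ?thesis using that by (simp add: at_within_Icc_at)
  qed
  have ev: "\<forall>\<^sub>F t in nhds s. H (t + pi) - H (t - pi) = G t"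
  proof -
   have "\<forall>\<^sub>F t in nhds s. t \<in> ball s 1" by (intro eventually_nhds_in_open) auto
   then show ?thesis
   proof eventually_elim
    case (elim t)
    have "integral {-b..t-pi} f + integral {t-pi..t+pi} f = integral {-b..t+pi} f"
     by (rule Henstock_Kurzweil_Integration.integral_combine)
      (use elim pi_gt_zero in \<open>auto simp: b_def dist_real_def intro!: integrable_continuous_real c\<close>)
    then show ?case by (simp add: H_def G_def algebra_simps)
   qed
  qed
  have bb: "-b < s + pi" "s + pi < b" "-b < s - pi" "s - pi < b"
   using pi_gt_zero abs_ge_self[of s] abs_ge_minus_self[of s] unfolding b_def by linarith+
  have "((%t. H (t + pi) - H (t - pi)) has_vector_derivative (f (s + pi) - f (s - pi))) (at s)"
  proof (rule has_vector_derivative_diff)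
   show "((%t. H (t + pi)) has_vector_derivative f (s + pi)) (at s)"
    using vector_diff_chain_at[of "%t. t + pi" 1 s H "f (s + pi)"] H[OF bb(1,2)]
     has_vector_derivative_add[OF has_vector_derivative_id has_vector_derivative_const[of pi], of "at s"]
    by (simp add: o_def)
   show "((%t. H (t - pi)) has_vector_derivative f (s - pi)) (at s)"
    using vector_diff_chain_at[of "%t. t - pi" 1 s H "f (s - pi)"] H[OF bb(3,4)]
     has_vector_derivative_diff[OF has_vector_derivative_id has_vector_derivative_const[of pi], of "at s"]
    by (simp add: o_def)
  qed
  moreover have "f (s + pi) = f (s - pi)" using per[of "s - pi"] by (simp add: algebra_simps)
  ultimately have "((%t. H (t + pi) - H (t - pi)) has_vector_derivative 0) (at s)" by simp
  then show ?thesis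
   unfolding has_vector_derivative_def
  proof (rule has_derivative_transform_eventually[where g=G])
   show "\<forall>\<^sub>F t in at s. H (t + pi) - H (t - pi) = G t"
    unfolding eventually_at_filter using ev by (rule eventually_mono) simp
   show "H (s + pi) - H (s - pi) = G s" using eventually_nhds_x_imp_x[OF ev] .
  qed simp
 qed
 then have "EX c. ALL s:UNIV. G s = c"
  by (intro has_derivative_zero_constant) (auto simp: has_vector_derivative_def)
 then have "G s = G 0" by (metis UNIV_I)
 then show ?thesis using sh[of s] sh[of 0] by simp
qed

section \<open>Surface measure and rotations\<close>

abbreviation "SS \<equiv> sphere (0::R3) 1"

text \<open>Lebesgue measure is pinned down by its values on boxes, and orthogonal images of boxes
  keep their volume.\<close>

lemma lborel_distr_orthogonal:
 fixes R :: "R3 => R3"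
 assumes R: "orthogonal_transformation R"
 shows "distr lborel borel R = lborel"
proof (rule lborel_eqI[symmetric])
 define Q where "Q = inv R"
 have Q: "orthogonal_transformation Q" unfolding Q_def by (rule orthogonal_transformation_inv[OF R])
 have Rm[measurable]: "R \<in> borel_measurable borel"
  using R by (intro borel_measurable_continuous_onI linear_continuous_on linear_conv_bounded_linear[THEN iffD1] orthogonal_transformation_linear)
 show "emeasure (distr lborel borel R) (box l u) = ennreal (\<Prod>b\<in>Basis. (u - l) \<bullet> b)"
  if "!!b. b \<in> Basis ==> l \<bullet> b <= u \<bullet> b" for l u
 proof -
  have vim: "R -` box l u = Q ` box l u"
   using orthogonal_transformation_bij[OF R] by (simp add: Q_def bij_vimage_eq_inv_image)
  have m: "R -` box l u \<in> sets borel" by (rule measurable_sets_borel[OF Rm]) auto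
  have "emeasure (distr lborel borel R) (box l u) = emeasure lborel (Q ` box l u)"
   by (subst emeasure_distr) (auto simp: vim)
  also have "... = emeasure lebesgue (Q ` box l u)"
   using m by (simp add: vim)
  also have "... = ennreal (measure lebesgue (Q ` box l u))"
   using measurable_orthogonal_image[OF Q, of "box l u"] by (intro emeasure_eq_measure2) auto
  also have "... = ennreal (measure lebesgue (box l u))"
   using measure_orthogonal_image[OF Q, of "box l u"] by simp
  also have "... = ennreal (\<Prod>b\<in>Basis. (u - l) \<bullet> b)"
   using that by (simp add: measure_lborel_box_eq inner_diff_left)
  finally show ?thesis .
 qed
qed simp

abbreviation "pball \<equiv> restrict_space lborel (ball (0::R3) 1 - {0})"
abbreviation "bsph \<equiv> restrict_space lborel SS"
abbreviation "nrml \<equiv> (%x::R3. x /\<^sub>R norm x)"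

lemma nrml_measurable: "nrml \<in> pball \<rightarrow>\<^sub>M bsph"
proof (rule measurable_restrict_space2)
 show "nrml \<in> pball \<rightarrow>\<^sub>M lborel" by (intro measurable_restrict_space1) simp
qed (auto simp: space_restrict_space)

abbreviation "nL \<equiv> Lp_nm sigmaS"
abbreviation "LL \<equiv> in_Lp sigmaS"
abbreviation sint :: "(R3 => 'b::{banach,second_countable_topology}) => 'b" (binder "\<integral>S" 10)
 where "sint \<equiv> integral\<^sup>L sigmaS"
abbreviation "Lconv p f g \<equiv> (%n::nat. nL p (%x. f n x - g x)) \<longlonglongrightarrow> 0"

lemma space_sigmaS [simp]: "space sigmaS = SS"
 by (simp add: sigmaS_def space_restrict_space)

lemma emeasure_pball: "emeasure pball (space pball) = ennreal (4/3 * pi)"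
proof -
 have "emeasure pball (space pball) = emeasure lborel (ball (0::R3) 1 - {0})"
  by (simp add: emeasure_restrict_space space_restrict_space)
 also have "... = emeasure lborel (ball (0::R3) 1)"
  by (rule emeasure_Diff_null_set) auto
 also have "... = ennreal (4/3 * pi)"
  by (subst emeasure_ball) (auto simp: unit_ball_vol_3)
 finally show ?thesis .
qed

lemma emeasure_sigmaS: "emeasure sigmaS SS = ennreal (4 * pi)"
proof -
 have "emeasure sigmaS SS = emeasure (density (distr pball bsph nrml) (%_. 3)) SS"
 proof -
  have "SS \<in> sets (density (distr pball bsph nrml) (%_. 3))" by (auto simp: sets_restrict_space intro!: image_eqI[of _ _ SS])
  then show ?thesis unfolding sigmaS_def by (subst emeasure_completion) auto
 qed
 also have "... = 3 * emeasure (distr pball bsph nrml) SS"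
  by (subst emeasure_density_const) (auto simp: sets_restrict_space)
 also have "emeasure (distr pball bsph nrml) SS = emeasure pball (space pball)"
  by (subst emeasure_distr[OF nrml_measurable]) (auto simp: sets_restrict_space space_restrict_space intro!: arg_cong2[where f=emeasure])
 also have "3 * ... = ennreal (4 * pi)"
  unfolding emeasure_pball by (simp add: ennreal_mult''[symmetric] ennreal_numeral[symmetric] del: ennreal_numeral)
 finally show ?thesis .
qed

global_interpretation sg: cmeas sigmaS
proof (intro cmeas.intro finite_measureI cmeas_axioms.intro)
 show "emeasure sigmaS (space sigmaS) ~= \<infinity>" by (simp add: emeasure_sigmaS)
 show "(%x. x) \<in> sigmaS \<rightarrow>\<^sub>M borel"
  unfolding sigmaS_def by (intro measurable_completion) (simp add: measurable_restrict_space1)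
qed simp

lemma measure_sigmaS: "measure sigmaS SS = 4 * pi"
 by (simp add: measure_def emeasure_sigmaS)

lemma integral_sigmaS:
 fixes f :: "R3 => 'b::{banach,second_countable_topology}"
 assumes "continuous_on SS f"
 shows "(\<integral>S x. f x) = 3 *R (\<integral>x. f (nrml x) \<partial>pball)"
proof -
 have m[measurable]: "f \<in> borel_measurable bsph"
  using borel_measurable_continuous_on_restrict[OF assms] by (simp cong: measurable_cong_sets add: sets_restrict_space)
 have "(\<integral>S x. f x) = (\<integral>x. f x \<partial>(density (distr pball bsph nrml) (%_. ennreal 3)))"
  unfolding sigmaS_def by (subst integral_completion) auto
 also have "... = (\<integral>x. 3 *R f x \<partial>(distr pball bsph nrml))"
  by (rule integral_density) auto
 also have "... = (\<integral>x. 3 *R f (nrml x) \<partial>pball)"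
  by (rule integral_distr[OF nrml_measurable]) auto
 finally show ?thesis by simp
qed

text \<open>Radial projection commutes with R, so the invariance of Lebesgue measure on the
  punctured ball passes to its push-forward.\<close>

lemma sigmaS_rotation:
 fixes f :: "R3 => 'b::{banach,second_countable_topology}"
 assumes R: "orthogonal_transformation R" and f: "continuous_on SS f"
 shows "(\<integral>S x. f (R x)) = (\<integral>S x. f x)"
proof -
 have nR: "norm (R x) = norm x" for x using orthogonal_transformation_norm[OF R] .
 have lin: "linear R" by (rule orthogonal_transformation_linear[OF R])
 have Rm[measurable]: "R \<in> borel_measurable borel"
  by (intro borel_measurable_continuous_onI linear_continuous_on linear_conv_bounded_linear[THEN iffD1] lin)
 have fR: "continuous_on SS (%x. f (R x))"
  by (rule continuous_on_compose2[OF f])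
   (auto simp: nR intro!: linear_continuous_on linear_conv_bounded_linear[THEN iffD1] lin)
 have m: "f \<in> borel_measurable bsph"
  using borel_measurable_continuous_on_restrict[OF f] by (simp cong: measurable_cong_sets add: sets_restrict_space)
 have m1: "(%x. f (nrml x)) \<in> borel_measurable pball"
  using measurable_compose[OF nrml_measurable m] .
 then have [measurable]: "(%x. indicator (ball 0 1 - {0}) x *R f (nrml x)) \<in> borel_measurable lborel"
  by (subst (asm) borel_measurable_restrict_space_iff) auto
 have "(\<integral>S x. f (R x)) = 3 *R (\<integral>x. f (R (nrml x)) \<partial>pball)" by (rule integral_sigmaS[OF fR])
 also have "(\<integral>x. f (R (nrml x)) \<partial>pball) = (\<integral>x. indicator (ball 0 1 - {0}) x *R f (R (nrml x)) \<partial>lborel)"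
  by (rule integral_restrict_space) auto
 also have "... = (\<integral>x. indicator (ball 0 1 - {0}) (R x) *R f (nrml (R x)) \<partial>lborel)"
  by (intro LINT_cong refl)
   (auto simp: indicator_def nR linear_scale[OF lin] linear_0[OF lin] orthogonal_transformation_scaleR[OF R] split: if_splits dest: arg_cong[of _ _ norm])
 also have "... = (\<integral>x. indicator (ball 0 1 - {0}) x *R f (nrml x) \<partial>(distr lborel borel R))"
  by (rule integral_distr[symmetric]) auto
 also have "... = (\<integral>x. indicator (ball 0 1 - {0}) x *R f (nrml x) \<partial>lborel)"
  by (simp add: lborel_distr_orthogonal[OF R])
 also have "... = (\<integral>x. f (nrml x) \<partial>pball)" by (rule integral_restrict_space[symmetric]) auto
 also have "3 *R ... = (\<integral>S x. f x)" by (rule integral_sigmaS[OF f, symmetric])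
 finally show ?thesis .
qed

section \<open>Rotation by the angle t about a unit axis n (Rodrigues' formula)\<close>

definition rot :: "R3 => real => R3 => R3" where
 "rot n t x = cos t *R x + sin t *R cross3 n x + ((1 - cos t) * (n \<bullet> x)) *R n"

lemma rot_inner: "norm n = 1 ==> n \<bullet> rot n t x = n \<bullet> x"
 by (simp add: rot_def inner_add_right dot_cross_self dot_square_norm algebra_simps)

lemma rot_orthogonal:
 assumes n: "norm n = 1" shows "orthogonal_transformation (rot n t)"
 unfolding orthogonal_transformation
proof (intro conjI allI)
 show "linear (rot n t)"
  by (rule linearI) (auto simp: rot_def cross_add_right cross_mult_right algebra_simps inner_add_right)
 fix x
 have nn: "n \<bullet> n = 1" using n by (simp add: dot_square_norm)
 have cc: "cross3 n x \<bullet> cross3 n x = x \<bullet> x - (n \<bullet> x)\<^sup>2"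
  using norm_cross[of n x] n by (simp add: power2_norm_eq_inner)
 have z: "x \<bullet> cross3 n x = 0" "cross3 n x \<bullet> x = 0" "cross3 n x \<bullet> n = 0" "n \<bullet> cross3 n x = 0"
  using dot_cross_self[of n x] dot_cross_self[of x n] by (auto simp: inner_commute)
 have "rot n t x \<bullet> rot n t x = (cos t)\<^sup>2 * (x \<bullet> x) + (sin t)\<^sup>2 * (x \<bullet> x - (n \<bullet> x)\<^sup>2)
   + (1 - cos t)\<^sup>2 * (n \<bullet> x)\<^sup>2 + 2 * cos t * (1 - cos t) * (n \<bullet> x)\<^sup>2"
  unfolding rot_def inner_add_left inner_add_right inner_scaleR_left inner_scaleR_right nn cc z inner_commute[of x n]
  by (simp add: power2_eq_square algebra_simps)
 also have "... = x \<bullet> x"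
  unfolding sin_squared_eq by (simp add: power2_eq_square algebra_simps)
 finally show "norm (rot n t x) = norm x" by (simp add: norm_eq_sqrt_inner)
qed

lemma norm_rot: "norm n = 1 ==> norm (rot n t x) = norm x"
 using orthogonal_transformation_norm[OF rot_orthogonal] by blast

lemma rot_rot:
 assumes n: "norm n = 1" shows "rot n s (rot n t x) = rot n (s + t) x"
proof -
 have nn: "n \<bullet> n = 1" using n by (simp add: dot_square_norm)
 have c: "cross3 n (rot n t x) = cos t *R cross3 n x + sin t *R ((n \<bullet> x) *R n - x)"
  by (simp add: rot_def cross_add_right cross_mult_right Lagrange nn)
 have "rot n s (rot n t x) = cos s *R rot n t x + sin s *R cross3 n (rot n t x) + ((1 - cos s) * (n \<bullet> x)) *R n"
  by (subst rot_def) (simp add: rot_inner[OF n])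
 also have "... = (cos s * cos t - sin s * sin t) *R x + (sin s * cos t + cos s * sin t) *R cross3 n x
   + ((1 - (cos s * cos t - sin s * sin t)) * (n \<bullet> x)) *R n"
  unfolding c by (simp add: rot_def algebra_simps)
 also have "... = rot n (s + t) x" by (simp add: rot_def cos_add sin_add)
 finally show ?thesis .
qed

lemma rot_0 [simp]: "rot n 0 x = x" by (simp add: rot_def)

lemma rot_periodic [simp]: "rot n (t + 2 * pi) x = rot n t x" by (simp add: rot_def)

lemma cross3_continuous [continuous_intros]:
 assumes "continuous_on A f" "continuous_on A g"
 shows "continuous_on A (%x. cross3 (f x) (g x))"
proof -
 have "ALL i. continuous_on A (%x. cross3 (f x) (g x) $ i)"
  unfolding forall_3 cross_components by (intro conjI continuous_intros assms)
 then have comp: "continuous_on A (%x. cross3 (f x) (g x) $ i)" for i by blast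
 have "continuous_on A (%x. \<chi> i. cross3 (f x) (g x) $ i)"
  by (intro continuous_on_vec_lambda comp)
 then show ?thesis by simp
qed

lemma rot_continuous [continuous_intros]:
 fixes n :: "'a::t2_space => R3"
 assumes "continuous_on A n" "continuous_on A t" "continuous_on A x"
 shows "continuous_on A (%a. rot (n a) (t a) (x a))"
 unfolding rot_def by (intro continuous_intros assms)

lemma rot_deriv:
 assumes n: "norm n = 1"
 shows "((%t. rot n t x) has_vector_derivative cross3 n (rot n t x)) (at t)"
proof -
 have nn: "n \<bullet> n = 1" using n by (simp add: dot_square_norm)
 have "((%t. rot n t x) has_vector_derivative (- sin t *R x + cos t *R cross3 n x + (sin t * (n \<bullet> x)) *R n)) (at t)"
  unfolding rot_def by (auto intro!: derivative_eq_intros)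
 moreover have "cross3 n (rot n t x) = - sin t *R x + cos t *R cross3 n x + (sin t * (n \<bullet> x)) *R n"
 proof -
  have "cross3 n (rot n t x) = cos t *R cross3 n x + sin t *R ((n \<bullet> x) *R n - x)"
   by (simp add: rot_def cross_add_right cross_mult_right Lagrange nn)
  then show ?thesis by (simp add: algebra_simps)
 qed
 ultimately show ?thesis by simp
qed

section \<open>Integration by parts, zonal and polar integration\<close>

text \<open>The gradient is carried along as an explicit field because \<open>grad\<close> is a
  definite description and says nothing before differentiability is known; \<open>C1g_grad\<close>
  leads back to \<open>grad\<close>.\<close>

definition C1g :: "(R3 => real) => (R3 => R3) => bool" where
 "C1g f g \<longleftrightarrow> (ALL x. (f has_derivative (%h. g x \<bullet> h)) (at x)) & continuous_on UNIV g"

lemma C1g_cont: "C1g f g ==> continuous_on A f"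
 unfolding C1g_def by (meson has_derivative_at_withinI has_derivative_continuous_on)

lemma C1g_cont_grad: "C1g f g ==> continuous_on A g"
 unfolding C1g_def using continuous_on_subset by blast

lemma C1g_inner: "C1g (%x. x \<bullet> a) (%x. a)"
 unfolding C1g_def by (auto intro!: derivative_eq_intros simp: inner_commute)

lemma C1g_mult:
 assumes "C1g f f'" "C1g g g'" shows "C1g (%x. f x * g x) (%x. f x *R g' x + g x *R f' x)"
 unfolding C1g_def
proof (intro conjI allI)
 fix x
 show "((%x. f x * g x) has_derivative (%h. (f x *R g' x + g x *R f' x) \<bullet> h)) (at x)"
  using assms unfolding C1g_def
  by (auto intro!: derivative_eq_intros simp: inner_add_left mult.commute)
qed (intro continuous_intros C1g_cont[OF assms(1)] C1g_cont[OF assms(2)] C1g_cont_grad[OF assms(1)] C1g_cont_grad[OF assms(2)])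

text \<open>The derivative of f along the orbit of a rotation integrates to 0 over a full turn.
  Averaging over the sphere and using rotation invariance leaves 2 pi times the integral of that
  derivative, which is a component of x cross grad f.\<close>

lemma integral_rot_deriv:
 assumes C: "C1g f g"
 shows "(\<integral>S x. cross3 x (g x) \<bullet> n) = 0"
proof (cases "n = 0")
 case False
 define m where "m = n /\<^sub>R norm n"
 have m: "norm m = 1" using False by (simp add: m_def)
 define D where "D x = g x \<bullet> cross3 m x" for x
 have Dc: "continuous_on A D" for A unfolding D_def by (intro continuous_intros C1g_cont_grad[OF C])
 have Dc2: "continuous_on (SS \<times> {-pi..pi}) (%(x,t). D (rot m t x))"
  unfolding case_prod_unfold by (rule continuous_on_compose2[OF Dc[of UNIV]]) (auto intro!: continuous_intros)
 have z: "(\<integral>t. D (rot m t x) \<partial>Iv (-pi) pi) = 0" for x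
 proof -
  have "((%t. f (rot m t x)) has_real_derivative D (rot m t x)) (at t)" for t
  proof -
   have "((%t. f (rot m t x)) has_derivative (%h. g (rot m t x) \<bullet> (h *R cross3 m (rot m t x)))) (at t)"
    using diff_chain_at[OF rot_deriv[OF m, unfolded has_vector_derivative_def]] C
    unfolding C1g_def o_def by blast
   then show ?thesis by (simp add: has_field_derivative_def D_def mult.commute[of _ "_ \<bullet> _"])
  qed
  then have "(\<integral>t. D (rot m t x) \<partial>Iv (-pi) pi) = f (rot m pi x) - f (rot m (-pi) x)"
   by (intro integral_Iv_FTC continuous_on_compose2[OF Dc] continuous_on_compose2[OF C1g_cont[OF C]] continuous_intros subset_UNIV) auto
  also have "rot m pi x = rot m (-pi) x" using rot_periodic[of m "-pi" x] by simp
  finally show ?thesis by simp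
 qed
 have "0 = (\<integral>S x. (\<integral>t. D (rot m t x) \<partial>Iv (-pi) pi))" using z by simp
 also have "... = (\<integral>t. (\<integral>S x. D (rot m t x)) \<partial>Iv (-pi) pi)"
  by (rule cont_swap[OF sg.cmeas_axioms cmeas_Iv]) (use Dc2 in simp)
 also have "... = (\<integral>t. (\<integral>S x. D x) \<partial>Iv (-pi) pi)"
  by (subst sigmaS_rotation[OF rot_orthogonal[OF m] Dc]) simp
 also have "... = 2 * pi * (\<integral>S x. D x)"
  by (simp add: measure_restrict_space)
 finally have "(\<integral>S x. D x) = 0" by simp
 moreover have "cross3 x (g x) \<bullet> n = norm n * D x" for x
 proof -
  have "cross3 x (g x) \<bullet> n = norm n * (cross3 x (g x) \<bullet> m)" using False by (simp add: m_def)
  also have "cross3 x (g x) \<bullet> m = D x"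
   unfolding D_def by (metis cross_triple inner_commute)
  finally show ?thesis .
 qed
 ultimately show ?thesis by simp
qed simp

text \<open>The divergence theorem on the sphere, with the factor 2 as mean curvature term. The
  tangential gradient is a combination of rotational derivatives with coefficients x . e_i; those
  derivatives have integral 0, and the product rule moves them onto the coefficients.\<close>

theorem sphere_ibp:
 assumes C: "C1g f g"
 shows "(\<integral>S x. (g x - (x \<bullet> g x) *R x) \<bullet> v) = 2 * (\<integral>S x. f x * (x \<bullet> v))"
proof -
 note gc = C1g_cont_grad[OF C] and fc = C1g_cont[OF C]
 define e where "e i = (axis i 1 :: R3)" for i
 \<comment> \<open>Rotational derivatives of the product (x . a) f integrate to 0; expanding the
   product gives integration by parts.\<close>
 have A: "(\<integral>S x. (x \<bullet> a) * (cross3 x (g x) \<bullet> n)) = - (\<integral>S x. f x * (cross3 x a \<bullet> n))" for a n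
 proof -
  have "(\<integral>S x. cross3 x ((x \<bullet> a) *R g x + f x *R a) \<bullet> n) = 0"
   by (rule integral_rot_deriv[OF C1g_mult[OF C1g_inner C]])
  moreover have "integrable sigmaS (%x. (x \<bullet> a) * (cross3 x (g x) \<bullet> n))" "integrable sigmaS (%x. f x * (cross3 x a \<bullet> n))"
   by (intro sg.cont_int continuous_intros gc fc)+
  ultimately show ?thesis by (simp add: cross_add_right cross_mult_right inner_add_left)
 qed
 have vexp: "(g x - (x \<bullet> g x) *R x) \<bullet> v = (\<Sum>i\<in>UNIV. (x \<bullet> e i) * (cross3 x (g x) \<bullet> cross3 (e i) v))" if "x \<in> SS" for x
 proof -
  have xx: "x \<bullet> x = 1" using that by (simp add: dot_square_norm)
  have "(\<Sum>i\<in>UNIV. (x \<bullet> e i) * (cross3 x (g x) \<bullet> cross3 (e i) v)) = cross3 x (g x) \<bullet> cross3 (\<Sum>i\<in>UNIV. (x \<bullet> e i) *R e i) v"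
   by (simp add: sum_3 cross_add_left cross_mult_left inner_add_right)
  also have "(\<Sum>i\<in>UNIV. (x \<bullet> e i) *R e i) = x"
  proof -
   have "(\<Sum>i\<in>UNIV. (x \<bullet> e i) *R e i) $ j = x $ j" for j
   proof -
    have 1: "x \<bullet> e i = x $ i" for i by (simp add: e_def inner_axis)
    have 2: "e i $ j = (if i = j then 1 else 0)" for i by (simp add: e_def axis_def)
    show ?thesis by (simp add: 1 2 if_distrib cong: if_cong)
   qed
   then show ?thesis by (simp add: vec_eq_iff)
  qed
  also have "cross3 x (g x) \<bullet> cross3 x v = (x \<bullet> x) * (g x \<bullet> v) - (x \<bullet> v) * (g x \<bullet> x)" by (rule dot_cross)
  finally show ?thesis by (simp add: xx inner_diff_left inner_diff_right inner_commute)
 qed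
 have "(\<integral>S x. (g x - (x \<bullet> g x) *R x) \<bullet> v) = (\<integral>S x. (\<Sum>i\<in>UNIV. (x \<bullet> e i) * (cross3 x (g x) \<bullet> cross3 (e i) v)))"
  by (rule LINT_cong[OF refl]) (use vexp in simp)
 also have "... = (\<Sum>i\<in>UNIV. (\<integral>S x. (x \<bullet> e i) * (cross3 x (g x) \<bullet> cross3 (e i) v)))"
  by (rule LINT_sum) (intro sg.cont_int continuous_intros gc)
 also have "... = (\<Sum>i\<in>UNIV. - (\<integral>S x. f x * (cross3 x (e i) \<bullet> cross3 (e i) v)))" by (simp add: A)
 also have "... = (\<integral>S x. (\<Sum>i\<in>UNIV. - (f x * (cross3 x (e i) \<bullet> cross3 (e i) v))))"
  by (subst LINT_sum) (auto intro!: sg.cont_int continuous_intros fc)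
 also have "... = (\<integral>S x. 2 * (f x * (x \<bullet> v)))"
 proof (rule LINT_cong[OF refl])
  fix x
  \<comment> \<open>Each term is x_i v_i - x . v, and the three add up to x . v - 3 (x . v). This is
    the origin of the 2.\<close>
  have "(\<Sum>i\<in>UNIV. cross3 x (e i) \<bullet> cross3 (e i) v) = - 2 * (x \<bullet> v)"
  proof -
   have "(\<Sum>i\<in>UNIV. cross3 x (e i) \<bullet> cross3 (e i) v) = (\<Sum>i\<in>UNIV. x $ i * v $ i - x \<bullet> v)"
    by (rule sum.cong) (simp_all add: dot_cross e_def inner_axis inner_axis' inner_axis_axis)
   also have "... = x \<bullet> v - 3 * (x \<bullet> v)"
    by (simp add: sum_subtractf inner_vec_def)
   finally show ?thesis by simp
  qed
  then have "(\<Sum>i\<in>UNIV. f x * (cross3 x (e i) \<bullet> cross3 (e i) v)) = f x * (- 2 * (x \<bullet> v))"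
   by (simp add: sum_distrib_left[symmetric])
  then show "(\<Sum>i\<in>UNIV. - (f x * (cross3 x (e i) \<bullet> cross3 (e i) v))) = 2 * (f x * (x \<bullet> v))"
   by (simp add: sum_negf)
 qed
 finally show ?thesis by simp
qed

text \<open>Integrating (x . y)^(k+1) by parts in the direction x gives M(k+2) = (k+1)/(k+3) M(k)
  for the moments, the recursion that the integrals of t^k over [-1,1] satisfy as well; k = 0 and k
  = 1 start it.\<close>

lemma zonal_moment:
 assumes x: "norm x = 1"
 shows "(\<integral>S y. (x \<bullet> y) ^ k) = 2 * pi * (\<integral>t. t ^ k \<partial>Iv (-1) 1)"
proof -
 have Iv: "(\<integral>t. t ^ k \<partial>Iv (-1) 1) = (1 - (-1) ^ Suc k) / real (Suc k)" for k
 proof -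
  have "(\<integral>t. t ^ k \<partial>Iv (-1) 1) = 1 ^ Suc k / real (Suc k) - (-1) ^ Suc k / real (Suc k)"
   by (rule integral_Iv_FTC) (auto intro!: derivative_eq_intros continuous_intros simp del: power_Suc of_nat_Suc)
  then show ?thesis by (simp only: diff_divide_distrib power_one)
 qed
 have xx: "x \<bullet> x = 1" using x by (simp add: dot_square_norm)
 show ?thesis
 proof (induction k rule: induct_nat_012)
  case 0
  then show ?case using measure_sigmaS by (simp add: Iv measure_restrict_space)
 next
  case 1
  have "C1g (%x. 1) (%x. 0)" by (simp add: C1g_def)
  from sphere_ibp[OF this, of x] show ?case using Iv[of 1] by (simp add: inner_commute)
 next
  case (ge2 k)
  have "C1g (%y. (x \<bullet> y) ^ Suc k) (%y. (real (Suc k) * (x \<bullet> y) ^ k) *R x)"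
   unfolding C1g_def
   by (auto intro!: derivative_eq_intros continuous_intros simp: fun_eq_iff simp del: power_Suc of_nat_Suc)
  note ibp = sphere_ibp[OF this, of x]
  have i: "integrable sigmaS (%y. (x \<bullet> y) ^ j)" for j by (intro sg.cont_int continuous_intros)
  have "(\<integral>S y. ((real (Suc k) * (x \<bullet> y) ^ k) *R x - (y \<bullet> ((real (Suc k) * (x \<bullet> y) ^ k) *R x)) *R y) \<bullet> x)
    = (\<integral>S y. real (Suc k) * ((x \<bullet> y) ^ k - (x \<bullet> y) ^ Suc (Suc k)))"
   by (rule LINT_cong[OF refl])
    (simp add: inner_diff_left inner_diff_right xx inner_commute right_diff_distrib del: of_nat_Suc)
  also have "... = real (Suc k) * ((\<integral>S y. (x \<bullet> y) ^ k) - (\<integral>S y. (x \<bullet> y) ^ Suc (Suc k)))"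
   using i[of k] i[of "Suc (Suc k)"] by (simp del: power_Suc of_nat_Suc)
  finally have "real (Suc k) * ((\<integral>S y. (x \<bullet> y) ^ k) - (\<integral>S y. (x \<bullet> y) ^ Suc (Suc k)))
    = 2 * (\<integral>S y. (x \<bullet> y) ^ Suc (Suc k))"
   unfolding ibp by (simp add: inner_commute mult.commute)
  then have "(\<integral>S y. (x \<bullet> y) ^ Suc (Suc k)) = real (Suc k) * (\<integral>S y. (x \<bullet> y) ^ k) / (real k + 3)"
   by (simp add: field_simps del: power_Suc)
  also have "... = 2 * pi * (\<integral>t. t ^ Suc (Suc k) \<partial>Iv (-1) 1)"
  proof -
   have "real (Suc k) * (2 * pi * ((1 - (- 1) ^ Suc k) / real (Suc k))) = 2 * pi * (1 - (- 1) ^ Suc k)"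
    by (simp del: of_nat_Suc power_Suc)
   moreover have "(- 1) ^ Suc (Suc (Suc k)) = ((- 1) ^ Suc k :: real)" "real (Suc (Suc (Suc k))) = real k + 3" by simp_all
   ultimately show ?thesis unfolding ge2 Iv by (simp only: times_divide_eq_right)
  qed
  finally show ?case .
 qed
qed

text \<open>Archimedes' theorem that the height x . y is uniformly distributed, carried from
  monomials to continuous functions by Weierstrass approximation.\<close>

theorem zonal_integral:
 fixes u :: "real => real"
 assumes x: "norm x = 1" and u: "continuous_on {-1..1} u"
 shows "(\<integral>S y. u (x \<bullet> y)) = 2 * pi * (\<integral>t. u t \<partial>Iv (-1) 1)"
proof (rule ccontr)
 define J where "J v = (\<integral>S y. v (x \<bullet> y)) - 2 * pi * (\<integral>t. v t \<partial>Iv (-1) 1)" for v :: "real => real"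
 assume "\<not> ?thesis"
 then have pos: "0 < \<bar>J u\<bar>" by (simp add: J_def)
 \<comment> \<open>An error below e changes the two integrals by at most 8 pi e together, which this
   choice makes half of |J u|.\<close>
 define e where "e = \<bar>J u\<bar> / (16 * pi)"
 have e: "0 < e" using pos by (simp add: e_def)
 interpret I: cmeas "Iv (-1) 1" by (rule cmeas_Iv)
 obtain q where q: "real_polynomial_function q" "!!t. t \<in> {-1..1} ==> \<bar>u t - q t\<bar> < e"
  using Stone_Weierstrass_real_polynomial_function[of "{-1..1}" u e] u e by auto
 obtain a n where an: "q = (%t. \<Sum>i\<le>n. a i * t ^ i)"
  using q(1) real_polynomial_function_iff_sum by blast
 have dom: "x \<bullet> y \<in> {-1..1}" if "y \<in> SS" for y
  using Cauchy_Schwarz_ineq2[of x y] x that by (auto simp: abs_le_iff)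
 have qc: "continuous_on A q" for A unfolding an by (intro continuous_intros)
 have comp: "continuous_on SS (%y. v (x \<bullet> y))" if "continuous_on {-1..1} v" for v :: "real => real"
  by (rule continuous_on_compose2[OF that]) (use dom in \<open>auto intro!: continuous_intros\<close>)
 have Jq: "J q = 0"
 proof -
  have "(\<integral>S y. q (x \<bullet> y)) = (\<Sum>i\<le>n. a i * (\<integral>S y. (x \<bullet> y) ^ i))"
   unfolding an by (subst LINT_sum) (auto intro!: sg.cont_int continuous_intros)
  also have "... = 2 * pi * (\<Sum>i\<le>n. a i * (\<integral>t. t ^ i \<partial>Iv (-1) 1))"
   unfolding zonal_moment[OF x] sum_distrib_left by (simp add: algebra_simps)
  also have "(\<Sum>i\<le>n. a i * (\<integral>t. t ^ i \<partial>Iv (-1) 1)) = (\<integral>t. q t \<partial>Iv (-1) 1)"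
   unfolding an by (subst LINT_sum) (auto intro!: I.cont_int continuous_intros)
  finally show ?thesis by (simp add: J_def)
 qed
 have uq: "continuous_on {-1..1} (%t. u t - q t)" by (intro continuous_intros u qc)
 have "(\<integral>t. u t - q t \<partial>Iv (-1) 1) = (\<integral>t. u t \<partial>Iv (-1) 1) - (\<integral>t. q t \<partial>Iv (-1) 1)"
  by (rule LINT_diff) (use u qc in \<open>auto intro!: I.cont_int\<close>)
 moreover have "(\<integral>S y. u (x \<bullet> y) - q (x \<bullet> y)) = (\<integral>S y. u (x \<bullet> y)) - (\<integral>S y. q (x \<bullet> y))"
  by (rule LINT_diff) (use comp[OF u] comp[OF qc] in \<open>auto intro!: sg.cont_int\<close>)
 ultimately have "J u = J (%t. u t - q t)"
  using Jq unfolding J_def by (simp add: right_diff_distrib)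
 then have "\<bar>J u\<bar> <= \<bar>(\<integral>S y. u (x \<bullet> y) - q (x \<bullet> y))\<bar> + 2 * pi * \<bar>\<integral>t. u t - q t \<partial>Iv (-1) 1\<bar>"
  unfolding J_def by (simp add: abs_mult order_trans[OF abs_triangle_ineq4])
 also have "... <= e * (4 * pi) + 2 * pi * (e * 2)"
 proof (intro add_mono mult_left_mono)
  have "\<bar>(\<integral>S y. u (x \<bullet> y) - q (x \<bullet> y))\<bar> <= (\<integral>S y. \<bar>u (x \<bullet> y) - q (x \<bullet> y)\<bar>)"
   using integral_norm_bound[of sigmaS "%y. u (x \<bullet> y) - q (x \<bullet> y)"] by simp
  also have "... <= (\<integral>S y. e)"
   by (intro integral_mono sg.cont_int continuous_on_rabs)
    (use q dom comp[OF uq] in \<open>auto intro: less_imp_le\<close>)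
  finally show "\<bar>(\<integral>S y. u (x \<bullet> y) - q (x \<bullet> y))\<bar> <= e * (4 * pi)" by (simp add: measure_sigmaS mult.commute)
  have "\<bar>\<integral>t. u t - q t \<partial>Iv (-1) 1\<bar> <= (\<integral>t. \<bar>u t - q t\<bar> \<partial>Iv (-1) 1)"
   using integral_norm_bound[of "Iv (-1) 1" "%t. u t - q t"] by simp
  also have "... <= (\<integral>t. e \<partial>Iv (-1) 1)"
   by (intro integral_mono I.cont_int continuous_on_rabs) (use q uq in \<open>auto intro: less_imp_le\<close>)
  finally show "\<bar>\<integral>t. u t - q t \<partial>Iv (-1) 1\<bar> <= e * 2" by (simp add: measure_restrict_space mult.commute)
 qed auto
 also have "... = \<bar>J u\<bar> / 2" by (simp add: e_def)
 finally show False using pos by simp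
qed

section \<open>Polar coordinates on the sphere about a given point\<close>

lemma exists_orthogonal_unit:
 fixes x :: R3 obtains e where "norm e = 1" "x \<bullet> e = 0"
proof -
 obtain y where "y ~= 0" "orthogonal x y" using orthogonal_to_vector_exists[of x] by auto
 then show ?thesis using that[of "y /\<^sub>R norm y"] by (auto simp: orthogonal_def)
qed

lemma rot_perp: "x \<bullet> e = 0 ==> rot x t e = cos t *R e + sin t *R cross3 x e"
 by (simp add: rot_def)

text \<open>For e and u orthogonal to x the product e cross u is a multiple of x. So the coordinates
  of u along e and x cross e have square sum 1 and are the cosine and sine of an angle.\<close>

lemma perp_unit_is_rot:
 assumes x: "norm x = 1" and e: "norm e = 1" "x \<bullet> e = 0" and u: "norm u = 1" "x \<bullet> u = 0"
 obtains t where "u = rot x t e"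
proof -
 have sq: "x \<bullet> x = 1" "e \<bullet> e = 1" "u \<bullet> u = 1" using x e u by (auto simp: dot_square_norm)
 define f where "f = cross3 x e"
 have ff: "f \<bullet> f = 1" "f \<bullet> e = 0" using e x by (auto simp: f_def dot_cross sq dot_cross_self inner_commute)
 have "cross3 x (cross3 e u) = 0" by (simp add: Lagrange e u)
 then have "cross3 x (cross3 x (cross3 e u)) = 0" by simp
 then have par: "cross3 e u = (x \<bullet> cross3 e u) *R x" by (simp add: Lagrange[of x x] sq)
 have "(cross3 e u) \<bullet> (cross3 e u) = (x \<bullet> cross3 e u)\<^sup>2"
  by (subst (1 2) par) (simp add: sq power2_eq_square)
 moreover have "(cross3 e u) \<bullet> (cross3 e u) = 1 - (u \<bullet> e)\<^sup>2"
  by (simp add: dot_cross sq inner_commute power2_eq_square)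
 moreover have "x \<bullet> cross3 e u = u \<bullet> f" unfolding f_def by (metis cross_triple inner_commute)
 ultimately have "(u \<bullet> e)\<^sup>2 + (u \<bullet> f)\<^sup>2 = 1" by simp
 then obtain t where t: "u \<bullet> e = cos t" "u \<bullet> f = sin t" using sincos_total_2pi by metis
 have "(u - cos t *R e - sin t *R f) \<bullet> (u - cos t *R e - sin t *R f) = 1 - (cos t)\<^sup>2 - (sin t)\<^sup>2"
 proof -
  have c: "e \<bullet> u = cos t" "f \<bullet> u = sin t" "e \<bullet> f = 0" using t ff by (auto simp: inner_commute)
  show ?thesis
   by (simp add: inner_diff_left inner_diff_right c t ff sq power2_eq_square algebra_simps)
 qed
 also have "... = 0" using sin_cos_squared_add[of t] by linarith
 finally have "u = cos t *R e + sin t *R f" by (simp add: diff_diff_eq)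
 then show ?thesis using that[of t] by (simp add: rot_perp e f_def)
qed

lemma rot_linear:
 "rot n t (a *R x + b *R y) = a *R rot n t x + b *R rot n t y"
 by (simp add: rot_def cross_add_right cross_mult_right algebra_simps inner_add_right)

lemma rot_self: "norm n = 1 ==> rot n t n = n"
 by (simp add: rot_def dot_square_norm algebra_simps)

lemma polar_point:
 assumes x: "norm x = 1" and e: "norm e = 1" "x \<bullet> e = 0" and ab: "a\<^sup>2 + b\<^sup>2 = 1"
 shows "norm (a *R x + b *R rot x t e) = 1"
proof -
 have "rot x t e \<bullet> rot x t e = 1" "x \<bullet> rot x t e = 0" "x \<bullet> x = 1"
  using norm_rot[OF x, of t e] rot_inner[OF x, of t e] x e by (auto simp: dot_square_norm)
 moreover from this have "rot x t e \<bullet> x = 0" by (simp add: inner_commute)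
 ultimately have "(a *R x + b *R rot x t e) \<bullet> (a *R x + b *R rot x t e) = 1"
  using ab by (simp add: inner_add_left inner_add_right power2_eq_square)
 then show ?thesis by (simp add: norm_eq_1)
qed

text \<open>Averaging F over the rotations about x makes it zonal without changing its integral, and
  the zonal formula applies. In the second form t runs over whole great circles, so that every point
  is met twice, whence the 1/2; in this form oddness along great circles becomes visible.\<close>

theorem sphere_polar:
 fixes F :: "R3 => real"
 assumes x: "norm x = 1" and e: "norm e = 1" "x \<bullet> e = 0" and F: "continuous_on SS F"
 shows "(\<integral>S y. F y) = (\<integral>t. (\<integral>s. F (t *R x + sqrt (1 - t\<^sup>2) *R rot x s e) \<partial>Iv (-pi) pi) \<partial>Iv (-1) 1)" (is ?A)
  and "(\<integral>S y. F y) = 1/2 * (\<integral>t. \<bar>sin t\<bar> * (\<integral>s. F (cos t *R x + sin t *R rot x s e) \<partial>Iv (-pi) pi) \<partial>Iv (-pi) pi)" (is ?B)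
  and "continuous_on {-1..1} (%t. (\<integral>s. F (t *R x + sqrt (1 - t\<^sup>2) *R rot x s e) \<partial>Iv (-pi) pi))" (is ?C)
proof -
 interpret P: cmeas "Iv (-pi) pi" by (rule cmeas_Iv)
 define m where "m t = (\<integral>s. F (t *R x + sqrt (1 - t\<^sup>2) *R rot x s e) \<partial>Iv (-pi) pi)" for t
 have sq: "t\<^sup>2 <= 1" if "t \<in> {-1..1}" for t :: real using that by (simp add: abs_square_le_1 abs_le_iff)
 have mc: "continuous_on {-1..1} m"
  unfolding m_def
 proof (rule P.int_param_cont1)
  show "continuous_on ({-1..1} \<times> space (Iv (-pi) pi)) (%(t,s). F (t *R x + sqrt (1 - t\<^sup>2) *R rot x s e))"
   unfolding case_prod_unfold
   by (rule continuous_on_compose2[OF F])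
    (auto intro!: continuous_intros polar_point[OF x e] simp: sq)
 qed
 then show ?C by (simp add: m_def)
 have shift: "(\<integral>s. F (a *R x + b *R rot x (s + s0) e) \<partial>Iv (-pi) pi) = (\<integral>s. F (a *R x + b *R rot x s e) \<partial>Iv (-pi) pi)"
  if "a\<^sup>2 + b\<^sup>2 = 1" for a b s0
  using integral_periodic_shift[of "%s. F (a *R x + b *R rot x s e)" s0]
  by (simp add: continuous_on_compose2[OF F] continuous_intros polar_point[OF x e that] image_subset_iff)
 \<comment> \<open>The average depends on y only through t = x . y: y differs from the reference
   point by an angle s0, which periodicity absorbs. At the poles sqrt (1 - t^2) = 0 and any angle
   does.\<close>
 have Am: "(\<integral>s. F (rot x s y) \<partial>Iv (-pi) pi) = m (x \<bullet> y)" if y: "y \<in> SS" for y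
 proof -
  define t where "t = x \<bullet> y"
  have t1: "t \<in> {-1..1}" using Cauchy_Schwarz_ineq2[of x y] x y by (auto simp: abs_le_iff t_def)
  have xx: "x \<bullet> x = 1" "y \<bullet> y = 1" using x y by (auto simp: dot_square_norm)
  have "(y - t *R x) \<bullet> (y - t *R x) = 1 - t\<^sup>2"
   using xx by (simp add: inner_diff_left inner_diff_right t_def inner_commute power2_eq_square)
  then have nz: "norm (y - t *R x) = sqrt (1 - t\<^sup>2)" by (simp add: norm_eq_sqrt_inner)
  obtain s0 where s0: "y = t *R x + sqrt (1 - t\<^sup>2) *R rot x s0 e"
  proof (cases "sqrt (1 - t\<^sup>2) = 0")
   case True
   then show ?thesis using that[of 0] nz by simp
  next
   case False
   define u where "u = (y - t *R x) /\<^sub>R sqrt (1 - t\<^sup>2)"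
   have "0 < sqrt (1 - t\<^sup>2)" using nz False by (metis norm_ge_zero less_eq_real_def)
   then have "norm u = 1" "x \<bullet> u = 0" using nz xx by (auto simp: u_def inner_diff_right t_def)
   then obtain s0 where "u = rot x s0 e" using perp_unit_is_rot[OF x e] by blast
   moreover have "y = t *R x + sqrt (1 - t\<^sup>2) *R u" using False by (simp add: u_def)
   ultimately show ?thesis using that[of s0] by simp
  qed
  have "rot x s y = t *R x + sqrt (1 - t\<^sup>2) *R rot x (s + s0) e" for s
   by (subst s0) (simp add: rot_linear rot_self[OF x] rot_rot[OF x])
  then have "(\<integral>s. F (rot x s y) \<partial>Iv (-pi) pi) = (\<integral>s. F (t *R x + sqrt (1 - t\<^sup>2) *R rot x (s + s0) e) \<partial>Iv (-pi) pi)"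
   by simp
  also have "... = m t" unfolding m_def by (rule shift) (use sq[OF t1] in simp)
  finally show ?thesis by (simp add: t_def)
 qed
 have "2 * pi * (\<integral>S y. F y) = (\<integral>s. (\<integral>S y. F (rot x s y)) \<partial>Iv (-pi) pi)"
  by (subst sigmaS_rotation[OF rot_orthogonal[OF x] F]) (simp add: measure_restrict_space)
 also have "... = (\<integral>S y. (\<integral>s. F (rot x s y) \<partial>Iv (-pi) pi))"
  by (rule cont_swap[OF cmeas_Iv sg.cmeas_axioms], unfold case_prod_unfold, rule continuous_on_compose2[OF F])
   (auto intro!: continuous_intros simp: norm_rot[OF x])
 also have "... = (\<integral>S y. m (x \<bullet> y))"
  by (rule LINT_cong[OF refl]) (use Am in simp)
 also have "... = 2 * pi * (\<integral>t. m t \<partial>Iv (-1) 1)" by (rule zonal_integral[OF x mc])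
 finally have A: "(\<integral>S y. F y) = (\<integral>t. m t \<partial>Iv (-1) 1)" by simp
 then show ?A by (simp add: m_def)
 define mm where "mm t = (\<integral>s. F (cos t *R x + sin t *R rot x s e) \<partial>Iv (-pi) pi)" for t
 \<comment> \<open>For negative sin t the sign is absorbed by the half turn s + pi.\<close>
 have mm: "mm t = m (cos t)" for t
 proof (cases "0 <= sin t")
  case True
  then have "sqrt (1 - (cos t)\<^sup>2) = sin t" by (simp add: sin_squared_eq[symmetric])
  then show ?thesis by (simp add: mm_def m_def)
 next
  case False
  then have s: "sqrt (1 - (cos t)\<^sup>2) = - sin t" by (simp add: sin_squared_eq[symmetric])
  have "rot x (s + pi) e = - rot x s e" for s by (simp add: rot_perp e)
  then have "(\<integral>s. F (cos t *R x + (- sin t) *R rot x (s + pi) e) \<partial>Iv (-pi) pi) = mm t"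
   by (simp add: mm_def)
  moreover have "(\<integral>s. F (cos t *R x + (- sin t) *R rot x (s + pi) e) \<partial>Iv (-pi) pi) = m (cos t)"
   by (subst shift) (auto simp: m_def s)
  ultimately show ?thesis by simp
 qed
 define M where "M u = integral {-1..u} m" for u
 have Mc: "continuous_on {-1..1} M"
  unfolding M_def by (intro indefinite_integral_continuous_1 integrable_continuous_real mc)
 have Md: "(M has_real_derivative m u) (at u)" if "-1 < u" "u < 1" for u
 proof -
  have "(M has_vector_derivative m u) (at u within {-1..1})"
   unfolding M_def by (rule integral_has_vector_derivative[OF mc]) (use that in auto)
  then show ?thesis using that by (simp add: at_within_Icc_at has_real_derivative_iff_has_vector_derivative)
 qed
 have cb: "-1 < cos t & cos t < 1" if "0 < t" "t < pi" for t
  using cos_monotone_0_pi[of 0 t] cos_monotone_0_pi[of t pi] that by auto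
 have hc: "continuous_on A (%t. \<bar>sin t\<bar> * m (cos t))" for A
  by (intro continuous_intros continuous_on_compose2[OF mc]) auto
 have h1: "((%t. \<bar>sin t\<bar> * m (cos t)) has_integral (- M (cos pi) - - M (cos 0))) {0..pi}"
 proof (rule fundamental_theorem_of_calculus_interior)
  show "continuous_on {0..pi} (%t. - M (cos t))"
   by (intro continuous_intros continuous_on_compose2[OF Mc]) auto
  fix t assume t: "t \<in> {0<..<pi}"
  then have "((%t. - M (cos t)) has_real_derivative - (m (cos t) * - sin t)) (at t)"
   using cb[of t] by (intro DERIV_minus DERIV_chain2[OF Md] DERIV_cos) auto
  then show "((%t. - M (cos t)) has_vector_derivative \<bar>sin t\<bar> * m (cos t)) (at t)"
   using t sin_gt_zero[of t] by (simp add: has_real_derivative_iff_has_vector_derivative mult.commute)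
 qed simp
 have h2: "((%t. \<bar>sin t\<bar> * m (cos t)) has_integral (M (cos 0) - M (cos (-pi)))) {-pi..0}"
 proof (rule fundamental_theorem_of_calculus_interior)
  show "continuous_on {-pi..0} (%t. M (cos t))"
   by (intro continuous_intros continuous_on_compose2[OF Mc]) auto
  fix t assume t: "t \<in> {-pi<..<0}"
  then have "((%t. M (cos t)) has_real_derivative (m (cos t) * - sin t)) (at t)"
   using cb[of "-t"] by (intro DERIV_chain2[OF Md] DERIV_cos) auto
  then show "((%t. M (cos t)) has_vector_derivative \<bar>sin t\<bar> * m (cos t)) (at t)"
   using t sin_gt_zero[of "-t"] by (simp add: has_real_derivative_iff_has_vector_derivative mult.commute)
 qed simp
 have "((%t. \<bar>sin t\<bar> * m (cos t)) has_integral ((M 1 - M (-1)) + (M 1 - M (-1)))) {-pi..pi}"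
  by (rule has_integral_combine[of "-pi" 0 pi]) (use h1 h2 in auto)
 moreover have "M (-1) = 0" by (simp add: M_def)
 ultimately have "(\<integral>t. \<bar>sin t\<bar> * m (cos t) \<partial>Iv (-pi) pi) = 2 * M 1"
  by (subst integral_Iv[OF hc]) (auto intro: integral_unique)
 also have "M 1 = (\<integral>t. m t \<partial>Iv (-1) 1)" by (simp add: M_def integral_Iv[OF mc])
 finally show ?B using A by (simp add: mm[symmetric] mm_def)
qed

text \<open>On the cap x . y > 1 - r^2/2, where the exponential u is at least 1; u is zonal with an
  elementary antiderivative. The maximal inequality uses the order r^2.\<close>

lemma sigmaS_cap_le:
 assumes x: "norm x = 1" and r: "0 < r"
 shows "measure sigmaS (SS \<inter> ball x r) <= exp 1 * pi * r\<^sup>2"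
proof -
 define u where "u t = exp (1 - 2 * (1 - t) / r\<^sup>2)" for t :: real
 have uc: "continuous_on A u" for A unfolding u_def using r by (intro continuous_intros) auto
 have m: "SS \<inter> ball x r \<in> sets sigmaS"
  using measurable_sets[OF sg.id_meas, of "ball x r"] by (simp add: Int_commute)
 have "measure sigmaS (SS \<inter> ball x r) = (\<integral>S y. indicator (SS \<inter> ball x r) y)"
  using m by (simp add: Int_absorb2)
 also have "... <= (\<integral>S y. u (x \<bullet> y))"
 proof (rule integral_mono)
  show "integrable sigmaS (%y. indicator (SS \<inter> ball x r) y :: real)" by (rule integrable_real_indicator[OF m]) (simp add: sg.emeasure_finite less_top[symmetric])
  show "integrable sigmaS (%y. u (x \<bullet> y))" unfolding u_def using r by (intro sg.cont_int continuous_intros) auto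
  fix y assume y: "y \<in> space sigmaS"
  show "indicator (SS \<inter> ball x r) y <= u (x \<bullet> y)"
  proof (cases "y \<in> ball x r")
   case True
   then have "(norm (x - y))\<^sup>2 < r\<^sup>2" using r by (intro power_strict_mono) (auto simp: dist_norm)
   moreover have "(norm (x - y))\<^sup>2 = 2 * (1 - x \<bullet> y)"
   proof -
    have "x \<bullet> x = 1" "y \<bullet> y = 1" using x y by (auto simp: dot_square_norm)
    then show ?thesis by (simp add: power2_norm_eq_inner inner_diff_left inner_diff_right inner_commute)
   qed
   ultimately have "2 * (1 - x \<bullet> y) / r\<^sup>2 <= 1" using r by (simp add: field_simps)
   then show ?thesis by (simp add: u_def indicator_def)
  qed (simp add: u_def)
 qed
 also have "... = 2 * pi * (\<integral>t. u t \<partial>Iv (-1) 1)" by (rule zonal_integral[OF x uc])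
 also have "(\<integral>t. u t \<partial>Iv (-1) 1) = r\<^sup>2 / 2 * u 1 - r\<^sup>2 / 2 * u (-1)"
 proof (rule integral_Iv_FTC)
  show "((%t. r\<^sup>2 / 2 * u t) has_real_derivative u t) (at t)" for t
   unfolding u_def using r by (auto intro!: derivative_eq_intros)
 qed (auto intro!: uc continuous_intros)
 also have "... <= r\<^sup>2 / 2 * u 1" by (simp add: u_def)
 also have "u 1 = exp 1" by (simp add: u_def)
 finally show ?thesis by (simp add: mult_left_mono algebra_simps)
qed

section \<open>Homogeneous harmonic polynomials\<close>

lemma C1g_grad: "C1g f g ==> grad f x = g x"
proof -
 assume C: "C1g f g"
 then have d: "(f has_derivative (%h. g x \<bullet> h)) (at x)" by (simp add: C1g_def)
 have *: "D = g x" if "(f has_derivative (%h. D \<bullet> h)) (at x)" for D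
 proof -
  have "(%h. D \<bullet> h) = (%h. g x \<bullet> h)" using has_derivative_unique[OF that d] .
  then have "ALL h. D \<bullet> h = g x \<bullet> h" by (simp add: fun_eq_iff)
  then show ?thesis by (simp only: vector_eq_rdot)
 qed
 show ?thesis unfolding grad_def by (rule the_equality, rule d, rule *)
qed

lemma C1g_grad_self: "C1g f g ==> C1g f (grad f)"
proof -
 assume C: "C1g f g"
 have "grad f = g" by (rule ext) (rule C1g_grad[OF C])
 then show ?thesis using C by simp
qed

lemma C1g_add: "C1g f f' ==> C1g g g' ==> C1g (%x. f x + g x) (%x. f' x + g' x)"
 unfolding C1g_def by (auto intro!: derivative_eq_intros continuous_intros simp: inner_add_left)

lemma C1g_const: "C1g (%x. a) (%x. 0)"
 by (simp add: C1g_def)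

lemma C1g_sum: "(!!i. i \<in> I ==> C1g (f i) (f' i)) ==> C1g (%x. \<Sum>i\<in>I. f i x) (%x. \<Sum>i\<in>I. f' i x)"
 by (induction I rule: infinite_finite_induct) (auto intro: C1g_add C1g_const)

text \<open>Exponents of degree l as triples, symmetric in the three variables, in place of the
  nested sum in \<open>hpoly\<close>; derivatives and products with coordinates become index
  shifts.\<close>

definition tri :: "nat => (nat \<times> nat \<times> nat) set" where
 "tri l = {(i,j,k). i + j + k = l}"

lemma finite_tri [simp]: "finite (tri l)"
 by (rule finite_subset[of _ "{..l} \<times> {..l} \<times> {..l}"]) (auto simp: tri_def)

lemma hpoly_tri: "hpoly l c x = (\<Sum>(i,j,k)\<in>tri l. c i j k * (x$1)^i * (x$2)^j * (x$3)^k)"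
proof -
 have "hpoly l c x = (\<Sum>(i,j)\<in>Sigma {..l} (%i. {..l-i}). c i j (l - i - j) * (x$1)^i * (x$2)^j * (x$3)^(l - i - j))"
  unfolding hpoly_def by (rule sum.Sigma) auto
 also have "... = (\<Sum>(i,j,k)\<in>tri l. c i j k * (x$1)^i * (x$2)^j * (x$3)^k)"
  by (rule sum.reindex_bij_witness[of _ "%(i,j,k). (i,j)" "%(i,j). (i,j,l-i-j)"]) (auto simp: tri_def)
 finally show ?thesis .
qed

lemma tri_shift1:
 assumes "!!j k. f 0 j k = (0::real)"
 shows "(\<Sum>(i,j,k)\<in>tri (Suc l). f i j k) = (\<Sum>(i,j,k)\<in>tri l. f (Suc i) j k)"
proof -
 have "(\<Sum>(i,j,k)\<in>tri (Suc l). f i j k) = (\<Sum>(i,j,k)\<in>{z \<in> tri (Suc l). fst z ~= 0}. f i j k)"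
  by (rule sum.mono_neutral_right) (auto intro!: gr0I simp: assms)
 also have "... = (\<Sum>(i,j,k)\<in>tri l. f (Suc i) j k)"
  by (rule sum.reindex_bij_witness[of _ "%(i,j,k). (Suc i,j,k)" "%(i,j,k). (i-1,j,k)"]) (auto simp: tri_def)
 finally show ?thesis .
qed

lemma tri_shift2:
 assumes "!!j k. f j 0 k = (0::real)"
 shows "(\<Sum>(i,j,k)\<in>tri (Suc l). f i j k) = (\<Sum>(i,j,k)\<in>tri l. f i (Suc j) k)"
proof -
 have "(\<Sum>(i,j,k)\<in>tri (Suc l). f i j k) = (\<Sum>(i,j,k)\<in>{z \<in> tri (Suc l). fst (snd z) ~= 0}. f i j k)"
  by (rule sum.mono_neutral_right) (auto intro!: gr0I simp: assms)
 also have "... = (\<Sum>(i,j,k)\<in>tri l. f i (Suc j) k)"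
  by (rule sum.reindex_bij_witness[of _ "%(i,j,k). (i,Suc j,k)" "%(i,j,k). (i,j-1,k)"]) (auto simp: tri_def)
 finally show ?thesis .
qed

lemma tri_shift3:
 assumes "!!j k. f j k 0 = (0::real)"
 shows "(\<Sum>(i,j,k)\<in>tri (Suc l). f i j k) = (\<Sum>(i,j,k)\<in>tri l. f i j (Suc k))"
proof -
 have "(\<Sum>(i,j,k)\<in>tri (Suc l). f i j k) = (\<Sum>(i,j,k)\<in>{z \<in> tri (Suc l). snd (snd z) ~= 0}. f i j k)"
  by (rule sum.mono_neutral_right) (auto intro!: gr0I simp: assms)
 also have "... = (\<Sum>(i,j,k)\<in>tri l. f i j (Suc k))"
  by (rule sum.reindex_bij_witness[of _ "%(i,j,k). (i,j,Suc k)" "%(i,j,k). (i,j,k-1)"]) (auto simp: tri_def)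
 finally show ?thesis .
qed

type_synonym coefs = "nat => nat => nat => real"

text \<open>Coefficients of the partial derivative in direction m; \<open>xc\<close> below gives
  those of the product with the m-th coordinate.\<close>

definition dc :: "3 => coefs => coefs" where
 "dc m c i j k = (if m = 1 then real (Suc i) * c (Suc i) j k else if m = 2 then real (Suc j) * c i (Suc j) k
   else real (Suc k) * c i j (Suc k))"

definition xc :: "3 => coefs => coefs" where
 "xc m c i j k = (if m = 1 then (if i = 0 then 0 else c (i - 1) j k) else if m = 2 then (if j = 0 then 0 else c i (j - 1) k)
   else (if k = 0 then 0 else c i j (k - 1)))"

lemma hpoly_xc: "hpoly (Suc l) (xc m c) x = x $ m * hpoly l c x"
proof -
 consider "m = 1" | "m = 2" | "m = 3" using exhaust_3 by blast
 then show ?thesis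
 proof cases
  case 1
  then show ?thesis unfolding hpoly_tri by (subst tri_shift1) (auto simp: xc_def sum_distrib_left case_prod_unfold mult_ac intro!: sum.cong)
 next
  case 2
  then show ?thesis unfolding hpoly_tri by (subst tri_shift2) (auto simp: xc_def sum_distrib_left case_prod_unfold mult_ac intro!: sum.cong)
 next
  case 3
  then show ?thesis unfolding hpoly_tri by (subst tri_shift3) (auto simp: xc_def sum_distrib_left case_prod_unfold mult_ac intro!: sum.cong)
 qed
qed

lemma hpoly_lin: "hpoly l (%i j k. a * c i j k + b * d i j k) x = a * hpoly l c x + b * hpoly l d x"
 unfolding hpoly_tri sum_distrib_left sum.distrib[symmetric]
 by (rule sum.cong) (auto simp: distrib_right mult.assoc)

lemma hpoly_C1g: "C1g (hpoly (Suc l) c) (%x. \<chi> m. hpoly l (dc m c) x)"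
proof -
 define g where "g i j k x = (\<chi> m::3. c i j k * (if m = 1 then real i * (x$1)^(i-1) * (x$2)^j * (x$3)^k
   else if m = 2 then real j * (x$1)^i * (x$2)^(j-1) * (x$3)^k
   else real k * (x$1)^i * (x$2)^j * (x$3)^(k-1)))" for i j k and x :: R3
 have 1: "C1g (%x. c i j k * (x$1)^i * (x$2)^j * (x$3)^k) (g i j k)" for i j k
  unfolding C1g_def
 proof (intro conjI allI)
  fix x
  show "((%x. c i j k * (x$1)^i * (x$2)^j * (x$3)^k) has_derivative (%h. g i j k x \<bullet> h)) (at x)"
   by (auto intro!: derivative_eq_intros bounded_linear_imp_has_derivative[OF bounded_linear_vec_nth]
     simp: g_def inner_vec_def sum_3 fun_eq_iff algebra_simps)
  have "continuous_on UNIV (%x. g i j k x $ m)" for m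
   by (cases "m = 1"; cases "m = 2") (auto simp: g_def intro!: continuous_intros)
  then have "continuous_on UNIV (%x. \<chi> m. g i j k x $ m)" by (rule continuous_on_vec_lambda)
  then show "continuous_on UNIV (g i j k)" by simp
 qed
 have "C1g (%x. \<Sum>z\<in>tri (Suc l). case z of (i,j,k) => c i j k * (x$1)^i * (x$2)^j * (x$3)^k)
   (%x. \<Sum>z\<in>tri (Suc l). case z of (i,j,k) => g i j k x)"
  by (rule C1g_sum) (use 1 in \<open>auto\<close>)
 moreover have "(\<Sum>z\<in>tri (Suc l). case z of (i,j,k) => g i j k x) = (\<chi> m. hpoly l (dc m c) x)" for x
 proof -
  have "(\<Sum>(i,j,k)\<in>tri (Suc l). g i j k x $ m) = hpoly l (dc m c) x" for m
  proof -
   consider "m = 1" | "m = 2" | "m = 3" using exhaust_3 by blast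
   then show ?thesis
   proof cases
    case 1
    then show ?thesis unfolding hpoly_tri by (subst tri_shift1) (auto simp: g_def dc_def mult_ac intro!: sum.cong)
   next
    case 2
    then show ?thesis unfolding hpoly_tri by (subst tri_shift2) (auto simp: g_def dc_def mult_ac intro!: sum.cong)
   next
    case 3
    then show ?thesis unfolding hpoly_tri by (subst tri_shift3) (auto simp: g_def dc_def mult_ac intro!: sum.cong)
   qed
  qed
  then show ?thesis by (simp add: vec_eq_iff case_prod_unfold)
 qed
 moreover have "hpoly (Suc l) c = (%x. \<Sum>z\<in>tri (Suc l). case z of (i,j,k) => c i j k * (x$1)^i * (x$2)^j * (x$3)^k)"
  by (rule ext) (simp add: hpoly_tri)
 ultimately show ?thesis by simp
qed

lemma hpoly_0: "hpoly 0 c x = c 0 0 0" by (simp add: hpoly_def)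

lemma hpoly_homogeneous: "hpoly l c (r *R x) = r ^ l * hpoly l c x"
proof -
 have "(r * x$1)^i * (r * x$2)^j * (r * x$3)^k = r^l * ((x$1)^i * (x$2)^j * (x$3)^k)" if "(i,j,k) \<in> tri l" for i j k
  using that by (auto simp: tri_def power_mult_distrib power_add)
 then show ?thesis unfolding hpoly_tri sum_distrib_left
  by (intro sum.cong) (auto simp: mult.assoc mult.left_commute)
qed

lemma hpoly_euler: "(\<Sum>m\<in>UNIV. x $ m * hpoly l (dc m c) x) = real (Suc l) * hpoly (Suc l) c x"
proof -
 have x: "x $ m * hpoly l (dc m c) x = hpoly (Suc l) (xc m (dc m c)) x" for m by (simp add: hpoly_xc)
 have "(\<Sum>m\<in>UNIV. x $ m * hpoly l (dc m c) x) = hpoly (Suc l) (xc 1 (dc 1 c)) x + hpoly (Suc l) (xc 2 (dc 2 c)) x + hpoly (Suc l) (xc 3 (dc 3 c)) x"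
  by (simp only: sum_3 x)
 also have "... = (\<Sum>(i,j,k)\<in>tri (Suc l). (real i + real j + real k) * (c i j k * (x$1)^i * (x$2)^j * (x$3)^k))"
  unfolding hpoly_tri sum.distrib[symmetric]
  by (rule sum.cong) (auto simp: xc_def dc_def algebra_simps)
 also have "... = (\<Sum>(i,j,k)\<in>tri (Suc l). real (Suc l) * (c i j k * (x$1)^i * (x$2)^j * (x$3)^k))"
  by (rule sum.cong) (auto simp: tri_def simp flip: of_nat_add)
 also have "... = real (Suc l) * hpoly (Suc l) c x"
  by (simp add: hpoly_tri sum_distrib_left case_prod_unfold)
 finally show ?thesis .
qed

text \<open>Extending the coefficients by zero to integer indices removes all boundary cases from the
 harmonicity relations.\<close>

definition ext_coef :: "coefs => int => int => int => real" where
 "ext_coef c i j k = (if 0 <= i & 0 <= j & 0 <= k then c (nat i) (nat j) (nat k) else 0)"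

lemma harmonic_ext:
 assumes c: "harmonic_coeffs l c" and abd: "a + b + d + 2 = int l"
 shows "of_int ((a+2)*(a+1)) * ext_coef c (a+2) b d + of_int ((b+2)*(b+1)) * ext_coef c a (b+2) d
   + of_int ((d+2)*(d+1)) * ext_coef c a b (d+2) = 0"
proof (cases "0 <= a & 0 <= b & 0 <= d")
 case True
 then have "nat a + nat b + nat d + 2 = l" using abd by linarith
 with c have "real ((nat a+2)*(nat a+1)) * c (nat a+2) (nat b) (nat d) + real ((nat b+2)*(nat b+1)) * c (nat a) (nat b+2) (nat d)
    + real ((nat d+2)*(nat d+1)) * c (nat a) (nat b) (nat d+2) = 0"
  unfolding harmonic_coeffs_def by blast
 then show ?thesis using True by (simp add: ext_coef_def nat_add_distrib algebra_simps)
next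
 case False
 \<comment> \<open>For u = -1 and u = -2 the factor (u+2)(u+1) vanishes; further below the extended
   coefficient is 0.\<close>
 have z: "of_int ((u+2)*(u+1)) * C = (0::real)" if "u < 0" "u + 2 < 0 ==> C = 0" for u :: int and C
 proof (cases "u + 2 < 0")
  case False
  then have "u = -1 \<or> u = -2" using that by linarith
  then show ?thesis by auto
 qed (use that in simp)
 from False consider "a < 0" | "b < 0" | "d < 0" by linarith
 then show ?thesis
 proof cases
  case 1
  then show ?thesis using z[OF 1, of "ext_coef c (a+2) b d"] by (simp add: ext_coef_def)
 next
  case 2
  then show ?thesis using z[OF 2, of "ext_coef c a (b+2) d"] by (simp add: ext_coef_def)
 next
  case 3
  then show ?thesis using z[OF 3, of "ext_coef c a b (d+2)"] by (simp add: ext_coef_def)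
 qed
qed

lemma harmonic_dc:
 assumes "harmonic_coeffs (Suc l) c" shows "harmonic_coeffs l (dc m c)"
 unfolding harmonic_coeffs_def
proof (intro allI impI)
 fix a b d :: nat assume abd: "a + b + d + 2 = l"
 note h = assms[unfolded harmonic_coeffs_def, rule_format]
 consider "m = 1" | "m = 2" | "m = 3" using exhaust_3 by blast
 then show "real ((a+2)*(a+1)) * dc m c (a+2) b d + real ((b+2)*(b+1)) * dc m c a (b+2) d + real ((d+2)*(d+1)) * dc m c a b (d+2) = 0"
 proof cases
  case 1
  have "real (a + 1) * (real ((Suc a+2)*(Suc a+1)) * c (Suc a+2) b d + real ((b+2)*(b+1)) * c (Suc a) (b+2) d + real ((d+2)*(d+1)) * c (Suc a) b (d+2)) = 0"
   using h[of "Suc a" b d] abd by simp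
  then show ?thesis using 1 by (simp add: dc_def algebra_simps)
 next
  case 2
  have "real (b + 1) * (real ((a+2)*(a+1)) * c (a+2) (Suc b) d + real ((Suc b+2)*(Suc b+1)) * c a (Suc b+2) d + real ((d+2)*(d+1)) * c a (Suc b) (d+2)) = 0"
   using h[of a "Suc b" d] abd by simp
  then show ?thesis using 2 by (simp add: dc_def algebra_simps)
 next
  case 3
  have "real (d + 1) * (real ((a+2)*(a+1)) * c (a+2) b (Suc d) + real ((b+2)*(b+1)) * c a (b+2) (Suc d) + real ((Suc d+2)*(Suc d+1)) * c a b (Suc d+2)) = 0"
   using h[of a b "Suc d"] abd by simp
  then show ?thesis using 3 by (simp add: dc_def algebra_simps)
 qed
qed

text \<open>Coefficients of (2l+1) x_m Y - |x|^2 d_m Y, where Y has the coefficients c: up to a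
  factor the harmonic part of degree l + 1 of x_m Y.\<close>

definition upc :: "3 => nat => coefs => coefs" where
 "upc m l c i j k = real (2 * l + 1) * xc m c i j k
   - (xc 1 (xc 1 (dc m c)) i j k + xc 2 (xc 2 (dc m c)) i j k + xc 3 (xc 3 (dc m c)) i j k)"

lemma xc_ext: "xc 1 c i j k = ext_coef c (int i - 1) (int j) (int k)"
 by (cases i) (simp_all add: xc_def ext_coef_def)

lemma nat_cases_2: obtains "n = 0" | "n = 1" | k where "n = Suc (Suc k)"
 by (metis One_nat_def not0_implies_Suc)

lemma xxdc_ext:
 "xc 1 (xc 1 (dc 1 c)) i j k = (real i - 1) * ext_coef c (int i - 1) (int j) (int k)"
 "xc 2 (xc 2 (dc 1 c)) i j k = (real i + 1) * ext_coef c (int i + 1) (int j - 2) (int k)"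
 "xc 3 (xc 3 (dc 1 c)) i j k = (real i + 1) * ext_coef c (int i + 1) (int j) (int k - 2)"
  apply (cases i rule: nat_cases_2; auto simp: xc_def dc_def ext_coef_def nat_add_distrib)
  apply (cases j rule: nat_cases_2; auto simp: xc_def dc_def ext_coef_def nat_add_distrib)
 apply (cases k rule: nat_cases_2; auto simp: xc_def dc_def ext_coef_def nat_add_distrib)
 done

text \<open>By exchange of variables the computation for x_1 covers x_2 and x_3.\<close>

lemma upc_swap: "upc 2 l c i j k = upc 1 l (%i j k. c j i k) j i k" "upc 3 l c i j k = upc 1 l (%i j k. c k j i) k j i"
 by (auto simp: upc_def xc_def dc_def)

lemma harmonic_swap:
 assumes "harmonic_coeffs l c" shows "harmonic_coeffs l (%i j k. c j i k)" "harmonic_coeffs l (%i j k. c k j i)"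
proof -
 note h = assms[unfolded harmonic_coeffs_def, rule_format]
 have g: "real ((a+2)*(a+1)) * c b (a+2) d + real ((b+2)*(b+1)) * c (b+2) a d + real ((d+2)*(d+1)) * c b a (d+2) = 0"
  "real ((a+2)*(a+1)) * c d b (a+2) + real ((b+2)*(b+1)) * c d (b+2) a + real ((d+2)*(d+1)) * c (d+2) b a = 0"
  if "a + b + d + 2 = l" for a b d
  using h[of b a d] h[of d b a] that by (simp_all add: add_ac)
 show "harmonic_coeffs l (%i j k. c j i k)" "harmonic_coeffs l (%i j k. c k j i)"
  unfolding harmonic_coeffs_def using g by blast+
qed

text \<open>A coefficient of the Laplacian of the raised polynomial combines three harmonicity
  relations of the original one, at (a-1, b, d), (a+1, b-2, d) and (a+1, b, d-2), with factors 2l +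
  2 - a, -(a+1) and -(a+1).\<close>

lemma upc_identity:
 fixes a b d l :: real
 assumes h: "(a+1)*a*p + (b+2)*(b+1)*q + (d+2)*(d+1) * s = 0" "(a+3)*(a+2)*t + b*(b-1)*p + (d+2)*(d+1) * v = 0"
  "(a+3)*(a+2)*u + (b+2)*(b+1)*w + d*(d-1)*p = 0" and l: "l = a + b + d + 1"
 shows "(a+2)*(a+1)*((2*l+1)*p - ((a+1)*p + (a+3)*t + (a+3)*u)) + (b+2)*(b+1)*((2*l+1)*q - ((a-1)*q + (a+1)*p + (a+1)*w))
   + (d+2)*(d+1)*((2*l+1) * s - ((a-1) * s + (a+1) * v + (a+1)*p)) = 0"
proof -
 have "(a+2)*(a+1)*((2*l+1)*p - ((a+1)*p + (a+3)*t + (a+3)*u)) + (b+2)*(b+1)*((2*l+1)*q - ((a-1)*q + (a+1)*p + (a+1)*w))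
   + (d+2)*(d+1)*((2*l+1) * s - ((a-1) * s + (a+1) * v + (a+1)*p))
  = (2*l+2-a) * ((a+1)*a*p + (b+2)*(b+1)*q + (d+2)*(d+1) * s) - (a+1) * ((a+3)*(a+2)*t + b*(b-1)*p + (d+2)*(d+1) * v)
   - (a+1) * ((a+3)*(a+2)*u + (b+2)*(b+1)*w + d*(d-1)*p)"
  unfolding l by (simp add: algebra_simps)
 then show ?thesis unfolding h by simp
qed

lemma harmonic_upc_1:
 assumes c: "harmonic_coeffs l c" shows "harmonic_coeffs (Suc l) (upc 1 l c)"
 unfolding harmonic_coeffs_def
proof (intro allI impI)
 fix a b d :: nat assume abd: "a + b + d + 2 = Suc l"
 define A B D where "A = int a" and "B = int b" and "D = int d"
 note h = harmonic_ext[OF c]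
 define C where "C = ext_coef c"
 have l: "real l = real a + real b + real d + 1" using abd by linarith
 have r: "of_int A = real a" "of_int B = real b" "of_int D = real d" by (simp_all add: A_def B_def D_def)
 have ab: "A + B + D + 1 = int l" using abd by (simp add: A_def B_def D_def)
 have e: "int (a + 2) - 1 = A + 1" "int (a + 2) + 1 = A + 3" "int a - 1 = A - 1" "int a + 1 = A + 1"
  "int (b + 2) - 2 = B" "int b - 2 = B - 2" "int (d + 2) - 2 = D" "int d - 2 = D - 2"
  by (simp_all add: A_def B_def D_def)
 have e': "int (b + 2) = B + 2" "int b = B" "int (d + 2) = D + 2" "int d = D" by (simp_all add: B_def D_def)
 have r2: "real (a + 2) - 1 = real a + 1" "real (a + 2) + 1 = real a + 3" "real (2 * l + 1) = 2 * real l + 1" by simp_all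
 have r3: "real ((a+2)*(a+1)) = (real a + 2) * (real a + 1)" "real ((b+2)*(b+1)) = (real b + 2) * (real b + 1)" "real ((d+2)*(d+1)) = (real d + 2) * (real d + 1)" by (simp_all add: algebra_simps)
 have h1: "(real a+1)*real a*C (A + 1) B D + (real b+2)*(real b+1)*C (A - 1) (B + 2) D + (real d+2)*(real d+1)*C (A - 1) B (D + 2) = 0"
  using h[of "A - 1" B D] ab by (simp add: r C_def algebra_simps)
 have h2: "(real a+3)*(real a+2)*C (A + 3) (B - 2) D + real b*(real b-1)*C (A + 1) B D + (real d+2)*(real d+1)*C (A + 1) (B - 2) (D + 2) = 0"
  using h[of "A + 1" "B - 2" D] ab by (simp add: r C_def algebra_simps)
 have h3: "(real a+3)*(real a+2)*C (A + 3) B (D - 2) + (real b+2)*(real b+1)*C (A + 1) (B + 2) (D - 2) + real d*(real d-1)*C (A + 1) B D = 0"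
  using h[of "A + 1" B "D - 2"] ab by (simp add: r C_def algebra_simps)
 have u1: "upc 1 l c (a+2) b d = (2*real l+1)*C (A + 1) B D - ((real a+1)*C (A + 1) B D + (real a+3)*C (A + 3) (B - 2) D + (real a+3)*C (A + 3) B (D - 2))"
  unfolding upc_def xxdc_ext unfolding xc_ext e r2 unfolding e' C_def[symmetric] by (simp only: add_ac)
 have u2: "upc 1 l c a (b+2) d = (2*real l+1)*C (A - 1) (B + 2) D - ((real a-1)*C (A - 1) (B + 2) D + (real a+1)*C (A + 1) B D + (real a+1)*C (A + 1) (B + 2) (D - 2))"
  unfolding upc_def xxdc_ext unfolding xc_ext e r2 unfolding e' C_def[symmetric] by (simp only: add_ac)
 have u3: "upc 1 l c a b (d+2) = (2*real l+1)*C (A - 1) B (D + 2) - ((real a-1)*C (A - 1) B (D + 2) + (real a+1)*C (A + 1) (B - 2) (D + 2) + (real a+1)*C (A + 1) B D)"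
  unfolding upc_def xxdc_ext unfolding xc_ext e r2 unfolding e' C_def[symmetric] by (simp only: add_ac)
 show "real ((a+2)*(a+1)) * upc 1 l c (a+2) b d + real ((b+2)*(b+1)) * upc 1 l c a (b+2) d + real ((d+2)*(d+1)) * upc 1 l c a b (d+2) = 0"
  using upc_identity[OF h1 h2 h3 l] unfolding u1 u2 u3 r3 by linarith
qed

lemma harmonic_upc:
 assumes c: "harmonic_coeffs l c" shows "harmonic_coeffs (Suc l) (upc m l c)"
proof -
 consider "m = 1" | "m = 2" | "m = 3" using exhaust_3 by blast
 then show ?thesis
 proof cases
  case 1
  then show ?thesis using harmonic_upc_1[OF c] by simp
 next
  case 2
  show ?thesis unfolding 2 using harmonic_swap(1)[OF harmonic_upc_1[OF harmonic_swap(1)[OF c]]] by (simp add: upc_swap[abs_def])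
 next
  case 3
  show ?thesis unfolding 3 using harmonic_swap(2)[OF harmonic_upc_1[OF harmonic_swap(2)[OF c]]] by (simp add: upc_swap[abs_def])
 qed
qed

section \<open>Harmonic expansion of polynomials\<close>

lemma sph_harmI: "harmonic_coeffs l c ==> hpoly l c \<in> sph_harm l"
 by (auto simp: sph_harm_def)

lemma sph_harm_zero: "(%x. 0) \<in> sph_harm l"
proof -
 have "hpoly l (%i j k. 0) = (%x. 0)" by (simp add: hpoly_def fun_eq_iff)
 then show ?thesis using sph_harmI[of l "%i j k. 0"] by (simp add: harmonic_coeffs_def)
qed

lemma sph_harm_lin:
 assumes "Y \<in> sph_harm l" "Z \<in> sph_harm l" shows "(%x. a * Y x + b * Z x) \<in> sph_harm l"
proof -
 obtain c d where c: "harmonic_coeffs l c" "Y = hpoly l c" and d: "harmonic_coeffs l d" "Z = hpoly l d"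
  using assms by (auto simp: sph_harm_def)
 have "harmonic_coeffs l (%i j k. a * c i j k + b * d i j k)"
  unfolding harmonic_coeffs_def
 proof (intro allI impI)
  fix i j k :: nat assume "i + j + k + 2 = l"
  then have "a * (real ((i+2)*(i+1)) * c (i+2) j k + real ((j+2)*(j+1)) * c i (j+2) k + real ((k+2)*(k+1)) * c i j (k+2)) = 0"
   "b * (real ((i+2)*(i+1)) * d (i+2) j k + real ((j+2)*(j+1)) * d i (j+2) k + real ((k+2)*(k+1)) * d i j (k+2)) = 0"
   using c(1) d(1) unfolding harmonic_coeffs_def by auto
  then show "real ((i+2)*(i+1)) * (a * c (i+2) j k + b * d (i+2) j k) + real ((j+2)*(j+1)) * (a * c i (j+2) k + b * d i (j+2) k)
   + real ((k+2)*(k+1)) * (a * c i j (k+2) + b * d i j (k+2)) = 0"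
   by (simp only: distrib_left mult.left_commute[of a] mult.left_commute[of b])
 qed
 then have "hpoly l (%i j k. a * c i j k + b * d i j k) \<in> sph_harm l" by (rule sph_harmI)
 moreover have "hpoly l (%i j k. a * c i j k + b * d i j k) = (%x. a * Y x + b * Z x)"
  by (rule ext) (simp add: hpoly_lin c d)
 ultimately show ?thesis by simp
qed

lemma sph_harm_cmult: "Y \<in> sph_harm l ==> (%x. a * Y x) \<in> sph_harm l"
 using sph_harm_lin[of Y l Y a 0] by simp

lemma sph_harm_0_const: assumes "Y \<in> sph_harm 0" obtains a where "Y = (%x. a)"
proof -
 from assms obtain c where "Y = hpoly 0 c" unfolding sph_harm_def by blast
 then have "Y = (%x. c 0 0 0)" by (simp add: hpoly_0 fun_eq_iff)
 then show ?thesis by (rule that)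
qed

lemma const_sph_harm: "(%x. a) \<in> sph_harm 0"
proof -
 have "hpoly 0 (%i j k. a) = (%x. a)" by (simp add: hpoly_0 fun_eq_iff)
 then show ?thesis using sph_harmI[of 0 "%i j k. a"] by (simp add: harmonic_coeffs_def)
qed

lemma sph_harm_C1g: assumes "Y \<in> sph_harm l" shows "C1g Y (grad Y)"
proof (cases l)
 case 0
 with assms obtain a where "Y = (%x. a)" using sph_harm_0_const by blast
 then show ?thesis using C1g_grad_self[OF C1g_const] by simp
next
 case (Suc k)
 with assms show ?thesis by (auto simp: sph_harm_def intro: C1g_grad_self[OF hpoly_C1g])
qed

lemma sph_harm_cont: "Y \<in> sph_harm l ==> continuous_on A Y"
 using C1g_cont[OF sph_harm_C1g] .

lemma sph_harm_grad_0: assumes "Y \<in> sph_harm 0" shows "grad Y x = 0"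
proof -
 obtain a where "Y = (%x. a)" using sph_harm_0_const[OF assms] .
 then show ?thesis using C1g_grad[OF C1g_const] by simp
qed

lemma hpoly_grad: "grad (hpoly (Suc l) c) x $ m = hpoly l (dc m c) x"
 by (simp add: C1g_grad[OF hpoly_C1g])

lemma sph_harm_grad_comp:
 assumes "Y \<in> sph_harm (Suc l)" shows "(%x. grad Y x $ m) \<in> sph_harm l"
proof -
 obtain c where c: "harmonic_coeffs (Suc l) c" "Y = hpoly (Suc l) c" using assms by (auto simp: sph_harm_def)
 have "(%x. grad Y x $ m) = hpoly l (dc m c)" by (rule ext) (simp add: c hpoly_grad)
 then show ?thesis using sph_harmI[OF harmonic_dc[OF c(1)]] by simp
qed

lemma sph_harm_euler: assumes "Y \<in> sph_harm l" shows "x \<bullet> grad Y x = real l * Y x"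
proof (cases l)
 case 0
 then show ?thesis using assms by (simp add: sph_harm_grad_0)
next
 case (Suc k)
 then obtain c where c: "Y = hpoly (Suc k) c" using assms by (auto simp: sph_harm_def)
 show ?thesis unfolding c Suc hpoly_euler[symmetric] by (simp add: inner_vec_def hpoly_grad)
qed

lemma sph_harm_homogeneous: "Y \<in> sph_harm l ==> Y (r *R x) = r ^ l * Y x"
 by (auto simp: sph_harm_def hpoly_homogeneous)

lemma sph_harm_laplacian:
 assumes "Y \<in> sph_harm l" shows "(\<Sum>m\<in>UNIV. grad (%x. grad Y x $ m) x $ m) = 0"
proof (cases l)
 case 0
 then have "(%x. grad Y x $ m) = (%x. 0)" for m using assms by (simp add: sph_harm_grad_0)
 then show ?thesis using C1g_grad[OF C1g_const] by simp
next
 case (Suc k)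
 show ?thesis
 proof (cases k)
  case 0
  then have "(%x. grad Y x $ m) \<in> sph_harm 0" for m using assms Suc sph_harm_grad_comp by simp
  then show ?thesis using sph_harm_grad_0 by simp
 next
  case (Suc j)
  then obtain c where c: "harmonic_coeffs (Suc (Suc j)) c" "Y = hpoly (Suc (Suc j)) c" using assms \<open>l = Suc k\<close> by (auto simp: sph_harm_def)
  have "(%x. grad Y x $ m) = hpoly (Suc j) (dc m c)" for m by (rule ext) (simp add: c hpoly_grad)
  then have "(\<Sum>m\<in>UNIV. grad (%x. grad Y x $ m) x $ m) = (\<Sum>m\<in>UNIV. hpoly j (dc m (dc m c)) x)"
   by (simp add: hpoly_grad)
  also have "... = (\<Sum>(i,j,k)\<in>tri j. 0)"
   unfolding sum_3 hpoly_tri sum.distrib[symmetric]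
  proof (rule sum.cong[OF refl])
   fix z assume "z \<in> tri j"
   then obtain p q r where z: "z = (p,q,r)" "p + q + r + 2 = Suc (Suc j)" by (auto simp: tri_def)
   have "dc 1 (dc 1 c) p q r + dc 2 (dc 2 c) p q r + dc 3 (dc 3 c) p q r = 0"
    using c(1)[unfolded harmonic_coeffs_def, rule_format, OF z(2)] by (simp add: dc_def algebra_simps)
   then have "(dc 1 (dc 1 c) p q r + dc 2 (dc 2 c) p q r + dc 3 (dc 3 c) p q r) * ((x$1)^p * (x$2)^q * (x$3)^r) = 0" by simp
   then show "(case z of (i,j,k) => dc 1 (dc 1 c) i j k * (x$1)^i * (x$2)^j * (x$3)^k) +
    (case z of (i,j,k) => dc 2 (dc 2 c) i j k * (x$1)^i * (x$2)^j * (x$3)^k) +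
    (case z of (i,j,k) => dc 3 (dc 3 c) i j k * (x$1)^i * (x$2)^j * (x$3)^k) = (case z of (i,j,k) => 0)"
    unfolding z by (simp add: distrib_right mult.assoc)
  qed
  finally show ?thesis by simp
 qed
qed

text \<open>Raising operator. Since |x| = 1 on the sphere, it exhibits x_m Y there as a combination
  of a harmonic of degree l + 1 and the derivative d_m Y of degree l - 1.\<close>

lemma sph_harm_up:
 assumes "Y \<in> sph_harm l"
 shows "(%x. (2 * real l + 1) * (x $ m * Y x) - (x \<bullet> x) * grad Y x $ m) \<in> sph_harm (Suc l)"
proof (cases l)
 case 0
 with assms obtain a where a: "Y = (%x. a)" using sph_harm_0_const by blast
 have "hpoly (Suc 0) (xc m (%i j k. a)) = (%x. x $ m * a)" by (rule ext) (simp add: hpoly_xc hpoly_0)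
 moreover have "harmonic_coeffs (Suc 0) (xc m (%i j k. a))" by (simp add: harmonic_coeffs_def)
 ultimately show ?thesis using sph_harmI[of "Suc 0" "xc m (%i j k. a)"] 0 by (simp add: a C1g_grad[OF C1g_const])
next
 case (Suc k)
 then obtain c where c: "harmonic_coeffs l c" "Y = hpoly (Suc k) c" using assms by (auto simp: sph_harm_def)
 have "hpoly (Suc l) (upc m l c) x = (2 * real l + 1) * (x $ m * Y x) - (x \<bullet> x) * grad Y x $ m" for x
 proof -
  have u: "upc m l c = (%i j k. real (2 * l + 1) * xc m c i j k + (-1) * (1 * (1 * xc 1 (xc 1 (dc m c)) i j k + 1 * xc 2 (xc 2 (dc m c)) i j k) + 1 * xc 3 (xc 3 (dc m c)) i j k))"
   by (intro ext) (simp add: upc_def)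
  have "hpoly (Suc l) (upc m l c) x = real (2 * l + 1) * hpoly (Suc l) (xc m c) x + (-1) * (1 * (1 * hpoly (Suc l) (xc 1 (xc 1 (dc m c))) x + 1 * hpoly (Suc l) (xc 2 (xc 2 (dc m c))) x) + 1 * hpoly (Suc l) (xc 3 (xc 3 (dc m c))) x)"
   unfolding u by (simp only: hpoly_lin)
  then show ?thesis unfolding Suc hpoly_xc c hpoly_grad
   by (simp add: inner_vec_def sum_3 algebra_simps)
 qed
 then have "(%x. (2 * real l + 1) * (x $ m * Y x) - (x \<bullet> x) * grad Y x $ m) = hpoly (Suc l) (upc m l c)" by auto
 then show ?thesis using sph_harmI[OF harmonic_upc[OF c(1)]] by simp
qed

text \<open>Equality is asked on the sphere only: off it a polynomial is in general no sum of
  homogeneous harmonics.\<close>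

definition Hsp :: "(R3 => real) set" where
 "Hsp = {f. EX N Ys. (ALL l<N. Ys l \<in> sph_harm l) & (ALL x:SS. f x = (\<Sum>l<N. Ys l x))}"

text \<open>Padding with zeros makes every longer sum valid too, so that two members can be written
  with the same number of terms.\<close>

lemma HspE:
 assumes "f \<in> Hsp"
 shows "EX Ys N. (ALL l. Ys l \<in> sph_harm l) & (ALL x M. x \<in> SS --> N <= M --> f x = (\<Sum>l<M. Ys l x))"
proof -
 from assms obtain N Ys where N: "ALL l<N. Ys l \<in> sph_harm l" "ALL x:SS. f x = (\<Sum>l<N. Ys l x)"
  unfolding Hsp_def mem_Collect_eq by (elim exE conjE)
 define Zs where "Zs l = (if l < N then Ys l else (%x. 0))" for l
 have "f x = (\<Sum>l<M. Zs l x)" if "x \<in> SS" "N <= M" for x M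
 proof -
  have "f x = (\<Sum>l<N. Zs l x)" using N(2) that(1) by (simp add: Zs_def)
  also have "... = (\<Sum>l<M. Zs l x)" by (rule sum.mono_neutral_left) (use that in \<open>auto simp: Zs_def\<close>)
  finally show ?thesis .
 qed
 moreover have "Zs l \<in> sph_harm l" for l using N(1) sph_harm_zero by (simp add: Zs_def)
 ultimately show ?thesis by blast
qed

lemma HspI: "(!!l. Ys l \<in> sph_harm l) ==> (!!x. x \<in> SS ==> f x = (\<Sum>l<N. Ys l x)) ==> f \<in> Hsp"
 unfolding Hsp_def by blast

lemma Hsp_lin:
 assumes "f \<in> Hsp" "g \<in> Hsp" shows "(%x. a * f x + b * g x) \<in> Hsp"
proof -
 obtain Ys N where Y': "(ALL l. Ys l \<in> sph_harm l) & (ALL x M. x \<in> SS --> N <= M --> f x = (\<Sum>l<M. Ys l x))"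
  using HspE[OF assms(1)] by (elim exE)
 then have Y: "!!l. Ys l \<in> sph_harm l" "!!x M. x \<in> SS ==> N <= M ==> f x = (\<Sum>l<M. Ys l x)" by auto
 obtain Zs N' where Z': "(ALL l. Zs l \<in> sph_harm l) & (ALL x M. x \<in> SS --> N' <= M --> g x = (\<Sum>l<M. Zs l x))"
  using HspE[OF assms(2)] by (elim exE)
 then have Z: "!!l. Zs l \<in> sph_harm l" "!!x M. x \<in> SS ==> N' <= M ==> g x = (\<Sum>l<M. Zs l x)" by auto
 show ?thesis
 proof (rule HspI)
  show "(%x. a * Ys l x + b * Zs l x) \<in> sph_harm l" for l by (rule sph_harm_lin[OF Y(1) Z(1)])
  show "a * f x + b * g x = (\<Sum>l<max N N'. a * Ys l x + b * Zs l x)" if "x \<in> SS" for x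
   using Y(2)[OF that, of "max N N'"] Z(2)[OF that, of "max N N'"] by (simp add: sum.distrib sum_distrib_left)
 qed
qed

lemma Hsp_cong: "f \<in> Hsp ==> (!!x. x \<in> SS ==> g x = f x) ==> g \<in> Hsp"
 unfolding Hsp_def by auto

lemma sph_harm_Hsp: assumes "Y \<in> sph_harm l" shows "Y \<in> Hsp"
proof (rule HspI)
 show "(if k = l then Y else (%x. 0)) \<in> sph_harm k" for k using assms sph_harm_zero by simp
 show "Y x = (\<Sum>k<Suc l. (if k = l then Y else (%x. 0)) x)" for x
  by (simp add: if_distrib[of "%f. f x"] cong: if_cong)
qed

lemma Hsp_sum: "(!!i. i \<in> I ==> f i \<in> Hsp) ==> (%x. \<Sum>i\<in>I. f i x) \<in> Hsp"
proof (induction I rule: infinite_finite_induct)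
 case (insert i I)
 then have "(%x. 1 * f i x + 1 * (\<Sum>i\<in>I. f i x)) \<in> Hsp" by (intro Hsp_lin) auto
 then show ?case using insert by simp
qed (use sph_harm_Hsp[OF sph_harm_zero] in auto)

lemma Hsp_coord: assumes "f \<in> Hsp" shows "(%x. x $ m * f x) \<in> Hsp"
proof -
 have Y: "(%x. x $ m * Y x) \<in> Hsp" if Y: "Y \<in> sph_harm l" for Y l
 proof -
  have "(%x. grad Y x $ m) \<in> Hsp"
  proof (cases l)
   case 0
   then have "(%x. grad Y x $ m) = (%x. 0)" using Y by (simp add: sph_harm_grad_0)
   then show ?thesis using sph_harm_Hsp[OF sph_harm_zero] by simp
  next
   case (Suc k)
   then show ?thesis using sph_harm_Hsp[OF sph_harm_grad_comp] Y by simp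
  qed
  from Hsp_lin[OF sph_harm_Hsp[OF sph_harm_up[OF Y, of m]] this, of "1 / (2 * real l + 1)" "1 / (2 * real l + 1)"]
  show ?thesis
  proof (rule Hsp_cong)
   fix x assume "x \<in> SS"
   then have xx: "x \<bullet> x = 1" by (simp add: norm_eq_1)
   have "2 * real l + 1 ~= 0" by linarith
   then show "x $ m * Y x = 1 / (2 * real l + 1) * ((2 * real l + 1) * (x $ m * Y x) - (x \<bullet> x) * grad Y x $ m) + 1 / (2 * real l + 1) * grad Y x $ m"
    unfolding xx right_diff_distrib by simp
  qed
 qed
 obtain Ys N where N': "(ALL l. Ys l \<in> sph_harm l) & (ALL x M. x \<in> SS --> N <= M --> f x = (\<Sum>l<M. Ys l x))"
  using HspE[OF assms(1)] by (elim exE)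
 then have N: "!!l. Ys l \<in> sph_harm l" "!!x M. x \<in> SS ==> N <= M ==> f x = (\<Sum>l<M. Ys l x)" by auto
 have "(%x. \<Sum>l<N. x $ m * Ys l x) \<in> Hsp" by (rule Hsp_sum) (rule Y[OF N(1)])
 then show ?thesis by (rule Hsp_cong) (simp add: N(2)[OF _ order_refl] sum_distrib_left)
qed

lemma vec3_expand: "(\<Sum>m\<in>UNIV. x $ m *R axis m 1) = (x::R3)"
proof -
 have ax: "axis i 1 $ j = (if i = j then 1 else (0::real))" for i j :: 3 by (simp add: axis_def)
 have "(\<Sum>m\<in>UNIV. x $ m *R axis m 1) $ j = x $ j" for j
  unfolding sum_component vector_scaleR_component ax by (simp add: if_distrib cong: if_cong)
 then show ?thesis unfolding vec_eq_iff by blast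
qed

lemma bounded_linear_R3:
 fixes f :: "R3 => real" assumes "bounded_linear f" shows "f x = (\<Sum>m\<in>UNIV. x $ m * f (axis m 1))"
proof -
 interpret bounded_linear f by fact
 have "f x = f (\<Sum>m\<in>UNIV. x $ m *R axis m 1)" by (simp add: vec3_expand)
 also have "... = (\<Sum>m\<in>UNIV. x $ m * f (axis m 1))" by (simp add: sum scaleR)
 finally show ?thesis .
qed

text \<open>Multiplication by a polynomial, rather than membership of the polynomial, is what passes
  through the product case of the induction.\<close>

lemma Hsp_poly_mult:
 assumes "real_polynomial_function q" shows "!!f. f \<in> Hsp ==> (%x. q x * f x) \<in> Hsp"
 using assms
proof (induction q rule: real_polynomial_function.induct)
 case (linear q)
 have "(%x. \<Sum>m\<in>UNIV. q (axis m 1) * (x $ m * f x) + 0 * (x $ m * f x)) \<in> Hsp"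
  by (intro Hsp_sum Hsp_lin Hsp_coord linear)
 then show ?case
 proof (rule Hsp_cong)
  fix x
  show "q x * f x = (\<Sum>m\<in>UNIV. q (axis m 1) * (x $ m * f x) + 0 * (x $ m * f x))"
   by (subst bounded_linear_R3[OF linear(1), of x], unfold sum_distrib_right, rule sum.cong) simp_all
 qed
next
 case (const c)
 then show ?case using Hsp_lin[of f f c 0] by simp
next
 case (add p q)
 then show ?case using Hsp_lin[of "%x. p x * f x" "%x. q x * f x" 1 1] by (simp add: distrib_right)
next
 case (mult p q)
 then show ?case by (simp add: mult.assoc)
qed

theorem Hsp_poly: "real_polynomial_function q ==> q \<in> Hsp"
 using Hsp_poly_mult[of q "%x. 1"] sph_harm_Hsp[OF const_sph_harm] by simp

section \<open>Polynomials are smooth, smooth functions are continuously differentiable\<close>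

lemma rpf_grad:
 fixes q :: "R3 => real"
 assumes "real_polynomial_function q"
 shows "C1g q (grad q) & (ALL m. real_polynomial_function (%x. grad q x $ m))"
proof -
 have "EX g. C1g q g & (ALL m. real_polynomial_function (%x. g x $ m))"
  using assms
 proof (induction q rule: real_polynomial_function.induct)
  case (linear q)
  define v where "v = (\<chi> m. q (axis m 1))"
  have "q = (%x. x \<bullet> v)"
   unfolding v_def inner_vec_def by (rule ext, subst bounded_linear_R3[OF linear]) simp
  then have "C1g q (%x. v)" using C1g_inner by simp
  moreover have "real_polynomial_function (%x::R3. v $ m)" for m by (rule real_polynomial_function.intros(2))
  ultimately show ?case by blast
 next
  case (const c)
  have "real_polynomial_function (%x::R3. (0::R3) $ m)" for m by (rule real_polynomial_function.intros(2))
  then show ?case using C1g_const by blast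
 next
  case (add p q)
  then obtain g h where "C1g p g" "C1g q h" "ALL m. real_polynomial_function (%x. g x $ m)" "ALL m. real_polynomial_function (%x. h x $ m)" by blast
  moreover from this have "real_polynomial_function (%x. (g x + h x) $ m)" for m
   unfolding vector_add_component by (intro real_polynomial_function.intros(3)) simp_all
  ultimately show ?case using C1g_add by blast
 next
  case (mult p q)
  then obtain g h where "C1g p g" "C1g q h" "ALL m. real_polynomial_function (%x. g x $ m)" "ALL m. real_polynomial_function (%x. h x $ m)" by blast
  moreover from this have "real_polynomial_function (%x. (p x *R h x + q x *R g x) $ m)" for m
   unfolding vector_add_component vector_scaleR_component real_scaleR_def
   using mult.hyps by (rule_tac real_polynomial_function.intros(3)[OF real_polynomial_function.intros(4) real_polynomial_function.intros(4)]) simp_all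
  ultimately show ?case using C1g_mult by blast
 qed
 then obtain g where g: "C1g q g" "ALL m. real_polynomial_function (%x. g x $ m)" by blast
 moreover have "grad q = g" by (rule ext) (rule C1g_grad[OF g(1)])
 ultimately show ?thesis by simp
qed

lemma rpf_nth: "real_polynomial_function (%x::R3. x $ m)"
 by (intro real_polynomial_function.intros(1) bounded_linear_vec_nth)

lemma rpf_hpoly: "real_polynomial_function (hpoly l c)"
proof -
 have "hpoly l c = (%x. \<Sum>z\<in>tri l. c (fst z) (fst (snd z)) (snd (snd z)) * (x$1)^fst z * (x$2)^fst (snd z) * (x$3)^snd (snd z))"
  by (rule ext) (simp add: hpoly_tri case_prod_unfold)
 moreover have "real_polynomial_function (%x. \<Sum>z\<in>tri l. c (fst z) (fst (snd z)) (snd (snd z)) * (x$1)^fst z * (x$2)^fst (snd z) * (x$3)^snd (snd z))"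
  by (intro real_polynomial_function_sum real_polynomial_function.intros(2,4) real_polynomial_function_power rpf_nth) auto
 ultimately show ?thesis by simp
qed

lemma rpf_sph_harm: "Y \<in> sph_harm l ==> real_polynomial_function Y"
 by (auto simp: sph_harm_def rpf_hpoly)

lemma C1g_partial:
 assumes "C1g f g"
 shows "((%t. f (x + t *R axis i 1)) has_real_derivative g x $ i) (at 0)" "partial i f x = g x $ i"
proof -
 have f: "(f has_derivative (%h. g (x + 0 *R axis i 1) \<bullet> h)) (at (x + 0 *R axis i 1))" using assms by (simp add: C1g_def)
 have "((%t. x + t *R axis i 1) has_derivative (%t. t *R axis i 1)) (at (0::real))"
  by (auto intro!: derivative_eq_intros)
 from diff_chain_at[OF this f]
 show 1: "((%t. f (x + t *R axis i 1)) has_real_derivative g x $ i) (at 0)"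
  by (simp add: o_def has_field_derivative_def inner_axis mult_commute_abs)
 show "partial i f x = g x $ i"
  unfolding partial_def by (rule the_equality, rule 1, rule DERIV_unique[OF _ 1])
qed

lemma rpf_iter_partial: "real_polynomial_function f ==> real_polynomial_function (iter_partial is f)"
proof (induction "is")
 case Nil
 then show ?case by (simp add: iter_partial_def)
next
 case (Cons i "is")
 then have r: "real_polynomial_function (iter_partial is f)" by simp
 have "iter_partial (i # is) f = (%x. grad (iter_partial is f) x $ i)"
  using C1g_partial(2) rpf_grad[OF r] by (auto simp: iter_partial_def)
 then show ?case using rpf_grad[OF r] by simp
qed

theorem rpf_smooth: assumes "real_polynomial_function f" shows "smooth f"
 unfolding smooth_def
proof (intro allI conjI)
 fix "is" i x
 have r: "real_polynomial_function (iter_partial is f)" by (rule rpf_iter_partial[OF assms])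
 show "continuous_on UNIV (iter_partial is f)" using rpf_grad[OF r] C1g_cont by blast
 show "(%t. iter_partial is f (x + t *R axis i 1)) differentiable (at 0)"
  using C1g_partial(1) rpf_grad[OF r] real_differentiable_def by blast
qed

lemma mvt_real:
 assumes "!!t. (\<phi> has_real_derivative \<phi>' t) (at t)"
 obtains \<tau> where "\<bar>\<tau>\<bar> <= \<bar>a\<bar>" "\<phi> a - \<phi> 0 = a * \<phi>' \<tau>"
proof -
 consider "a = 0" | "a < 0" | "0 < a" by linarith
 then show ?thesis
 proof cases
  case 1
  then show ?thesis using that[of 0] by simp
 next
  case 2
  then obtain z where "a < z" "z < 0" "\<phi> 0 - \<phi> a = (0 - a) * \<phi>' z" using MVT2[of a 0 \<phi> \<phi>'] assms by blast
  then show ?thesis using that[of z] 2 by (simp add: algebra_simps)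
 next
  case 3
  then obtain z where "0 < z" "z < a" "\<phi> a - \<phi> 0 = (a - 0) * \<phi>' z" using MVT2[of 0 a \<phi> \<phi>'] assms by blast
  then show ?thesis using that[of z] 3 by (simp add: algebra_simps)
 qed
qed

text \<open>\<open>smooth\<close> speaks of iterated partial derivatives. Continuity of the first
  ones yields a total derivative: go from x to y parallel to the axes and apply the mean value
  theorem on each leg.\<close>

lemma C1g_from_partials:
 fixes P :: "3 => R3 => real"
 assumes d: "!!i x. ((%t. f (x + t *R axis i 1)) has_real_derivative P i x) (at 0)"
  and c: "!!i. continuous_on UNIV (P i)"
 shows "C1g f (%x. \<chi> i. P i x)"
 unfolding C1g_def
proof (intro conjI allI)
 show "continuous_on UNIV (%x. \<chi> i. P i x)" by (intro continuous_on_vec_lambda c)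
 fix x
 have line: "EX \<xi>. dist \<xi> z <= \<bar>a\<bar> & f (z + a *R axis i 1) - f z = a * P i \<xi>" for z a i
 proof -
  have "((%t. f (z + t *R axis i 1)) has_real_derivative P i (z + t *R axis i 1)) (at t)" for t
   using d[of "z + t *R axis i 1" i]
   by (subst DERIV_shift[of _ _ 0 t, simplified]) (simp add: algebra_simps)
  then obtain \<tau> where "\<bar>\<tau>\<bar> <= \<bar>a\<bar>" "f (z + a *R axis i 1) - f (z + 0 *R axis i 1) = a * P i (z + \<tau> *R axis i 1)"
   by (rule mvt_real)
  then show ?thesis by (intro exI[of _ "z + \<tau> *R axis i 1"]) (auto simp: dist_norm)
 qed
 show "(f has_derivative (%h. (\<chi> i. P i x) \<bullet> h)) (at x)"
  unfolding has_derivative_at_alt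
 proof (intro conjI allI impI)
  show "bounded_linear (%h. (\<chi> i. P i x) \<bullet> h)" by (rule bounded_linear_inner_right)
  fix e :: real assume e: "0 < e"
  have "EX \<delta>>0. ALL y. dist y x < \<delta> --> \<bar>P i y - P i x\<bar> < e / 3" for i
   using c[of i, unfolded continuous_on_iff, rule_format, of x "e/3"] e by (auto simp: dist_real_def)
  then have "ALL i. EX d. d > 0 & (ALL y. dist y x < d --> \<bar>P i y - P i x\<bar> < e / 3)" by blast
  from choice[OF this] obtain \<delta> where \<delta>': "ALL i. \<delta> i > 0 & (ALL y. dist y x < \<delta> i --> \<bar>P i y - P i x\<bar> < e / 3)" ..
  then have \<delta>: "!!i. 0 < \<delta> i" "!!i y. dist y x < \<delta> i ==> \<bar>P i y - P i x\<bar> < e / 3" by auto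
  \<comment> \<open>Every evaluation point on the three legs lies within 3 \<open>norm h\<close> of
    x, hence the division by 3.\<close>
  define r where "r = min (\<delta> 1) (min (\<delta> 2) (\<delta> 3)) / 3"
  have r: "0 < r" "3 * r <= \<delta> i" for i
   using \<delta>(1) exhaust_3[of i] by (auto simp: r_def)
  show "EX d>0. ALL y. norm (y - x) < d --> norm (f y - f x - (\<chi> i. P i x) \<bullet> (y - x)) <= e * norm (y - x)"
  proof (intro exI[of _ r] conjI allI impI r)
   fix y assume y: "norm (y - x) < r"
   define h where "h = y - x"
   have hc: "\<bar>h $ i\<bar> <= norm h" for i by (rule component_le_norm_cart)
   define p1 where "p1 = x + h $ 1 *R axis 1 1"
   define p2 where "p2 = p1 + h $ 2 *R axis 2 1"
   have y3: "y = p2 + h $ 3 *R axis 3 1"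
    using vec3_expand[of h] by (simp add: p1_def p2_def h_def sum_3 algebra_simps)
   have d1: "dist p1 x <= norm h" "dist p2 p1 <= norm h" using hc by (auto simp: p1_def p2_def dist_norm)
   obtain a1 where a1: "dist a1 x <= norm h" "f p1 - f x = h $ 1 * P 1 a1" using line[of x "h$1" 1] order_trans[OF _ hc[of 1]] unfolding p1_def by blast
   obtain a2 where a2: "dist a2 p1 <= norm h" "f p2 - f p1 = h $ 2 * P 2 a2" using line[of p1 "h$2" 2] order_trans[OF _ hc[of 2]] unfolding p2_def by blast
   obtain a3 where a3: "dist a3 p2 <= norm h" "f y - f p2 = h $ 3 * P 3 a3" using line[of p2 "h$3" 3] order_trans[OF _ hc[of 3]] unfolding y3 by blast
   have hr: "norm h < r" using y by (simp add: h_def)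
   have "dist a1 x < \<delta> 1" "dist a2 x < \<delta> 2" "dist a3 x < \<delta> 3"
    using a1(1) a2(1) a3(1) d1 hr r(2)[of 1] r(2)[of 2] r(2)[of 3] r(1) norm_ge_zero[of h]
     dist_triangle[of a2 x p1] dist_triangle[of a3 x p2] dist_triangle[of p2 x p1] by linarith+
   then have b: "\<bar>P 1 a1 - P 1 x\<bar> < e / 3" "\<bar>P 2 a2 - P 2 x\<bar> < e / 3" "\<bar>P 3 a3 - P 3 x\<bar> < e / 3" using \<delta>(2) by auto
   have "f y - f x - (\<chi> i. P i x) \<bullet> (y - x) = h $ 1 * (P 1 a1 - P 1 x) + h $ 2 * (P 2 a2 - P 2 x) + h $ 3 * (P 3 a3 - P 3 x)"
    using a1(2) a2(2) a3(2) by (simp add: h_def[symmetric] inner_vec_def sum_3 algebra_simps)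
   also have "norm ... <= norm h * (e/3) + norm h * (e/3) + norm h * (e/3)"
    unfolding real_norm_def using b hc
    by (intro order_trans[OF abs_triangle_ineq] add_mono; unfold abs_mult; intro mult_mono) (auto intro: less_imp_le)
   finally show "norm (f y - f x - (\<chi> i. P i x) \<bullet> (y - x)) <= e * norm (y - x)" by (simp add: h_def mult.commute)
  qed
 qed
qed

theorem smooth_C1g: assumes "smooth f" shows "C1g f (grad f)"
proof -
 have d: "((%t. f (x + t *R axis i 1)) has_real_derivative partial i f x) (at 0)" for i x
 proof -
  have "(%t. iter_partial [] f (x + t *R axis i 1)) differentiable (at 0)" using assms unfolding smooth_def by blast
  then obtain D where D: "((%t. f (x + t *R axis i 1)) has_real_derivative D) (at 0)"
   by (auto simp: iter_partial_def real_differentiable_def)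
  have "partial i f x = D" unfolding partial_def by (rule the_equality, rule D, rule DERIV_unique[OF _ D])
  then show ?thesis using D by simp
 qed
 have "continuous_on UNIV (iter_partial [i] f)" for i using assms unfolding smooth_def by blast
 then have "continuous_on UNIV (partial i f)" for i by (simp add: iter_partial_def)
 from C1g_from_partials[OF d this] show ?thesis by (rule C1g_grad_self)
qed

section \<open>Poisson and Newton kernels\<close>

text \<open>Fubini for a continuous kernel against data that are merely integrable, the situation of
  all Poisson integrals of L^p functions.\<close>

lemma cont_swap_L1:
 fixes K :: "'a::euclidean_space => 'c::euclidean_space => 'b::{banach,second_countable_topology}" and g :: "'c => real"
 assumes M: "cmeas M" and N: "cmeas N" and K: "continuous_on (space M \<times> space N) (%(x,y). K x y)" and g: "integrable N g"
 shows "(\<integral>x. (\<integral>y. g y *R K x y \<partial>N) \<partial>M) = (\<integral>y. g y *R (\<integral>x. K x y \<partial>M) \<partial>N)"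
proof -
 interpret M: cmeas M by fact
 interpret N: cmeas N by fact
 interpret P: pair_sigma_finite M N ..
 interpret MN: cmeas "M \<Otimes>\<^sub>M N" by (rule cmeas_pair) fact+
 have Kn: "continuous_on (space M \<times> space N) (%(x,y). norm (K x y))"
  using continuous_on_norm[OF K] by (simp add: case_prod_unfold)
 have gn: "integrable N (%y. \<bar>g y\<bar>)" using g by simp
 have int: "integrable (M \<Otimes>\<^sub>M N) (%(x,y). g y *R K x y)"
 proof (rule P.Fubini_integrable)
  have [measurable]: "g \<in> borel_measurable N" using g by auto
  have [measurable]: "(%(x,y). K x y) \<in> borel_measurable (M \<Otimes>\<^sub>M N)"
   by (rule MN.cont_meas) (simp add: space_pair_measure K)
  show "(%(x,y). g y *R K x y) \<in> borel_measurable (M \<Otimes>\<^sub>M N)" by measurable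
  have "integrable M (%x. \<integral>y. \<bar>g y\<bar> *R norm (K x y) \<partial>N)"
   by (intro M.cont_int N.int_param_cont[OF Kn gn])
  then show "integrable M (%x. \<integral>y. norm (case (x, y) of (x, y) => g y *R K x y) \<partial>N)" by simp
  show "AE x in M. integrable N (%y. case (x, y) of (x, y) => g y *R K x y)"
  proof (rule AE_I2)
   fix x assume x: "x \<in> space M"
   from N.int_bdd_mult[OF continuous_on_slice1[OF K x] g]
   show "integrable N (%y. case (x, y) of (x, y) => g y *R K x y)" by simp
  qed
 qed
 have "(\<integral>x. (\<integral>y. g y *R K x y \<partial>N) \<partial>M) = (\<integral>y. (\<integral>x. g y *R K x y \<partial>M) \<partial>N)"
  by (rule P.Fubini_integral[symmetric, OF int])
 then show ?thesis by simp
qed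

text \<open>Every kernel below is a polynomial in x, y and powers of the inverse distance, so the
  one rule \<open>rho_deriv\<close> serves them all. \<open>gN\<close> and \<open>gP\<close> are the
  gradients in x of the Newton and Poisson kernels.\<close>

definition rho :: "R3 => R3 => real" where "rho x y = inverse (norm (x - y))"

definition Nker :: "R3 => R3 => real" where "Nker x y = 1 / (4 * pi) * rho x y"

definition gN :: "R3 => R3 => R3" where "gN x y = (- (1 / (4 * pi)) * rho x y ^ 3) *R (x - y)"

definition gP :: "R3 => R3 => R3" where
 "gP x y = (1 / (4 * pi)) *R ((- 2 * rho x y ^ 3) *R x - (3 * (1 - x \<bullet> x) * rho x y ^ 5) *R (x - y))"

text \<open>Gradient of the i-th component of \<open>gP\<close>, hence a row of the Hessian of the
  Poisson kernel.\<close>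

definition hP :: "3 => R3 => R3 => R3" where
 "hP i x y = (1 / (4 * pi)) *R ((- 2) *R (rho x y ^ 3 *R axis i 1 - (3 * rho x y ^ 5 * x $ i) *R (x - y))
   - 3 *R ((- 2 * (x $ i - y $ i) * rho x y ^ 5) *R x
    + (1 - x \<bullet> x) *R (rho x y ^ 5 *R axis i 1 - (5 * rho x y ^ 7 * (x $ i - y $ i)) *R (x - y))))"

lemma Pker_rho: "Pker x y = 1 / (4 * pi) * ((1 - x \<bullet> x) * rho x y ^ 3)"
 unfolding Pker_def rho_def power2_norm_eq_inner[symmetric] power_inverse
 by (simp only: divide_inverse mult_1_left mult.assoc)

lemma ball_neq_sphere: "x \<in> ball 0 1 ==> y \<in> SS ==> x ~= y"
 by auto

lemma rho_pos: "x ~= y ==> 0 < rho x y"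
 by (simp add: rho_def)

lemma rho_sq: "x ~= y ==> rho x y ^ 2 * ((x - y) \<bullet> (x - y)) = 1"
 unfolding rho_def power_inverse power2_norm_eq_inner[symmetric] by simp

lemma rho_deriv:
 assumes "x ~= y"
 shows "((%x. rho x y ^ k) has_derivative (%h. (- real k * rho x y ^ (k + 2)) * ((x - y) \<bullet> h))) (at x)"
proof -
 have n: "((%x. norm (x - y)) has_derivative (%h. sgn (x - y) \<bullet> h)) (at x)"
 proof -
  have 1: "((%x. x - y) has_derivative (%h. h)) (at x)" by (auto intro!: derivative_eq_intros)
  have 2: "(norm has_derivative (%h. h \<bullet> sgn (x - y))) (at (x - y))" by (rule has_derivative_norm) (use assms in simp)
  show ?thesis using diff_chain_at[OF 1 2] by (simp add: o_def inner_commute)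
 qed
 have nz: "norm (x - y) ~= 0" using assms by simp
 have "((%x. rho x y) has_derivative (%h. - (inverse (norm (x - y)) * (sgn (x - y) \<bullet> h) * inverse (norm (x - y))))) (at x)"
  unfolding rho_def by (rule Deriv.has_derivative_inverse[OF nz n])
 moreover have "- (inverse (norm (x - y)) * (sgn (x - y) \<bullet> h) * inverse (norm (x - y))) = - (rho x y ^ 3) * ((x - y) \<bullet> h)" for h
  by (simp add: rho_def sgn_div_norm power3_eq_cube)
 ultimately have r: "((%x. rho x y) has_derivative (%h. - (rho x y ^ 3) * ((x - y) \<bullet> h))) (at x)" by simp
 have "((%x. rho x y ^ k) has_derivative (%h. of_nat k * (- (rho x y ^ 3) * ((x - y) \<bullet> h)) * rho x y ^ (k - 1))) (at x)"
  by (rule has_derivative_power[OF r])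
 moreover have "(%h. of_nat k * (- (rho x y ^ 3) * ((x - y) \<bullet> h)) * rho x y ^ (k - 1)) = (%h. (- real k * rho x y ^ (k + 2)) * ((x - y) \<bullet> h))"
  by (cases k) (simp_all add: fun_eq_iff power_add power3_eq_cube power2_eq_square algebra_simps)
 ultimately show ?thesis by (simp only:)
qed

lemma Nker_deriv: "x ~= y ==> ((%x. Nker x y) has_derivative (%h. gN x y \<bullet> h)) (at x)"
 unfolding Nker_def gN_def using has_derivative_mult_right[OF rho_deriv[of x y 1], of "1 / (4 * pi)"]
 by (simp add: power3_eq_cube mult.assoc)

lemma inner_self_deriv: "((%x. 1 - x \<bullet> x) has_derivative (%h. - 2 * (x \<bullet> h))) (at (x::R3))"
 by (auto intro!: derivative_eq_intros simp: inner_commute)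

lemma Pker_deriv:
 assumes "x ~= y" shows "((%x. Pker x y) has_derivative (%h. gP x y \<bullet> h)) (at x)"
proof -
 have "((%x. 1 / (4 * pi) * ((1 - x \<bullet> x) * rho x y ^ 3)) has_derivative
   (%h. 1 / (4 * pi) * ((1 - x \<bullet> x) * ((- real 3 * rho x y ^ (3 + 2)) * ((x - y) \<bullet> h)) + (- 2 * (x \<bullet> h)) * rho x y ^ 3))) (at x)"
  by (intro has_derivative_mult_right has_derivative_mult inner_self_deriv rho_deriv assms)
 moreover have "1 / (4 * pi) * ((1 - x \<bullet> x) * ((- real 3 * rho x y ^ (3 + 2)) * ((x - y) \<bullet> h)) + (- 2 * (x \<bullet> h)) * rho x y ^ 3) = gP x y \<bullet> h" for h
  by (simp add: gP_def inner_diff_left algebra_simps)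
 ultimately show ?thesis by (simp add: Pker_rho)
qed

lemma gP_deriv:
 assumes "x ~= y" shows "((%x. gP x y $ i) has_derivative (%h. hP i x y \<bullet> h)) (at x)"
proof -
 have c: "((%x. x $ i) has_derivative (%h. h $ i)) (at x)" for x :: R3
  by (rule bounded_linear_imp_has_derivative[OF bounded_linear_vec_nth])
 have c': "((%x. x $ i - y $ i) has_derivative (%h. h $ i)) (at x)" for x :: R3
  by (auto intro!: derivative_eq_intros c)
 have "((%x. 1 / (4 * pi) * ((- 2) * (rho x y ^ 3 * x $ i) - 3 * ((1 - x \<bullet> x) * (rho x y ^ 5 * (x $ i - y $ i))))) has_derivative
   (%h. 1 / (4 * pi) * ((- 2) * (rho x y ^ 3 * h $ i + ((- real 3 * rho x y ^ (3 + 2)) * ((x - y) \<bullet> h)) * x $ i)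
    - 3 * ((1 - x \<bullet> x) * (rho x y ^ 5 * h $ i + ((- real 5 * rho x y ^ (5 + 2)) * ((x - y) \<bullet> h)) * (x $ i - y $ i))
     + (- 2 * (x \<bullet> h)) * (rho x y ^ 5 * (x $ i - y $ i)))))) (at x)"
  by (intro has_derivative_mult_right has_derivative_diff has_derivative_mult inner_self_deriv rho_deriv assms c c')
 moreover have "1 / (4 * pi) * ((- 2) * (rho x y ^ 3 * h $ i + ((- real 3 * rho x y ^ (3 + 2)) * ((x - y) \<bullet> h)) * x $ i)
    - 3 * ((1 - x \<bullet> x) * (rho x y ^ 5 * h $ i + ((- real 5 * rho x y ^ (5 + 2)) * ((x - y) \<bullet> h)) * (x $ i - y $ i))
     + (- 2 * (x \<bullet> h)) * (rho x y ^ 5 * (x $ i - y $ i)))) = hP i x y \<bullet> h" for h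
  unfolding hP_def inner_scaleR_left inner_diff_left inner_add_left inner_axis'
  by (simp add: algebra_simps)
 moreover have "1 / (4 * pi) * ((- 2) * (rho x y ^ 3 * x $ i) - 3 * ((1 - x \<bullet> x) * (rho x y ^ 5 * (x $ i - y $ i)))) = gP x y $ i" for x
  by (simp add: gP_def)
 ultimately show ?thesis by simp
qed

lemma sphere_dist_id:
 assumes "y \<in> SS" shows "(x - y) \<bullet> (x - y) = 2 * (x \<bullet> (x - y)) + (1 - x \<bullet> x)"
proof -
 have "y \<bullet> y = 1" using assms by (simp add: norm_eq_1[symmetric])
 then show ?thesis by (simp add: inner_diff_left inner_diff_right inner_commute)
qed

text \<open>Harmonicity of the Poisson kernel in x. It reduces to |x-y|^2 = 2 x . (x-y) + 1 - |x|^2,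
  which is |y| = 1 in disguise.\<close>

lemma hP_trace:
 assumes "x ~= y" "y \<in> SS" shows "(\<Sum>i\<in>UNIV. hP i x y $ i) = 0"
proof -
 define z where "z = x - y"
 define r where "r = rho x y"
 have s1: "(\<Sum>i\<in>UNIV. x $ i * z $ i) = x \<bullet> z" "(\<Sum>i\<in>UNIV. z $ i * z $ i) = z \<bullet> z" by (simp_all add: inner_vec_def)
 have "hP i x y $ i = (1 / (4 * pi)) * (- 2 * r^3 + 12 * r^5 * (x $ i * z $ i) - 3 * (1 - x \<bullet> x) * r^5 + 15 * (1 - x \<bullet> x) * r^7 * (z $ i * z $ i))" for i
 proof -
  have zi: "x $ i - y $ i = z $ i" by (simp add: z_def)
  show ?thesis
   unfolding hP_def r_def[symmetric] z_def[symmetric] zi by (simp add: algebra_simps)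
 qed
 then have "(\<Sum>i\<in>UNIV. hP i x y $ i) = (1 / (4 * pi)) * (- 6 * r^3 + 12 * r^5 * (x \<bullet> z) - 9 * (1 - x \<bullet> x) * r^5 + 15 * (1 - x \<bullet> x) * r^7 * (z \<bullet> z))"
  by (simp only: sum_distrib_left[symmetric] sum.distrib sum_subtractf s1) simp
 note sum = this
 have e: "r^2 * (z \<bullet> z) = 1" unfolding r_def z_def by (rule rho_sq[OF assms(1)])
 have "r^7 * (z \<bullet> z) = r^5 * (r^2 * (z \<bullet> z))" "r^5 * (z \<bullet> z) = r^3 * (r^2 * (z \<bullet> z))" by (simp_all flip: power_add)
 then have r7: "r^7 * (z \<bullet> z) = r^5" and r3: "r^3 = r^5 * (z \<bullet> z)" unfolding e by simp_all
 have zz: "z \<bullet> z = 2 * (x \<bullet> z) + (1 - x \<bullet> x)" unfolding z_def by (rule sphere_dist_id[OF assms(2)])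
 have "- 6 * r^3 + 12 * r^5 * (x \<bullet> z) - 9 * (1 - x \<bullet> x) * r^5 + 15 * (1 - x \<bullet> x) * r^7 * (z \<bullet> z)
  = - 6 * (r^5 * (z \<bullet> z)) + 12 * r^5 * (x \<bullet> z) - 9 * (1 - x \<bullet> x) * r^5 + 15 * (1 - x \<bullet> x) * (r^7 * (z \<bullet> z))"
  unfolding r3[symmetric] by simp
 also have "... = 0" unfolding r7 unfolding zz by (simp add: algebra_simps)
 finally show ?thesis unfolding sum by simp
qed

text \<open>Integrated against boundary data this becomes a differential equation along rays that
  links the two potentials; \<open>Npot_sph_harm\<close> solves it.\<close>

lemma Pker_Nker:
 assumes "x ~= y" "y \<in> SS" shows "2 * (x \<bullet> gN x y) + Nker x y = Pker x y"
proof -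
 define z where "z = x - y"
 define r where "r = rho x y"
 have e: "r^2 * (z \<bullet> z) = 1" unfolding r_def z_def by (rule rho_sq[OF assms(1)])
 have zz: "z \<bullet> z = 2 * (x \<bullet> z) + (1 - x \<bullet> x)" unfolding z_def by (rule sphere_dist_id[OF assms(2)])
 have "r = r * (r^2 * (z \<bullet> z))" unfolding e by simp
 also have "... = r^3 * (2 * (x \<bullet> z) + (1 - x \<bullet> x))" unfolding zz by (simp add: power3_eq_cube power2_eq_square)
 finally have r: "r = r^3 * (2 * (x \<bullet> z) + (1 - x \<bullet> x))" .
 have "2 * (x \<bullet> gN x y) + Nker x y = 1 / (4 * pi) * (r - 2 * (r^3 * (x \<bullet> z)))"
  by (simp add: gN_def Nker_def r_def[symmetric] z_def[symmetric] algebra_simps)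
 also have "r - 2 * (r^3 * (x \<bullet> z)) = (1 - x \<bullet> x) * r^3" by (subst (1) r) (simp add: algebra_simps)
 finally show ?thesis by (simp add: Pker_rho r_def)
qed

lemma rho_cont: "continuous_on (ball 0 1 \<times> SS) (%z. rho (fst z) (snd z) ^ k)"
 unfolding rho_def by (intro continuous_intros) auto

lemma kernels_cont:
 shows "continuous_on (ball 0 1 \<times> SS) (%(x,y). Pker x y)"
  and "continuous_on (ball 0 1 \<times> SS) (%(x,y). Nker x y)"
  and "continuous_on (ball 0 1 \<times> SS) (%(x,y). gP x y)"
  and "continuous_on (ball 0 1 \<times> SS) (%(x,y). gN x y)"
  and "continuous_on (ball 0 1 \<times> SS) (%(x,y). hP i x y)"
 using rho_cont[of 1] unfolding Pker_rho Nker_def gP_def gN_def hP_def case_prod_unfold power_one_right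
 by (intro continuous_intros rho_cont; simp)+

lemmas Pker_cont = kernels_cont(1) and Nker_cont = kernels_cont(2)

lemma Pker_cont_y: "x \<in> ball 0 1 ==> continuous_on SS (Pker x)"
 by (rule continuous_on_slice1[OF Pker_cont])

lemma Pker_int: "x \<in> ball 0 1 ==> integrable sigmaS f ==> integrable sigmaS (%y. Pker x y * f y)"
 using sg.int_bdd_mult[of "Pker x" f] Pker_cont_y by (simp add: mult.commute)

lemma Pker_pos: "x \<in> ball 0 1 ==> y \<in> SS ==> 0 < Pker x y"
proof -
 assume x: "x \<in> ball 0 1" and y: "y \<in> SS"
 have "x \<bullet> x < 1" using x by (simp add: power2_norm_eq_inner[symmetric] abs_square_less_1)
 then show ?thesis using rho_pos[OF ball_neq_sphere[OF x y]] by (simp add: Pker_rho)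
qed

lemma Poisson_alt: "Poisson f x = (\<integral>S y. f y * Pker x y)"
 by (simp add: Poisson_def mult.commute)

definition Npot :: "(R3 => real) => R3 => real" where "Npot f x = (\<integral>S y. f y * Nker x y)"

lemma Poisson_deriv:
 assumes x: "x \<in> ball 0 1" and f: "integrable sigmaS f"
 shows "(Poisson f has_derivative (%h. (\<integral>S y. f y *R gP x y) \<bullet> h)) (at x)"
  and "grad (Poisson f) x = (\<integral>S y. f y *R gP x y)"
proof -
 have "((%x. \<integral>S y. f y * Pker x y) has_derivative (%h. (\<integral>S y. f y *R gP x y) \<bullet> h)) (at x)"
  using x f by (intro sg.int_deriv[of "ball 0 1"])
   (simp_all add: Pker_deriv ball_neq_sphere kernels_cont Pker_cont_y del: mem_sphere_0 mem_ball_0)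
 then show d: "(Poisson f has_derivative (%h. (\<integral>S y. f y *R gP x y) \<bullet> h)) (at x)"
  unfolding Poisson_alt[abs_def] .
 have "D = (\<integral>S y. f y *R gP x y)" if "(Poisson f has_derivative (%h. D \<bullet> h)) (at x)" for D
 proof -
  have "(%h. D \<bullet> h) = (%h. (\<integral>S y. f y *R gP x y) \<bullet> h)" using has_derivative_unique[OF that d] .
  then have "ALL h. D \<bullet> h = (\<integral>S y. f y *R gP x y) \<bullet> h" by (simp add: fun_eq_iff)
  then show ?thesis by (simp only: vector_eq_rdot)
 qed
 then show "grad (Poisson f) x = (\<integral>S y. f y *R gP x y)"
  unfolding grad_def by (rule the_equality[where P="%D. (Poisson f has_derivative (%h. D \<bullet> h)) (at x)", OF d])
qed

lemma Npot_deriv: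
 assumes x: "x \<in> ball 0 1" and f: "integrable sigmaS f"
 shows "(Npot f has_derivative (%h. (\<integral>S y. f y *R gN x y) \<bullet> h)) (at x)"
 unfolding Npot_def using x f continuous_on_slice1[OF Nker_cont]
 by (intro sg.int_deriv[of "ball 0 1"])
   (simp_all add: Nker_deriv ball_neq_sphere kernels_cont del: mem_sphere_0 mem_ball_0)

lemma gP_cont_y: "x \<in> ball 0 1 ==> continuous_on SS (gP x)"
 by (rule continuous_on_slice1[OF kernels_cont(3)])

lemma Poisson_grad_deriv:
 assumes x: "x \<in> ball 0 1" and f: "integrable sigmaS f"
 shows "((%x. (\<integral>S y. f y *R gP x y) $ i) has_derivative (%h. (\<integral>S y. f y *R hP i x y) \<bullet> h)) (at x)"
proof -
 have gc: "continuous_on SS (%y. gP x y $ i)" if "x \<in> ball 0 1" for x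
  by (intro continuous_intros gP_cont_y that)
 have "((%x. \<integral>S y. f y * (gP x y $ i)) has_derivative (%h. (\<integral>S y. f y *R hP i x y) \<bullet> h)) (at x)"
  using x f by (intro sg.int_deriv[of "ball 0 1"])
   (simp_all add: gP_deriv ball_neq_sphere kernels_cont gc del: mem_sphere_0 mem_ball_0)
 then show ?thesis
 proof (rule has_derivative_transform_within_open[of _ _ _ _ "ball 0 1"])
  fix x :: R3 assume "x \<in> ball 0 1"
  then have "integrable sigmaS (%y. f y *R gP x y)" by (intro sg.int_bdd_mult f) (simp add: gP_cont_y)
  from integral_inner_left[OF _, of "axis i 1" sigmaS "%y. f y *R gP x y"] this
  show "(\<integral>S y. f y * (gP x y $ i)) = (\<integral>S y. f y *R gP x y) $ i"
   by (simp add: inner_axis)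
 qed (use x in auto)
qed

section \<open>Poisson integrals of harmonics\<close>

lemma rball: "0 <= r ==> r < 1 ==> y \<in> SS ==> r *R y \<in> ball (0::R3) 1"
 by simp

lemma dist_sq_rsphere:
 assumes "x \<in> SS" "y \<in> SS" shows "(norm (r *R x - y))\<^sup>2 = 1 + r\<^sup>2 - 2 * r * (x \<bullet> y)"
proof -
 have 1: "x \<bullet> x = 1" "y \<bullet> y = 1" using assms by (auto simp: norm_eq_1)
 have "(r *R x - y) \<bullet> (r *R x - y) = r * r * (x \<bullet> x) - 2 * r * (x \<bullet> y) + y \<bullet> y"
  by (simp add: inner_diff_left inner_diff_right inner_commute algebra_simps)
 then show ?thesis unfolding power2_norm_eq_inner 1 by (simp add: power2_eq_square)
qed

lemma norm_rsphere:
 assumes "x \<in> SS" "y \<in> SS" shows "norm (r *R x - y) = sqrt (1 + r\<^sup>2 - 2 * r * (x \<bullet> y))"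
 using dist_sq_rsphere[OF assms, of r] by (metis norm_ge_zero real_sqrt_unique)

lemma rho_sym: assumes "x \<in> SS" "y \<in> SS" shows "rho (r *R x) y = rho (r *R y) x"
 unfolding rho_def norm_rsphere[OF assms] norm_rsphere[OF assms(2,1)] by (simp add: inner_commute)

lemma Pker_sym: assumes "x \<in> SS" "y \<in> SS" shows "Pker (r *R x) y = Pker (r *R y) x"
proof -
 have "x \<bullet> x = 1" "y \<bullet> y = 1" using assms by (auto simp: norm_eq_1)
 then show ?thesis by (simp add: Pker_rho rho_sym[OF assms])
qed

lemma DD_pos: "0 <= r ==> r < 1 ==> t <= 1 ==> (1 - r)\<^sup>2 <= 1 + r\<^sup>2 - 2 * r * t" for r t :: real
proof -
 assume "0 <= r" "r < 1" "t <= 1"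
 then have "r * t <= r * 1" by (intro mult_left_mono)
 then show ?thesis by (simp add: power2_eq_square algebra_simps)
qed

text \<open>The kernel is zonal about x, and with D = 1 + r^2 - 2rt the power D^(-3/2) has the
  antiderivative D^(-1/2)/r in the height t.\<close>

lemma Pker_integral:
 assumes x: "x \<in> SS" and r: "0 < r" "r < 1"
 shows "(\<integral>S y. Pker (r *R x) y) = 1"
proof -
 define D where "D t = 1 + r\<^sup>2 - 2 * r * t" for t
 have Dp: "0 < D t" if "t <= 1" for t
  using DD_pos[of r t] r that by (smt (verit) D_def zero_less_power2)
 have Dc: "continuous_on {-1..1} D" unfolding D_def by (intro continuous_intros)
 have nx: "norm x = 1" using x by simp
 have D1: "sqrt (D 1) = 1 - r" "sqrt (D (-1)) = 1 + r"
 proof -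
  have "D 1 = (1 - r)\<^sup>2" "D (-1) = (1 + r)\<^sup>2" by (simp_all add: D_def power2_eq_square algebra_simps)
  then show "sqrt (D 1) = 1 - r" "sqrt (D (-1)) = 1 + r" using r by simp_all
 qed
 have Dd: "((%t. sqrt (D t)) has_real_derivative (- r * inverse (sqrt (D t)))) (at t)" if "t < 1" for t
 proof -
  have "(D has_real_derivative (- 2 * r)) (at t)" unfolding D_def by (auto intro!: derivative_eq_intros)
  from DERIV_chain2[OF DERIV_real_sqrt[OF Dp] this] that show ?thesis by (simp add: mult.commute)
 qed
 have cP: "continuous_on {-1..1} (%t. inverse (sqrt (D t)) ^ k)" for k
  by (intro continuous_intros Dc) (use Dp in \<open>auto simp: less_imp_neq[symmetric]\<close>)
 have i3: "(\<integral>t. inverse (sqrt (D t)) ^ 3 \<partial>Iv (-1) 1) = (1/r) * inverse (sqrt (D 1)) - (1/r) * inverse (sqrt (D (-1)))"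
 proof (rule integral_Iv_FTC)
  show "continuous_on {-1..1} (%t. inverse (sqrt (D t)) ^ 3)" by (rule cP)
  show "((%t. (1/r) * inverse (sqrt (D t))) has_real_derivative inverse (sqrt (D t)) ^ 3) (at t)" if "-1 < t" "t < 1" for t
  proof -
   have "sqrt (D t) ~= 0" using Dp[of t] that by simp
   from DERIV_cmult[OF DERIV_inverse'[OF Dd[OF that(2)] this], of "1/r"] r
   show ?thesis by (simp add: power3_eq_cube mult.assoc)
  qed
  show "continuous_on {-1..1} (%t. (1/r) * inverse (sqrt (D t)))"
   using continuous_on_mult_left[OF cP[of 1], of "1/r"] by simp
 qed simp
 have rho: "rho (r *R x) y = inverse (sqrt (D (x \<bullet> y)))" if "y \<in> SS" for y
  by (simp add: rho_def norm_rsphere[OF x that] D_def)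
 have xx: "x \<bullet> x = 1" using nx by (simp add: norm_eq_1)
 have "(\<integral>S y. Pker (r *R x) y) = (\<integral>S y. 1 / (4 * pi) * (1 - r\<^sup>2) * inverse (sqrt (D (x \<bullet> y))) ^ 3)"
  by (rule LINT_cong[OF refl]) (simp add: Pker_rho rho xx power2_eq_square)
 also have "... = 1 / (4 * pi) * (1 - r\<^sup>2) * (2 * pi * (\<integral>t. inverse (sqrt (D t)) ^ 3 \<partial>Iv (-1) 1))"
  using zonal_integral[OF nx, of "%t. inverse (sqrt (D t)) ^ 3"] cP[of 3] by simp
 also have "... = (1 - r\<^sup>2) / (2 * r) * (inverse (1 - r) - inverse (1 + r))"
 proof -
  have "1 / (4 * pi) * c * (2 * pi * (1 / r * A - 1 / r * B)) = c / (2 * r) * (A - B)" for c A B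
   using r by (simp add: field_simps)
  then show ?thesis unfolding i3 D1 .
 qed
 also have "(1 - r\<^sup>2) / (2 * r) * (inverse (1 - r) - inverse (1 + r)) = 1"
 proof -
  have f: "1 - r\<^sup>2 = (1 - r) * (1 + r)" by (simp add: power2_eq_square algebra_simps)
  have "(1 - r) * (1 + r) * (inverse (1 - r) - inverse (1 + r)) = (1 + r) * ((1 - r) * inverse (1 - r)) - (1 - r) * ((1 + r) * inverse (1 + r))"
   by (simp add: algebra_simps)
  also have "... = 2 * r" using r by simp
  finally show ?thesis unfolding f using r by simp
 qed
 finally show "(\<integral>S y. Pker (r *R x) y) = 1" .
qed

lemma rsphere_kernel_cont:
 assumes "0 < r" "r < 1" "continuous_on (ball 0 1 \<times> SS) (%(x,y). K x y)"
 shows "continuous_on (SS \<times> SS) (%(x,y). K (r *R x) y)"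
proof -
 have "continuous_on (SS \<times> SS) (%z. (%(x,y). K x y) (r *R fst z, snd z))"
  by (rule continuous_on_compose2[OF assms(3)]) (use assms in \<open>auto intro!: continuous_intros\<close>)
 then show ?thesis by (simp add: case_prod_unfold)
qed

lemma Poisson_approx:
 assumes f: "continuous_on SS f" and e: "0 < e"
 obtains d where "0 < d" "d < 1" "!!r y. 1 - d < r ==> r < 1 ==> y \<in> SS ==> \<bar>Poisson f (r *R y) - f y\<bar> < e"
proof -
 obtain M where M: "0 < M" "!!x. x \<in> SS ==> \<bar>f x\<bar> <= M" using sg.cont_bound[of f] f by auto
 have "uniformly_continuous_on SS f" using f by (intro compact_uniformly_continuous) auto
 then obtain \<delta> where \<delta>: "0 < \<delta>" "!!y z. y \<in> SS ==> z \<in> SS ==> dist z y < \<delta> ==> dist (f z) (f y) < e / 2"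
  unfolding uniformly_continuous_on_def using e by (metis half_gt_zero)
 define C where "C = (\<delta> / 2) ^ 3"
 have C: "0 < C" using \<delta> by (simp add: C_def)
 \<comment> \<open>The bound \<delta>/2 keeps r y at distance at least \<delta>/2 from points z with
   |z - y| >= \<delta>, where the kernel is then at most 2d/(4 pi C). The bound e C/(16 M) makes the
   resulting far part 4 M d/C at most e/4.\<close>
 define d where "d = min (1/2) (min (\<delta> / 2) (e * C / (16 * M)))"
 have d: "0 < d" "d <= 1/2" "d <= \<delta> / 2" "d <= e * C / (16 * M)" using \<delta> e C M by (auto simp: d_def)
 have "\<bar>Poisson f (r *R y) - f y\<bar> < e" if r: "1 - d < r" "r < 1" and y: "y \<in> SS" for r y
 proof -
  have r0: "0 < r" using r d by linarith
  have b: "r *R y \<in> ball 0 1" using r0 r y by simp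
  have Pi: "(\<integral>S z. Pker (r *R y) z) = 1" by (rule Pker_integral[OF y r0 r(2)])
  have fi: "integrable sigmaS f" using f by (intro sg.cont_int) simp
  note i1 = Pker_int[OF b fi]
  have i2: "integrable sigmaS (Pker (r *R y))" using Pker_cont_y[OF b] by (intro sg.cont_int) simp
  have "Poisson f (r *R y) - f y = (\<integral>S z. Pker (r *R y) z * (f z - f y))"
   unfolding Poisson_def using i1 i2 Pi by (simp add: right_diff_distrib)
  also have "\<bar>...\<bar> <= (\<integral>S z. \<bar>Pker (r *R y) z * (f z - f y)\<bar>)"
   using integral_norm_bound[of sigmaS "%z. Pker (r *R y) z * (f z - f y)"] by simp
  also have "... <= (\<integral>S z. Pker (r *R y) z * (e/2) + 2 * M * (2 * d / (4 * pi * C)))"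
  proof (rule integral_mono)
   show "integrable sigmaS (%z. \<bar>Pker (r *R y) z * (f z - f y)\<bar>)"
    using i1 i2 by (simp add: right_diff_distrib)
   show "integrable sigmaS (%z. Pker (r *R y) z * (e/2) + 2 * M * (2 * d / (4 * pi * C)))" using i2 by simp
   fix z assume "z \<in> space sigmaS"
   then have z: "z \<in> SS" by simp
   have P0: "0 < Pker (r *R y) z" by (rule Pker_pos[OF b z])
   show "\<bar>Pker (r *R y) z * (f z - f y)\<bar> <= Pker (r *R y) z * (e/2) + 2 * M * (2 * d / (4 * pi * C))"
   proof (cases "dist z y < \<delta>")
    case True
    then have "\<bar>f z - f y\<bar> <= e/2" using \<delta>(2)[OF y z] by (simp add: dist_real_def)
    then have "Pker (r *R y) z * \<bar>f z - f y\<bar> <= Pker (r *R y) z * (e/2)" using P0 by (intro mult_left_mono) auto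
    then show ?thesis using P0 M d C by (simp add: abs_mult add_increasing2)
   next
    case False
    have "norm (y - z) <= norm (r *R y - z) + norm (y - r *R y)" using norm_triangle_ineq[of "r *R y - z" "y - r *R y"] by simp
    moreover have "norm (y - r *R y) = 1 - r"
    proof -
     have "y - r *R y = (1 - r) *R y" by (simp add: scaleR_diff_left)
     then show ?thesis using y r by simp
    qed
    ultimately have n: "\<delta> / 2 <= norm (r *R y - z)" using False r d by (simp add: dist_norm norm_minus_commute)
    have "C <= norm (r *R y - z) ^ 3" unfolding C_def using n \<delta> by (intro power_mono) auto
    moreover have "1 - (norm (r *R y))\<^sup>2 <= 2 * d"
    proof -
     have "1 - r\<^sup>2 = (1 - r) * (1 + r)" by (simp add: power2_eq_square algebra_simps)
     also have "... <= d * 2" using r r0 by (intro mult_mono) auto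
     finally show ?thesis using y r0 by (simp add: power_mult_distrib)
    qed
    moreover have "0 <= 1 - (norm (r *R y))\<^sup>2" using y r r0 by (simp add: abs_square_le_1)
    ultimately have "(1 - (norm (r *R y))\<^sup>2) / norm (r *R y - z) ^ 3 <= 2 * d / C"
     using C by (intro frac_le) auto
    then have "(1 / (4 * pi)) * ((1 - (norm (r *R y))\<^sup>2) / norm (r *R y - z) ^ 3) <= (1 / (4 * pi)) * (2 * d / C)"
     by (intro mult_left_mono) auto
    then have "Pker (r *R y) z <= 2 * d / (4 * pi * C)" by (simp add: Pker_def mult_ac)
    moreover have "\<bar>f z - f y\<bar> <= 2 * M" using M(2)[OF z] M(2)[OF y] by linarith
    ultimately have "Pker (r *R y) z * \<bar>f z - f y\<bar> <= (2 * d / (4 * pi * C)) * (2 * M)"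
     using P0 M d C by (intro mult_mono) auto
    then show ?thesis using P0 e by (simp add: abs_mult mult.commute add_increasing)
   qed
  qed
  also have "... = e / 2 + 4 * M * d / C"
   using i2 Pi measure_sigmaS by simp
  also have "4 * M * d / C <= e / 4"
   using d(4) M C by (simp add: field_simps)
  finally show ?thesis using e by linarith
 qed
 then show ?thesis using d by (intro that[of d]) auto
qed

text \<open>Adding e|y|^2 raises the Laplacian from 0 to 6e, so at every interior point some pure
  second derivative is positive and an interior maximum is impossible; the extra term costs at most
  e. With the derivatives given as fields g and h the argument runs along coordinate lines.\<close>

lemma harmonic_max_principle:
 fixes v :: "R3 => real" and g :: "R3 => R3" and h :: "3 => R3 => R3"
 assumes r: "0 < r" "r < 1"
  and dv: "!!x. x \<in> ball 0 1 ==> (v has_derivative (%y. g x \<bullet> y)) (at x)"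
  and dg: "!!x i. x \<in> ball 0 1 ==> ((%x. g x $ i) has_derivative (%y. h i x \<bullet> y)) (at x)"
  and tr: "!!x. x \<in> ball 0 1 ==> (\<Sum>i\<in>UNIV. h i x $ i) = 0"
  and bd: "!!y. norm y = r ==> v y <= M"
  and x: "norm x <= r"
 shows "v x <= M"
proof (rule field_le_epsilon)
 fix e :: real assume e: "0 < e"
 define w where "w y = v y + e * (y \<bullet> y)" for y
 have sub: "cball 0 r \<subseteq> ball (0::R3) 1" using r by auto
 have vc: "continuous_on (cball 0 r) v"
 proof (intro continuous_at_imp_continuous_on ballI)
  fix y assume "y \<in> cball (0::R3) r"
  then have "y \<in> ball 0 1" using sub by blast
  from has_derivative_continuous[OF dv[OF this]] show "isCont v y" .
 qed
 have wc: "continuous_on (cball 0 r) w" unfolding w_def by (intro continuous_intros vc)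
 have "EX x0:cball 0 r. ALL y:cball 0 r. w y <= w x0"
  by (rule continuous_attains_sup[OF compact_cball _ wc]) (use r in simp)
 then obtain x0 where x0: "x0 \<in> cball 0 r" "ALL y:cball 0 r. w y <= w x0" by blast
 have "norm x0 = r"
 proof (rule ccontr)
  assume "norm x0 ~= r"
  then have n: "norm x0 < r" using x0(1) by simp
  have x0b: "x0 \<in> ball 0 1" using n r by simp
  define a where "a i t = x0 + t *R (axis i 1 :: R3)" for i t
  define \<rho> where "\<rho> = r - norm x0"
  have ab: "norm (a i t) < r" if "\<bar>t\<bar> < \<rho>" for i t
   using norm_triangle_ineq[of x0 "t *R axis i 1"] that by (simp add: a_def \<rho>_def)
  have ad: "(a i has_derivative (%s. s *R axis i 1)) (at t)" for i t
   unfolding a_def by (auto intro!: derivative_eq_intros)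
  define p where "p i t = g (a i t) $ i + 2 * e * (x0 $ i + t)" for i t
  have d1: "((%t. w (a i t)) has_real_derivative p i t) (at t)" if "\<bar>t\<bar> < \<rho>" for i t
  proof -
   have "a i t \<in> ball 0 1" using ab[OF that, of i] r by simp
   from diff_chain_at[OF ad dv[OF this]]
   have 1: "((%t. v (a i t)) has_real_derivative g (a i t) $ i) (at t)"
    by (simp add: o_def has_field_derivative_def inner_axis mult_commute_abs)
   have sq: "a i t \<bullet> a i t = x0 \<bullet> x0 + 2 * t * x0 $ i + t\<^sup>2" for t
    by (simp add: a_def inner_add_left inner_add_right inner_axis inner_axis' inner_axis_axis power2_eq_square algebra_simps)
   have 2: "((%t. e * (a i t \<bullet> a i t)) has_real_derivative 2 * e * (x0 $ i + t)) (at t)"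
    unfolding sq by (auto intro!: derivative_eq_intros simp: algebra_simps)
   show ?thesis unfolding w_def p_def by (rule DERIV_add[OF 1 2])
  qed
  have d2: "(p i has_real_derivative (h i x0 $ i + 2 * e)) (at 0)" for i
  proof -
   have a0: "a i 0 = x0" by (simp add: a_def)
   have "((%x. g x $ i) has_derivative (%y. h i x0 \<bullet> y)) (at (a i 0))" unfolding a0 by (rule dg[OF x0b])
   from diff_chain_at[OF ad this]
   have 1: "((%t. g (a i t) $ i) has_real_derivative h i x0 $ i) (at 0)"
    by (simp add: o_def has_field_derivative_def inner_axis mult_commute_abs)
   have 2: "((%t. 2 * e * (x0 $ i + t)) has_real_derivative 2 * e) (at 0)" by (auto intro!: derivative_eq_intros)
   show ?thesis unfolding p_def by (rule DERIV_add[OF 1 2])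
  qed
  have \<rho>0: "0 < \<rho>" using n by (simp add: \<rho>_def)
  have p0: "p i 0 = 0" for i
  proof (rule DERIV_local_max[OF d1[of 0] \<rho>0])
   show "\<bar>0::real\<bar> < \<rho>" using \<rho>0 by simp
   show "ALL t. \<bar>0 - t\<bar> < \<rho> --> w (a i t) <= w (a i 0)"
    using x0(2) ab by (auto simp: a_def less_imp_le)
  qed
  have "(\<Sum>i\<in>UNIV. h i x0 $ i + 2 * e) = 6 * e" using tr[OF x0b] by (simp add: sum.distrib)
  then have "EX i. 0 < h i x0 $ i + 2 * e"
   using e sum_nonpos[of UNIV "%i. h i x0 $ i + 2 * e"] by (metis mult_pos_pos not_le zero_less_numeral)
  then obtain i where i: "0 < h i x0 $ i + 2 * e" ..
  from DERIV_pos_inc_right[OF d2 i]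
  obtain d where d: "0 < d" "ALL t>0. t < d --> p i 0 < p i (0 + t)" by blast
  define T where "T = min d \<rho> / 2"
  have T: "0 < T" "T < d" "T < \<rho>" using d \<rho>0 by (auto simp: T_def)
  have "EX z>0. z < T & w (a i T) - w (a i 0) = (T - 0) * p i z"
   by (rule MVT2[OF T(1)]) (use d1 T in auto)
  then obtain z where z: "0 < z" "z < T" "w (a i T) - w (a i 0) = (T - 0) * p i z" by blast
  then have "0 < p i z" using d(2)[rule_format, of z] T p0 by simp
  then have "0 < (T - 0) * p i z" using T(1) by simp
  then have "w (a i 0) < w (a i T)" using z(3) by linarith
  moreover have "w (a i T) <= w (a i 0)" using x0(2)[rule_format, of "a i T"] ab[of T i] T by (simp add: a_def)
  ultimately show False by simp
 qed
 then have "v x0 <= M" by (rule bd)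
 have "v x <= w x" using e by (simp add: w_def)
 also have "... <= w x0" using x0(2)[rule_format, of x] x by simp
 also have "... <= M + e * r\<^sup>2" using \<open>v x0 <= M\<close> \<open>norm x0 = r\<close> by (simp add: w_def power2_norm_eq_inner[symmetric])
 also have "... <= M + e * 1" using e r by (intro add_left_mono mult_left_mono) (auto simp: abs_square_le_1)
 finally show "v x <= M + e" by simp
qed

text \<open>Both \<open>Poisson Y\<close> and Y are harmonic in the ball, and on a sphere of radius
  r near 1 both are close to the boundary values: the first by approximation, the second by
  homogeneity. The sign s yields both one-sided bounds from one use of the maximum
  principle.\<close>

lemma Poisson_dominated:
 fixes u :: "R3 => real"
 assumes Y: "Y \<in> sph_harm l" and x: "x \<in> ball 0 1" and s: "s = 1 \<or> s = -1" and e: "0 < e"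
 shows "s * (Poisson Y x - Y x) <= e"
proof -
 have Yc: "continuous_on A Y" for A by (rule sph_harm_cont[OF Y])
 have Yi: "integrable sigmaS Y" by (intro sg.cont_int Yc)
 obtain d where d: "0 < d" "d < 1" "!!r y. 1 - d < r ==> r < 1 ==> y \<in> SS ==> \<bar>Poisson Y (r *R y) - Y y\<bar> < e/2"
  using Poisson_approx[OF Yc[of SS], of "e/2"] e by auto
 obtain M where M: "0 < M" "!!x. x \<in> SS ==> \<bar>Y x\<bar> <= M" using sg.cont_bound[of Y] Yc by auto
 have "((%r. (1 - r ^ l) * M) \<longlongrightarrow> (1 - 1 ^ l) * M) (at_left (1::real))" by (intro tendsto_intros)
 then have "\<forall>\<^sub>F r in at_left 1. (1 - r ^ l) * M < e/2" using e by (intro order_tendstoD) auto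
 moreover have "\<forall>\<^sub>F r in at_left 1. max (1 - d) (norm x) < r"
  by (rule eventually_at_left_real[of "max (1 - d) (norm x)" 1, THEN eventually_mono]) (use x d in auto)
 moreover have "\<forall>\<^sub>F r in at_left (1::real). r < 1" by (simp add: eventually_at_filter)
 ultimately have "\<forall>\<^sub>F r in at_left 1. (1 - r ^ l) * M < e/2 & max (1 - d) (norm x) < r & r < 1" by eventually_elim auto
 then obtain r where r: "(1 - r ^ l) * M < e/2" "max (1 - d) (norm x) < r" "r < 1"
  using eventually_happens by force
 have r0: "0 < r" using r d by auto
 show ?thesis
 proof (rule harmonic_max_principle[where r=r and v="%x. s * (Poisson Y x - Y x)"
    and g="%x. s *R ((\<integral>S y. Y y *R gP x y) - grad Y x)"
    and h="%i x. s *R ((\<integral>S y. Y y *R hP i x y) - grad (%x. grad Y x $ i) x)"])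
  show "0 < r" "r < 1" "norm x <= r" using r0 r by auto
  fix x :: R3 assume x: "x \<in> ball 0 1"
  have "(Y has_derivative (%h. grad Y x \<bullet> h)) (at x)" using sph_harm_C1g[OF Y] by (simp add: C1g_def)
  then have "((%x. s * (Poisson Y x - Y x)) has_derivative (%h. s * ((\<integral>S y. Y y *R gP x y) \<bullet> h - grad Y x \<bullet> h))) (at x)"
   by (intro has_derivative_mult_right has_derivative_diff Poisson_deriv(1)[OF x Yi])
  then show "((%x. s * (Poisson Y x - Y x)) has_derivative (%h. s *R ((\<integral>S y. Y y *R gP x y) - grad Y x) \<bullet> h)) (at x)"
   by (simp add: inner_diff_left)
  have Yg: "C1g (%x. grad Y x $ i) (grad (%x. grad Y x $ i))" for i
  proof -
   have "C1g Y (grad Y) & (ALL m. real_polynomial_function (%x. grad Y x $ m))" by (rule rpf_grad[OF rpf_sph_harm[OF Y]])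
   then show ?thesis using rpf_grad[of "%x. grad Y x $ i"] by blast
  qed
  then have "((%x. grad Y x $ i) has_derivative (%h. grad (%x. grad Y x $ i) x \<bullet> h)) (at x)" for i by (simp add: C1g_def)
  then have "((%x. s * ((\<integral>S y. Y y *R gP x y) $ i - grad Y x $ i)) has_derivative (%h. s * ((\<integral>S y. Y y *R hP i x y) \<bullet> h - grad (%x. grad Y x $ i) x \<bullet> h))) (at x)" for i
   by (intro has_derivative_mult_right has_derivative_diff Poisson_grad_deriv[OF x Yi])
  then show "((%x. (s *R ((\<integral>S y. Y y *R gP x y) - grad Y x)) $ i) has_derivative
    (%h. s *R ((\<integral>S y. Y y *R hP i x y) - grad (%x. grad Y x $ i) x) \<bullet> h)) (at x)" for i
   by (simp add: inner_diff_left)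
  have hi: "integrable sigmaS (%y. Y y *R hP i x y)" for i
   by (intro sg.int_bdd_mult Yi) (use continuous_on_slice1[OF kernels_cont(5) x] in simp)
  have "(\<Sum>i\<in>UNIV. (\<integral>S y. Y y *R hP i x y) $ i) = (\<Sum>i\<in>UNIV. (\<integral>S y. Y y * hP i x y $ i))"
  proof (rule sum.cong[OF refl])
   fix i
   show "(\<integral>S y. Y y *R hP i x y) $ i = (\<integral>S y. Y y * hP i x y $ i)"
    using integral_inner_left[OF _, of "axis i 1" sigmaS "%y. Y y *R hP i x y"] hi[of i] by (simp add: inner_axis)
  qed
  also have "... = (\<integral>S y. (\<Sum>i\<in>UNIV. Y y * hP i x y $ i))"
  proof (rule LINT_sum[symmetric])
   show "integrable sigmaS (%y. Y y * hP i x y $ i)" for i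
    using integrable_inner_left[OF _, of "axis i 1" sigmaS "%y. Y y *R hP i x y"] hi[of i] by (simp add: inner_axis)
  qed
  also have "... = (\<integral>S y. 0)"
  proof (rule LINT_cong[OF refl])
   fix y assume "y \<in> space sigmaS"
   then have "y \<in> SS" by simp
   then have "(\<Sum>i\<in>UNIV. hP i x y $ i) = 0" using hP_trace ball_neq_sphere[OF x] by blast
   then show "(\<Sum>i\<in>UNIV. Y y * hP i x y $ i) = 0" by (simp add: sum_distrib_left[symmetric])
  qed
  finally show "(\<Sum>i\<in>UNIV. (s *R ((\<integral>S y. Y y *R hP i x y) - grad (%x. grad Y x $ i) x)) $ i) = 0"
   using sph_harm_laplacian[OF Y, of x] by (simp add: sum_distrib_left[symmetric] sum_subtractf)
 next
  fix y :: R3 assume y: "norm y = r"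
  define z where "z = y /\<^sub>R r"
  have z: "z \<in> SS" "y = r *R z" using y r0 by (auto simp: z_def)
  have "\<bar>Poisson Y (r *R z) - Y z\<bar> < e/2" by (rule d(3)) (use r z in auto)
  moreover have "Y (r *R z) = r ^ l * Y z" by (rule sph_harm_homogeneous[OF Y])
  moreover have "\<bar>Y z - r ^ l * Y z\<bar> < e/2"
  proof -
   have "Y z - r ^ l * Y z = (1 - r ^ l) * Y z" by (simp add: algebra_simps)
   moreover have "0 <= 1 - r ^ l" using r0 r by (simp add: power_le_one)
   ultimately have "\<bar>Y z - r ^ l * Y z\<bar> <= (1 - r ^ l) * M"
    using M(2)[OF z(1)] by (simp add: abs_mult mult_left_mono)
   then show ?thesis using r(1) by linarith
  qed
  ultimately have "\<bar>Poisson Y y - Y y\<bar> <= e" unfolding z(2) by linarith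
  then show "s * (Poisson Y y - Y y) <= e" using s by auto
 qed
qed

theorem Poisson_sph_harm:
 assumes Y: "Y \<in> sph_harm l" and x: "x \<in> ball 0 1"
 shows "Poisson Y x = Y x"
proof -
 have "1 * (Poisson Y x - Y x) <= 0" "-1 * (Poisson Y x - Y x) <= 0"
  by (rule field_le_epsilon, use Poisson_dominated[OF Y x, of 1] in simp)
   (rule field_le_epsilon, use Poisson_dominated[OF Y x, of "-1"] in simp)
 then show ?thesis by (intro antisym) simp_all
qed

text \<open>Along a ray the potential w satisfies 2 s w' + w = s^l Y(x), with particular solution
  s^l Y(x)/(2l+1). The homogeneous solutions are multiples of s^(-1/2), excluded because w is
  regular at 0: sqrt s times the difference is constant and vanishes at 0.\<close>

theorem Npot_sph_harm:
 assumes Y: "Y \<in> sph_harm l" and x: "x \<in> SS" and r: "0 < r" "r < 1"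
 shows "Npot Y (r *R x) = r ^ l * Y x / (2 * real l + 1)"
proof -
 have Yi: "integrable sigmaS Y" by (intro sg.cont_int sph_harm_cont[OF Y])
 define w where "w s = Npot Y (s *R x)" for s
 define w' where "w' s = (\<integral>S y. Y y *R gN (s *R x) y) \<bullet> x" for s
 define a where "a = Y x / (2 * real l + 1)"
 have nl: "2 * real l + 1 ~= 0" by linarith
 have xb: "s *R x \<in> ball 0 1" if "\<bar>s\<bar> < 1" for s using that x by simp
 have w: "(w has_real_derivative w' s) (at s)" if s: "\<bar>s\<bar> < 1" for s
 proof -
  have "((%s. s *R x) has_derivative (%t. t *R x)) (at s)" by (auto intro!: derivative_eq_intros)
  from diff_chain_at[OF this Npot_deriv[OF xb[OF s] Yi]]
  moreover have "w = (%s. Npot Y (s *R x))" by (simp add: w_def fun_eq_iff)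
  ultimately show ?thesis by (simp add: o_def w'_def has_field_derivative_def mult_commute_abs)
 qed
 have ode: "2 * s * w' s + w s = s ^ l * Y x" if s: "0 < s" "s < 1" for s
 proof -
  have b: "s *R x \<in> ball 0 1" by (rule xb) (use s in simp)
  have gi: "integrable sigmaS (%y. Y y *R gN (s *R x) y)"
   by (intro sg.int_bdd_mult Yi) (use continuous_on_slice1[OF kernels_cont(4) b] in simp)
  have Ni: "integrable sigmaS (%y. Y y * Nker (s *R x) y)"
   using sg.int_bdd_mult[OF _ Yi, of "Nker (s *R x)"] continuous_on_slice1[OF Nker_cont b] by simp
  have "w' s = (\<integral>S y. Y y * (gN (s *R x) y \<bullet> x))"
   unfolding w'_def using integral_inner_left[OF _, of x sigmaS "%y. Y y *R gN (s *R x) y"] gi by simp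
  moreover have gi': "integrable sigmaS (%y. Y y * (gN (s *R x) y \<bullet> x))"
   using integrable_inner_left[OF _, of x sigmaS "%y. Y y *R gN (s *R x) y"] gi by simp
  ultimately have "2 * s * w' s + w s = (\<integral>S y. 2 * s * (Y y * (gN (s *R x) y \<bullet> x)) + Y y * Nker (s *R x) y)"
   unfolding w_def Npot_def using Ni by simp
  also have "... = (\<integral>S y. Y y * Pker (s *R x) y)"
  proof (rule LINT_cong[OF refl])
   fix y assume "y \<in> space sigmaS"
   then have y: "y \<in> SS" by simp
   show "2 * s * (Y y * (gN (s *R x) y \<bullet> x)) + Y y * Nker (s *R x) y = Y y * Pker (s *R x) y"
    unfolding Pker_Nker[OF ball_neq_sphere[OF b y] y, symmetric] by (simp add: inner_commute algebra_simps)
  qed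
  also have "... = s ^ l * Y x"
   using Poisson_sph_harm[OF Y b] by (simp add: Poisson_alt sph_harm_homogeneous[OF Y])
  finally show ?thesis .
 qed
 define q where "q s = sqrt s * (w s - s ^ l * a)" for s
 have qd: "(q has_real_derivative 0) (at s)" if s: "0 < s" "s < 1" for s
 proof -
  have "(q has_real_derivative (inverse (sqrt s) / 2 * (w s - s ^ l * a) + (w' s - real l * s ^ (l - 1) * a) * sqrt s)) (at s)"
   unfolding q_def using s
   by (intro DERIV_mult DERIV_real_sqrt DERIV_diff w DERIV_cmult_right) (auto intro!: derivative_eq_intros)
  moreover have "inverse (sqrt s) / 2 * (w s - s ^ l * a) + (w' s - real l * s ^ (l - 1) * a) * sqrt s = 0"
  proof -
   have sl: "s * s ^ (l - 1) * real l = s ^ l * real l" by (cases l) auto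
   have "2 * s * (w' s - real l * s ^ (l - 1) * a) + (w s - s ^ l * a) = s ^ l * Y x - 2 * (s * s ^ (l - 1) * real l) * a - s ^ l * a"
    using ode[OF s] by (simp add: algebra_simps)
   also have "... = s ^ l * (Y x - (2 * real l + 1) * a)" unfolding sl by (simp add: algebra_simps)
   also have "... = 0" using nl by (simp add: a_def)
   finally have "2 * s * (w' s - real l * s ^ (l - 1) * a) + (w s - s ^ l * a) = 0" .
   then have "inverse (sqrt s) / 2 * (2 * s * (w' s - real l * s ^ (l - 1) * a) + (w s - s ^ l * a)) = 0" by simp
   moreover have isq: "inverse (sqrt s) * s = sqrt s" using s by (simp add: inverse_eq_divide real_div_sqrt)
   moreover have "inverse (sqrt s) / 2 * (2 * s * u + v) = inverse (sqrt s) / 2 * v + u * sqrt s" for u v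
   proof -
    have "inverse (sqrt s) / 2 * (2 * s * u + v) = inverse (sqrt s) / 2 * v + u * (inverse (sqrt s) * s)"
     by (simp add: distrib_left)
    then show ?thesis unfolding isq .
   qed
   ultimately show ?thesis by (simp only:)
  qed
  ultimately show ?thesis by simp
 qed
 have q0: "q 0 = 0" by (simp add: q_def)
 have wc: "continuous_on {0..r} w"
  by (intro continuous_at_imp_continuous_on ballI DERIV_isCont[OF w]) (use r in auto)
 have "continuous_on {0..r} q" unfolding q_def by (intro continuous_intros wc)
 then have "q r = q 0"
  using DERIV_isconst_end[of 0 r q] r qd by auto
 then have "w r = r ^ l * a" using q0 r by (simp add: q_def)
 then show ?thesis by (simp add: w_def a_def)
qed

section \<open>Density of polynomials\<close>

text \<open>Regularity places A between a compact K and an open U whose difference has measure below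
  e; a Urysohn function for K and the complement of U differs from the indicator only on U -
  K.\<close>

lemma borel_indicator_approx:
 fixes N :: "'a::euclidean_space measure"
 assumes s: "sets N = sets borel" and fin: "finite_measure N" and A: "A \<in> sets N" and e: "0 < e"
 shows "EX \<phi>::'a => real. continuous_on UNIV \<phi> & (ALL x. \<bar>\<phi> x\<bar> <= 1) & (\<integral>x. \<bar>indicator A x - \<phi> x\<bar> \<partial>N) < e"
proof -
 interpret finite_measure N by fact
 have fA: "emeasure N (space N) ~= \<infinity>" using emeasure_finite by simp
 have Ab: "A \<in> sets borel" using A s by simp
 have "(SUP K\<in>{K. K \<subseteq> A & compact K}. emeasure N K) = emeasure N A"
  by (rule inner_regular[OF s fA Ab, symmetric])
 moreover have "emeasure N A < emeasure N A + ennreal (e/2)"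
  using e emeasure_finite[of A] by (simp add: ennreal_add_diff_cancel_right top.not_eq_extremum)
 ultimately have "EX K:{K. K \<subseteq> A & compact K}. emeasure N A < emeasure N K + ennreal (e/2)"
 proof -
  assume sup: "(SUP K\<in>{K. K \<subseteq> A & compact K}. emeasure N K) = emeasure N A" and lt: "emeasure N A < emeasure N A + ennreal (e/2)"
  show ?thesis
  proof (rule ccontr)
   assume "\<not> ?thesis"
   then have le: "emeasure N K + ennreal (e/2) <= emeasure N A" if "K \<subseteq> A" "compact K" for K using that by force
   have "(SUP K\<in>{K. K \<subseteq> A & compact K}. emeasure N K) + ennreal (e/2) <= emeasure N A"
    by (subst ennreal_SUP_add_left[symmetric]) (auto intro!: SUP_least le exI[of _ "{}"])
   then show False using sup lt by simp
  qed
 qed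
 then obtain K where K: "K \<subseteq> A" "compact K" "emeasure N A < emeasure N K + ennreal (e/2)" by blast
 have "emeasure N A + ennreal (e/2) > (INF U\<in>{U. A \<subseteq> U & open U}. emeasure N U)"
  unfolding outer_regular[OF s fA Ab, symmetric] using e emeasure_finite[of A] by (simp add: top.not_eq_extremum)
 then obtain U where U: "A \<subseteq> U" "open U" "emeasure N U < emeasure N A + ennreal (e/2)"
  unfolding Inf_less_iff by blast
 have Ks: "K \<in> sets N" and Us: "U \<in> sets N" using K U s by (auto intro: borel_compact borel_open)
 have mK: "measure N A < measure N K + e/2"
  using K(3) e unfolding emeasure_eq_measure by (simp add: ennreal_plus[symmetric] ennreal_less_iff del: ennreal_plus)
 have mU: "measure N U < measure N A + e/2"
  using U(3) e unfolding emeasure_eq_measure by (simp add: ennreal_plus[symmetric] ennreal_less_iff del: ennreal_plus)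
 have "measure N (U - K) = measure N U - measure N K"
  by (rule finite_measure_Diff) (use Ks Us K U in auto)
 then have mUK: "measure N (U - K) < e" using mK mU by linarith
 have "EX \<phi>::'a => real. continuous_on UNIV \<phi> & (ALL x. \<phi> x \<in> closed_segment 0 1) & (ALL x:-U. \<phi> x = 0) & (ALL x:K. \<phi> x = 1)"
  by (rule Urysohn[of "-U" K 0 1]) (use K U in \<open>auto simp: compact_imp_closed\<close>)
 then obtain \<phi> :: "'a => real" where \<phi>: "continuous_on UNIV \<phi>" "!!x. \<phi> x \<in> closed_segment 0 1" "!!x. x \<in> -U ==> \<phi> x = 0" "!!x. x \<in> K ==> \<phi> x = 1"
  by blast
 have \<phi>01: "0 <= \<phi> x" "\<phi> x <= 1" for x using \<phi>(2)[of x] by (auto simp: closed_segment_eq_real_ivl)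
 have [measurable]: "\<phi> \<in> borel_measurable N" using \<phi>(1) borel_measurable_continuous_onI s measurable_cong_sets by blast
 have [measurable]: "A \<in> sets N" "U - K \<in> sets N" using A Us Ks by auto
 have "(\<integral>x. \<bar>indicator A x - \<phi> x\<bar> \<partial>N) <= (\<integral>x. indicator (U - K) x \<partial>N)"
 proof (rule integral_mono)
  show "integrable N (%x. \<bar>indicator A x - \<phi> x\<bar>)"
  proof (rule integrable_const_bound[of _ 2])
   have "\<bar>indicator A x - \<phi> x\<bar> <= 2" for x using \<phi>01[of x] by (simp add: indicator_def abs_le_iff)
   then show "AE x in N. norm \<bar>indicator A x - \<phi> x\<bar> <= 2" by simp
  qed measurable
  show "integrable N (indicator (U - K) :: 'a => real)" by (rule integrable_real_indicator) (auto simp: less_top[symmetric])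
  show "\<bar>indicator A x - \<phi> x\<bar> <= indicator (U - K) x" for x
   using \<phi>(3)[of x] \<phi>(4)[of x] \<phi>01[of x] K(1) U(1) by (auto simp: indicator_def abs_le_iff)
 qed
 also have "... = measure N (U - K)" using Us Ks sets.sets_into_space[of "U - K" N] by (simp add: Int_absorb2)
 also have "... < e" by (rule mUK)
 finally show ?thesis using \<phi> \<phi>01 by (intro exI[of _ \<phi>]) (auto simp: abs_le_iff intro: order_trans[of _ 0])
qed

lemma borel_L1_approx:
 fixes N :: "'a::euclidean_space measure" and f :: "'a => real"
 assumes s: "sets N = sets borel" and fin: "finite_measure N" and f: "integrable N f"
 shows "ALL e>0. EX \<phi>::'a => real. continuous_on UNIV \<phi> & (EX B. ALL x. \<bar>\<phi> x\<bar> <= B) & (\<integral>x. \<bar>f x - \<phi> x\<bar> \<partial>N) < e"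
 using f
proof (induction f rule: integrable_induct)
 interpret finite_measure N by fact
 have cm: "\<phi> \<in> borel_measurable N" if "continuous_on UNIV \<phi>" for \<phi> :: "'a => real"
  using that borel_measurable_continuous_onI s measurable_cong_sets by blast
 have ci: "integrable N \<phi>" if "continuous_on UNIV \<phi>" "ALL x. \<bar>\<phi> x\<bar> <= B" for \<phi> :: "'a => real" and B
  by (rule integrable_const_bound[of _ B]) (use that cm in auto)
 {
  case (base A c)
  show ?case
  proof (intro allI impI)
   fix e :: real assume e: "0 < e"
   have "0 < e / (\<bar>c\<bar> + 1)" using e by (simp add: add_nonneg_pos)
   from borel_indicator_approx[OF s fin base(1) this] obtain \<phi> :: "'a => real"
    where p: "continuous_on UNIV \<phi>" "ALL x. \<bar>\<phi> x\<bar> <= 1" "(\<integral>x. \<bar>indicator A x - \<phi> x\<bar> \<partial>N) < e / (\<bar>c\<bar> + 1)" by blast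
   have "(\<integral>x. \<bar>indicator A x *R c - c * \<phi> x\<bar> \<partial>N) = (\<integral>x. \<bar>c\<bar> * \<bar>indicator A x - \<phi> x\<bar> \<partial>N)"
    by (rule LINT_cong[OF refl]) (simp add: abs_mult[symmetric] algebra_simps)
   also have "... = \<bar>c\<bar> * (\<integral>x. \<bar>indicator A x - \<phi> x\<bar> \<partial>N)" by simp
   also have "... <= \<bar>c\<bar> * (e / (\<bar>c\<bar> + 1))" using p(3) by (intro mult_left_mono) auto
   also have "... < e" using e by (simp add: field_simps add_nonneg_pos)
   finally have "(\<integral>x. \<bar>indicator A x *R c - c * \<phi> x\<bar> \<partial>N) < e" .
   moreover have "\<bar>c * \<phi> x\<bar> <= \<bar>c\<bar>" for x using p(2) mult_left_mono[of "\<bar>\<phi> x\<bar>" 1 "\<bar>c\<bar>"] by (simp add: abs_mult)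
   ultimately show "EX \<phi>::'a => real. continuous_on UNIV \<phi> & (EX B. ALL x. \<bar>\<phi> x\<bar> <= B) & (\<integral>x. \<bar>indicator A x *R c - \<phi> x\<bar> \<partial>N) < e"
    using p(1) by (intro exI[of _ "%x. c * \<phi> x"] conjI exI[of _ "\<bar>c\<bar>"] continuous_intros) auto
  qed
 next
  case (add f g)
  show ?case
  proof (intro allI impI)
   fix e :: real assume e: "0 < e"
   then have e2: "0 < e/2" by simp
   from add(3)[rule_format, OF e2] obtain \<phi> :: "'a => real" and B where p: "continuous_on UNIV \<phi>" "ALL x. \<bar>\<phi> x\<bar> <= B" "(\<integral>x. \<bar>f x - \<phi> x\<bar> \<partial>N) < e/2" by blast
   from add(4)[rule_format, OF e2] obtain \<psi> :: "'a => real" and B' where q: "continuous_on UNIV \<psi>" "ALL x. \<bar>\<psi> x\<bar> <= B'" "(\<integral>x. \<bar>g x - \<psi> x\<bar> \<partial>N) < e/2" by blast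
   have "(\<integral>x. \<bar>f x + g x - (\<phi> x + \<psi> x)\<bar> \<partial>N) <= (\<integral>x. \<bar>f x - \<phi> x\<bar> + \<bar>g x - \<psi> x\<bar> \<partial>N)"
    using add(1,2) ci[OF p(1,2)] ci[OF q(1,2)] by (intro integral_mono) auto
   also have "... = (\<integral>x. \<bar>f x - \<phi> x\<bar> \<partial>N) + (\<integral>x. \<bar>g x - \<psi> x\<bar> \<partial>N)"
    using add(1,2) ci[OF p(1,2)] ci[OF q(1,2)] by simp
   also have "... < e" using p(3) q(3) by simp
   finally have "(\<integral>x. \<bar>f x + g x - (\<phi> x + \<psi> x)\<bar> \<partial>N) < e" .
   moreover have "\<bar>\<phi> x + \<psi> x\<bar> <= B + B'" for x using p(2) q(2) by (meson abs_triangle_ineq add_mono order_trans)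
   ultimately show "EX \<phi>::'a => real. continuous_on UNIV \<phi> & (EX B. ALL x. \<bar>\<phi> x\<bar> <= B) & (\<integral>x. \<bar>f x + g x - \<phi> x\<bar> \<partial>N) < e"
    using p(1) q(1) by (intro exI[of _ "%x. \<phi> x + \<psi> x"] conjI exI[of _ "B + B'"] continuous_intros) auto
  qed
 next
  case (lim f u)
  have [measurable]: "f \<in> borel_measurable N" using lim by auto
  have [measurable]: "u i \<in> borel_measurable N" for i using lim(1) by auto
  have "(%i. \<integral>x. \<bar>f x - u i x\<bar> \<partial>N) \<longlonglongrightarrow> (\<integral>x. 0 \<partial>N)"
  proof (rule integral_dominated_convergence[where w="%x. 3 * \<bar>f x\<bar>"])
   show "integrable N (%x. 3 * \<bar>f x\<bar>)" using lim by auto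
   show "AE x in N. (%i. \<bar>f x - u i x\<bar>) \<longlonglongrightarrow> 0"
   proof (rule AE_I2)
    fix x assume "x \<in> space N"
    then have "(%i. u i x) \<longlonglongrightarrow> f x" using lim by auto
    from tendsto_rabs[OF tendsto_diff[OF tendsto_const[of "f x"] this]] show "(%i. \<bar>f x - u i x\<bar>) \<longlonglongrightarrow> 0" by simp
   qed
   show "AE x in N. norm \<bar>f x - u i x\<bar> <= 3 * \<bar>f x\<bar>" for i
   proof (rule AE_I2)
    fix x assume "x \<in> space N"
    then have "norm (u i x) <= 2 * norm (f x)" using lim by auto
    then show "norm \<bar>f x - u i x\<bar> <= 3 * \<bar>f x\<bar>" using abs_triangle_ineq4[of "f x" "u i x"] by simp
   qed
  qed auto
  then have l0: "(%i. \<integral>x. \<bar>f x - u i x\<bar> \<partial>N) \<longlonglongrightarrow> 0" by simp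
  show ?case
  proof (intro allI impI)
   fix e :: real assume e: "0 < e"
   then have e2: "0 < e/2" by simp
   have "\<forall>\<^sub>F i in sequentially. (\<integral>x. \<bar>f x - u i x\<bar> \<partial>N) < e/2" using order_tendstoD(2)[OF l0 e2] .
   then obtain i where i: "(\<integral>x. \<bar>f x - u i x\<bar> \<partial>N) < e/2" by (auto simp: eventually_sequentially)
   have "ALL e>0. EX \<phi>::'a => real. continuous_on UNIV \<phi> & (EX B. ALL x. \<bar>\<phi> x\<bar> <= B) & (\<integral>x. \<bar>u i x - \<phi> x\<bar> \<partial>N) < e" using lim by blast
   from this[rule_format, OF e2] obtain \<phi> :: "'a => real" and B where p: "continuous_on UNIV \<phi>" "ALL x. \<bar>\<phi> x\<bar> <= B" "(\<integral>x. \<bar>u i x - \<phi> x\<bar> \<partial>N) < e/2" by blast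
   have "(\<integral>x. \<bar>f x - \<phi> x\<bar> \<partial>N) <= (\<integral>x. \<bar>f x - u i x\<bar> + \<bar>u i x - \<phi> x\<bar> \<partial>N)"
    using lim(1)[of i] lim(4) ci[OF p(1,2)] by (intro integral_mono) auto
   also have "... = (\<integral>x. \<bar>f x - u i x\<bar> \<partial>N) + (\<integral>x. \<bar>u i x - \<phi> x\<bar> \<partial>N)"
    using lim(1)[of i] lim(4) ci[OF p(1,2)] by simp
   also have "... < e" using i p(3) by simp
   finally show "EX \<phi>::'a => real. continuous_on UNIV \<phi> & (EX B. ALL x. \<bar>\<phi> x\<bar> <= B) & (\<integral>x. \<bar>f x - \<phi> x\<bar> \<partial>N) < e" using p by blast
  qed
 }
qed

text \<open>Regularity is formulated for Borel measures on the whole space, while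
  \<open>sigmaS\<close> is a completed measure on the sphere. So f is replaced by a Borel
  representative extended by zero, and the measure by its image under inclusion.\<close>

lemma sigmaS_L1_approx:
 assumes f: "integrable sigmaS f" and e: "0 < (e::real)"
 obtains \<phi> :: "R3 => real" where "continuous_on UNIV \<phi>" "(\<integral>S x. \<bar>f x - \<phi> x\<bar>) < e"
proof -
 define N where "N = distr sigmaS borel (%x. x)"
 have sN: "sets N = sets borel" by (simp add: N_def)
 have fN: "finite_measure N" unfolding N_def by (rule sg.finite_measure_distr[OF sg.id_meas])
 have "f \<in> borel_measurable sigmaS" using f by auto
 then obtain g where g: "g \<in> borel_measurable (density (distr pball bsph nrml) (%_. 3))" "AE x in density (distr pball bsph nrml) (%_. 3). f x = g x"
  using completion_ex_borel_measurable_real unfolding sigmaS_def by blast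
 have gb: "g \<in> borel_measurable bsph" using g(1) by simp
 define g0 where "g0 x = indicator SS x *R g x" for x
 have g0: "g0 \<in> borel_measurable borel"
  using gb unfolding g0_def[abs_def] by (subst (asm) borel_measurable_restrict_space_iff) auto
 have AE1: "AE x in sigmaS. f x = g x" unfolding sigmaS_def by (rule AE_completion[OF g(2)])
 have AE: "AE x in sigmaS. f x = g0 x"
  using AE1 AE_space by eventually_elim (simp add: g0_def)
 have g0m: "g0 \<in> borel_measurable sigmaS" using measurable_compose[OF sg.id_meas g0] .
 have g0i: "integrable sigmaS g0"
  using integrable_cong_AE[OF _ g0m AE] f by auto
 then have "integrable N g0" unfolding N_def by (subst integrable_distr_eq[OF sg.id_meas g0])
 from borel_L1_approx[OF sN fN this, rule_format, OF e] obtain \<phi> :: "R3 => real" where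
  p: "continuous_on UNIV \<phi>" "(\<integral>x. \<bar>g0 x - \<phi> x\<bar> \<partial>N) < e" by blast
 have pm: "\<phi> \<in> borel_measurable borel" using p(1) by (rule borel_measurable_continuous_onI)
 have "(%x. \<bar>g0 x - \<phi> x\<bar>) \<in> borel_measurable borel" using g0 pm by measurable
 then have "(\<integral>x. \<bar>g0 x - \<phi> x\<bar> \<partial>N) = (\<integral>S x. \<bar>g0 x - \<phi> x\<bar>)"
  unfolding N_def by (rule integral_distr[OF sg.id_meas])
 also have "... = (\<integral>S x. \<bar>f x - \<phi> x\<bar>)"
  by (rule integral_cong_AE) (use AE g0m measurable_compose[OF sg.id_meas pm] f in \<open>auto elim!: eventually_mono\<close>)
 finally show ?thesis using p that by simp
qed

text \<open>For functions bounded by n the p-th power of a difference is at most (2n)^(p-1) times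
  the difference, so after truncation approximation in L^1 suffices.\<close>

theorem Lp_cont_approx:
 assumes f: "LL p f" and p: "1 <= p" and e: "0 < (e::real)"
 obtains \<phi> :: "R3 => real" where "continuous_on UNIV \<phi>" "nL p (%x. f x - \<phi> x) < e"
proof -
 have fm[measurable]: "f \<in> borel_measurable sigmaS" using f by (simp add: in_Lp_def)
 define tr :: "nat => real => real" where "tr n t = max (- real n) (min (real n) t)" for n t
 have tr_b: "\<bar>tr n t\<bar> <= real n" for n t by (auto simp: tr_def)
 have tr_lip: "\<bar>tr n t - tr n u\<bar> <= \<bar>t - u\<bar>" for n t u by (auto simp: tr_def)
 have tr_le: "\<bar>t - tr n t\<bar> <= \<bar>t\<bar>" for n t by (auto simp: tr_def)
 have tr_eq: "tr n t = t" if "\<bar>t\<bar> <= real n" for n t using that by (auto simp: tr_def)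
 have [measurable]: "(%x. tr n (f x)) \<in> borel_measurable sigmaS" for n unfolding tr_def by measurable
 have "(%n. \<integral>S x. \<bar>f x - tr n (f x)\<bar> powr p) \<longlonglongrightarrow> (\<integral>S x. 0)"
 proof (rule integral_dominated_convergence[where w="%x. \<bar>f x\<bar> powr p"])
  show "integrable sigmaS (%x. \<bar>f x\<bar> powr p)" using f by (simp add: in_Lp_def)
  show "AE x in sigmaS. (%n. \<bar>f x - tr n (f x)\<bar> powr p) \<longlonglongrightarrow> 0"
  proof (rule AE_I2)
   fix x
   obtain N :: nat where N: "\<bar>f x\<bar> <= real N" using real_arch_simple by blast
   have "\<bar>f x - tr n (f x)\<bar> powr p = 0" if "n >= N" for n
    using tr_eq[of "f x" n] N that by simp
   then have "\<forall>\<^sub>F n in sequentially. \<bar>f x - tr n (f x)\<bar> powr p = 0"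
    unfolding eventually_sequentially by blast
   then show "(%n. \<bar>f x - tr n (f x)\<bar> powr p) \<longlonglongrightarrow> 0" by (rule tendsto_eventually)
  qed
  show "AE x in sigmaS. norm (\<bar>f x - tr n (f x)\<bar> powr p) <= \<bar>f x\<bar> powr p" for n
   using tr_le p by (intro AE_I2) (auto intro!: powr_mono2)
 qed measurable
 then have lim: "(%n. \<integral>S x. \<bar>f x - tr n (f x)\<bar> powr p) \<longlonglongrightarrow> 0" by simp
 have "0 < (e/2) powr p" using e by simp
 from order_tendstoD(2)[OF lim this] obtain n0 where n0: "!!n. n >= n0 ==> (\<integral>S x. \<bar>f x - tr n (f x)\<bar> powr p) < (e/2) powr p"
  unfolding eventually_sequentially by blast
 define n where "n = Suc n0"
 have n: "(\<integral>S x. \<bar>f x - tr n (f x)\<bar> powr p) < (e/2) powr p" "0 < real n" using n0[of n] by (auto simp: n_def)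
 define fn where "fn x = tr n (f x)" for x
 have fnm[measurable]: "fn \<in> borel_measurable sigmaS" unfolding fn_def by measurable
 have fnL: "LL p fn" by (rule sg.Lp_nm_uniform(1)[of fn "real n"]) (use tr_b p fnm in \<open>auto simp: fn_def\<close>)
 have fn1: "nL p (%x. f x - fn x) <= e/2"
  using n(1) e p by (subst Lp_nm_le_iff) (auto simp: fn_def)
 \<comment> \<open>Chosen so that (2n)^(p-1) \<delta> = (e/4)^p.\<close>
 define \<delta> where "\<delta> = (e/4) powr p / (2 * real n) powr (p - 1)"
 have \<delta>: "0 < \<delta>" using e n by (simp add: \<delta>_def)
 have "integrable sigmaS fn" by (rule in_Lp_integrable[OF sg.finite_measure_axioms fnL p])
 then obtain \<phi> :: "R3 => real" where q: "continuous_on UNIV \<phi>" "(\<integral>S x. \<bar>fn x - \<phi> x\<bar>) < \<delta>"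
  by (rule sigmaS_L1_approx[OF _ \<delta>])
 define \<psi> where "\<psi> x = tr n (\<phi> x)" for x
 have \<psi>c: "continuous_on A \<psi>" for A unfolding \<psi>_def tr_def
  by (intro continuous_intros continuous_on_subset[OF q(1)]) auto
 have \<psi>m: "\<psi> \<in> borel_measurable sigmaS" by (rule sg.cont_meas[OF \<psi>c])
 have \<phi>m: "\<phi> \<in> borel_measurable sigmaS" using q(1) by (intro sg.cont_meas continuous_on_subset[OF q(1)]) auto
 have \<phi>i: "integrable sigmaS \<phi>" by (intro sg.cont_int continuous_on_subset[OF q(1)]) auto
 have \<psi>L: "LL p \<psi>" using p by (intro sg.cont_in_Lp \<psi>c) auto
 have "(\<integral>S x. norm (fn x - \<psi> x) powr p) <= (\<integral>S x. (2 * real n) powr (p - 1) * \<bar>fn x - \<phi> x\<bar>)"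
 proof (rule integral_mono)
  show "integrable sigmaS (%x. norm (fn x - \<psi> x) powr p)" using in_Lp_diff[OF fnL \<psi>L p] by (simp add: in_Lp_def)
  show "integrable sigmaS (%x. (2 * real n) powr (p - 1) * \<bar>fn x - \<phi> x\<bar>)"
   using \<open>integrable sigmaS fn\<close> \<phi>i by auto
  fix x
  have a: "\<bar>fn x - \<psi> x\<bar> <= \<bar>fn x - \<phi> x\<bar>"
  proof -
   have "fn x = tr n (fn x)" unfolding fn_def using tr_eq[OF tr_b] by simp
   then show ?thesis unfolding \<psi>_def using tr_lip by metis
  qed
  have b: "\<bar>fn x - \<psi> x\<bar> <= 2 * real n" using tr_b[of n "f x"] tr_b[of n "\<phi> x"] unfolding fn_def \<psi>_def by linarith
  have "\<bar>fn x - \<psi> x\<bar> powr p = \<bar>fn x - \<psi> x\<bar> powr (p - 1) * \<bar>fn x - \<psi> x\<bar>"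
   by (cases "fn x = \<psi> x") (auto simp: powr_diff)
  also have "... <= (2 * real n) powr (p - 1) * \<bar>fn x - \<phi> x\<bar>"
   using a b p by (intro mult_mono powr_mono2) auto
  finally show "norm (fn x - \<psi> x) powr p <= (2 * real n) powr (p - 1) * \<bar>fn x - \<phi> x\<bar>" by simp
 qed
 also have "... = (2 * real n) powr (p - 1) * (\<integral>S x. \<bar>fn x - \<phi> x\<bar>)" by simp
 also have "... <= (2 * real n) powr (p - 1) * \<delta>" using q(2) by (intro mult_left_mono) auto
 also have "... = (e/4) powr p" using n by (simp add: \<delta>_def)
 finally have fn2: "nL p (%x. fn x - \<psi> x) <= e/4" using e p by (subst Lp_nm_le_iff) auto
 have "nL p (%x. (f x - fn x) + (fn x - \<psi> x)) <= nL p (%x. f x - fn x) + nL p (%x. fn x - \<psi> x)"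
  by (rule Lp_nm_triangle[OF in_Lp_diff[OF f fnL p] in_Lp_diff[OF fnL \<psi>L p] p])
 then have "nL p (%x. f x - \<psi> x) < e" using fn1 fn2 e by simp
 then show ?thesis using that[OF \<psi>c] by blast
qed

theorem Lp_poly_approx:
 assumes f: "LL p f" and p: "1 <= p" and e: "0 < (e::real)"
 obtains q :: "R3 => real" where "real_polynomial_function q" "nL p (%x. f x - q x) < e"
proof -
 have "0 < e/2" using e by simp
 from Lp_cont_approx[OF f p this] obtain \<phi> :: "R3 => real" where
  \<phi>: "continuous_on UNIV \<phi>" "nL p (%x. f x - \<phi> x) < e/2" .
 define d where "d = e / (2 * ((4 * pi) powr (1/p) + 1))"
 have "0 <= (4 * pi) powr (1/p)" by simp
 then have pos: "0 < (4 * pi) powr (1/p) + 1" by linarith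
 have d: "0 < d" "d * (4 * pi) powr (1/p) <= e/2" using e pos by (auto simp: d_def field_simps)
 have "continuous_on SS \<phi>" using \<phi>(1) continuous_on_subset by blast
 then have "EX q. real_polynomial_function q & (ALL x:SS. \<bar>\<phi> x - q x\<bar> < d)"
  using Stone_Weierstrass_real_polynomial_function[of SS \<phi> d] d by (metis compact_sphere)
 then obtain q where q: "real_polynomial_function q" "!!x. x \<in> SS ==> \<bar>\<phi> x - q x\<bar> < d" by blast
 have qc: "continuous_on A q" for A using rpf_grad[OF q(1)] C1g_cont by blast
 have \<phi>c: "continuous_on SS \<phi>" using \<phi>(1) continuous_on_subset by blast
 have \<phi>L: "LL p \<phi>" using p \<phi>c by (intro sg.cont_in_Lp) auto
 have qL: "LL p q" using p by (intro sg.cont_in_Lp qc) auto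
 have "nL p (%x. \<phi> x - q x) <= d * measure sigmaS (space sigmaS) powr (1/p)"
  by (rule sg.Lp_nm_uniform(2)) (use q(2) d p qc \<phi>c in \<open>auto intro!: sg.cont_meas continuous_intros less_imp_le\<close>)
 then have "nL p (%x. \<phi> x - q x) <= e/2" using d(2) by (simp add: measure_sigmaS)
 moreover have "nL p (%x. (f x - \<phi> x) + (\<phi> x - q x)) <= nL p (%x. f x - \<phi> x) + nL p (%x. \<phi> x - q x)"
  by (rule Lp_nm_triangle[OF in_Lp_diff[OF f \<phi>L p] in_Lp_diff[OF \<phi>L qL p] p])
 ultimately have "nL p (%x. f x - q x) < e" using \<phi>(2) by simp
 then show ?thesis using that[OF q(1)] by blast
qed

section \<open>Radial limits of Poisson integrals\<close>

text \<open>Exceptional sets appear only as subsets of measurable sets of small measure; their own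
  measurability is never established.\<close>

lemma AE_smallI:
 assumes "!!e. 0 < (e::real) ==> EX V:sets M. emeasure M V <= ennreal e & (ALL x:space M - V. Q x)"
 shows "AE x in M. Q x"
proof -
 have "ALL n. EX V. V \<in> sets M & emeasure M V <= ennreal (1 / real (Suc n)) & (ALL x:space M - V. Q x)"
 proof
  fix n
  have "0 < 1 / real (Suc n)" by simp
  from assms[OF this] show "EX V. V \<in> sets M & emeasure M V <= ennreal (1 / real (Suc n)) & (ALL x:space M - V. Q x)" by blast
 qed
 from choice[OF this] obtain V where V: "ALL n. V n \<in> sets M & emeasure M (V n) <= ennreal (1 / real (Suc n)) & (ALL x:space M - V n. Q x)" ..
 define W where "W = (\<Inter>n. V n)"
 have W: "W \<in> sets M" unfolding W_def using V by (intro sets.countable_INT) auto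
 have le: "emeasure M W <= ennreal (1 / real (Suc n))" for n
 proof -
  have "emeasure M W <= emeasure M (V n)" by (rule emeasure_mono) (use V in \<open>auto simp: W_def\<close>)
  then show ?thesis using V order_trans by blast
 qed
 have "emeasure M W <= 0"
 proof (rule LIMSEQ_le[OF tendsto_const])
  show "(%n. ennreal (1 / real (Suc n))) \<longlonglongrightarrow> 0"
   using tendsto_ennrealI[OF LIMSEQ_Suc[OF lim_1_over_n[where 'a=real]]] by (simp add: ennreal_0)
 qed (use le in blast)
 then have "W \<in> null_sets M" using W by auto
 moreover have "{x \<in> space M. \<not> Q x} \<subseteq> W" using V by (auto simp: W_def)
 ultimately show ?thesis by (rule AE_I')
qed

lemma ball_int:
 fixes g :: "R3 => real"
 assumes "integrable sigmaS g" shows "integrable sigmaS (%y. indicator (ball x r) y * g y)"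
proof -
 have [measurable]: "g \<in> borel_measurable sigmaS" using assms by auto
 have [measurable]: "(%y. indicator (ball x r) y :: real) \<in> borel_measurable sigmaS"
  using measurable_compose[OF sg.id_meas borel_measurable_indicator[of "ball x r"]] by simp
 have "(%y. indicator (ball x r) y * g y) \<in> borel_measurable sigmaS" by measurable
 then show ?thesis
  by (rule LINT_bound[OF assms]) (simp add: indicator_def del: mem_ball)
qed

text \<open>Weak type (1,1) of the maximal function: cover the bad points by bad balls, select
  disjoint ones by Vitali's lemma and enlarge them five times. The factor 25 exp 1 pi is the cap
  bound at radius 5s, and V is the union of the enlarged caps.\<close>

lemma maximal_weak_type:
 assumes g: "integrable sigmaS g" "!!x. 0 <= g x" and lam: "0 < lam"
 shows "EX V:sets sigmaS. emeasure sigmaS V <= ennreal (25 * exp 1 * pi / lam * (\<integral>S y. g y))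
   & (ALL x:SS - V. ALL r>0. (\<integral>S y. indicator (ball x r) y * g y) <= lam * r\<^sup>2)"
proof -
 \<comment> \<open>The covering lemma needs bounded radii. The bound 3 suffices because a ball of
   radius 3 about a point of the sphere contains the whole sphere.\<close>
 define K where "K = {z :: R3 \<times> real. fst z \<in> SS & 0 < snd z & snd z <= 3 & lam * (snd z)\<^sup>2 < (\<integral>S y. indicator (ball (fst z) (snd z)) y * g y)}"
 have cov: "fst ` K \<subseteq> (\<Union>z\<in>K. ball (fst z) (snd z))"
 proof
  fix x assume "x \<in> fst ` K"
  then obtain z where "z \<in> K" "x = fst z" by blast
  then show "x \<in> (\<Union>z\<in>K. ball (fst z) (snd z))" by (intro UN_I[of z]) (auto simp: K_def)
 qed
 obtain C where C: "countable C" "C \<subseteq> K"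
   "pairwise (%i j. disjnt (ball (fst i) (snd i)) (ball (fst j) (snd j))) C"
   "fst ` K \<subseteq> (\<Union>i\<in>C. ball (fst i) (5 * snd i))"
  by (rule Vitali_covering_lemma_balls[OF cov, of 3]) (auto simp: K_def)
 define I where "I = to_nat_on C ` C"
 define z where "z n = from_nat_into C n" for n
 have zC: "z n \<in> C" if "n \<in> I" for n using that C(1) by (auto simp: I_def z_def)
 have zinj: "z n ~= z m" if "n \<in> I" "m \<in> I" "n ~= m" for n m using that C(1) by (auto simp: I_def z_def)
 define U where "U n = (if n \<in> I then SS \<inter> ball (fst (z n)) (5 * snd (z n)) else {})" for n
 define W where "W n = (if n \<in> I then ball (fst (z n)) (snd (z n)) else {})" for n
 have bs: "SS \<inter> ball a s \<in> sets sigmaS" for a s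
  using measurable_sets[OF sg.id_meas, of "ball a s"] by (simp add: Int_commute)
 have Us: "U n \<in> sets sigmaS" for n by (simp add: U_def bs)
 have Wd: "disjoint_family_on W A" for A
  unfolding disjoint_family_on_def
 proof (intro ballI impI)
  fix m n :: nat assume mn: "m ~= n"
  show "W m \<inter> W n = {}"
   using C(3) zC[of m] zC[of n] zinj[of m n] mn unfolding pairwise_def W_def disjnt_def by auto
 qed
 define c where "c = 25 * exp 1 * pi / lam"
 have c: "0 < c" using lam by (simp add: c_def)
 have Wi: "integrable sigmaS (%y. indicator (W n) y * g y)" for n using ball_int[OF g(1)] by (simp add: W_def)
 have UW: "emeasure sigmaS (U n) <= ennreal (c * (\<integral>S y. indicator (W n) y * g y))" for n
 proof (cases "n \<in> I")
  case True
  obtain a s where zas: "z n = (a, s)" by (cases "z n")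
  have zK: "(a, s) \<in> K" using zC[OF True] C(2) zas by auto
  then have a: "norm a = 1" "0 < s" "lam * s\<^sup>2 < (\<integral>S y. indicator (ball a s) y * g y)" by (auto simp: K_def)
  have "measure sigmaS (U n) <= exp 1 * pi * (5 * s)\<^sup>2"
   using sigmaS_cap_le[OF a(1), of "5 * s"] a(2) True by (simp add: U_def zas)
  also have "... = c * (lam * s\<^sup>2)" using lam by (simp add: c_def power_mult_distrib)
  also have "... <= c * (\<integral>S y. indicator (W n) y * g y)"
   using a(3) c True by (intro mult_left_mono) (auto simp: W_def zas)
  finally show ?thesis by (simp add: sg.emeasure_eq_measure ennreal_leI)
 qed (simp add: U_def)
 have "emeasure sigmaS (\<Union>n. U n) <= (\<Sum>n. emeasure sigmaS (U n))"
  by (rule emeasure_subadditive_countably) (use Us in auto)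
 also have "... <= ennreal (c * (\<integral>S y. g y))"
 proof (rule suminf_le_const[OF summableI])
  fix m
  have "(\<Sum>n<m. emeasure sigmaS (U n)) <= (\<Sum>n<m. ennreal (c * (\<integral>S y. indicator (W n) y * g y)))"
   by (rule sum_mono) (rule UW)
  also have "... = ennreal (\<Sum>n<m. c * (\<integral>S y. indicator (W n) y * g y))"
   using c g(2) by (intro sum_ennreal) (auto intro!: mult_nonneg_nonneg integral_nonneg_AE)
  also have "... <= ennreal (c * (\<integral>S y. g y))"
  proof (rule ennreal_leI)
   have "(\<Sum>n<m. c * (\<integral>S y. indicator (W n) y * g y)) = c * (\<integral>S y. (\<Sum>n<m. indicator (W n) y * g y))"
    by (subst LINT_sum) (auto simp: sum_distrib_left Wi)
   also have "... <= c * (\<integral>S y. g y)"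
   proof (intro mult_left_mono integral_mono)
    show "integrable sigmaS (%y. \<Sum>n<m. indicator (W n) y * g y)" by (rule Bochner_Integration.integrable_sum) (rule Wi)
    fix y
    have "(\<Sum>n<m. indicator (W n) y :: real) = indicator (\<Union>n<m. W n) y"
     by (rule indicator_UN_disjoint[symmetric]) (auto intro: Wd)
    also have "... <= 1" by (simp add: indicator_def)
    finally have "(\<Sum>n<m. indicator (W n) y :: real) * g y <= 1 * g y" using g(2) by (intro mult_right_mono)
    then show "(\<Sum>n<m. indicator (W n) y * g y) <= g y" by (simp add: sum_distrib_right)
   qed (use g c in auto)
   finally show "(\<Sum>n<m. c * (\<integral>S y. indicator (W n) y * g y)) <= c * (\<integral>S y. g y)" .
  qed
  finally show "(\<Sum>n<m. emeasure sigmaS (U n)) <= ennreal (c * (\<integral>S y. g y))" .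
 qed
 finally have mV: "emeasure sigmaS (\<Union>n. U n) <= ennreal (c * (\<integral>S y. g y))" .
 have "(\<integral>S y. indicator (ball x r) y * g y) <= lam * r\<^sup>2" if x: "x \<in> SS - (\<Union>n. U n)" and r: "0 < r" for x r
 proof -
  have 3: "(\<integral>S y. indicator (ball x s) y * g y) <= lam * s\<^sup>2" if s: "0 < s" "s <= 3" for s
  proof (rule ccontr)
   assume "\<not> ?thesis"
   then have "(x, s) \<in> K" using x s by (simp add: K_def)
   then have "x \<in> fst ` K" by (rule image_eqI[rotated]) simp
   then obtain i where i: "i \<in> C" "x \<in> ball (fst i) (5 * snd i)" using C(4) by blast
   have "to_nat_on C i \<in> I" "z (to_nat_on C i) = i" using i(1) C(1) by (auto simp: I_def z_def)
   then have "x \<in> U (to_nat_on C i)" using i(2) x by (simp add: U_def)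
   then show False using x by blast
  qed
  show ?thesis
  proof (cases "r <= 3")
   case False
   have in3: "y \<in> ball x 3 & y \<in> ball x r" if "y \<in> SS" for y
   proof -
    have "norm (x - y) <= norm x + norm y" by (rule norm_triangle_ineq4)
    then show ?thesis using that x False by (simp add: dist_norm)
   qed
   have "(\<integral>S y. indicator (ball x r) y * g y) = (\<integral>S y. indicator (ball x 3) y * g y)"
    by (rule LINT_cong[OF refl]) (use in3 in \<open>simp add: indicator_def\<close>)
   also have "... <= lam * 3\<^sup>2" by (rule 3) auto
   also have "... <= lam * r\<^sup>2" using lam False by (intro mult_left_mono power_mono) auto
   finally show ?thesis .
  qed (use 3 r in simp)
 qed
 moreover have "(\<Union>n. U n) \<in> sets sigmaS" using Us by auto
 ultimately show ?thesis using mV unfolding c_def by (intro bexI[of _ "\<Union>n. U n"]) auto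
qed

text \<open>On the dyadic shell |x - y| ~ 2^k d with d = 1 - r the kernel is at most 32 d/(2^k d)^3,
  and the ball of radius 2^k d carries mass at most lam (2^k d)^2. The products form the series 32
  lam 2^(-k), whose sum is at most 64 lam.\<close>

lemma Poisson_maximal_bound:
 assumes g: "integrable sigmaS g" "!!x. 0 <= g x" and x: "x \<in> SS" and r: "0 < r" "r < 1" and lam: "0 <= lam"
  and max: "!!s. 0 < s ==> (\<integral>S y. indicator (ball x s) y * g y) <= lam * s\<^sup>2"
 shows "Poisson g (r *R x) <= 64 * lam"
proof -
 define d where "d = 1 - r"
 have d: "0 < d" using r by (simp add: d_def)
 obtain n :: nat where "3 / d < 2 ^ n" using real_arch_pow[of 2 "3 / d"] by auto
 then have n: "3 < 2 ^ n * d" using d by (simp add: field_simps)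
 define T where "T k y = 32 * d / (2 ^ k * d) ^ 3 * indicator (ball x (2 ^ k * d)) y" for k and y
 have T0: "0 <= T k y" for k y using d by (simp add: T_def)
 have pt: "Pker (r *R x) y <= (\<Sum>k\<le>n. T k y)" if y: "y \<in> SS" for y
 proof -
  define D where "D = norm (x - y)"
  have D2: "D < 2 ^ n * d"
   using norm_triangle_ineq4[of x y] x y n by (simp add: D_def)
  define k where "k = (LEAST k. D < 2 ^ k * d)"
  have k: "D < 2 ^ k * d" "k <= n" unfolding k_def using D2 by (auto intro: LeastI Least_le)
  have xr: "norm (x - r *R x) = d"
  proof -
   have "x - r *R x = (1 - r) *R x" by (simp add: scaleR_diff_left)
   then show ?thesis using x r by (simp add: d_def)
  qed
  have n1: "D <= norm (r *R x - y) + d"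
   using norm_triangle_ineq[of "r *R x - y" "x - r *R x"] xr by (simp add: D_def)
  have n2: "d <= norm (r *R x - y)"
   using norm_triangle_ineq2[of y "r *R x"] x y r by (simp add: d_def norm_minus_commute)
  \<comment> \<open>From |x-y| <= |rx-y| + d and d <= |rx-y| follows |x-y| <= 2|rx-y|; minimality of
    k bounds |x-y| below by half of 2^k d.\<close>
  have low: "2 ^ k * d / 4 <= norm (r *R x - y)"
  proof (cases k)
   case 0
   then show ?thesis using n2 d by simp
  next
   case (Suc j)
   have "\<not> D < 2 ^ j * d" using not_less_Least[of j "%k. D < 2 ^ k * d"] Suc by (simp add: k_def)
   moreover have "2 ^ k * d / 4 = 2 ^ j * d / 2" using Suc by simp
   ultimately show ?thesis using n1 n2 by linarith
  qed
  have "(2 ^ k * d / 4) ^ 3 <= norm (r *R x - y) ^ 3" using low d by (intro power_mono) auto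
  moreover have "1 - (norm (r *R x))\<^sup>2 <= 2 * d"
  proof -
   have "1 - r\<^sup>2 = (1 - r) * (1 + r)" by (simp add: power2_eq_square algebra_simps)
   also have "... <= d * 2" using r by (intro mult_mono) (auto simp: d_def)
   finally show ?thesis using x by (simp add: power_mult_distrib)
  qed
  moreover have "0 <= 1 - (norm (r *R x))\<^sup>2" using x r by (simp add: abs_square_le_1)
  ultimately have "(1 - (norm (r *R x))\<^sup>2) / norm (r *R x - y) ^ 3 <= 2 * d / (2 ^ k * d / 4) ^ 3"
   using d by (intro frac_le) auto
  then have "1 / (4 * pi) * ((1 - (norm (r *R x))\<^sup>2) / norm (r *R x - y) ^ 3) <= 1 / (4 * 1) * (2 * d / (2 ^ k * d / 4) ^ 3)"
   using d pi_gt3 x r by (intro mult_mono divide_left_mono) (auto simp: abs_square_le_1)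
  then have "Pker (r *R x) y <= 1 / 4 * (2 * d / (2 ^ k * d / 4) ^ 3)" by (simp add: Pker_def)
  also have "... = T k y"
   using k(1) by (simp add: T_def D_def dist_norm power_divide)
  also have "... <= (\<Sum>k\<le>n. T k y)" using k(2) T0 by (intro member_le_sum) auto
  finally show ?thesis .
 qed
 have b: "r *R x \<in> ball 0 1" using x r by simp
 have Ti: "integrable sigmaS (%y. T k y * g y)" for k
  using ball_int[OF g(1), of x "2 ^ k * d"] by (simp add: T_def mult.assoc)
 have "Poisson g (r *R x) <= (\<integral>S y. (\<Sum>k\<le>n. T k y) * g y)"
  unfolding Poisson_def
 proof (rule integral_mono)
  show "integrable sigmaS (%y. (\<Sum>k\<le>n. T k y) * g y)" using Ti by (simp add: sum_distrib_right)
  show "integrable sigmaS (%y. Pker (r *R x) y * g y)" by (rule Pker_int[OF b g(1)])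
  show "Pker (r *R x) y * g y <= (\<Sum>k\<le>n. T k y) * g y" if "y \<in> space sigmaS" for y
   using pt that g(2) by (intro mult_right_mono) auto
 qed
 also have "... = (\<Sum>k\<le>n. \<integral>S y. T k y * g y)"
  unfolding sum_distrib_right by (rule LINT_sum) (rule Ti)
 also have "... <= (\<Sum>k\<le>n. 32 * lam * (1/2) ^ k)"
 proof (rule sum_mono)
  fix k
  have "(\<integral>S y. T k y * g y) = 32 * d / (2 ^ k * d) ^ 3 * (\<integral>S y. indicator (ball x (2 ^ k * d)) y * g y)"
   by (simp add: T_def mult.assoc)
  also have "... <= 32 * d / (2 ^ k * d) ^ 3 * (lam * (2 ^ k * d)\<^sup>2)"
   using d by (intro mult_left_mono max) auto
  also have "... = 32 * lam * (1/2) ^ k"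
   using d by (simp add: power3_eq_cube power2_eq_square field_simps power_divide)
  finally show "(\<integral>S y. T k y * g y) <= 32 * lam * (1/2) ^ k" .
 qed
 also have "... = 32 * lam * (\<Sum>k\<le>n. (1/2) ^ k)" by (simp add: sum_distrib_left)
 also have "... <= 32 * lam * 2"
 proof (rule mult_left_mono)
  have "(\<Sum>k<Suc n. (1/2::real) ^ k) <= 2" by (subst geometric_sum) auto
  then show "(\<Sum>k\<le>n. (1/2::real) ^ k) <= 2" by (simp add: lessThan_Suc_atMost)
 qed (use lam in simp)
 finally show ?thesis by simp
qed

text \<open>Approximate f in L^1 by a continuous \<phi>. Outside a set of small measure the Poisson
  integral of |f - \<phi>| is at most 64 lam and |f - \<phi>| itself at most lam, while \<phi>
  converges uniformly and costs another lam: 66 lam in total.\<close>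

theorem Poisson_Fatou:
 assumes f: "integrable sigmaS f"
 shows "AE x in sigmaS. ((%r. Poisson f (r *R x)) \<longlongrightarrow> f x) (at_left 1)"
proof -
 have fm[measurable]: "f \<in> borel_measurable sigmaS" using f by auto
 have step: "AE x in sigmaS. \<forall>\<^sub>F r in at_left 1. \<bar>Poisson f (r *R x) - f x\<bar> <= 66 * lam" if lam: "0 < lam" for lam
 proof (rule AE_smallI)
  fix e :: real assume e: "0 < e"
  \<comment> \<open>The summands are the constants of the maximal inequality, for the set V, and of
    Markov's inequality, for the set W.\<close>
  define c where "c = 25 * exp 1 * pi / lam + 1 / lam"
  have c: "0 < c" using lam by (simp add: c_def add_pos_pos)
  have "0 < e / c" using e c by simp
  from sigmaS_L1_approx[OF f this] obtain \<phi> :: "R3 => real" where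
   p: "continuous_on UNIV \<phi>" "(\<integral>S x. \<bar>f x - \<phi> x\<bar>) < e / c" .
  have pc: "continuous_on SS \<phi>" using p(1) continuous_on_subset by blast
  have pi: "integrable sigmaS \<phi>" using pc by (intro sg.cont_int) simp
  have [measurable]: "\<phi> \<in> borel_measurable sigmaS" using pi by auto
  define g where "g x = \<bar>f x - \<phi> x\<bar>" for x
  have g: "integrable sigmaS g" "!!x. 0 <= g x" using f pi by (auto simp: g_def[abs_def])
  obtain V where V: "V \<in> sets sigmaS" "emeasure sigmaS V <= ennreal (25 * exp 1 * pi / lam * (\<integral>S y. g y))"
   "ALL x:SS - V. ALL r>0. (\<integral>S y. indicator (ball x r) y * g y) <= lam * r\<^sup>2"
   using maximal_weak_type[OF g lam] by blast
  define W where "W = {x \<in> space sigmaS. lam <= g x}"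
  have Ws: "W \<in> sets sigmaS" unfolding W_def g_def by measurable
  have "measure sigmaS W <= (\<integral>S y. g y) / lam"
   unfolding W_def by (rule integral_Markov_inequality_measure[where A=\<open>{}\<close>]) (use g lam in auto)
  then have W: "emeasure sigmaS W <= ennreal (1 / lam * (\<integral>S y. g y))"
   by (simp add: sg.emeasure_eq_measure ennreal_leI)
  show "EX V:sets sigmaS. emeasure sigmaS V <= ennreal e & (ALL x:space sigmaS - V. \<forall>\<^sub>F r in at_left 1. \<bar>Poisson f (r *R x) - f x\<bar> <= 66 * lam)"
  proof (intro bexI[of _ "V \<union> W"] conjI ballI)
   have g0: "0 <= (\<integral>S y. g y)" using g by auto
   have "emeasure sigmaS (V \<union> W) <= emeasure sigmaS V + emeasure sigmaS W"
    by (rule emeasure_subadditive) fact+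
   also have "... <= ennreal (25 * exp 1 * pi / lam * (\<integral>S y. g y)) + ennreal (1 / lam * (\<integral>S y. g y))"
    by (intro add_mono V W)
   also have "... = ennreal (c * (\<integral>S y. g y))"
    using g0 lam by (subst ennreal_plus[symmetric]) (auto simp: c_def distrib_right)
   also have "... <= ennreal e"
    using p(2) c by (intro ennreal_leI) (simp add: g_def[abs_def] pos_less_divide_eq mult.commute less_imp_le)
   finally show "emeasure sigmaS (V \<union> W) <= ennreal e" .
   fix x assume x: "x \<in> space sigmaS - (V \<union> W)"
   then have xS: "x \<in> SS" "x \<in> SS - V" "g x <= lam" by (auto simp: W_def)
   obtain d where d: "0 < d" "d < 1" "!!r y. 1 - d < r ==> r < 1 ==> y \<in> SS ==> \<bar>Poisson \<phi> (r *R y) - \<phi> y\<bar> < lam"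
    using Poisson_approx[OF pc lam] by metis
   have "\<forall>\<^sub>F r in at_left 1. r \<in> {1 - d<..<1}" by (rule eventually_at_left_real) (use d in simp)
   then show "\<forall>\<^sub>F r in at_left 1. \<bar>Poisson f (r *R x) - f x\<bar> <= 66 * lam"
   proof eventually_elim
    case (elim r)
    then have r: "0 < r" "r < 1" "1 - d < r" using d by auto
    have b: "r *R x \<in> ball 0 1" using xS r by simp
    have "Poisson f (r *R x) - Poisson \<phi> (r *R x) = (\<integral>S y. Pker (r *R x) y * (f y - \<phi> y))"
     unfolding Poisson_def using Pker_int[OF b f] Pker_int[OF b pi] by (simp add: right_diff_distrib)
    also have "\<bar>...\<bar> <= (\<integral>S y. \<bar>Pker (r *R x) y * (f y - \<phi> y)\<bar>)"
     using integral_norm_bound[of sigmaS "%y. Pker (r *R x) y * (f y - \<phi> y)"] by simp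
    also have "... = Poisson g (r *R x)"
     unfolding Poisson_def
    proof (rule LINT_cong[OF refl])
     fix y assume "y \<in> space sigmaS"
     then have "0 < Pker (r *R x) y" using Pker_pos[OF b] by simp
     then show "\<bar>Pker (r *R x) y * (f y - \<phi> y)\<bar> = Pker (r *R x) y * g y" by (simp add: abs_mult g_def)
    qed
    also have "... <= 64 * lam"
     by (rule Poisson_maximal_bound[OF g xS(1) r(1,2)]) (use V(3) xS(2) lam in auto)
    finally have "\<bar>Poisson f (r *R x) - Poisson \<phi> (r *R x)\<bar> <= 64 * lam" .
    moreover have "\<bar>Poisson \<phi> (r *R x) - \<phi> x\<bar> < lam" by (rule d(3)[OF r(3,2) xS(1)])
    moreover have "\<bar>f x - \<phi> x\<bar> <= lam" using xS(3) by (simp add: g_def)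
    ultimately show ?case by linarith
   qed
  qed (use V Ws in auto)
 qed
 have "AE x in sigmaS. ALL n. \<forall>\<^sub>F r in at_left 1. \<bar>Poisson f (r *R x) - f x\<bar> <= 66 * (1 / real (Suc n))"
  unfolding AE_all_countable by (intro allI step) simp
 then show ?thesis
 proof eventually_elim
  case (elim x)
  show ?case
  proof (rule tendstoI)
   fix e :: real assume "0 < e"
   then obtain n where n: "inverse (real (Suc n)) < e / 66" using reals_Archimedean[of "e/66"] by auto
   have "\<forall>\<^sub>F r in at_left 1. \<bar>Poisson f (r *R x) - f x\<bar> <= 66 * (1 / real (Suc n))" using elim by blast
   then show "\<forall>\<^sub>F r in at_left 1. dist (Poisson f (r *R x)) (f x) < e"
   proof eventually_elim
    case (elim r)
    then show ?case using n by (simp add: dist_real_def inverse_eq_divide)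
   qed
  qed
 qed
qed

section \<open>Contractive multipliers\<close>

text \<open>Fubini and symmetry of the kernel move the operator from f to the test function, on
  which its action is known explicitly.\<close>

lemma kernel_pair:
 fixes f Y :: "R3 => real"
 assumes K: "continuous_on (SS \<times> SS) (%(x,y). K x y)" "!!x y. x \<in> SS ==> y \<in> SS ==> K x y = K y x"
  and f: "integrable sigmaS f" and Y: "continuous_on SS Y"
 shows "(\<integral>S x. (\<integral>S y. f y * K x y) * Y x) = (\<integral>S y. f y * (\<integral>S x. Y x * K y x))"
proof -
 have c: "continuous_on (SS \<times> SS) (%z. K (fst z) (snd z))" using K(1) by (simp add: case_prod_beta)
 have Yc: "continuous_on (SS \<times> SS) (%z. Y (fst z))"
  by (rule continuous_on_compose2[OF Y]) (auto intro!: continuous_intros)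
 have "(\<integral>S x. (\<integral>S y. f y *R (K x y * Y x))) = (\<integral>S y. f y *R (\<integral>S x. K x y * Y x))"
  by (rule cont_swap_L1[OF sg.cmeas_axioms sg.cmeas_axioms _ f])
    (simp add: case_prod_beta, intro continuous_on_mult c Yc)
 moreover have "(\<integral>S y. f y *R (K x y * Y x)) = (\<integral>S y. f y * K x y) * Y x" for x
  by (simp add: mult.assoc[symmetric])
 moreover have "(\<integral>S y. f y *R (\<integral>S x. K x y * Y x)) = (\<integral>S y. f y * (\<integral>S x. Y x * K y x))"
 proof (rule LINT_cong[OF refl])
  fix y assume y: "y \<in> space sigmaS"
  have "(\<integral>S x. K x y * Y x) = (\<integral>S x. Y x * K y x)"
   by (rule LINT_cong[OF refl]) (use y K(2) in \<open>simp add: mult.commute\<close>)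
  then show "f y *R (\<integral>S x. K x y * Y x) = f y * (\<integral>S x. Y x * K y x)" by simp
 qed
 ultimately show ?thesis by simp
qed

lemma Poisson_coeff:
 assumes f: "integrable sigmaS f" and Y: "Y \<in> sph_harm l" and r: "0 < r" "r < 1"
 shows "(\<integral>S x. Poisson f (r *R x) * Y x) = r ^ l * (\<integral>S x. f x * Y x)"
proof -
 have "(\<integral>S x. Poisson f (r *R x) * Y x) = (\<integral>S y. f y * (\<integral>S x. Y x * Pker (r *R y) x))"
  unfolding Poisson_alt
  by (rule kernel_pair[OF rsphere_kernel_cont[OF r Pker_cont] Pker_sym f sph_harm_cont[OF Y]])
 also have "... = (\<integral>S y. r ^ l * (f y * Y y))"
 proof (rule LINT_cong[OF refl])
  fix y assume "y \<in> space sigmaS"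
  then have "r *R y \<in> ball 0 1" using r by (intro rball) auto
  then show "f y * (\<integral>S x. Y x * Pker (r *R y) x) = r ^ l * (f y * Y y)"
   using Poisson_sph_harm[OF Y] sph_harm_homogeneous[OF Y] by (simp add: Poisson_alt)
 qed
 finally show ?thesis by simp
qed

text \<open>Pair the Poisson integral of Y at radius 1/2 with Z: acting on Y it gives the factor
  (1/2)^l, moved over to Z it gives (1/2)^m.\<close>

lemma sph_harm_orthogonal:
 assumes Y: "Y \<in> sph_harm l" and Z: "Z \<in> sph_harm m" and n: "l ~= m"
 shows "(\<integral>S x. Y x * Z x) = 0"
proof -
 define I where "I = (\<integral>S x. Y x * Z x)"
 have "(\<integral>S x. Poisson Y ((1/2) *R x) * Z x) = (\<integral>S x. (1/2) ^ l * (Y x * Z x))"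
  by (rule LINT_cong[OF refl])
    (subst Poisson_sph_harm[OF Y], auto intro!: rball simp: sph_harm_homogeneous[OF Y])
 also have "... = (1/2) ^ l * I" unfolding I_def by (rule integral_mult_right_zero)
 moreover have "(\<integral>S x. Poisson Y ((1/2) *R x) * Z x) = (1/2) ^ m * I"
  unfolding I_def by (rule Poisson_coeff[OF sg.cont_int Z]) (use sph_harm_cont[OF Y] in auto)
 ultimately have "(1/2) ^ l * I = (1/2) ^ m * I" by linarith
 then have "I = 0 \<or> (1/2::real) ^ l = (1/2) ^ m" using mult_right_cancel by blast
 then show ?thesis using n power_inject_exp'[of "1/2::real" l m] by (auto simp: I_def)
qed

lemma int_mult_cont: "integrable sigmaS f ==> continuous_on SS g ==> integrable sigmaS (%x. f x * g x :: real)"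
 using sg.int_bdd_mult[of g f] by simp

lemma cont_pairing_zero:
 assumes f: "integrable sigmaS f" and z: "!!l Y. Y \<in> sph_harm l ==> (\<integral>S x. f x * Y x) = 0"
  and g: "continuous_on SS g"
 shows "(\<integral>S x. f x * g x) = 0"
proof -
 have H: "(\<integral>S x. f x * q x) = 0" if "q \<in> Hsp" for q
 proof -
  from HspE[OF that] obtain Ys N where Y: "ALL l. Ys l \<in> sph_harm l" "ALL x M. x \<in> SS --> N <= M --> q x = (\<Sum>l<M. Ys l x)" by metis
  have "(\<integral>S x. f x * q x) = (\<integral>S x. (\<Sum>l<N. f x * Ys l x))"
   by (rule LINT_cong[OF refl]) (simp add: sum_distrib_left[symmetric] Y(2)[rule_format, OF _ order_refl])
  also have "... = (\<Sum>l<N. (\<integral>S x. f x * Ys l x))"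
   by (rule LINT_sum) (use Y f in \<open>blast intro: int_mult_cont sph_harm_cont\<close>)
  also have "... = 0" by (simp add: z[OF Y(1)[rule_format]])
  finally show ?thesis .
 qed
 have le: "\<bar>(\<integral>S x. f x * g x)\<bar> <= 0 + e * (\<integral>S x. \<bar>f x\<bar>)" if e: "0 < e" for e
 proof -
  have "EX q. real_polynomial_function q & (ALL x:SS. \<bar>g x - q x\<bar> < e)"
   using Stone_Weierstrass_real_polynomial_function[of SS g e] g e by (metis compact_sphere)
  then obtain q where q: "real_polynomial_function q" "ALL x:SS. \<bar>g x - q x\<bar> < e" by blast
  have qc: "continuous_on SS q" using rpf_grad[OF q(1)] C1g_cont by blast
  have "(\<integral>S x. f x * g x) = (\<integral>S x. f x * g x) - (\<integral>S x. f x * q x)" using H[OF Hsp_poly[OF q(1)]] by simp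
  also have "... = (\<integral>S x. f x * g x - f x * q x)"
   by (rule LINT_diff[symmetric]) (auto intro: int_mult_cont f g qc)
  also have "\<bar>...\<bar> <= (\<integral>S x. e * \<bar>f x\<bar>)"
  proof (rule order_trans[OF integral_abs_bound integral_mono])
   show "integrable sigmaS (%x. \<bar>f x * g x - f x * q x\<bar>)" by (intro integrable_abs LINT_integrable_diff int_mult_cont f g qc)
   show "integrable sigmaS (%x. e * \<bar>f x\<bar>)" using f by simp
   fix x assume "x \<in> space sigmaS"
   then have "\<bar>f x\<bar> * \<bar>g x - q x\<bar> <= \<bar>f x\<bar> * e" using q(2) by (intro mult_left_mono) (auto intro: less_imp_le)
   then show "\<bar>f x * g x - f x * q x\<bar> <= e * \<bar>f x\<bar>" by (simp add: abs_mult[symmetric] right_diff_distrib mult.commute)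
  qed
  finally show ?thesis by simp
 qed
 have "\<bar>(\<integral>S x. f x * g x)\<bar> <= 0"
 proof (rule field_le_epsilon)
  fix e :: real assume e: "0 < e"
  define A where "A = (\<integral>S x. \<bar>f x\<bar>)"
  have A: "0 <= A" by (simp add: A_def)
  have "0 < e / (A + 1)" using e A by simp
  from le[OF this] have "\<bar>(\<integral>S x. f x * g x)\<bar> <= e / (A + 1) * A" by (simp add: A_def)
  also have "... <= e" using e A by (simp add: field_simps)
  finally show "\<bar>(\<integral>S x. f x * g x)\<bar> <= 0 + e" by simp
 qed
 then show ?thesis by simp
qed

lemma at_left_ball: "x \<in> SS ==> \<forall>\<^sub>F r in at_left 1. r *R x \<in> ball 0 1 & 0 < r & r < (1::real)"
 by (rule eventually_mono[OF eventually_at_left_real[of 0]]) auto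

text \<open>The Poisson kernel at an interior point is continuous on the sphere, so vanishing
  coefficients give a vanishing Poisson integral, whose radial limit is f almost everywhere.\<close>

theorem coeffs_unique:
 assumes f: "integrable sigmaS f" and z: "!!l Y. Y \<in> sph_harm l ==> (\<integral>S x. f x * Y x) = 0"
 shows "AE x in sigmaS. f x = 0"
proof -
 have P: "Poisson f x = 0" if "x \<in> ball 0 1" for x
  unfolding Poisson_alt by (rule cont_pairing_zero[OF f z Pker_cont_y[OF that]])
 from Poisson_Fatou[OF f] show ?thesis
 proof (rule AE_mp, intro AE_I2 impI)
  fix x assume x: "x \<in> space sigmaS" and l: "((%r. Poisson f (r *R x)) \<longlongrightarrow> f x) (at_left 1)"
  have "((%r. Poisson f (r *R x)) \<longlongrightarrow> 0) (at_left 1)"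
   by (rule tendsto_eventually, rule eventually_mono[OF at_left_ball[of x]]) (use x P in auto)
  then show "f x = 0" using tendsto_unique[OF _ l] by simp
 qed
qed

section \<open>Calculus of multiplier relations\<close>

lemma mult_rel_unique:
 assumes "mult_rel \<beta> f h" "mult_rel \<beta> f' h'" "AE x in sigmaS. f x = f' x" shows "AE x in sigmaS. h x = h' x"
proof -
 have m: "f \<in> borel_measurable sigmaS" "f' \<in> borel_measurable sigmaS" using assms by (auto simp: mult_rel_def)
 have Ym: "Y \<in> borel_measurable sigmaS" if "Y \<in> sph_harm l" for Y l using sph_harm_cont[OF that] by (intro sg.cont_meas)
 have eq: "(\<integral>S x. f x * Y x) = (\<integral>S x. f' x * Y x)" if "Y \<in> sph_harm l" for Y l
  by (rule integral_cong_AE) (use m Ym[OF that] assms(3) in auto)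
 have "AE x in sigmaS. h x - h' x = 0"
 proof (rule coeffs_unique)
  show "integrable sigmaS (%x. h x - h' x)" using assms by (auto simp: mult_rel_def)
  fix l Y assume Y: "Y \<in> sph_harm l"
  have "(\<integral>S x. (h x - h' x) * Y x) = (\<integral>S x. h x * Y x) - (\<integral>S x. h' x * Y x)"
   unfolding left_diff_distrib
   by (rule LINT_diff) (use assms Y in \<open>auto intro!: int_mult_cont sph_harm_cont simp: mult_rel_def\<close>)
  also have "... = 0" using assms Y eq[OF Y] by (simp add: mult_rel_def)
  finally show "(\<integral>S x. (h x - h' x) * Y x) = 0" .
 qed
 then show ?thesis by simp
qed

lemma mult_rel_lin:
 assumes "mult_rel \<beta> f h" "mult_rel \<beta> f' h'"
 shows "mult_rel \<beta> (%x. a * f x + b * f' x) (%x. a * h x + b * h' x)"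
proof -
 have i: "integrable sigmaS f" "integrable sigmaS h" "integrable sigmaS f'" "integrable sigmaS h'" using assms by (auto simp: mult_rel_def)
 have *: "(\<integral>S x. (a * u x + b * v x) * Y x) = a * (\<integral>S x. u x * Y x) + b * (\<integral>S x. v x * Y x)"
  if "integrable sigmaS u" "integrable sigmaS v" "Y \<in> sph_harm l" for u v Y l
 proof -
  have "integrable sigmaS (%x. u x * Y x)" "integrable sigmaS (%x. v x * Y x)"
   using that by (auto intro!: int_mult_cont sph_harm_cont)
  then show ?thesis by (simp add: distrib_right mult.assoc)
 qed
 show ?thesis unfolding mult_rel_def
 proof (intro conjI allI ballI)
  fix l Y assume Y: "Y \<in> sph_harm l"
  show "(\<integral>S x. (a * h x + b * h' x) * Y x) = \<beta> l * (\<integral>S x. (a * f x + b * f' x) * Y x)"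
   using assms Y unfolding *[OF i(2,4) Y] *[OF i(1,3) Y] mult_rel_def by (simp add: algebra_simps)
 qed (use i in auto)
qed

lemma mult_rel_add:
 assumes "mult_rel \<beta> f h" "mult_rel \<gamma> f k" shows "mult_rel (%l. a * \<beta> l + b * \<gamma> l) f (%x. a * h x + b * k x)"
 unfolding mult_rel_def
proof (intro conjI allI ballI)
 have i: "integrable sigmaS h" "integrable sigmaS k" using assms by (auto simp: mult_rel_def)
 fix l Y assume Y: "Y \<in> sph_harm l"
 have "integrable sigmaS (%x. h x * Y x)" "integrable sigmaS (%x. k x * Y x)"
  using i Y by (auto intro!: int_mult_cont sph_harm_cont)
 then show "(\<integral>S x. (a * h x + b * k x) * Y x) = (a * \<beta> l + b * \<gamma> l) * (\<integral>S x. f x * Y x)"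
  using assms Y by (simp add: mult_rel_def algebra_simps)
qed (use assms in \<open>auto simp: mult_rel_def\<close>)

lemma mult_rel_inverse:
 assumes "mult_rel \<beta> f h" "!!l. \<gamma> l * \<beta> l = 1" shows "mult_rel \<gamma> h f"
 using assms by (auto simp: mult_rel_def mult.assoc[symmetric])

lemma sum_sph_harm_cont: "(!!l. Ys l \<in> sph_harm l) ==> continuous_on A (%x. \<Sum>l<(N::nat). Ys l x)"
 by (intro continuous_on_sum sph_harm_cont)

lemma sum_mult_rel:
 fixes N :: nat
 assumes Y: "!!l. Ys l \<in> sph_harm l"
 shows "mult_rel \<beta> (%x. \<Sum>l<N. Ys l x) (%x. \<Sum>l<N. \<beta> l * Ys l x)"
 unfolding mult_rel_def
proof (intro conjI allI ballI)
 show "integrable sigmaS (%x. \<Sum>l<N. Ys l x)" by (rule sg.cont_int) (use sum_sph_harm_cont[of Ys] Y in auto)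
 show "integrable sigmaS (%x. \<Sum>l<N. \<beta> l * Ys l x)"
  by (rule sg.cont_int) (use sum_sph_harm_cont[of "%l x. \<beta> l * Ys l x"] sph_harm_cmult[OF Y] in auto)
 fix m Z assume Z: "Z \<in> sph_harm m"
 have i: "integrable sigmaS (%x. Ys l x * Z x)" for l
  by (rule sg.cont_int) (intro continuous_on_mult sph_harm_cont[OF Y] sph_harm_cont[OF Z])
 have "(\<integral>S x. (\<Sum>l<N. \<beta> l * Ys l x) * Z x) = (\<Sum>l<N. \<beta> l * (\<integral>S x. Ys l x * Z x))"
  using i by (simp add: sum_distrib_right mult.assoc)
 also have "... = (\<Sum>l<N. \<beta> m * (\<integral>S x. Ys l x * Z x))"
 proof (rule sum.cong[OF refl])
  fix l
  show "\<beta> l * (\<integral>S x. Ys l x * Z x) = \<beta> m * (\<integral>S x. Ys l x * Z x)"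
   using sph_harm_orthogonal[OF Y[of l] Z] by (cases "l = m") auto
 qed
 also have "... = \<beta> m * (\<integral>S x. (\<Sum>l<N. Ys l x) * Z x)"
  using i by (simp add: sum_distrib_right sum_distrib_left)
 finally show "(\<integral>S x. (\<Sum>l<N. \<beta> l * Ys l x) * Z x) = \<beta> m * (\<integral>S x. (\<Sum>l<N. Ys l x) * Z x)" .
qed

section \<open>Multipliers that do not increase the L^p norm\<close>

lemma Poisson_contraction:
 assumes f: "LL p f" and p: "1 <= p" and r: "0 < r" "r < 1"
 shows "LL p (%x. Poisson f (r *R x))" "nL p (%x. Poisson f (r *R x)) <= nL p f"
proof -
 have a: "(\<integral>S y. \<bar>Pker (r *R x) y\<bar>) = 1" if x: "x \<in> SS" for x
 proof -
  have "0 < Pker (r *R x) y" if "y \<in> SS" for y using Pker_pos[OF rball that] x r by auto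
  then have "(\<integral>S y. \<bar>Pker (r *R x) y\<bar>) = (\<integral>S y. Pker (r *R x) y)"
   by (intro LINT_cong) (auto simp: less_imp_le)
  then show ?thesis using Pker_integral[OF x r] by simp
 qed
 have b: "(\<integral>S x. \<bar>Pker (r *R x) y\<bar>) = (\<integral>S x. \<bar>Pker (r *R y) x\<bar>)" if "y \<in> SS" for y
  by (rule LINT_cong) (use that Pker_sym in auto)
 have K: "continuous_on (space sigmaS \<times> space sigmaS) (%(x,y). Pker (r *R x) y)"
  using rsphere_kernel_cont[OF r Pker_cont] by simp
 note S = Schur_test[OF sg.cmeas_axioms sg.cmeas_axioms K zero_less_one _ _ f p]
 show "LL p (%x. Poisson f (r *R x))" unfolding Poisson_alt by (rule S) (auto simp: a b)
 have "nL p (%x. Poisson f (r *R x)) <= 1 * nL p f" unfolding Poisson_alt by (rule S) (auto simp: a b)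
 then show "nL p (%x. Poisson f (r *R x)) <= nL p f" by simp
qed

text \<open>Asked for finite sums of harmonics, where the multiplier is a formula and not a limit;
  \<open>contractive_extend\<close> supplies L^p. In this form the notion is closed under products,
  subconvex combinations and pointwise limits of symbols.\<close>

definition contractive :: "real => (nat => real) => bool" where
 "contractive p \<beta> \<longleftrightarrow> (ALL Ys N. (ALL l. Ys l \<in> sph_harm l) -->
   nL p (%x. \<Sum>l<N. \<beta> l * Ys l x) <= nL p (%x. \<Sum>l<N. Ys l x))"

lemma sum_sph_harm_Lp:
 fixes N :: nat
 assumes "!!l. Ys l \<in> sph_harm l" "1 <= p" shows "LL p (%x. \<Sum>l<N. \<beta> l * Ys l x)"
 by (rule sg.cont_in_Lp) (use assms in \<open>auto intro!: continuous_intros sph_harm_cont[OF assms(1)]\<close>)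

lemma Lp_nm_cong: "(!!x. x \<in> space M ==> f x = g x) ==> Lp_nm M p f = Lp_nm M p g"
 unfolding Lp_nm_def by (intro arg_cong2[where f="(powr)"] refl LINT_cong) auto

lemma contractive_power:
 assumes p: "1 <= p" and r: "0 < r" "r < 1" shows "contractive p (%l. r ^ l)"
 unfolding contractive_def
proof (intro allI impI)
 fix Ys and N :: nat assume Y: "ALL l. Ys l \<in> sph_harm l"
 define f where "f x = (\<Sum>l<N. Ys l x)" for x
 have f: "LL p f" using sum_sph_harm_Lp[of Ys p "%_. 1" N] Y p by (simp add: f_def[abs_def])
 have "Poisson f (r *R x) = (\<Sum>l<N. r ^ l * Ys l x)" if x: "x \<in> SS" for x
 proof -
  have b: "r *R x \<in> ball 0 1" using x r by (intro rball) auto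
  have "Poisson f (r *R x) = (\<Sum>l<N. Poisson (Ys l) (r *R x))"
   unfolding Poisson_alt f_def sum_distrib_right
   by (rule LINT_sum) (use Y b in \<open>blast intro: int_mult_cont sg.cont_int sph_harm_cont Pker_cont_y\<close>)
  also have "... = (\<Sum>l<N. r ^ l * Ys l x)"
   by (intro sum.cong refl) (simp add: Poisson_sph_harm[OF Y[rule_format] b] sph_harm_homogeneous[OF Y[rule_format]])
  finally show ?thesis .
 qed
 then have "nL p (%x. \<Sum>l<N. r ^ l * Ys l x) = nL p (%x. Poisson f (r *R x))"
  by (intro Lp_nm_cong) simp
 then show "nL p (%x. \<Sum>l<N. r ^ l * Ys l x) <= nL p (%x. \<Sum>l<N. Ys l x)"
  using Poisson_contraction(2)[OF f p r] by (simp add: f_def[abs_def])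
qed

lemma contractive_const: "0 <= c ==> c <= 1 ==> 1 <= p ==> contractive p (%_. c)"
 unfolding contractive_def
 using Lp_nm_scaleR[of p sigmaS c "_::R3 => real"] by (simp add: sum_distrib_left[symmetric] mult_left_le_one_le)

lemma contractive_mult:
 assumes "contractive p \<beta>" "contractive p \<gamma>" shows "contractive p (%l. \<beta> l * \<gamma> l)"
 unfolding contractive_def
proof (intro allI impI)
 fix Ys and N :: nat assume Y: "ALL l. Ys l \<in> sph_harm l"
 then have "ALL l. (%x. \<gamma> l * Ys l x) \<in> sph_harm l" using sph_harm_cmult by blast
 then have "nL p (%x. \<Sum>l<N. \<beta> l * (\<gamma> l * Ys l x)) <= nL p (%x. \<Sum>l<N. \<gamma> l * Ys l x)"
  using assms(1) unfolding contractive_def by (elim allE[of _ "%l x. \<gamma> l * Ys l x"]) blast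
 also have "... <= nL p (%x. \<Sum>l<N. Ys l x)" using assms(2) Y unfolding contractive_def by blast
 finally show "nL p (%x. \<Sum>l<N. \<beta> l * \<gamma> l * Ys l x) <= nL p (%x. \<Sum>l<N. Ys l x)" by (simp add: mult.assoc)
qed

lemma contractive_sum:
 fixes n :: nat
 assumes "!!j. contractive p (\<beta> j)" "!!j. 0 <= c j" "(\<Sum>j<n. c j) <= 1" "1 <= p"
 shows "contractive p (%l. \<Sum>j<n. c j * \<beta> j l)"
 unfolding contractive_def
proof (intro allI impI)
 fix Ys and N :: nat assume Y: "ALL l. Ys l \<in> sph_harm l"
 define f where "f j x = (\<Sum>l<N. \<beta> j l * Ys l x)" for j x
 have f: "LL p (f j)" for j unfolding f_def[abs_def] using Y assms(4) by (intro sum_sph_harm_Lp) auto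
 have fle: "nL p (f j) <= nL p (%x. \<Sum>l<N. Ys l x)" for j
  using assms(1) Y unfolding contractive_def f_def[abs_def] by blast
 have "(\<Sum>l<N. (\<Sum>j<n. c j * \<beta> j l) * Ys l x) = (\<Sum>j<n. c j *R f j x)" for x
  unfolding f_def sum_distrib_right scaleR_conv_of_real sum_distrib_left by (subst sum.swap) (simp add: mult.assoc)
 then have "nL p (%x. \<Sum>l<N. (\<Sum>j<n. c j * \<beta> j l) * Ys l x) <= (\<Sum>j<n. nL p (%x. c j *R f j x))"
  by simp (rule Lp_nm_sum_le, use in_Lp_scaleR[OF f] assms(4) in auto)
 also have "... = (\<Sum>j<n. c j * nL p (f j))"
  using assms(2,4) by (intro sum.cong refl) (subst Lp_nm_scaleR, auto)
 also have "... <= (\<Sum>j<n. c j * nL p (%x. \<Sum>l<N. Ys l x))"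
  using assms(2) fle by (intro sum_mono mult_left_mono) auto
 also have "... = (\<Sum>j<n. c j) * nL p (%x. \<Sum>l<N. Ys l x)" by (simp add: sum_distrib_right)
 also have "... <= 1 * nL p (%x. \<Sum>l<N. Ys l x)" using assms(3) by (intro mult_right_mono) auto
 finally show "nL p (%x. \<Sum>l<N. (\<Sum>j<n. c j * \<beta> j l) * Ys l x) <= nL p (%x. \<Sum>l<N. Ys l x)" by simp
qed

text \<open>For a fixed finite sum, convergence of finitely many symbol values is convergence in
  norm.\<close>

lemma contractive_lim:
 fixes \<beta> :: "nat => nat => real"
 assumes "!!n. contractive p (\<beta> n)" "!!l. (%n. \<beta> n l) \<longlonglongrightarrow> \<gamma> l" and p: "1 <= p"
 shows "contractive p \<gamma>"
 unfolding contractive_def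
proof (intro allI impI)
 fix Ys and N :: nat assume Y: "ALL l. Ys l \<in> sph_harm l"
 define f where "f c x = (\<Sum>l<N. c l * Ys l x)" for c x
 have f: "LL p (f c)" for c unfolding f_def[abs_def] using Y p by (intro sum_sph_harm_Lp) auto
 have YL: "LL p (Ys l)" for l using Y p by (intro sg.cont_in_Lp sph_harm_cont) auto
 have lim0: "(%n. nL p (%x. f (\<beta> n) x - f \<gamma> x)) \<longlonglongrightarrow> 0"
 proof (rule tendsto_sandwich[OF _ _ tendsto_const])
  have "nL p (%x. f (\<beta> n) x - f \<gamma> x) <= (\<Sum>l<N. \<bar>\<beta> n l - \<gamma> l\<bar> * nL p (Ys l))" for n
  proof -
   have "nL p (%x. f (\<beta> n) x - f \<gamma> x) = nL p (%x. \<Sum>l<N. (\<beta> n l - \<gamma> l) *R Ys l x)"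
    by (simp add: f_def sum_subtractf left_diff_distrib)
   also have "... <= (\<Sum>l<N. nL p (%x. (\<beta> n l - \<gamma> l) *R Ys l x))"
    by (rule Lp_nm_sum_le) (use in_Lp_scaleR[OF YL] p in auto)
   also have "... = (\<Sum>l<N. \<bar>\<beta> n l - \<gamma> l\<bar> * nL p (Ys l))"
    using p by (intro sum.cong refl Lp_nm_scaleR) auto
   finally show ?thesis .
  qed
  then show "\<forall>\<^sub>F n in sequentially. nL p (%x. f (\<beta> n) x - f \<gamma> x) <= (\<Sum>l<N. \<bar>\<beta> n l - \<gamma> l\<bar> * nL p (Ys l))" by simp
  have "(%n. \<Sum>l<N. \<bar>\<beta> n l - \<gamma> l\<bar> * nL p (Ys l)) \<longlonglongrightarrow> (\<Sum>l<N. \<bar>\<gamma> l - \<gamma> l\<bar> * nL p (Ys l))"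
   by (intro tendsto_sum tendsto_mult tendsto_rabs tendsto_diff tendsto_const assms(2))
  then show "(%n. \<Sum>l<N. \<bar>\<beta> n l - \<gamma> l\<bar> * nL p (Ys l)) \<longlonglongrightarrow> 0" by simp
 qed simp
 have "(%n. nL p (f (\<beta> n))) \<longlonglongrightarrow> nL p (f \<gamma>)"
  by (rule Lp_nm_tendsto[OF f f p lim0])
 then have "nL p (f \<gamma>) <= nL p (%x. \<Sum>l<N. Ys l x)"
  by (rule LIMSEQ_le_const2) (use assms(1) Y in \<open>auto simp: contractive_def f_def[abs_def]\<close>)
 then show "nL p (%x. \<Sum>l<N. \<gamma> l * Ys l x) <= nL p (%x. \<Sum>l<N. Ys l x)"
  by (simp add: f_def[abs_def])
qed

text \<open>(1-s)/(1-s^(cl+1)) is the sum over j of (1-s) s^j (s^(cj))^l, a convex combination of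
  Poisson symbols of radii s^(cj); s -> 1 gives 1/(cl+1). The case c = 1 inverts l + 1, the case c =
  2 serves the duality argument for the projection.\<close>

lemma contractive_recip:
 assumes p: "1 <= p" and c: "0 < c" shows "contractive p (%l. 1 / (real (c * l) + 1))"
proof -
 \<comment> \<open>The quotient (1-s)/(1-s^(cl+1)) as reciprocal of a finite geometric sum, a form
   that is continuous at s = 1.\<close>
 define \<gamma> where "\<gamma> s l = 1 / (\<Sum>i<Suc (c * l). s ^ i)" for s :: real and l :: nat
 have 1: "contractive p (\<gamma> s)" if s: "0 < s" "s < 1" for s
 proof (rule contractive_lim[OF _ _ p])
  show "contractive p (%l. \<Sum>j<n. ((1 - s) * s ^ j) * (s ^ (c * j)) ^ l)" for n
  proof (rule contractive_sum[OF _ _ _ p])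
   show "contractive p (%l. (s ^ (c * j)) ^ l)" for j
   proof (cases "j = 0")
    case True then show ?thesis using contractive_const[of 1 p] p by simp
   next
    case False
    then show ?thesis using s p by (intro contractive_power) (use c in \<open>auto simp: power_less_one_iff\<close>)
   qed
   have "(\<Sum>j<n. (1 - s) * s ^ j) = 1 - s ^ n" using one_diff_power_eq[of s n] by (simp add: sum_distrib_left)
   then show "(\<Sum>j<n. (1 - s) * s ^ j) <= 1" using s by simp
  qed (use s in simp)
  fix l
  have "s ^ Suc (c * l) < 1" using s by (subst power_less_one_iff) auto
  then have sl: "norm (s ^ Suc (c * l)) < 1" using s by simp
  have "(%n. (1 - s) * (\<Sum>j<n. (s ^ Suc (c * l)) ^ j)) \<longlonglongrightarrow> (1 - s) * (1 / (1 - s ^ Suc (c * l)))"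
   using geometric_sums[OF sl] by (intro tendsto_mult tendsto_const) (simp only: sums_def)
  moreover have "(1 - s) * (1 / (1 - s ^ Suc (c * l))) = \<gamma> s l"
   using s unfolding one_diff_power_eq[of s "Suc (c * l)"] \<gamma>_def by simp
  moreover have "(1 - s) * (\<Sum>j<n. (s ^ Suc (c * l)) ^ j) = (\<Sum>j<n. ((1 - s) * s ^ j) * (s ^ (c * j)) ^ l)" for n
   by (simp add: sum_distrib_left power_mult[symmetric] power_add[symmetric] mult.assoc mult.commute algebra_simps)
  ultimately show "(%n. \<Sum>j<n. ((1 - s) * s ^ j) * (s ^ (c * j)) ^ l) \<longlonglongrightarrow> \<gamma> s l" by simp
 qed
 define s where "s n = 1 - 1 / real (Suc (Suc n))" for n
 show ?thesis
 proof (rule contractive_lim[OF _ _ p])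
  show "contractive p (\<gamma> (s n))" for n by (rule 1) (auto simp: s_def)
  have s1: "s \<longlonglongrightarrow> 1"
  proof -
   have "(%n. 1 - 1 / real (Suc (Suc n))) \<longlonglongrightarrow> 1 - 0"
    by (intro tendsto_diff tendsto_const LIMSEQ_Suc[OF LIMSEQ_Suc[OF lim_1_over_n]])
   then show ?thesis by (simp add: s_def[abs_def])
  qed
  fix l
  have "(%n. \<gamma> (s n) l) \<longlonglongrightarrow> 1 / (\<Sum>i<Suc (c * l). 1 ^ i)"
   unfolding \<gamma>_def by (intro tendsto_divide tendsto_const tendsto_sum tendsto_power s1) (simp del: of_nat_mult)
  then show "(%n. \<gamma> (s n) l) \<longlonglongrightarrow> 1 / (real (c * l) + 1)" by (simp add: add.commute del: of_nat_mult)
 qed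
qed

text \<open>With x = 1/(l+1) the symbol is (1 - sqrt (1-x))/x, the smaller root of L = (1 + x
  L^2)/2. The iteration of this equation from 0 uses only products and averages, which preserve
  contractivity, so no series coefficients have to be computed.\<close>

lemma contractive_sqrt_defect:
 assumes p: "1 <= p" shows "contractive p (%l. (real l + 1) - sqrtLap l)"
proof -
 define m :: "nat => nat => real" where "m = rec_nat (%_. 0) (%_ f l. 1/2 * 1 + 1/2 * (1 / (real l + 1) * (f l * f l)))"
 have m0: "m 0 = (%_. 0)" and mS: "m (Suc n) = (%l. 1/2 * 1 + 1/2 * (1 / (real l + 1) * (m n l * m n l)))" for n
  by (auto simp: m_def)
 have add: "contractive p (%l. 1/2 * \<beta> l + 1/2 * \<gamma> l)" if "contractive p \<beta>" "contractive p \<gamma>" for \<beta> \<gamma>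
  using contractive_sum[of p "%j. if j = 0 then \<beta> else \<gamma>" "%_. 1/2" 2] that p by (auto simp: numeral_2_eq_2)
 show ?thesis
 proof (rule contractive_lim[OF _ _ p])
  show "contractive p (m n)" for n
  proof (induction n)
   case 0 then show ?case using contractive_const[of 0 p] p by (simp add: m0)
  next
   case (Suc n)
   show ?case unfolding mS
    using contractive_recip[OF p, of 1] by (intro add contractive_mult Suc p contractive_const) auto
  qed
  fix l
  define x where "x = 1 / (real l + 1)"
  have x: "0 < x" "x <= 1" by (auto simp: x_def)
  have R: "m (Suc n) l = (1 + x * (m n l)\<^sup>2) / 2" for n     proof -
   have "1/2 * 1 + 1/2 * t = (1 + t) / 2" for t :: real by simp
   then show ?thesis by (simp only: mS x_def power2_eq_square)
  qed
  have b: "0 <= m n l & m n l <= 1" for n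
  proof (induction n)
   case 0 then show ?case by (simp add: m0)
  next
   case (Suc n)
   then have "(m n l)\<^sup>2 <= 1" by (simp add: abs_square_le_1)
   then have "x * (m n l)\<^sup>2 <= 1" "0 <= x * (m n l)\<^sup>2" using x by (auto intro: mult_le_one)
   then show ?case unfolding R by simp
  qed
  have inc: "m n l <= m (Suc n) l" for n
  proof (induction n)
   case 0 then show ?case using b[of 1] by (simp add: m0)
  next
   case (Suc n)
   have "x * (m n l)\<^sup>2 <= x * (m (Suc n) l)\<^sup>2" using Suc b x by (intro mult_left_mono power_mono) auto
   then show ?case unfolding R[of n] R[of "Suc n"] by simp
  qed
  obtain L where L: "(%n. m n l) \<longlonglongrightarrow> L"
   by (rule incseq_convergent[of "%n. m n l" 1]) (use inc b in \<open>auto intro: incseq_SucI\<close>)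
  have L1: "L <= 1" by (rule LIMSEQ_le_const2[OF L]) (use b in auto)
  have "(%n. (1 + x * (m n l)\<^sup>2) / 2) \<longlonglongrightarrow> (1 + x * L\<^sup>2) / 2" by (intro tendsto_intros L) auto
  then have "(%n. m (Suc n) l) \<longlonglongrightarrow> (1 + x * L\<^sup>2) / 2" by (simp only: R)
  from LIMSEQ_unique[OF LIMSEQ_Suc[OF L] this] have "L = (1 + x * L\<^sup>2) / 2" .
  then have "2 * L = 2 * ((1 + x * L\<^sup>2) / 2)" by (rule arg_cong)
  then have "2 * L = 1 + x * L\<^sup>2" by (simp only: times_divide_eq_right nonzero_mult_div_cancel_left[OF zero_neq_numeral[symmetric]])
  then have q: "x * L\<^sup>2 = 2 * L - 1" by (simp only: add_diff_cancel_left')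
  have "(1 - x * L)\<^sup>2 = 1 - 2 * x * L + x * (x * L\<^sup>2)" by (simp add: power2_eq_square algebra_simps)
  also have "... = 1 - x" unfolding q by (simp add: algebra_simps)
  finally have "(1 - x * L)\<^sup>2 = 1 - x" .
  \<comment> \<open>This sign selects the smaller root; it holds because the iterates never exceed
    1.\<close>
  moreover have "0 <= 1 - x * L"
  proof (cases "0 <= L")
   case True then have "x * L <= 1" using x L1 by (intro mult_le_one) auto
   then show ?thesis by simp
  next
   case False then have "x * L <= 0" using x by (intro mult_nonneg_nonpos) auto
   then show ?thesis by simp
  qed
  ultimately have e: "sqrt (1 - x) = 1 - x * L" by (rule real_sqrt_unique)
  have "real l * (real l + 1) = (real l + 1)\<^sup>2 * (1 - x)" by (simp add: x_def power2_eq_square field_simps)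
  then have "sqrtLap l = sqrt ((real l + 1)\<^sup>2) * sqrt (1 - x)"
   unfolding sqrtLap_def by (simp only: real_sqrt_mult)
  also have "... = (real l + 1) * (1 - x * L)" unfolding e by simp
  also have "... = real l + 1 - (real l + 1) * x * L" by (simp add: algebra_simps)
  also have "(real l + 1) * x = 1" by (simp add: x_def)
  finally have "L = (real l + 1) - sqrtLap l" by simp
  then show "(%n. m n l) \<longlonglongrightarrow> (real l + 1) - sqrtLap l" using L by simp
 qed
qed

section \<open>From finite sums of harmonics to L^p\<close>

lemma pairing_tendsto:
 fixes f :: "nat => R3 => real" and g Y :: "R3 => real"
 assumes f: "!!n. integrable sigmaS (f n)" "integrable sigmaS g" and lim: "(%n. \<integral>S x. norm (f n x - g x)) \<longlonglongrightarrow> 0"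
  and Y: "continuous_on SS Y"
 shows "(%n. \<integral>S x. f n x * Y x) \<longlonglongrightarrow> (\<integral>S x. g x * Y x)"
proof -
 obtain B where B: "0 < B" "!!x. x \<in> SS ==> norm (Y x) <= B" using sg.cont_bound[of Y] Y by auto
 show ?thesis
 proof (rule LIM_zero_cancel[OF Lim_null_comparison])
  show "\<forall>\<^sub>F n in sequentially. norm ((\<integral>S x. f n x * Y x) - (\<integral>S x. g x * Y x)) <= B * (\<integral>S x. norm (f n x - g x))"
  proof (intro always_eventually allI)
   fix n
   have "(\<integral>S x. f n x * Y x) - (\<integral>S x. g x * Y x) = (\<integral>S x. (f n x - g x) * Y x)"
    unfolding left_diff_distrib by (rule LINT_diff[symmetric]) (auto intro: int_mult_cont f Y)
   also have "norm ... <= (\<integral>S x. B * norm (f n x - g x))"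
    unfolding real_norm_def
   proof (rule order_trans[OF integral_abs_bound integral_mono])
    show "integrable sigmaS (%x. \<bar>(f n x - g x) * Y x\<bar>)" by (intro integrable_abs int_mult_cont LINT_integrable_diff f Y)
    show "integrable sigmaS (%x. B * \<bar>f n x - g x\<bar>)" using f by auto
    show "\<bar>(f n x - g x) * Y x\<bar> <= B * \<bar>f n x - g x\<bar>" if "x \<in> space sigmaS" for x
     using B(2)[of x] that by (auto simp: abs_mult mult.commute[of _ "\<bar>Y x\<bar>"] intro: mult_right_mono)
   qed
   finally show "norm ((\<integral>S x. f n x * Y x) - (\<integral>S x. g x * Y x)) <= B * (\<integral>S x. norm (f n x - g x))"
    by simp
  qed
  show "(%n. B * (\<integral>S x. norm (f n x - g x))) \<longlonglongrightarrow> 0" using tendsto_mult_right_zero[OF lim] by simp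
 qed
qed

lemma Lp_poly_seq:
 assumes f: "LL p f" and p: "1 <= p"
 shows "EX q :: nat => R3 => real. (ALL n. real_polynomial_function (q n) & LL p (q n)) &
  Lconv p q f"
proof -
 have "ALL n. EX q. real_polynomial_function q & nL p (%x. f x - q x) < 1 / real (Suc n)"
 proof
  fix n
  have "0 < 1 / real (Suc n)" by simp
  from Lp_poly_approx[OF f p this] obtain q where "real_polynomial_function q" "nL p (%x. f x - q x) < 1 / real (Suc n)" .
  then show "EX q. real_polynomial_function q & nL p (%x. f x - q x) < 1 / real (Suc n)" by blast
 qed
 from choice[OF this] obtain q where q: "ALL n. real_polynomial_function (q n) & nL p (%x. f x - q n x) < 1 / real (Suc n)" ..
 have qL: "LL p (q n)" for n
 proof (rule sg.cont_in_Lp)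
  have "C1g (q n) (grad (q n))" using rpf_grad q by blast
  then show "continuous_on (space sigmaS) (q n)" by (rule C1g_cont)
 qed (use p in simp)
 have "Lconv p q f"
 proof (rule tendsto_sandwich[OF _ _ tendsto_const LIMSEQ_Suc[OF lim_1_over_n]])
  show "\<forall>\<^sub>F n in sequentially. nL p (%x. q n x - f x) <= 1 / real (Suc n)"
  proof (intro always_eventually allI)
   fix n show "nL p (%x. q n x - f x) <= 1 / real (Suc n)"
    using q[rule_format, of n] Lp_nm_minus_commute[of sigmaS p "q n" f] by simp
  qed
 qed simp
 then show ?thesis using q qL by blast
qed

lemma Lp_limit_cauchy:
 assumes f: "!!n. in_Lp M p (f n)" "in_Lp M p g" "(%n. Lp_nm M p (%x. f n x - g x)) \<longlonglongrightarrow> 0" and p: "1 <= p" and e: "0 < (e::real)"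
 shows "EX N. ALL m>=N. ALL n>=N. Lp_nm M p (%x. f m x - f n x) < e"
proof -
 obtain N where N: "!!n. N <= n ==> Lp_nm M p (%x. f n x - g x) < e/2"
  using LIMSEQ_D[OF f(3), of "e/2"] e by auto
 have "Lp_nm M p (%x. f m x - f n x) < e" if "N <= m" "N <= n" for m n
 proof -
  have "Lp_nm M p (%x. (f m x - g x) - (f n x - g x)) <= Lp_nm M p (%x. f m x - g x) + Lp_nm M p (%x. f n x - g x)"
   by (rule Lp_nm_triangle_diff) (intro in_Lp_diff f p)+
  then show ?thesis using N[OF that(1)] N[OF that(2)] by simp
 qed
 then show ?thesis by blast
qed

lemma mult_rel_limit:
 assumes m: "!!n. mult_rel \<beta> (f n) (h n)" and L: "!!n. LL p (f n)" "LL p g" "!!n. LL p (h n)" "LL p k"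
  and lim: "Lconv p f g" "Lconv p h k" and p: "1 < p"
 shows "mult_rel \<beta> g k"
 unfolding mult_rel_def
proof (intro conjI allI ballI)
 have p1: "1 <= p" using p by simp
 have i: "integrable sigmaS (f n)" "integrable sigmaS (h n)" "integrable sigmaS g" "integrable sigmaS k" for n
  using L by (auto intro: in_Lp_integrable[OF sg.finite_measure_axioms _ p1])
 show "integrable sigmaS g" "integrable sigmaS k" by (rule i)+
 fix l Y assume Y: "Y \<in> sph_harm l"
 have c: "continuous_on SS Y" by (rule sph_harm_cont[OF Y])
 have "(%n. \<integral>S x. h n x * Y x) \<longlonglongrightarrow> (\<integral>S x. k x * Y x)"
  by (rule pairing_tendsto[OF i(2,4) L1_tendsto[OF sg.finite_measure_axioms L(3,4) p lim(2)] c])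
 moreover have "(%n. \<beta> l * (\<integral>S x. f n x * Y x)) \<longlonglongrightarrow> \<beta> l * (\<integral>S x. g x * Y x)"
  by (intro tendsto_mult tendsto_const pairing_tendsto[OF i(1,3) L1_tendsto[OF sg.finite_measure_axioms L(1,2) p lim(1)] c])
 moreover have "(\<integral>S x. h n x * Y x) = \<beta> l * (\<integral>S x. f n x * Y x)" for n
  using m Y by (auto simp: mult_rel_def)
 ultimately show "(\<integral>S x. k x * Y x) = \<beta> l * (\<integral>S x. g x * Y x)" using LIMSEQ_unique by simp
qed

theorem contractive_extend:
 assumes c: "contractive p \<beta>" and p: "1 < p" and f: "LL p f"
 obtains k where "LL p k" "nL p k <= nL p f" "mult_rel \<beta> f k"
proof -
 have p1: "1 <= p" using p by simp
 obtain q :: "nat => R3 => real" where q: "!!n. real_polynomial_function (q n)" "!!n. LL p (q n)"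
  "Lconv p q f" using Lp_poly_seq[OF f p1] by blast
 have H: "EX k. LL p k & nL p k <= nL p g & mult_rel \<beta> g k" if "g \<in> Hsp" for g
 proof -
  from HspE[OF that] obtain Ys N where Y: "ALL l. Ys l \<in> sph_harm l" "ALL x M. x \<in> SS --> N <= M --> g x = (\<Sum>l<M. Ys l x)" by metis
  have gY: "x \<in> space sigmaS ==> g x = (\<Sum>l<N. Ys l x)" for x using Y(2) by simp
  have e: "nL p g = nL p (%x. \<Sum>l<N. Ys l x)" by (rule Lp_nm_cong) (rule gY)
  have c': "(\<integral>S x. g x * Z x) = (\<integral>S x. (\<Sum>l<N. Ys l x) * Z x)" for Z
   by (rule LINT_cong) (auto simp only: gY)
  have gi: "integrable sigmaS g \<longleftrightarrow> integrable sigmaS (%x. \<Sum>l<N. Ys l x)"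
   by (rule LINT_integrable_cong) (auto simp only: gY)
  have "mult_rel \<beta> g (%x. \<Sum>l<N. \<beta> l * Ys l x)"
   using sum_mult_rel[of Ys \<beta> N] Y unfolding mult_rel_def c' gi by blast
  moreover have "nL p (%x. \<Sum>l<N. \<beta> l * Ys l x) <= nL p g"
   using c Y unfolding contractive_def e by blast
  moreover have "LL p (%x. \<Sum>l<N. \<beta> l * Ys l x)" using Y p by (intro sum_sph_harm_Lp) auto
  ultimately show ?thesis by blast
 qed
 have "ALL n. EX k. LL p k & nL p k <= nL p (q n) & mult_rel \<beta> (q n) k"
  using H Hsp_poly[OF q(1)] by blast
 from choice[OF this] obtain k where k: "ALL n. LL p (k n) & nL p (k n) <= nL p (q n) & mult_rel \<beta> (q n) (k n)" ..
 \<comment> \<open>The images \<open>k n\<close> are chosen separately for each n. Uniqueness of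
   coefficients identifies the difference of two of them with the image of \<open>q m - q n\<close>,
   and only then does contractivity make them Cauchy.\<close>
 have d: "nL p (%x. k m x - k n x) <= nL p (%x. q m x - q n x)" for m n
 proof -
  have qq: "(%x. 1 * q m x + (-1) * q n x) \<in> Hsp" by (intro Hsp_lin Hsp_poly q)
  obtain k' where k': "LL p k'" "nL p k' <= nL p (%x. 1 * q m x + (-1) * q n x)" "mult_rel \<beta> (%x. 1 * q m x + (-1) * q n x) k'"
   using H[OF qq] by blast
  have "mult_rel \<beta> (%x. 1 * q m x + (-1) * q n x) (%x. 1 * k m x + (-1) * k n x)" using k by (intro mult_rel_lin) auto
  from mult_rel_unique[OF this k'(3)] have "AE x in sigmaS. k m x - k n x = k' x" by simp
  then have "nL p (%x. k m x - k n x) = nL p k'"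
   by (intro Lp_nm_cong_AE borel_measurable_diff in_Lp_measurable[of _ p]) (use k k'(1) in auto)
  then show ?thesis using k'(2) by simp
 qed
 obtain h where h: "LL p h" "Lconv p k h"
 proof (rule Lp_complete[of sigmaS p k])
  fix e :: real assume "0 < e"
  from Lp_limit_cauchy[OF q(2) f q(3) p1 this] show "EX N. ALL m>=N. ALL n>=N. nL p (%x. k m x - k n x) < e"
   using d by (meson le_less_trans)
 qed (use k p in auto)
 have kn: "(%n. nL p (k n)) \<longlonglongrightarrow> nL p h" by (rule Lp_nm_tendsto) (use k h p in auto)
 have qn: "(%n. nL p (q n)) \<longlonglongrightarrow> nL p f" by (rule Lp_nm_tendsto[OF q(2) f p1 q(3)])
 have "nL p h <= nL p f" by (rule LIMSEQ_le[OF kn qn]) (use k in auto)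
 moreover have "mult_rel \<beta> f h" by (rule mult_rel_limit[OF _ q(2) f _ h(1) q(3) h(2) p]) (use k in auto)
 ultimately show ?thesis using that h(1) by blast
qed

section \<open>Conjugate functions on the circle\<close>

abbreviation "circ \<equiv> Iv (-pi) pi"
abbreviation "nC \<equiv> Lp_nm circ"
abbreviation cint :: "(real => 'b::{banach,second_countable_topology}) => 'b" (binder "\<integral>C" 10)
 where "cint \<equiv> integral\<^sup>L circ"

interpretation cc: cmeas circ by (rule cmeas_Iv)

text \<open>Cauchy's formula at the centre. Its circle is parametrised over [0, 2 pi], and a shift
  by pi moves the mean to the symmetric interval.\<close>

lemma circle_mean:
 assumes G: "G holomorphic_on ball 0 1" and r: "0 < r" "r < 1"
 shows "(\<integral>C t. G (of_real r * cis t)) = of_real (2 * pi) * G 0"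
proof -
 have sub: "cball 0 r \<subseteq> ball (0::complex) 1" using r by auto
 have "((%u. G u / (u - 0)) has_contour_integral (2 * of_real pi * \<i> * G 0)) (circlepath 0 r)"
  by (rule Cauchy_integral_circlepath_simple) (use holomorphic_on_subset[OF G sub] r in auto)
 then have "((%t. G (0 + r * cis t) / (0 + r * cis t - 0) * r * \<i> * cis t) has_integral (2 * of_real pi * \<i> * G 0)) {0..2*pi}"
  unfolding circlepath_def by (subst (asm) has_contour_integral_part_circlepath_iff) auto
 then have "((%t. \<i> * G (r * cis t)) has_integral (2 * of_real pi * \<i> * G 0)) {0..2*pi}"
  by (rule has_integral_eq[rotated]) (use r in auto)
 from has_integral_mult_right[OF this, of "-\<i>"] have "((%t. G (r * cis t)) has_integral (2 * of_real pi * G 0)) {0..2*pi}"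
  by (simp add: mult.assoc[symmetric]) (simp add: mult.assoc mult.left_commute[of \<i>])
 then have I: "integral {0..2*pi} (%t. G (r * cis t)) = 2 * of_real pi * G 0" by (rule integral_unique)
 have c: "continuous_on UNIV (%t. G (r * cis t))"
  by (rule continuous_on_compose2[OF holomorphic_on_imp_continuous_on[OF G]]) (use r in \<open>auto intro!: continuous_intros simp: norm_mult\<close>)
 have c': "continuous_on A (%t. G (r * cis t))" for A using c continuous_on_subset by blast
 have per: "G (r * cis (t + 2 * pi)) = G (r * cis t)" for t by (simp add: cis.ctr)
 have "(\<integral>C t. G (r * cis t)) = (\<integral>C t. G (r * cis (t + pi)))"
  by (rule integral_periodic_shift[OF c per, symmetric])
 also have "... = integral {-pi..pi} (%t. G (r * cis (t + pi)))"
  by (rule integral_Iv) (rule continuous_on_compose2[OF c], auto intro!: continuous_intros)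
 also have "... = integral {-pi+pi..pi+pi} (%t. G (r * cis t))"
  using integral_shift[of "-pi" pi pi "%t. G (r * cis t)"] c' by (simp add: o_def)
 finally show ?thesis using I by simp
qed

text \<open>Poisson kernel of the disc without its 1/(2 pi), and below it the conjugate kernel
  without its factor 2r: real and imaginary part of the Herglotz kernel.\<close>

definition pc :: "real => real => real" where "pc r t = (1 - r\<^sup>2) / (1 + r\<^sup>2 - 2 * r * cos t)"
definition ck :: "real => real => real" where "ck r t = sin t / (1 + r\<^sup>2 - 2 * r * cos t)"

lemma DD_pos': "0 <= r ==> r < 1 ==> 0 < 1 + r\<^sup>2 - 2 * r * cos t" for r t :: real
proof -
 assume r: "0 <= r" "r < 1"
 then have "0 < (1 - r)\<^sup>2" by simp
 also have "... <= 1 + r\<^sup>2 - 2 * r * cos t" by (rule DD_pos) (use r in auto)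
 finally show ?thesis .
qed

lemma pc_pos: "0 <= r ==> r < 1 ==> 0 < pc r t"
 unfolding pc_def by (rule divide_pos_pos) (simp add: abs_square_less_1, rule DD_pos')

lemma circ_kernels_cont:
 fixes f :: "'a::t2_space => real"
 assumes "0 <= r" "r < 1" "continuous_on A f" shows "continuous_on A (%x. pc r (f x))" "continuous_on A (%x. ck r (f x))"
 unfolding pc_def ck_def using DD_pos'[OF assms(1,2)] assms(3) by (auto intro!: continuous_intros simp: less_imp_neq[symmetric])

lemma Herglotz_kernel:
 assumes r: "0 <= r" "r < 1"
 shows "Re ((cis t + of_real r * cis x) / (cis t - of_real r * cis x)) = pc r (x - t)"
  and "Im ((cis t + of_real r * cis x) / (cis t - of_real r * cis x)) = 2 * r * ck r (x - t)"
proof -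
 define a b c d where "a = cos t" "b = sin t" "c = cos x" "d = sin x"
 have 1: "a\<^sup>2 + b\<^sup>2 = 1" "c\<^sup>2 + d\<^sup>2 = 1" by (auto simp: a_b_c_d_def)
 have D: "(a - r * c)\<^sup>2 + (b - r * d)\<^sup>2 = 1 + r\<^sup>2 - 2 * r * cos (x - t)"
 proof -
  have "(a - r * c)\<^sup>2 + (b - r * d)\<^sup>2 = (a\<^sup>2 + b\<^sup>2) + r\<^sup>2 * (c\<^sup>2 + d\<^sup>2) - 2 * r * (c * a + d * b)"
   by (simp add: power2_eq_square algebra_simps)
  then show ?thesis by (simp add: 1 cos_diff a_b_c_d_def)
 qed
 have N: "(a + r * c) * (a - r * c) + (b + r * d) * (b - r * d) = 1 - r\<^sup>2"
 proof -
  have "(a + r * c) * (a - r * c) + (b + r * d) * (b - r * d) = (a\<^sup>2 + b\<^sup>2) - r\<^sup>2 * (c\<^sup>2 + d\<^sup>2)"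
   by (simp add: power2_eq_square algebra_simps)
  then show ?thesis by (simp add: 1)
 qed
 have M: "(b + r * d) * (a - r * c) - (a + r * c) * (b - r * d) = 2 * r * sin (x - t)"
  by (simp add: sin_diff a_b_c_d_def algebra_simps)
 show "Re ((cis t + of_real r * cis x) / (cis t - of_real r * cis x)) = pc r (x - t)"
  using N D by (simp add: Re_divide pc_def a_b_c_d_def)
 show "Im ((cis t + of_real r * cis x) / (cis t - of_real r * cis x)) = 2 * r * ck r (x - t)"
  using M D by (simp add: Im_divide ck_def a_b_c_d_def)
qed

lemma pc_integral:
 assumes r: "0 < r" "r < 1"
 shows "(\<integral>C t. pc r (t - s)) = 2 * pi" "(\<integral>C t. pc r (s - t)) = 2 * pi"
proof -
 have h: "(%z::complex. (1 + z) / (1 - z)) holomorphic_on ball 0 1"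
  by (intro holomorphic_intros) (auto simp: dist_norm)
 have c: "continuous_on {-pi..pi} (%t. (1 + of_real r * cis t) / (1 - of_real r * cis t))"
  by (rule continuous_on_compose2[OF holomorphic_on_imp_continuous_on[OF h]]) (use r in \<open>auto intro!: continuous_intros simp: norm_mult\<close>)
 have "(\<integral>C t. pc r t) = (\<integral>C t. Re ((1 + of_real r * cis t) / (1 - of_real r * cis t)))"
  using Herglotz_kernel(1)[of r 0] r by (simp add: less_imp_le)
 also have "... = Re (\<integral>C t. (1 + of_real r * cis t) / (1 - of_real r * cis t))"
  by (rule integral_Re) (use c in \<open>auto intro: cc.cont_int\<close>)
 also have "... = 2 * pi" using circle_mean[OF h r] by simp
 finally have 1: "(\<integral>C t. pc r t) = 2 * pi" .
 have per: "pc r (t + 2 * pi) = pc r t" for t by (simp add: pc_def)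
 have "(\<integral>C t. pc r (t + - s)) = (\<integral>C t. pc r t)"
  by (rule integral_periodic_shift[OF circ_kernels_cont(1)[OF _ _ continuous_on_id] per]) (use r in auto)
 then show 2: "(\<integral>C t. pc r (t - s)) = 2 * pi" using 1 by simp
 have "pc r (s - t) = pc r (t - s)" for t using cos_minus[of "t - s"] by (simp add: pc_def)
 then show "(\<integral>C t. pc r (s - t)) = 2 * pi" using 2 by simp
qed

lemma circ_int_pos:
 fixes f :: "real => real"
 assumes f: "continuous_on {-pi..pi} f" "!!x. x \<in> {-pi..pi} ==> 0 < f x" shows "0 < (\<integral>C x. f x)"
proof -
 obtain m where m: "m \<in> {-pi..pi}" "ALL x:{-pi..pi}. f m <= f x" using continuous_attains_inf[OF _ _ f(1)] by auto
 have "0 < 2 * pi * f m" using f(2)[OF m(1)] by simp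
 also have "... = (\<integral>C x. f m)" by (subst integral_Iv) auto
 also have "... <= (\<integral>C x. f x)" using m f(1) by (intro integral_mono cc.cont_int) auto
 finally show ?thesis .
qed

text \<open>As 1 < p <= 2, the number p pi/2 lies in (pi/2, pi], so -cos (p a) is bounded below by a
  positive number for a near pi/2 and B absorbs the sine. Elsewhere cos a is bounded below and A
  does it. Larger p may leave the range of negative cosine and are left to duality.\<close>

lemma trig_sector:
 assumes p: "1 < p" "p <= (2::real)"
 shows "EX A B. 0 < A & 0 < B & (ALL a. \<bar>a\<bar> < pi/2 --> \<bar>sin a\<bar> powr p <= A * cos a powr p - B * cos (p * a))"
proof -
 define c0 where "c0 = - cos (p * (pi/2))"
 have "pi/2 < p * (pi/2)" "p * (pi/2) <= pi" using p by (auto simp: field_simps)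
 then have "cos (p * (pi/2)) < cos (pi/2)" by (intro cos_monotone_0_pi) auto
 then have c0: "0 < c0" by (simp add: c0_def)
 define B where "B = 2 / c0"
 have B: "0 < B" using c0 by (simp add: B_def)
 have "isCont (%a. cos (p * a)) (pi/2)" by (intro continuous_intros)
 then obtain d where d: "0 < d" "!!a. \<bar>a - pi/2\<bar> < d ==> \<bar>cos (p * a) - cos (p * (pi/2))\<bar> < c0 / 2"
  using c0 unfolding continuous_at_eps_delta dist_real_def by (metis half_gt_zero)
 define d' where "d' = min d (pi/4)"
 have "d' <= pi/4" by (simp add: d'_def)
 then have "d' < pi/2" using pi_gt_zero by linarith
 then have d': "0 < d'" "d' <= d" "d' < pi/2" using d(1) pi_gt_zero by (auto simp: d'_def)
 define c where "c = cos (pi/2 - d') powr p"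
 have "0 < cos (pi/2 - d')" using d' by (intro cos_gt_zero) auto
 then have c: "0 < c" by (simp add: c_def)
 have main: "sin a powr p <= (1 + B) / c * cos a powr p - B * cos (p * a)" if a: "0 <= a" "a < pi/2" for a
 proof (cases "pi/2 - d' < a")
  case True
  then have "\<bar>cos (p * a) - cos (p * (pi/2))\<bar> < c0 / 2" using a d' by (intro d(2)) auto
  then have "c0 / 2 <= - cos (p * a)" by (simp add: c0_def)
  then have "B * (c0/2) <= B * - cos (p * a)" using B by (intro mult_left_mono) auto
  then have "1 <= - (B * cos (p * a))" using c0 by (simp add: B_def)
  moreover have "sin a powr p <= 1 powr p" using a p by (intro powr_mono2 sin_ge_zero) auto
  moreover have "0 <= (1 + B) / c * cos a powr p" using B c by simp
  ultimately show ?thesis by simp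
 next
  case False
  then have "cos (pi/2 - d') <= cos a" using a d' by (intro cos_monotone_0_pi_le) auto
  then have "c <= cos a powr p" unfolding c_def using \<open>0 < cos (pi/2 - d')\<close> p by (intro powr_mono2) auto
  then have "(1 + B) / c * c <= (1 + B) / c * cos a powr p" using B c by (intro mult_left_mono) auto
  then have "1 + B <= (1 + B) / c * cos a powr p" using c by simp
  moreover have "B * cos (p * a) <= B * 1" using B by (intro mult_left_mono) auto
  moreover have "sin a powr p <= 1 powr p" using a p by (intro powr_mono2 sin_ge_zero) auto
  ultimately show ?thesis by simp
 qed
 have "\<bar>sin a\<bar> powr p <= (1 + B) / c * cos a powr p - B * cos (p * a)" if a: "\<bar>a\<bar> < pi/2" for a
 proof (cases "0 <= a")
  case True
  then show ?thesis using main[of a] a sin_ge_zero[of a] by simp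
 next
  case False
  then show ?thesis using main[of "-a"] a sin_ge_zero[of "-a"] by simp
 qed
 moreover have "0 < (1 + B) / c" using B c by simp
 ultimately show ?thesis using B by blast
qed

lemma sector_ineq:
 assumes p: "1 < p" "p <= (2::real)"
 shows "EX A B. 0 < A & 0 < B & (ALL z. 0 < Re z --> \<bar>Im z\<bar> powr p <= A * Re z powr p - B * Re (exp (of_real p * Ln z)))"
proof -
 obtain A B where AB: "0 < A" "0 < B" "!!a. \<bar>a\<bar> < pi/2 ==> \<bar>sin a\<bar> powr p <= A * cos a powr p - B * cos (p * a)"
  using trig_sector[OF p] by metis
 have "\<bar>Im z\<bar> powr p <= A * Re z powr p - B * Re (exp (of_real p * Ln z))" if z: "0 < Re z" for z
 proof -
  define a where "a = Im (Ln z)"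
  define R where "R = exp (Re (Ln z))"
  have R: "0 < R" by (simp add: R_def)
  have z0: "z ~= 0" using z by auto
  have a: "\<bar>a\<bar> < pi/2" unfolding a_def using Re_Ln_pos_lt_imp[OF z] .
  then have ca: "0 < cos a" by (intro cos_gt_zero_pi) auto
  have "z = exp (Ln z)" using z0 by simp
  then have zz: "Re z = R * cos a" "Im z = R * sin a" unfolding R_def a_def using Re_exp[of "Ln z"] Im_exp[of "Ln z"] by auto
  have "Re (exp (of_real p * Ln z)) = R powr p * cos (p * a)" by (simp add: Re_exp R_def a_def powr_def)
  moreover have "\<bar>Im z\<bar> powr p = R powr p * \<bar>sin a\<bar> powr p" using R by (simp add: zz abs_mult powr_mult)
  moreover have "Re z powr p = R powr p * cos a powr p" using R ca by (simp add: zz powr_mult)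
  moreover have "R powr p * \<bar>sin a\<bar> powr p <= R powr p * (A * cos a powr p - B * cos (p * a))"
   using AB(3)[OF a] by (intro mult_left_mono) auto
  ultimately show ?thesis by (simp add: algebra_simps)
 qed
 then show ?thesis using AB by blast
qed

definition cH :: "real => (real => real) => real => real" where
 "cH r F x = (\<integral>C t. F t * ck r (x - t))"

lemma circ_conv_cont:
 assumes F: "continuous_on UNIV F" and k: "continuous_on UNIV k"
 shows "continuous_on A (%x::real. (\<integral>C t. F t * k (x - t)) :: real)"
proof -
 have "continuous_on (UNIV \<times> {-pi..pi}) (%z::real\<times>real. F (snd z) * k (fst z - snd z))"
  by (intro continuous_on_mult continuous_on_compose2[OF F] continuous_on_compose2[OF k] continuous_intros) auto
 then have "continuous_on UNIV (%x. \<integral>C t. F t * k (x - t))"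
  by (intro cc.int_param_cont1) (simp add: case_prod_beta)
 then show ?thesis using continuous_on_subset by blast
qed

text \<open>The Herglotz integral of a positive F. Its positive real part keeps it away from the
  branch cut of the logarithm, so that its p-th power is holomorphic too.\<close>

lemma Herglotz:
 assumes F: "continuous_on UNIV F" "!!x. 0 < F x"
 obtains \<Phi> where "\<Phi> holomorphic_on ball 0 1"
  "!!r x. 0 <= r ==> r < 1 ==> Re (\<Phi> (of_real r * cis x)) = (\<integral>C t. F t * (pc r (x - t) / (2 * pi)))"
  "!!r x. 0 <= r ==> r < 1 ==> Im (\<Phi> (of_real r * cis x)) = r / pi * cH r F x"
  "!!z. z \<in> ball 0 1 ==> 0 < Re (\<Phi> z)"
proof -
 have Fc: "continuous_on A F" for A using F(1) continuous_on_subset by blast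
 define k :: "complex => real => complex" where "k z t = of_real (F t / (2 * pi)) * ((cis t + z) / (cis t - z))" for z t
 define \<Phi> where "\<Phi> z = integral (cbox (-pi) pi) (k z)" for z
 have nz: "cis t ~= z" if "z \<in> ball 0 1" for z t using that norm_cis[of t] by (metis dist_0_norm less_irrefl mem_ball)
 have kc: "continuous_on {-pi..pi} (k z)" if "z \<in> ball 0 1" for z
  unfolding k_def using nz[OF that] by (intro continuous_intros Fc) auto
 have "\<Phi> holomorphic_on ball 0 1" unfolding \<Phi>_def[abs_def]
 proof (rule leibniz_rule_holomorphic)
  fix z t assume z: "z \<in> ball (0::complex) 1" "t \<in> cbox (-pi) pi"
  have "((%z. (cis t + z) / (cis t - z)) has_field_derivative ((0 + 1) * (cis t - z) - (cis t + z) * (0 - 1)) / ((cis t - z) * (cis t - z))) (at z)"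
   by (intro DERIV_divide DERIV_add DERIV_diff DERIV_const DERIV_ident) (use nz[OF z(1), of t] in simp)
  from DERIV_cmult[OF this, of "of_real (F t / (2 * pi))"]
  have "((%z. k z t) has_field_derivative of_real (F t / (2 * pi)) * (2 * cis t / ((cis t - z) * (cis t - z)))) (at z)"
   by (simp add: k_def)
  then show "((%z. k z t) has_field_derivative of_real (F t / (2 * pi)) * (2 * cis t / ((cis t - z) * (cis t - z)))) (at z within ball 0 1)"
   by (rule has_field_derivative_at_within)
 next
  show "k z integrable_on cbox (-pi) pi" if "z \<in> ball 0 1" for z
   by (rule integrable_continuous) (use kc[OF that] in simp)
  show "continuous_on (ball 0 1 \<times> cbox (-pi) pi) (%(z, t). of_real (F t / (2 * pi)) * (2 * cis t / ((cis t - z) * (cis t - z))))"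
   unfolding case_prod_beta
   by (intro continuous_intros continuous_on_compose2[OF F(1)]) (use nz in fastforce)+
 qed simp
 moreover have kS: "k z t = (F t / (2 * pi)) *R ((cis t + z) / (cis t - z))" for z t
  by (simp add: k_def scaleR_conv_of_real)
 have eq: "\<Phi> z = (\<integral>C t. k z t)" if "z \<in> ball 0 1" for z
  unfolding \<Phi>_def using integral_Iv[OF kc[OF that]] by simp
 have b: "of_real r * cis x \<in> ball 0 1" if "0 <= r" "r < 1" for r x using that by (simp add: norm_mult)
 have ki: "integrable circ (k z)" if "z \<in> ball 0 1" for z using kc[OF that] by (intro cc.cont_int) simp
 have R: "Re (\<Phi> (of_real r * cis x)) = (\<integral>C t. F t * (pc r (x - t) / (2 * pi)))" if r: "0 <= r" "r < 1" for r x
  unfolding eq[OF b[OF r]] integral_Re[OF ki[OF b[OF r]], symmetric]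
  by (rule LINT_cong) (simp_all only: kS scaleR_complex.sel Herglotz_kernel[OF r] times_divide_eq_right times_divide_eq_left)
 moreover have "Im (\<Phi> (of_real r * cis x)) = r / pi * cH r F x" if r: "0 <= r" "r < 1" for r x
 proof -
  have "Im (\<Phi> (of_real r * cis x)) = (\<integral>C t. r / pi * (F t * ck r (x - t)))"
   unfolding eq[OF b[OF r]] integral_Im[OF ki[OF b[OF r]], symmetric]
   by (rule LINT_cong) (simp_all add: kS Herglotz_kernel[OF r])
  then show ?thesis by (simp only: cH_def integral_mult_right_zero)
 qed
 moreover have "0 < Re (\<Phi> z)" if z: "z \<in> ball 0 1" for z
 proof -
  have r: "0 <= cmod z" "cmod z < 1" using z by auto
  have "z = of_real (cmod z) * cis (Arg z)" using rcis_cmod_Arg[of z] by (simp add: rcis_def)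
  moreover have "0 < (\<integral>C t. F t * (pc (cmod z) (Arg z - t) / (2 * pi)))"
   by (rule circ_int_pos) (use F r pc_pos[OF r] in \<open>auto intro!: continuous_intros circ_kernels_cont Fc\<close>)
  ultimately show ?thesis using R[OF r, of "Arg z"] by simp
 qed
 ultimately show ?thesis using that by blast
qed

text \<open>Integrate the sector inequality for \<Phi> over the circle of radius r. The mean of the
  real part of \<Phi>^p is its value at 0, nonnegative since \<Phi>(0) is a positive real, so this
  term drops out. For r >= 1/2 division by r/pi costs at most 2 pi.\<close>

lemma conjugate_bound_low:
 assumes p: "1 < p" "p <= 2"
 obtains C where "0 < C" "!!r F. 1/2 <= r ==> r < 1 ==> continuous_on UNIV F ==> (!!x. 0 < F x) ==>
  nC p (cH r F) <= C * nC p F"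
proof -
 obtain A B where AB: "0 < A" "0 < B"
  "!!z. 0 < Re z ==> \<bar>Im z\<bar> powr p <= A * Re z powr p - B * Re (exp (of_real p * Ln z))"
  using sector_ineq[OF p] by metis
 have bd: "nC p (cH r F) <= 2 * pi * A powr (1/p) * nC p F"
  if rr: "1/2 <= r" "r < 1" and F: "continuous_on UNIV F" "!!x. 0 < F x" for r F
 proof -
  have r: "0 < r" "0 <= r" "r < 1" using rr by auto
  have Fc: "continuous_on S F" for S using F(1) continuous_on_subset by blast
  from Herglotz[OF F] obtain \<Phi> where \<Phi>: "\<Phi> holomorphic_on ball 0 1"
   "!!r x. 0 <= r ==> r < 1 ==> Re (\<Phi> (of_real r * cis x)) = (\<integral>C t. F t * (pc r (x - t) / (2 * pi)))"
   "!!r x. 0 <= r ==> r < 1 ==> Im (\<Phi> (of_real r * cis x)) = r / pi * cH r F x"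
   "!!z. z \<in> ball 0 1 ==> 0 < Re (\<Phi> z)" by blast
  define u where "u x = (\<integral>C t. F t * (pc r (x - t) / (2 * pi)))" for x
  define v where "v x = r / pi * cH r F x" for x
  define G where "G z = exp (of_real p * Ln (\<Phi> z))" for z
  have G: "G holomorphic_on ball 0 1" unfolding G_def using \<Phi>(1,4)
   by (intro holomorphic_intros) (auto simp: complex_nonpos_Reals_iff dest: leD)
  have b: "of_real r * cis x \<in> ball 0 1" for x using r by (simp add: norm_mult)
  have Gc: "continuous_on {-pi..pi} (%x. G (of_real r * cis x))"
   by (rule continuous_on_compose2[OF holomorphic_on_imp_continuous_on[OF G]]) (use b in \<open>auto intro!: continuous_intros simp del: mem_ball\<close>)
  have uc: "continuous_on S u" for S unfolding u_def
   by (rule circ_conv_cont[OF F(1), of "%t. pc r t / (2 * pi)"]) (use r in \<open>auto intro!: circ_kernels_cont continuous_intros\<close>)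
  have vc: "continuous_on S v" for S unfolding v_def cH_def
   using circ_conv_cont[OF F(1), of "ck r"] circ_kernels_cont(2)[OF r(2,3) continuous_on_id] by (auto intro!: continuous_intros)
  have u0: "0 < u x" for x using \<Phi>(4)[OF b[of x]] \<Phi>(2)[OF r(2,3)] by (simp add: u_def)
  have "\<Phi> 0 = of_real (Re (\<Phi> 0))" using \<Phi>(3)[of 0 0] by (simp add: complex_eq_iff)
  then have "G 0 = exp (of_real (p * ln (Re (\<Phi> 0))))" using \<Phi>(4)[of 0] Ln_of_real[of "Re (\<Phi> 0)"] unfolding G_def by simp
  then have G0: "0 <= Re (G 0)" by (simp add: Re_exp)
  have ui: "integrable circ (%x. u x powr p)" using u0 by (intro cc.cont_int continuous_intros uc) (auto simp: less_imp_neq[symmetric])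
  have Gi: "integrable circ (%x. G (of_real r * cis x))" using Gc by (intro cc.cont_int) simp
  have vL: "in_Lp circ p v" using p by (intro cc.cont_in_Lp vc) auto
  have "(\<integral>C x. norm (v x) powr p) <= (\<integral>C x. A * u x powr p - B * Re (G (of_real r * cis x)))"
  proof (rule integral_mono)
   show "integrable circ (%x. norm (v x) powr p)" using vL by (simp add: in_Lp_def)
   show "integrable circ (%x. A * u x powr p - B * Re (G (of_real r * cis x)))" using ui Gi by auto
   fix x
   show "norm (v x) powr p <= A * u x powr p - B * Re (G (of_real r * cis x))"
    using AB(3)[OF \<Phi>(4)[OF b[of x]]] \<Phi>(2,3)[OF r(2,3), of x] by (simp add: u_def v_def G_def)
  qed
  also have "... = A * (\<integral>C x. u x powr p) - B * Re (\<integral>C x. G (of_real r * cis x))"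
   using ui Gi by (simp add: integral_Re[OF Gi, symmetric] del: integral_Re)
  also have "... <= A * (\<integral>C x. u x powr p)" using G0 AB(2) circle_mean[OF G r(1,3)] by simp
  also have "... = A * (\<integral>C x. norm (u x) powr p)" using u0 by (simp add: less_imp_le)
  also have "... = (A powr (1/p) * nC p u) powr p"
   using AB(1) p by (simp add: powr_mult powr_powr Lp_nm_powr)
  finally have v: "nC p v <= A powr (1/p) * nC p u" using p by (subst Lp_nm_le_iff) auto
  have kc: "continuous_on (space circ \<times> space circ) (%(x,t). pc r (x - t) / (2 * pi))"
   unfolding case_prod_beta using r by (intro continuous_intros circ_kernels_cont) auto
  have abs: "\<bar>pc r s\<bar> = pc r s" for s using pc_pos[OF r(2,3), of s] by simp
  have "nC p u <= 1 * nC p F" unfolding u_def[abs_def]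
   by (rule Schur_test(2)[OF cmeas_Iv cmeas_Iv kc zero_less_one])
     (use p r pc_integral[OF r(1,3)] in \<open>auto simp: abs intro!: cc.cont_in_Lp Fc\<close>)
  then have "A powr (1/p) * nC p u <= A powr (1/p) * nC p F" by (intro mult_left_mono) auto
  with v have v2: "nC p v <= A powr (1/p) * nC p F" by simp
  have "cH r F = (%x. (pi / r) *R v x)" using r by (auto simp: v_def)
  then have "nC p (cH r F) = (pi / r) * nC p v" using Lp_nm_scaleR[of p circ "pi / r" v] p r by simp
  also have "... <= (2 * pi) * (A powr (1/p) * nC p F)"
   using v2 rr by (intro mult_mono) (auto simp: field_simps)
  finally show ?thesis by simp
 qed
 have "0 < 2 * pi * A powr (1/p)" using AB(1) by simp
 from that[OF this bd] show ?thesis by blast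
qed

lemma ck_odd: "ck r (- t) = - ck r t" by (simp add: ck_def)

lemma cH_diff:
 assumes "continuous_on UNIV F" "continuous_on UNIV G" "0 <= r" "r < 1"
 shows "cH r (%x. F x - G x) x = cH r F x - cH r G x"
proof -
 have *: "integrable circ (%t. F t * ck r (x - t))" if "continuous_on UNIV F" for F
  by (intro cc.cont_int continuous_on_mult circ_kernels_cont continuous_on_diff continuous_on_const continuous_on_id
     continuous_on_subset[OF that] assms) auto
 show ?thesis unfolding cH_def left_diff_distrib by (rule LINT_diff) (intro * assms)+
qed

lemma cH_cont: "continuous_on UNIV F ==> 0 <= r ==> r < 1 ==> continuous_on A (cH r F)"
 unfolding cH_def[abs_def] by (rule circ_conv_cont) (auto intro: circ_kernels_cont)

text \<open>The shift by d makes both parts of F strictly positive, as the Herglotz argument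
  demands; it cancels in the difference and its cost in norm is arbitrarily small.\<close>

lemma conjugate_bound_le2:
 assumes p: "1 < p" "p <= 2"
 obtains C where "0 < C" "!!r F. 1/2 <= r ==> r < 1 ==> continuous_on UNIV F ==> nC p (cH r F) <= C * nC p F"
proof -
 from conjugate_bound_low[OF p] obtain C where C: "0 < C" "!!r F. 1/2 <= r ==> r < 1 ==> continuous_on UNIV F ==> (!!x. 0 < F x) ==>
  nC p (cH r F) <= C * nC p F" by blast
 have p1: "1 <= p" "0 <= p" "0 < p" using p by auto
 have "nC p (cH r F) <= (2 * C) * nC p F" if r: "1/2 <= r" "r < 1" and F: "continuous_on UNIV F" for r F
 proof (rule field_le_epsilon)
  fix e :: real assume e: "0 < e"
  define N where "N = nC p (%_. 1::real)"
  define d where "d = e / (2 * C * (N + 1))"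
  have N: "0 <= N" by (simp add: N_def)
  have d: "0 < d" "2 * C * (d * N) <= e"
  proof -
   show "0 < d" using e C(1) N by (simp add: d_def)
   have "2 * C * (d * N) = e * (N / (N + 1))" using C(1) N by (simp add: d_def)
   also have "... <= e * 1" using e N by (intro mult_left_mono) auto
   finally show "2 * C * (d * N) <= e" by simp
  qed
  define F1 where "F1 x = max (F x) 0 + d" for x
  define F2 where "F2 x = max (- F x) 0 + d" for x
  have Fc: "continuous_on A F" for A using F continuous_on_subset by blast
  have c: "continuous_on A F1" "continuous_on A F2" for A unfolding F1_def F2_def by (intro continuous_intros Fc)+
  have L: "in_Lp circ p F" "in_Lp circ p (%_. d)" by (intro cc.cont_in_Lp Fc continuous_on_const p1)+
  have Fn: "nC p Fi <= nC p F + d * N" if Fi: "!!x. \<bar>Fi x\<bar> <= \<bar>F x\<bar> + d" "continuous_on UNIV Fi" for Fi :: "real => real"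
  proof -
   have L': "in_Lp circ p (%x. \<bar>F x\<bar>)" by (intro cc.cont_in_Lp continuous_intros Fc p1)
   have "nC p Fi <= nC p (%x. \<bar>F x\<bar> + d)"
    using Fi d(1) p1 by (intro Lp_nm_mono in_Lp_add[OF L' L(2)]) (auto intro!: cc.cont_meas continuous_on_subset[OF Fi(2)])
   also have "... <= nC p (%x. \<bar>F x\<bar>) + nC p (%x. d)" by (rule Lp_nm_triangle[OF L' L(2) p1(1)])
   also have "nC p (%x. d) = d * N" using Lp_nm_scaleR[of p circ d "%_. 1::real"] p d(1) by (simp add: N_def)
   also have "nC p (%x. \<bar>F x\<bar>) = nC p F" by (simp add: Lp_nm_def)
   finally show ?thesis .
  qed
  have cL: "in_Lp circ p (cH r Fi)" if "continuous_on UNIV Fi" for Fi using r p1 by (intro cc.cont_in_Lp cH_cont that) auto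
  have "cH r F = (%x. cH r F1 x - cH r F2 x)"
  proof
   fix x
   have "F = (%x. F1 x - F2 x)" by (auto simp: F1_def F2_def max_def)
   then show "cH r F x = cH r F1 x - cH r F2 x" using cH_diff[OF c(1) c(2), of r x] r by simp
  qed
  then have "nC p (cH r F) <= nC p (cH r F1) + nC p (cH r F2)"
   using Lp_nm_triangle_diff[OF cL[OF c(1)] cL[OF c(2)] p1(1)] by simp
  also have "... <= C * nC p F1 + C * nC p F2"
   using d(1) by (intro add_mono C(2) r c) (auto simp: F1_def F2_def max_def add_pos_nonneg)
  also have "... <= C * (nC p F + d * N) + C * (nC p F + d * N)"
   using C(1) d(1) by (intro add_mono mult_left_mono Fn c) (auto simp: F1_def F2_def)
  also have "... <= 2 * C * nC p F + e" using d(2) by (simp add: algebra_simps)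
  finally show "nC p (cH r F) <= 2 * C * nC p F + e" .
 qed
 then show ?thesis using that[of "2 * C"] C(1) by simp
qed

lemma cH_dual:
 assumes r: "0 <= r" "r < 1" and F: "continuous_on UNIV F" and G: "continuous_on UNIV G"
 shows "(\<integral>C x. cH r F x * G x) = - (\<integral>C x. F x * cH r G x)"
proof -
 have "(\<integral>C x. cH r F x * G x) = (\<integral>C x. (\<integral>C t. F t * ck r (x - t) * G x))" by (simp add: cH_def)
 also have "... = (\<integral>C t. (\<integral>C x. F t * ck r (x - t) * G x))"
  by (rule cont_swap[OF cmeas_Iv cmeas_Iv], unfold case_prod_beta)
    (intro continuous_intros circ_kernels_cont r continuous_on_compose2[OF F] continuous_on_compose2[OF G], auto)
 also have "... = (\<integral>C t. - (F t * cH r G t))"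
 proof (rule LINT_cong[OF refl])
  fix t
  have "F t * ck r (x - t) * G x = - F t * (G x * ck r (t - x))" for x using ck_odd[of r "x - t"] by simp
  then show "(\<integral>C x. F t * ck r (x - t) * G x) = - (F t * cH r G t)" by (simp add: cH_def)
 qed
 finally show ?thesis by simp
qed

text \<open>Last step of both duality arguments: I is the integral of |h|^p, estimated by testing
  with |h|^(p-2) h, whose q-norm is I^(1/q).\<close>

lemma powr_self_bound:
 fixes I K p q :: real
 assumes "0 <= I" "0 <= K" "1 / p + 1 / q = 1" "I <= K * I powr (1/q)" shows "I powr (1/p) <= K"
proof (cases "I = 0")
 case False
 then have I: "0 < I" using assms by simp
 have "I powr (1/p) * I powr (1/q) = I powr 1" unfolding powr_add[symmetric] assms(3) ..
 with assms(4) I have "I powr (1/p) * I powr (1/q) <= K * I powr (1/q)" by simp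
 then show ?thesis using I by (simp add: mult_le_cancel_right_pos)
qed (use assms in simp)

text \<open>For p > 2 the oddness of the kernel makes \<open>cH\<close> skew-adjoint, and the bound
  for q = p/(p-1) < 2 transfers by Hoelder's inequality with the test function |H|^(p-2) H, where H
  is \<open>cH r F\<close>.\<close>

theorem conjugate_bound:
 assumes p: "1 < p"
 obtains C where "0 < C" "!!r F. 1/2 <= r ==> r < 1 ==> continuous_on UNIV F ==> nC p (cH r F) <= C * nC p F"
proof (cases "p <= 2")
 case True
 from conjugate_bound_le2[OF p True] show ?thesis using that by blast
next
 case False
 define q where "q = p / (p - 1)"
 have q: "1 < q" "1/p + 1/q = 1" "(p - 1) * q = p" using conjugate_exponent[OF p] by (auto simp: q_def)
 have "q <= 2" using False by (simp add: q_def field_simps)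
 from conjugate_bound_le2[OF q(1) this] obtain C where C: "0 < C" "!!r F. 1/2 <= r ==> r < 1 ==> continuous_on UNIV F ==> nC q (cH r F) <= C * nC q F" by blast
 have "nC p (cH r F) <= C * nC p F" if r: "1/2 <= r" "r < 1" and F: "continuous_on UNIV F" for r F
 proof -
  have r0: "0 <= r" using r by simp
  have Hc: "continuous_on A (cH r F)" for A by (rule cH_cont[OF F r0 r(2)])
  define G where "G x = \<bar>cH r F x\<bar> powr (p - 2) * cH r F x" for x
  have G: "continuous_on A G" for A unfolding G_def using False by (intro continuous_intros continuous_on_powr' Hc) auto
  have Gn: "norm (G x) powr q = norm (cH r F x) powr p" for x
  proof (cases "cH r F x = 0")
   case False
   then have "norm (G x) = \<bar>cH r F x\<bar> powr (p - 1)" by (simp add: G_def abs_mult powr_diff power2_eq_square field_simps powr_numeral)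
   then show ?thesis by (simp add: powr_powr q(3))
  qed (simp add: G_def)
  define I where "I = (\<integral>C x. norm (cH r F x) powr p)"
  have I0: "0 <= I" by (simp add: I_def)
  have Gq: "nC q G = I powr (1/q)" by (simp only: Lp_nm_def Gn I_def)
  have L: "in_Lp circ p F" "in_Lp circ q (cH r G)"
   using p q r0 r by (auto intro!: cc.cont_in_Lp cH_cont G continuous_on_subset[OF F])
  have "cH r F x * G x = norm (cH r F x) powr p" for x
  proof (cases "cH r F x = 0")
   case False
   then show ?thesis by (simp add: G_def powr_diff powr_numeral power2_eq_square field_simps)
  qed simp
  then have "I = (\<integral>C x. cH r F x * G x)" by (simp add: I_def)
  also have "... = - (\<integral>C x. F x * cH r G x)" by (rule cH_dual[OF r0 r(2) F G])
  also have "... <= (\<integral>C x. \<bar>F x * cH r G x\<bar>)"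
   using integral_abs_bound[of circ "%x. F x * cH r G x"] by linarith
  also have "... <= nC p F * nC q (cH r G)" by (rule Holder(2)[OF L p q(1,2)])
  also have "... <= nC p F * (C * I powr (1/q))"
   unfolding Gq[symmetric] by (intro mult_left_mono C(2) r G) auto
  finally have le: "I <= C * nC p F * I powr (1/q)" by (simp add: mult_ac)
  show ?thesis using powr_self_bound[OF I0 _ q(2) le] C(1) by (simp add: Lp_nm_def I_def)
 qed
 then show ?thesis using that C(1) by blast
qed

section \<open>Riesz transforms by the method of rotations\<close>

text \<open>The gradient kernel of the single layer potential along a great circle through x, at
  angle t: |sin t| comes from polar coordinates, sin t from the tangential direction, the cube from
  the inverse distance.\<close>

definition kap :: "real => real => real" where
 "kap r t = sin t * \<bar>sin t\<bar> * inverse (sqrt (1 + r\<^sup>2 - 2 * r * cos t)) ^ 3"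

lemma kap_cont:
 fixes f :: "'a::t2_space => real"
 assumes "0 <= r" "r < 1" "continuous_on A f" shows "continuous_on A (%x. kap r (f x))"
 unfolding kap_def using DD_pos'[OF assms(1,2)] assms(3) by (auto intro!: continuous_intros simp: less_imp_neq[symmetric])

text \<open>With S = |sin t| and d the distance, the kernels are sin t S/d^3 and sin t/d^2, and (d -
  S)(d + S) = (r - cos t)^2. They differ by at most (r - cos t)^2/d^3, which is dominated by a
  multiple of the Poisson kernel plus a constant.\<close>

lemma kap_near_ck:
 assumes r: "1/2 <= r" "r < 1"
 shows "\<bar>kap r t - ck r t\<bar> <= 2 * pc r t + 4"
proof -
 define c where "c = cos t"
 define S where "S = \<bar>sin t\<bar>"
 define D where "D = 1 + r\<^sup>2 - 2 * r * c"
 define d where "d = sqrt D"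
 have D: "0 < D" using DD_pos'[of r t] r by (simp add: D_def c_def)
 have d: "0 < d" "d\<^sup>2 = D" using D by (auto simp: d_def)
 have c: "-1 <= c" "c <= 1" by (auto simp: c_def)
 have S: "0 <= S" "S\<^sup>2 = 1 - c\<^sup>2" using sin_squared_eq[of t] by (auto simp: S_def c_def)
 have key: "(d - S) * (d + S) = (r - c)\<^sup>2"
 proof -
  have "(d - S) * (d + S) = d\<^sup>2 - S\<^sup>2" by (simp add: power2_eq_square algebra_simps)
  then show ?thesis unfolding d(2) S(2) D_def by (simp add: power2_eq_square algebra_simps)
 qed
 have Sd: "S <= d"
 proof (rule ccontr)
  assume "\<not> S <= d"
  then have "(d - S) * (d + S) < 0" using d S by (intro mult_neg_pos) auto
  then show False unfolding key by (simp add: not_less[symmetric])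
 qed
 have "kap r t = sin t * S / d ^ 3" by (simp add: kap_def S_def d_def D_def c_def divide_inverse power_inverse)
 moreover have "ck r t = sin t / d\<^sup>2" unfolding d(2) by (simp add: ck_def D_def c_def)
 ultimately have "kap r t - ck r t = sin t * (S - d) / d ^ 3"
  using d(1) by (simp add: field_simps power3_eq_cube power2_eq_square)
 then have "\<bar>kap r t - ck r t\<bar> = S * (d - S) / d ^ 3" using Sd d(1) by (simp add: abs_mult S_def[symmetric])
 also have "... <= (r - c)\<^sup>2 / d ^ 3"
 proof (rule divide_right_mono)
  have "S * (d - S) <= (d + S) * (d - S)" using Sd d S by (intro mult_right_mono) auto
  then show "S * (d - S) <= (r - c)\<^sup>2" using key by (simp add: mult.commute)
 qed (use d in simp)
 also have "... <= (2 * (1 - r)\<^sup>2 + 2 * (1 - c)\<^sup>2) / d ^ 3"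
 proof (rule divide_right_mono)
  have "0 <= ((1 - r) + (1 - c))\<^sup>2" by simp
  then show "(r - c)\<^sup>2 <= 2 * (1 - r)\<^sup>2 + 2 * (1 - c)\<^sup>2" by (simp add: power2_eq_square algebra_simps)
 qed (use d in simp)
 also have "... = 2 * ((1 - r)\<^sup>2 / d ^ 3) + 2 * ((1 - c)\<^sup>2 / d ^ 3)" by (simp add: add_divide_distrib)
 also have "... <= 2 * pc r t + 2 * 2"
 proof (intro add_mono mult_left_mono)
  have "(1 - r)\<^sup>2 <= D" using DD_pos[of r c] r c by (simp add: D_def)
  then have rd: "1 - r <= d" unfolding d_def using r by (intro real_le_rsqrt) auto
  have "(1 - r)\<^sup>2 / d ^ 3 <= ((1 - r) * d) / d ^ 3"
   using rd r d(1) by (intro divide_right_mono) (auto simp: power2_eq_square intro: mult_left_mono)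
  also have "... = (1 - r) / D" unfolding d(2)[symmetric] using d(1) by (simp add: power3_eq_cube power2_eq_square)
  also have "... <= pc r t" unfolding pc_def
  proof -
   have "r\<^sup>2 <= r" using r by (simp add: power2_eq_square mult_left_le)
   then show "(1 - r) / D <= (1 - r\<^sup>2) / (1 + r\<^sup>2 - 2 * r * cos t)"
    using D by (simp add: D_def c_def divide_right_mono)
  qed
  finally show "(1 - r)\<^sup>2 / d ^ 3 <= pc r t" .
  define e where "e = sqrt (1 - c)"
  have e: "0 <= e" "e\<^sup>2 = 1 - c" using c by (auto simp: e_def)
  have "1 - c <= D"
  proof -
   have "0 + 1 * (1 - c) <= (1 - r)\<^sup>2 + 2 * r * (1 - c)" using r c by (intro add_mono mult_right_mono) auto
   also have "... = D" by (simp add: D_def power2_eq_square algebra_simps)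
   finally show ?thesis by simp
  qed
  then have ed: "e <= d" by (simp add: e_def d_def)
  have "e <= 2" unfolding e_def using c by (intro real_le_lsqrt) auto
  then have "e * e ^ 3 <= 2 * d ^ 3" using e ed d by (intro mult_mono power_mono) auto
  moreover have "(1 - c)\<^sup>2 = e * e ^ 3" unfolding e(2)[symmetric] by (simp add: power2_eq_square power3_eq_cube)
  ultimately show "(1 - c)\<^sup>2 / d ^ 3 <= 2" using d(1) by (simp add: field_simps)
 qed auto
 finally show ?thesis by simp
qed

text \<open>The part \<open>ck\<close> falls under the conjugate function theorem. The remainder has
  L^1 norm at most 12 pi = 2 (2 pi) + 4 (2 pi), so the Schur test applies to it.\<close>

lemma kap_bound:
 assumes p: "1 < p"
 shows "EX C>0. ALL r F. 1/2 <= r --> r < 1 --> continuous_on UNIV F --> (ALL t. F (t + 2 * pi) = F t) -->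
  nC p (%s. \<integral>C t. F (t + s) * kap r t) <= C * nC p F"
proof -
 from conjugate_bound[OF p] obtain C where C: "0 < C" "!!r F. 1/2 <= r ==> r < 1 ==> continuous_on UNIV F ==> nC p (cH r F) <= C * nC p F" by blast
 have "nC p (%s. \<integral>C t. F (t + s) * kap r t) <= (C + 12 * pi) * nC p F"
  if rr: "1/2 <= r" "r < 1" and F: "continuous_on UNIV F" and per: "!!t. F (t + 2 * pi) = F t" for r F
 proof -
  have r: "0 < r" "0 <= r" "r < 1" using rr by auto
  have Fc: "continuous_on A F" for A using F continuous_on_subset by blast
  define k where "k t = kap r t - ck r t" for t
  have kc: "continuous_on A (%x. k (f x))" if "continuous_on A f" for A and f :: "'x::t2_space => real"
   unfolding k_def using that r by (intro continuous_intros kap_cont circ_kernels_cont)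
  define E where "E s = (\<integral>C t. F t * k (s - t))" for s
  have Ec: "continuous_on A E" for A unfolding E_def by (rule circ_conv_cont[OF F kc[OF continuous_on_id]])
  have kap_odd: "kap r (- t) = - kap r t" for t by (simp add: kap_def)
  have sh: "(\<integral>C t. F (t + s) * kap r t) = - (cH r F s + E s)" for s
  proof -
   have "(\<integral>C t. F (t + s) * kap r (t + s - s)) = (\<integral>C t. F t * kap r (t - s))"
   proof (rule integral_periodic_shift[of "%t. F t * kap r (t - s)"])
    show "continuous_on UNIV (%t. F t * kap r (t - s))" using r by (intro continuous_intros F kap_cont) auto
    have kp: "kap r (u + 2 * pi) = kap r u" for u by (simp add: kap_def)
    show "F (t + 2 * pi) * kap r (t + 2 * pi - s) = F t * kap r (t - s)" for t
     using kp[of "t - s"] per[of t] by (simp add: algebra_simps)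
   qed
   also have "... = (\<integral>C t. - (F t * ck r (s - t) + F t * k (s - t)))"
    using kap_odd[of "s - _"] by (intro LINT_cong) (auto simp: k_def algebra_simps)
   also have "... = - ((\<integral>C t. F t * ck r (s - t)) + (\<integral>C t. F t * k (s - t)))"
    by (subst integral_minus, subst Bochner_Integration.integral_add)
      (use r in \<open>auto intro!: cc.cont_int continuous_intros Fc circ_kernels_cont kc\<close>)
   finally show ?thesis by (simp add: cH_def E_def)
  qed
  have p1: "1 <= p" using p by simp
  have L: "in_Lp circ p (cH r F)" "in_Lp circ p E" "in_Lp circ p F" using p1 r by (intro cc.cont_in_Lp cH_cont F Ec Fc; simp)+
  have i: "(\<integral>C t. \<bar>k (s - t)\<bar>) <= 12 * pi" "(\<integral>C t. \<bar>k (t - s)\<bar>) <= 12 * pi" for s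
  proof -
   have *: "(\<integral>C t. \<bar>k (g t)\<bar>) <= 12 * pi" if g: "continuous_on {-pi..pi} g" "(\<integral>C t. pc r (g t)) = 2 * pi" for g
   proof -
    have gi: "integrable circ (%t. pc r (g t))" using g r by (intro cc.cont_int circ_kernels_cont) auto
    have "(\<integral>C t. \<bar>k (g t)\<bar>) <= (\<integral>C t. 2 * pc r (g t) + 4)"
     using g r kap_near_ck[OF rr] by (intro integral_mono cc.cont_int continuous_intros kc circ_kernels_cont) (auto simp: k_def)
    also have "... = 2 * (2 * pi) + (\<integral>C t. 4)"
     using gi g(2) by (subst Bochner_Integration.integral_add) auto
    also have "(\<integral>C t. 4) = 2 * pi * (4::real)" by (subst integral_Iv) auto
    finally show ?thesis by simp
   qed
   show "(\<integral>C t. \<bar>k (s - t)\<bar>) <= 12 * pi" "(\<integral>C t. \<bar>k (t - s)\<bar>) <= 12 * pi"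
    by (rule *; simp add: continuous_intros pc_integral[OF r(1,3)])+
  qed
  have "nC p E <= (12 * pi) * nC p F" unfolding E_def[abs_def]
  proof (rule Schur_test(2)[OF cmeas_Iv cmeas_Iv])
   show "continuous_on (space circ \<times> space circ) (%(x, t). k (x - t))"
    unfolding case_prod_beta by (intro kc continuous_intros)
  qed (use i L p1 in auto)
  moreover have "nC p (%s. \<integral>C t. F (t + s) * kap r t) <= nC p (cH r F) + nC p E"
   unfolding sh Lp_nm_uminus by (rule Lp_nm_triangle[OF L(1,2) p1])
  ultimately show ?thesis using C(2)[OF rr F] by (simp add: algebra_simps)
 qed
 moreover have "0 < C + 12 * pi" using C by (simp add: add_pos_pos)
 ultimately show ?thesis by blast
qed

section \<open>Averaging the circle estimate over all axes\<close>

lemma rot_average: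
 fixes g :: "R3 => real"
 assumes g: "continuous_on SS g" and n: "norm n = 1"
 shows "2 * pi * (\<integral>S x. g x) = (\<integral>S x. (\<integral>C s. g (rot n s x)))"
proof -
 have "(\<integral>S x. (\<integral>C s. g (rot n s x))) = (\<integral>C s. (\<integral>S x. g (rot n s x)))"
  by (rule cont_swap[OF sg.cmeas_axioms cmeas_Iv], unfold case_prod_beta)
    (intro continuous_on_compose2[OF g] continuous_intros, auto simp: norm_rot[OF n])
 also have "... = (\<integral>C s. (\<integral>S x. g x))"
  by (simp add: sigmaS_rotation[OF rot_orthogonal[OF n] g])
 also have "... = 2 * pi * (\<integral>S x. g x)" by (subst integral_Iv) auto
 finally show ?thesis ..
qed

text \<open>Singular integral along the orbit of x under rotation about n. For n orthogonal to x the
  orbit is a great circle; other axes enter only through the smearing.\<close>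

definition TT :: "real => (R3 => real) => R3 => R3 => real" where
 "TT r f x n = (\<integral>C t. f (rot n t x) * kap r t)"

lemma TT_cont:
 assumes f: "continuous_on SS f" and r: "0 <= r" "r < 1"
 shows "continuous_on (SS \<times> SS) (%z. TT r f (fst z) (snd z))"
 unfolding TT_def
proof (rule cc.int_param_cont1)
 show "continuous_on ((SS \<times> SS) \<times> space circ) (%(z, t). f (rot (snd z) t (fst z)) * kap r t)"
  unfolding case_prod_beta
  by (intro continuous_on_mult kap_cont r continuous_on_compose2[OF f] continuous_intros) (auto simp: norm_rot)
qed

text \<open>The weight depends on x . n, which is constant on the orbits of rotation about n, so the
  circle estimate may be multiplied by it and integrated over the sphere.\<close>

lemma orbit_bound:
 assumes C: "0 < C" "!!F. continuous_on UNIV F ==> (!!t. F (t + 2 * pi) = F t) ==>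
  nC p (%s. \<integral>C t. F (t + s) * kap r t) <= C * nC p F"
  and f: "continuous_on SS f" and r: "0 <= r" "r < 1" and p: "1 < p" and n: "norm n = 1"
  and w: "continuous_on UNIV w" "!!t. 0 <= w (t::real)"
 shows "(\<integral>S x. w (x \<bullet> n) * \<bar>TT r f x n\<bar> powr p) <= C powr p * (\<integral>S x. w (x \<bullet> n) * \<bar>f x\<bar> powr p)"
proof -
 have wc: "continuous_on A (%x. w (x \<bullet> n))" for A by (rule continuous_on_compose2[OF w(1)]) (auto intro!: continuous_intros)
 have Tc: "continuous_on SS (%x. TT r f x n)"
  using continuous_on_slice2[of SS SS "TT r f" n] TT_cont[OF f r] n by (simp add: case_prod_beta)
 have c1: "continuous_on SS (%x. w (x \<bullet> n) * \<bar>TT r f x n\<bar> powr p)" and c2: "continuous_on SS (%x. w (x \<bullet> n) * \<bar>f x\<bar> powr p)"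
  using p by (auto intro!: continuous_on_mult continuous_on_powr' wc continuous_on_rabs Tc f continuous_on_const)
 have inv: "rot n s x \<bullet> n = x \<bullet> n" for s x using rot_inner[OF n, of s x] by (simp add: inner_commute)
 have le: "(\<integral>C s. w (rot n s x \<bullet> n) * \<bar>TT r f (rot n s x) n\<bar> powr p) <= C powr p * (\<integral>C s. w (rot n s x \<bullet> n) * \<bar>f (rot n s x)\<bar> powr p)"
  if x: "x \<in> SS" for x
 proof -
  define F where "F s = f (rot n s x)" for s
  have F: "continuous_on UNIV F" unfolding F_def
   by (rule continuous_on_compose2[OF f]) (use x in \<open>auto intro!: continuous_intros simp: norm_rot[OF n]\<close>)
  have "nC p (%s. \<integral>C t. F (t + s) * kap r t) <= C * nC p F" by (rule C(2)[OF F]) (simp add: F_def)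
  moreover have "(\<integral>C t. F (t + s) * kap r t) = TT r f (rot n s x) n" for s by (simp add: F_def TT_def rot_rot[OF n])
  ultimately have "(\<integral>C s. norm (TT r f (rot n s x) n) powr p) <= (C * nC p F) powr p"
   using C(1) p by (subst Lp_nm_le_iff[symmetric]) auto
  also have "... = C powr p * (\<integral>C s. \<bar>F s\<bar> powr p)" using C(1) p by (simp add: powr_mult Lp_nm_powr)
  finally have "(\<integral>C s. norm (TT r f (rot n s x) n) powr p) <= C powr p * (\<integral>C s. \<bar>F s\<bar> powr p)" .
  from mult_left_mono[OF this w(2)[of "x \<bullet> n"]] show ?thesis unfolding inv F_def by (simp add: mult.left_commute)
 qed
 have ci: "continuous_on SS (%x. \<integral>C s. g (rot n s x))" if "continuous_on SS g" for g :: "R3 => real"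
  by (rule cc.int_param_cont1, unfold case_prod_beta)
    (intro continuous_on_compose2[OF that] continuous_intros, auto simp: norm_rot[OF n])
 have "(\<integral>S x. (\<integral>C s. w (rot n s x \<bullet> n) * \<bar>TT r f (rot n s x) n\<bar> powr p))
  <= (\<integral>S x. C powr p * (\<integral>C s. w (rot n s x \<bullet> n) * \<bar>f (rot n s x)\<bar> powr p))"
  by (rule integral_mono) (use ci[OF c1] ci[OF c2] le in \<open>auto intro!: sg.cont_int continuous_intros\<close>)
 then have "2 * pi * (\<integral>S x. w (x \<bullet> n) * \<bar>TT r f x n\<bar> powr p) <= C powr p * (2 * pi * (\<integral>S x. w (x \<bullet> n) * \<bar>f x\<bar> powr p))"
  unfolding rot_average[OF c1 n] rot_average[OF c2 n] by simp
 then show ?thesis by simp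
qed

text \<open>Normalised tents, an approximate identity at 0. Applied to x . n they concentrate n on
  the circle orthogonal to x.\<close>

lemma tent_family:
 obtains w :: "nat => real => real" where "!!k. continuous_on UNIV (w k)" "!!k t. 0 <= w k t"
  "!!k. (\<integral>t. w k t \<partial>Iv (-1) 1) = 1" "!!H. continuous_on {-1..1} H ==> (%k. \<integral>t. w k t * H t \<partial>Iv (-1) 1) \<longlonglongrightarrow> (H 0 :: real)"
proof -
 interpret J: cmeas "Iv (-1) 1" by (rule cmeas_Iv)
 define v where "v k t = max 0 (1 - real k * \<bar>t\<bar>)" for k :: nat and t :: real
 have vc: "continuous_on A (v k)" for A k unfolding v_def by (intro continuous_intros)
 define c where "c k = (\<integral>t. v k t \<partial>Iv (-1) 1)" for k
 have c: "0 < c k" for k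
 proof -
  have "c k = integral {-1..1} (v k)" unfolding c_def by (rule integral_Iv[OF vc])
  moreover have "integral {-1..1} (v k) ~= 0"
  proof
   assume "integral {-1..1} (v k) = 0"
   moreover have "0 <= v k x" for x by (simp add: v_def)
   ultimately have "ALL x:{-1..1}. v k x = 0" by (subst (asm) integral_eq_0_iff) (simp_all add: vc)
   from bspec[OF this, of 0] show False by (simp add: v_def)
  qed
  moreover have "0 <= c k" unfolding c_def by (rule integral_nonneg_AE) (simp add: v_def)
  ultimately show ?thesis by linarith
 qed
 define w where "w k t = v k t / c k" for k t
 have wc: "continuous_on A (w k)" for A k unfolding w_def using c[of k] by (intro continuous_intros vc) auto
 have w0: "0 <= w k t" for k t using c[of k] by (simp add: w_def v_def)
 have w1: "(\<integral>t. w k t \<partial>Iv (-1) 1) = 1" for k using c[of k] by (simp add: w_def c_def)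
 have lim: "(%k. \<integral>t. w k t * H t \<partial>Iv (-1) 1) \<longlonglongrightarrow> H 0" if H: "continuous_on {-1..1} H" for H :: "real => real"
 proof (rule LIMSEQ_I)
  fix e :: real assume e: "0 < e"
  from H have "ALL x:{-1..1}. ALL e>0. EX d>0. ALL x':{-1..1}. dist x' x < d --> dist (H x') (H x) < e" by (simp only: continuous_on_iff)
  from this[THEN bspec, of 0] obtain d where d: "0 < d" "!!t. t \<in> {-1..1} ==> \<bar>t\<bar> < d ==> \<bar>H t - H 0\<bar> < e/2"
   using e unfolding dist_real_def by (metis atLeastAtMost_iff diff_zero half_gt_zero neg_le_0_iff_le zero_le_one)
  obtain N :: nat where N: "1 / d < real N" using reals_Archimedean2 by blast
  have "norm ((\<integral>t. w k t * H t \<partial>Iv (-1) 1) - H 0) < e" if k: "N <= k" for k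
  proof -
   have i: "integrable (Iv (-1) 1) (%t. w k t * H t)" "integrable (Iv (-1) 1) (%t. w k t * H 0)"
    by (intro J.cont_int continuous_on_mult wc continuous_on_const; simp add: H)+
   have "(\<integral>t. w k t * H t \<partial>Iv (-1) 1) - H 0 = (\<integral>t. w k t * H t - w k t * H 0 \<partial>Iv (-1) 1)"
    using w1[of k] by (subst LINT_diff[OF i]) simp
   also have "norm ... <= (\<integral>t. w k t * (e/2) \<partial>Iv (-1) 1)"
    unfolding real_norm_def
   proof (rule order_trans[OF integral_abs_bound integral_mono])
    fix t assume t: "t \<in> space (Iv (-1) 1)"
    show "\<bar>w k t * H t - w k t * H 0\<bar> <= w k t * (e/2)"
    proof (cases "\<bar>t\<bar> < d")
     case True
     then have "w k t * \<bar>H t - H 0\<bar> <= w k t * (e/2)" using d(2)[of t] t w0 by (intro mult_left_mono) (auto intro: less_imp_le)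
     then show ?thesis using w0[of k t] by (simp add: right_diff_distrib[symmetric] abs_mult)
    next
     case False
     have "1 <= real N * d" using N d(1) by (simp add: field_simps)
     also have "... <= real k * \<bar>t\<bar>" using k False d(1) by (intro mult_mono) auto
     finally have "w k t = 0" by (simp add: w_def v_def)
     then show ?thesis by simp
    qed
   qed (intro integrable_abs LINT_integrable_diff i J.cont_int continuous_on_mult wc continuous_on_const)+
   also have "... = e/2" using w1[of k] by simp
   finally show ?thesis using e by simp
  qed
  then show "EX N. ALL k>=N. norm ((\<integral>t. w k t * H t \<partial>Iv (-1) 1) - H 0) < e" by blast
 qed
 show ?thesis by (rule that[OF wc w0 w1 lim])
qed

text \<open>4 pi times the a-component of the tangential gradient of the Newton kernel at r
  x.\<close>

definition Rker :: "real => R3 => R3 => R3 => real" where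
 "Rker r a x y = rho (r *R x) y ^ 3 * ((y - (x \<bullet> y) *R x) \<bullet> a)"

lemma Rker_cont:
 assumes r: "0 < r" "r < 1" shows "continuous_on (SS \<times> SS) (%z. Rker r a (fst z) (snd z))"
proof -
 have "continuous_on (SS \<times> SS) (%z. rho (r *R fst z) (snd z) ^ 3)"
  using rsphere_kernel_cont[OF r, of "%x y. rho x y ^ 3"] rho_cont[of 3] by (simp add: case_prod_beta)
 then show ?thesis unfolding Rker_def by (rule continuous_on_mult) (intro continuous_intros)
qed

text \<open>Both sides are integrals over the unit vectors \<open>n\<close> orthogonal to \<open>x\<close>, i.e. over the great
 circles through \<open>x\<close>; the left-hand side smears \<open>n\<close> with the weight \<open>w k (x \<bullet> n)\<close>.\<close>

lemma great_circle_limit: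
 assumes w: "!!k::nat. continuous_on UNIV (w k)"
  "!!H. continuous_on {-1..1} H ==> (%k. \<integral>t. w k t * H t \<partial>Iv (-1) 1) \<longlonglongrightarrow> (H 0 :: real)"
  and f: "continuous_on SS f" and r: "0 < r" "r < 1" and x: "x \<in> SS"
 shows "(%k. 1/2 * (\<integral>S n. w k (x \<bullet> n) * ((cross3 n x \<bullet> a) * TT r f x n))) \<longlonglongrightarrow> (\<integral>S y. f y * Rker r a x y)"
proof -
 have r0: "0 <= r" using r by simp
 have nx: "norm x = 1" using x by simp
 obtain e where e: "norm e = 1" "x \<bullet> e = 0" by (rule exists_orthogonal_unit)
 define F where "F n = (cross3 n x \<bullet> a) * TT r f x n" for n
 have F: "continuous_on SS F" unfolding F_def
  using continuous_on_slice1[of SS SS "TT r f" x] TT_cont[OF f r0 r(2)] x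
  by (intro continuous_on_mult) (auto intro!: continuous_intros simp: case_prod_beta)
 define H where "H t = (\<integral>C s. F (t *R x + sqrt (1 - t\<^sup>2) *R rot x s e))" for t
 have H: "continuous_on {-1..1} H" unfolding H_def by (rule sphere_polar(3)[OF nx e F])
 have "(\<integral>S n. w k (x \<bullet> n) * F n) = (\<integral>t. w k t * H t \<partial>Iv (-1) 1)" for k
 proof -
  have c: "continuous_on SS (%n. w k (x \<bullet> n) * F n)"
   by (intro continuous_on_mult F continuous_on_compose2[OF w(1)[of k]] continuous_intros) auto
  have in': "x \<bullet> (t *R x + sqrt (1 - t\<^sup>2) *R rot x s e) = t" for t s
   using nx e rot_inner[OF nx, of s e] by (simp add: inner_add_right dot_square_norm)
  show ?thesis unfolding sphere_polar(1)[OF nx e c] H_def in' by simp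
 qed
 then have lim: "(%k. 1/2 * (\<integral>S n. w k (x \<bullet> n) * F n)) \<longlonglongrightarrow> 1/2 * H 0"
  using w(2)[OF H] by (intro tendsto_mult tendsto_const) simp
 \<comment> \<open>The direction in which the great circle with axis e leaves x. Rotation about x
   carries this relation to every axis orthogonal to x.\<close>
 define e' where "e' = cross3 e x"
 have e': "norm e' = 1" "x \<bullet> e' = 0"
 proof -
  have "(norm e')\<^sup>2 = 1" unfolding e'_def using norm_cross[of e x] nx e by (simp add: inner_commute)
  then show "norm e' = 1" by (simp add: abs_square_eq_1)
  show "x \<bullet> e' = 0" by (simp add: e'_def dot_cross_self)
 qed
 define u where "u s = rot x s e'" for s
 have u: "x \<bullet> u s = 0" for s using rot_inner[OF nx, of s e'] e' by (simp add: u_def)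
 have cu: "cross3 (rot x s e) x = u s" for s
 proof -
  have "cross3 (cross3 x e) x = cross3 x (cross3 e x)" by (simp add: cross3_simps)
  then show ?thesis unfolding u_def rot_perp[OF e(2)] rot_perp[OF e'(2)]
   by (simp add: e'_def cross_add_left cross_mult_left)
 qed
 have TTu: "TT r f x (rot x s e) = (\<integral>C t. f (cos t *R x + sin t *R u s) * kap r t)" for s
 proof -
  have z: "rot x s e \<bullet> x = 0" using rot_inner[OF nx, of s e] e by (simp add: inner_commute)
  show ?thesis unfolding TT_def rot_perp[OF z] cu ..
 qed
 have H0: "H 0 = (\<integral>C s. (\<integral>C t. f (cos t *R x + sin t *R u s) * kap r t * (u s \<bullet> a)))"
  unfolding H_def F_def by (simp add: cu TTu mult.commute[of "u _ \<bullet> a"])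
 have K: "continuous_on SS (%y. f y * Rker r a x y)"
  using continuous_on_slice1[of SS SS "Rker r a" x] Rker_cont[OF r, of a] x
  by (intro continuous_on_mult f) (auto simp: case_prod_beta)
 have kk: "\<bar>sin t\<bar> * (f y * Rker r a x y) = f y * kap r t * (u s \<bullet> a)" if y: "y = cos t *R x + sin t *R u s" for t s y
 proof -
  have xy: "x \<bullet> y = cos t" using u nx by (simp add: y inner_add_right dot_square_norm)
  have yS: "y \<in> SS" unfolding y u_def using polar_point[OF nx e', of "cos t" "sin t" s] by simp
  have "rho (r *R x) y = inverse (sqrt (1 + r\<^sup>2 - 2 * r * cos t))" by (simp add: rho_def norm_rsphere[OF x yS] xy)
  moreover have "y - (x \<bullet> y) *R x = sin t *R u s" by (simp add: xy) (simp add: y)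
  ultimately show ?thesis by (simp add: Rker_def kap_def)
 qed
 \<comment> \<open>Polar coordinates over full great circles: the weight |sin t| turns
   \<open>Rker\<close> into \<open>kap r t\<close> times the a-component of the direction
   \<open>u s\<close>.\<close>
 have "(\<integral>S y. f y * Rker r a x y) = 1/2 * (\<integral>C t. (\<integral>C s. f (cos t *R x + sin t *R u s) * kap r t * (u s \<bullet> a)))"
  unfolding sphere_polar(2)[OF nx e' K] u_def[symmetric] integral_mult_right_zero[symmetric] kk[OF refl] ..
 also have "(\<integral>C t. (\<integral>C s. f (cos t *R x + sin t *R u s) * kap r t * (u s \<bullet> a))) = H 0"
  unfolding H0
  by (rule cont_swap[OF cmeas_Iv cmeas_Iv], unfold case_prod_beta u_def)
    (intro continuous_on_mult kap_cont r0 r(2) continuous_on_compose2[OF f] continuous_intros, auto simp: polar_point[OF nx e'])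
 finally have "(\<integral>S y. f y * Rker r a x y) = 1/2 * H 0" .
 then show ?thesis using lim by (simp only: F_def)
qed

text \<open>Jensen in the axis n for the weight w_k(x . n), of total mass 2 pi, then Fubini and the
  orbit bound for each fixed n. The constant pi C = (1/2)(2 pi) C depends neither on k nor on r, and
  Fatou's lemma removes the smearing.\<close>

theorem Riesz_bound:
 assumes p: "1 < p"
 shows "EX C>0. ALL r f a. 1/2 <= r --> r < 1 --> continuous_on SS f --> norm a <= 1 -->
  nL p (%x. \<integral>S y. f y * Rker r a x y) <= C * nL p f"
proof -
 from kap_bound[OF p] obtain C where C: "0 < C" "ALL r F. 1/2 <= r --> r < 1 --> continuous_on UNIV F --> (ALL t. F (t + 2 * pi) = F t) -->
  nC p (%s. \<integral>C t. F (t + s) * kap r t) <= C * nC p F" by (elim exE conjE)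
 from tent_family obtain w :: "nat => real => real" where w: "!!k. continuous_on UNIV (w k)" "!!k t. 0 <= w k t"
  "!!k. (\<integral>t. w k t \<partial>Iv (-1) 1) = 1" "!!H. continuous_on {-1..1} H ==> (%k. \<integral>t. w k t * H t \<partial>Iv (-1) 1) \<longlonglongrightarrow> (H 0 :: real)" by blast
 have "nL p (%x. \<integral>S y. f y * Rker r a x y) <= pi * C * nL p f"
  if rr: "1/2 <= r" "r < 1" and f: "continuous_on SS f" and a: "norm a <= 1" for r f a
 proof -
  have r: "0 < r" "0 <= r" "r < 1" using rr by auto
  have wx: "continuous_on (SS \<times> SS) (%z. w k (fst z \<bullet> snd z))" for k
   by (rule continuous_on_compose2[OF w(1)]) (auto intro!: continuous_intros)
  note T = TT_cont[OF f r(2,3)]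
  have sl: "continuous_on SS (%n. g (x, n))" if "continuous_on (SS \<times> SS) g" "x \<in> SS" for x and g :: "R3 \<times> R3 => real"
   by (rule continuous_on_compose2[OF that(1)]) (use that in \<open>auto intro!: continuous_intros\<close>)
  define R where "R k x = 1/2 * (\<integral>S n. w k (x \<bullet> n) * ((cross3 n x \<bullet> a) * TT r f x n))" for k x
  have Gc: "continuous_on (SS \<times> SS) (%z. w k (fst z \<bullet> snd z) * ((cross3 (snd z) (fst z) \<bullet> a) * TT r f (fst z) (snd z)))" for k
   by (intro continuous_on_mult wx T continuous_intros)
  have Rc: "continuous_on SS (R k)" for k unfolding R_def
   by (intro continuous_on_mult continuous_on_const sg.int_param_cont1) (use Gc[of k] in \<open>simp add: case_prod_beta\<close>)
  have RL: "LL p (R k)" for k using Rc p by (intro sg.cont_in_Lp) auto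
  have zi: "(\<integral>S n. w k (x \<bullet> n)) = 2 * pi" if "x \<in> SS" for x k
   using zonal_integral[of x "w k"] that w(3) continuous_on_subset[OF w(1)] by simp
  have Pc: "continuous_on (SS \<times> SS) (%z. w k (fst z \<bullet> snd z) * \<bar>TT r f (fst z) (snd z)\<bar> powr p)" for k
   using p by (intro continuous_on_mult wx continuous_on_powr' continuous_on_rabs T continuous_on_const) auto
  have Rb: "nL p (R k) <= pi * C * nL p f" for k
  proof -
   have pt: "\<bar>R k x\<bar> powr p <= (1/2) powr p * ((2 * pi) powr (p - 1) * (\<integral>S n. w k (x \<bullet> n) * \<bar>TT r f x n\<bar> powr p))" if x: "x \<in> SS" for x
   proof -
    have i1: "integrable sigmaS (%n. w k (x \<bullet> n))" "integrable sigmaS (%n. w k (x \<bullet> n) * \<bar>TT r f x n\<bar> powr p)"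
     "integrable sigmaS (%n. w k (x \<bullet> n) * ((cross3 n x \<bullet> a) * TT r f x n))"
     by (rule sg.cont_int; use sl[OF wx[of k] x] sl[OF Pc[of k] x] sl[OF Gc[of k] x] in simp)+
    have i3: "integrable sigmaS (%n. w k (x \<bullet> n) * \<bar>TT r f x n\<bar>)"
     by (rule sg.cont_int, intro continuous_on_mult continuous_on_rabs) (use sl[OF wx[of k] x] sl[OF T x] in auto)
    note i1 = i1 i3
    have "\<bar>R k x\<bar> <= 1/2 * (\<integral>S n. w k (x \<bullet> n) * \<bar>TT r f x n\<bar>)"
    proof -
     have "\<bar>(\<integral>S n. w k (x \<bullet> n) * ((cross3 n x \<bullet> a) * TT r f x n))\<bar> <= (\<integral>S n. w k (x \<bullet> n) * \<bar>TT r f x n\<bar>)"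
     proof (rule order_trans[OF integral_abs_bound integral_mono])
      fix n assume "n \<in> space sigmaS"
      then have "norm n = 1" by simp
      have "\<bar>cross3 n x \<bullet> a\<bar> <= norm (cross3 n x) * norm a" by (rule Cauchy_Schwarz_ineq2)
      also have "... <= 1 * 1"
      proof (intro mult_mono a)
       have "(norm (cross3 n x))\<^sup>2 <= 1"
        using norm_cross[of n x] \<open>norm n = 1\<close> x by simp
       then show "norm (cross3 n x) <= 1" by (simp add: abs_square_le_1)
      qed auto
      finally have "\<bar>cross3 n x \<bullet> a\<bar> * \<bar>TT r f x n\<bar> <= 1 * \<bar>TT r f x n\<bar>" by (intro mult_right_mono) auto
      then show "\<bar>w k (x \<bullet> n) * ((cross3 n x \<bullet> a) * TT r f x n)\<bar> <= w k (x \<bullet> n) * \<bar>TT r f x n\<bar>"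
       using w(2) by (simp add: abs_mult mult_left_mono)
     qed (use i1 in auto)
     then show ?thesis by (simp add: R_def)
    qed
    then have "\<bar>R k x\<bar> powr p <= (1/2 * (\<integral>S n. w k (x \<bullet> n) * \<bar>TT r f x n\<bar>)) powr p" using p by (intro powr_mono2) auto
    also have "... = (1/2) powr p * (\<integral>S n. w k (x \<bullet> n) * \<bar>TT r f x n\<bar>) powr p"
     by (rule powr_mult)
    also have "... <= (1/2) powr p * ((2 * pi) powr (p - 1) * (\<integral>S n. w k (x \<bullet> n) * \<bar>TT r f x n\<bar> powr p))"
     by (intro mult_left_mono Jensen_weighted) (use w(2) i1 zi[OF x] p in auto)
    finally show ?thesis .
   qed
   have "(\<integral>S x. norm (R k x) powr p) <= (\<integral>S x. (1/2) powr p * ((2 * pi) powr (p - 1) * (\<integral>S n. w k (x \<bullet> n) * \<bar>TT r f x n\<bar> powr p)))"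
   proof (rule integral_mono)
    show "integrable sigmaS (%x. norm (R k x) powr p)" using RL by (simp add: in_Lp_def)
    show "integrable sigmaS (%x. (1/2) powr p * ((2 * pi) powr (p - 1) * (\<integral>S n. w k (x \<bullet> n) * \<bar>TT r f x n\<bar> powr p)))"
     by (rule sg.cont_int, intro continuous_on_mult continuous_on_const sg.int_param_cont1) (use Pc[of k] in \<open>simp add: case_prod_beta\<close>)
   qed (use pt in simp)
   also have "... = (1/2) powr p * ((2 * pi) powr (p - 1) * (\<integral>S n. (\<integral>S x. w k (x \<bullet> n) * \<bar>TT r f x n\<bar> powr p)))"
    by (subst cont_swap[OF sg.cmeas_axioms sg.cmeas_axioms, symmetric]) (use Pc[of k] in \<open>simp_all add: case_prod_beta\<close>)
   also have "... <= (1/2) powr p * ((2 * pi) powr (p - 1) * (\<integral>S n. C powr p * (\<integral>S x. w k (x \<bullet> n) * \<bar>f x\<bar> powr p)))"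
   proof (intro mult_left_mono integral_mono)
    have "continuous_on (SS \<times> SS) (%z. w k (snd z \<bullet> fst z) * \<bar>TT r f (snd z) (fst z)\<bar> powr p)"
     by (rule continuous_on_compose2[OF Pc, of _ "%z. (snd z, fst z)" for k, simplified]) (auto intro!: continuous_intros)
    then show "integrable sigmaS (%n. \<integral>S x. w k (x \<bullet> n) * \<bar>TT r f x n\<bar> powr p)"
     by (intro sg.cont_int sg.int_param_cont1) (simp add: case_prod_beta)
    have "continuous_on (SS \<times> SS) (%z. w k (snd z \<bullet> fst z) * \<bar>f (snd z)\<bar> powr p)"
     using p by (intro continuous_on_mult continuous_on_powr' continuous_on_rabs continuous_on_compose2[OF f] continuous_on_compose2[OF w(1)[of k]] continuous_intros) auto
    then show "integrable sigmaS (%n. C powr p * (\<integral>S x. w k (x \<bullet> n) * \<bar>f x\<bar> powr p))"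
     by (intro sg.cont_int continuous_on_mult continuous_on_const sg.int_param_cont1) (simp add: case_prod_beta)
    fix n assume "n \<in> space sigmaS"
    then show "(\<integral>S x. w k (x \<bullet> n) * \<bar>TT r f x n\<bar> powr p) <= C powr p * (\<integral>S x. w k (x \<bullet> n) * \<bar>f x\<bar> powr p)"
     by (intro orbit_bound[OF C(1) _ f r(2,3) p]) (use C(2) rr w in auto)
   qed auto
   also have "(\<integral>S n. C powr p * (\<integral>S x. w k (x \<bullet> n) * \<bar>f x\<bar> powr p)) = C powr p * (\<integral>S x. (\<integral>S n. w k (x \<bullet> n) * \<bar>f x\<bar> powr p))"
   proof -
    have "continuous_on (SS \<times> SS) (%z. w k (fst z \<bullet> snd z) * \<bar>f (fst z)\<bar> powr p)"
     using p by (intro continuous_on_mult wx continuous_on_powr' continuous_on_rabs continuous_on_compose2[OF f] continuous_intros) auto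
    then show ?thesis
     by (subst cont_swap[OF sg.cmeas_axioms sg.cmeas_axioms]) (simp_all add: case_prod_beta)
   qed
   also have "(\<integral>S x. (\<integral>S n. w k (x \<bullet> n) * \<bar>f x\<bar> powr p)) = (\<integral>S x. 2 * pi * \<bar>f x\<bar> powr p)"
    by (rule LINT_cong) (simp_all add: zi)
   also have "... = 2 * pi * nL p f powr p" using p by (simp add: Lp_nm_powr)
   also have "(1/2) powr p * ((2 * pi) powr (p - 1) * (C powr p * (2 * pi * nL p f powr p))) = (pi * C * nL p f) powr p"
   proof -
    have "(2 * pi) powr (p - 1) * (2 * pi) = (2 * pi) powr p" by (simp add: powr_diff)
    moreover have "(1/2) powr p * (2 * pi) powr p = pi powr p" by (simp add: powr_mult[symmetric])
    ultimately have "(1/2) powr p * ((2 * pi) powr (p - 1) * (C powr p * (2 * pi * L))) = pi powr p * C powr p * L" for L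
     by (metis (no_types, lifting) mult.assoc mult.left_commute)
    then show ?thesis using C(1) by (simp add: powr_mult)
   qed
   finally show ?thesis using C(1) p by (subst Lp_nm_le_iff) auto
  qed
  have Kc: "continuous_on SS (%x. \<integral>S y. f y * Rker r a x y)"
   by (rule sg.int_param_cont1, unfold case_prod_beta)
     (simp, intro continuous_on_mult Rker_cont r continuous_on_compose2[OF f] continuous_intros, auto)
  show ?thesis
  proof (rule Lp_fatou(2)[OF RL Rb])
   show "AE x in sigmaS. (%n. R n x) \<longlonglongrightarrow> (\<integral>S y. f y * Rker r a x y)"
    unfolding R_def by (rule AE_I2) (rule great_circle_limit[OF w(1,4) f r(1,3)], auto)
  qed (use p Kc in \<open>auto intro!: sg.cont_meas\<close>)
 qed
 moreover have "0 < pi * C" using C(1) by simp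
 ultimately show ?thesis by blast
qed

section \<open>Potentials and weak spherical gradients\<close>

lemma Lp_eqs: "Lp p f = LL p f" "Lp_norm p f = nL p f" "Lpv p F = LL p F" "Lpv_norm p F = nL p F"
 by (simp_all add: Lp_def Lp_norm_def Lpv_def Lpv_norm_def in_Lp_def Lp_nm_def)

lemma LL_int: "LL p f ==> 1 <= p ==> integrable sigmaS f"
 by (rule in_Lp_integrable[OF sg.finite_measure_axioms])

lemma cont_LL: "continuous_on SS f ==> 1 <= p ==> LL p f"
 by (rule sg.cont_in_Lp) auto

lemma grad_eqI:
 assumes "(f has_derivative (%h. D \<bullet> h)) (at x)" shows "grad f x = D"
 unfolding grad_def
proof (rule the_equality)
 show "(f has_derivative (%h. D \<bullet> h)) (at x)" by (rule assms)
 fix E assume "(f has_derivative (%h. E \<bullet> h)) (at x)"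
 then have "(%h. E \<bullet> h) = (%h. D \<bullet> h)" using has_derivative_unique assms by blast
 then have "ALL h. E \<bullet> h = D \<bullet> h" by (simp add: fun_eq_iff)
 then show "E = D" by (simp only: vector_eq_rdot)
qed

lemma harm_sum_C1g:
 fixes N :: nat
 assumes "!!l. Ys l \<in> sph_harm l" shows "C1g (%x. \<Sum>l<N. Ys l x) (%x. \<Sum>l<N. grad (Ys l) x)"
 by (rule C1g_sum) (rule sph_harm_C1g[OF assms])

text \<open>\<open>Npot_sph_harm\<close> identifies the potential off the origin; the punctured ball
  is an open neighbourhood of r x, which is enough for the gradient.\<close>

lemma Npot_grad:
 fixes N :: nat
 assumes Y: "!!l. Ys l \<in> sph_harm l" and r: "0 < r" "r < 1" and x: "x \<in> SS"
 shows "grad (%x. \<Sum>l<N. 1 / (2 * real l + 1) * Ys l x) (r *R x) = (\<integral>S y. (\<Sum>l<N. Ys l y) *R gN (r *R x) y)"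
proof (rule grad_eqI)
 let ?f = "%y. \<Sum>l<N. Ys l y"
 have fc: "continuous_on SS ?f" by (rule sum_sph_harm_cont[OF Y])
 have b: "r *R x \<in> ball 0 1" using x r by (intro rball) auto
 have eq: "Npot ?f z = (\<Sum>l<N. 1 / (2 * real l + 1) * Ys l z)" if z: "z \<in> ball 0 1 - {0}" for z
 proof -
  define s where "s = norm z"
  define y where "y = z /\<^sub>R s"
  have s: "0 < s" "s < 1" "y \<in> SS" "z = s *R y" using z by (auto simp: s_def y_def)
  have zb: "z \<in> ball 0 1" using z by simp
  have "Npot ?f z = (\<Sum>l<N. Npot (Ys l) z)"
   unfolding Npot_def sum_distrib_right
   by (rule LINT_sum)
     (intro int_mult_cont sg.cont_int, insert Y zb continuous_on_slice1[OF Nker_cont], auto intro: sph_harm_cont)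
  also have "... = (\<Sum>l<N. 1 / (2 * real l + 1) * Ys l z)"
   unfolding s(4) by (intro sum.cong refl) (simp add: Npot_sph_harm[OF Y s(3,1,2)] sph_harm_homogeneous[OF Y])
  finally show ?thesis .
 qed
 show "((%x. \<Sum>l<N. 1 / (2 * real l + 1) * Ys l x) has_derivative (%h. (\<integral>S y. ?f y *R gN (r *R x) y) \<bullet> h)) (at (r *R x))"
  by (rule has_derivative_transform_within_open[where s="ball 0 1 - {0}", OF Npot_deriv[OF b sg.cont_int] _ _ eq]) (use fc b r x in auto)
qed

text \<open>Inside the ball the tangential gradient of the potential is, up to 1/(4 pi), the
  operator of \<open>Riesz_bound\<close>, with a constant uniform in r; Fatou's lemma takes the
  bound to the sphere. The factor 3 counts the components.\<close>

theorem Riesz_sgrad: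
 assumes p: "1 < p"
 shows "EX C>0. ALL Ys N. (ALL l. Ys l \<in> sph_harm l) -->
  nL p (sgrad (%x. \<Sum>l<N. 1 / (2 * real l + 1) * Ys l x)) <= C * nL p (%x. \<Sum>l<N. Ys l x)"
proof -
 have p1: "1 <= p" using p by simp
 from Riesz_bound[OF p] obtain C where C: "0 < C" "ALL r f a. 1/2 <= r --> r < 1 --> continuous_on SS f --> norm a <= 1 -->
  nL p (%x. \<integral>S y. f y * Rker r a x y) <= C * nL p f" by (elim exE conjE)
 have "nL p (sgrad (%x. \<Sum>l<N. 1 / (2 * real l + 1) * Ys l x)) <= 3 * C * nL p (%x. \<Sum>l<N. Ys l x)" if "ALL l. Ys l \<in> sph_harm l" for Ys and N :: nat
 proof -
  have Y: "Ys l \<in> sph_harm l" for l using that by blast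
  define f where "f x = (\<Sum>l<N. Ys l x)" for x
  define u where "u x = (\<Sum>l<N. 1 / (2 * real l + 1) * Ys l x)" for x
  have fc: "continuous_on SS f" unfolding f_def by (rule sum_sph_harm_cont[OF Y])
  have u1: "C1g u (grad u)" unfolding u_def[abs_def] by (rule C1g_grad_self[OF harm_sum_C1g]) (rule sph_harm_cmult[OF Y])
  note gc = C1g_cont_grad[OF u1]
  have comp: "nL p (%x. sgrad u x \<bullet> a) <= C * nL p f" if a: "norm a <= 1" for a
  proof -
   define v where "v r x = (grad u (r *R x) - (x \<bullet> grad u (r *R x)) *R x) \<bullet> a" for r x
   have v: "v r x = 1 / (4 * pi) * (\<integral>S y. f y * Rker r a x y)" if r: "0 < r" "r < 1" and x: "x \<in> SS" for r x
   proof -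
    \<comment> \<open>Tangential part of a: against b the summand r x of r x - y disappears, which
      leaves \<open>Rker\<close>.\<close>
    define b where "b = a - (x \<bullet> a) *R x"
    have xx: "x \<bullet> x = 1" "x \<bullet> b = 0" using x by (auto simp: b_def inner_diff_right dot_square_norm)
    have rb: "r *R x \<in> ball 0 1" using x r by (intro rball) auto
    have "continuous_on SS (gN (r *R x))" using continuous_on_slice1[OF kernels_cont(4) rb] .
    then have i: "integrable sigmaS (%y. f y *R gN (r *R x) y)" by (intro sg.cont_int) (auto intro!: continuous_intros fc)
    have "v r x = grad u (r *R x) \<bullet> b" by (simp add: v_def b_def inner_diff_left inner_diff_right inner_commute)
    also have "... = (\<integral>S y. (f y *R gN (r *R x) y) \<bullet> b)"
     using Npot_grad[OF Y r x, of N] integral_inner_left[OF i, of b] by (simp add: u_def[abs_def] f_def)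
    also have "... = (\<integral>S y. 1 / (4 * pi) * (f y * Rker r a x y))"
    proof (rule LINT_cong[OF refl])
     fix y
     have "(r *R x - y) \<bullet> b = - ((y - (x \<bullet> y) *R x) \<bullet> a)"
      using xx(2) by (simp add: inner_diff_left) (simp add: b_def inner_diff_right inner_commute)
     then show "(f y *R gN (r *R x) y) \<bullet> b = 1 / (4 * pi) * (f y * Rker r a x y)" by (simp add: gN_def Rker_def)
    qed
    finally show ?thesis by simp
   qed
   define s where "s n = 1 - 1 / (real n + 2)" for n :: nat
   have s: "1/2 <= s n" "0 < s n" "s n < 1" for n by (auto simp: s_def field_simps)
   have s1: "s \<longlonglongrightarrow> 1" unfolding s_def by real_asymp
   have vc: "continuous_on SS (v r)" for r unfolding v_def
    by (intro continuous_intros continuous_on_compose2[OF gc[of UNIV]]) auto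
   show ?thesis
   proof (rule Lp_fatou(2))
    show "LL p (v (s n))" for n by (rule cont_LL[OF vc p1])
    show "nL p (v (s n)) <= C * nL p f" for n
    proof -
     have "nL p (v (s n)) = nL p (%x. (1 / (4 * pi)) *R (\<integral>S y. f y * Rker (s n) a x y))"
      by (rule Lp_nm_cong) (simp add: v[OF s(2,3)])
     also have "... = 1 / (4 * pi) * nL p (%x. \<integral>S y. f y * Rker (s n) a x y)" using p by (subst Lp_nm_scaleR) auto
     also have "... <= 1 * (C * nL p f)"
      using C s(1,3) fc a pi_gt3 by (intro mult_mono) auto
     finally show ?thesis by simp
    qed
    show "(%x. sgrad u x \<bullet> a) \<in> borel_measurable sigmaS" unfolding sgrad_def
     by (intro sg.cont_meas continuous_intros gc)
    show "AE x in sigmaS. (%n. v (s n) x) \<longlonglongrightarrow> sgrad u x \<bullet> a"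
    proof (rule AE_I2)
     fix x :: R3
     have "continuous (at x) (grad u)" using gc[of UNIV] by (simp add: continuous_on_eq_continuous_at)
     then have "isCont (grad u) (1 *R x)" by simp
     moreover have "(%n. s n *R x) \<longlonglongrightarrow> 1 *R x" by (intro tendsto_intros s1)
     ultimately have "(%n. grad u (s n *R x)) \<longlonglongrightarrow> grad u (1 *R x)" by (rule isCont_tendsto_compose)
     then show "(%n. v (s n) x) \<longlonglongrightarrow> sgrad u x \<bullet> a" unfolding v_def sgrad_def by (simp, intro tendsto_intros)
    qed
   qed (use p in simp)
  qed
  have sc: "continuous_on SS (sgrad u)" unfolding sgrad_def[abs_def] by (intro continuous_intros gc)
  have "sgrad u = (%x. \<Sum>m\<in>UNIV. (sgrad u x \<bullet> axis m 1) *R axis m 1)"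
   by (rule ext) (simp add: inner_axis vec3_expand)
  then have "nL p (sgrad u) = nL p (%x. \<Sum>m\<in>UNIV. (sgrad u x \<bullet> axis m 1) *R (axis m 1 :: R3))" by (rule arg_cong[where f="%F::R3 => R3. nL p F"])
  also have "... <= (\<Sum>m\<in>(UNIV::3 set). nL p (%x. (sgrad u x \<bullet> axis m 1) *R (axis m 1 :: R3)))"
   by (rule Lp_nm_sum_le[OF cont_LL p1]) (auto intro!: continuous_intros sc p1)
  also have "... = (\<Sum>m\<in>(UNIV::3 set). nL p (%x. sgrad u x \<bullet> axis m 1))" by (simp add: Lp_nm_def)
  also have "... <= (\<Sum>m\<in>(UNIV::3 set). C * nL p f)" by (intro sum_mono comp) simp
  finally show ?thesis by (simp add: u_def[abs_def] f_def[abs_def])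
 qed
 moreover have "0 < 3 * C" using C by simp
 ultimately show ?thesis by blast
qed

section \<open>The norm of W^{1,p} through the multiplier l + 1\<close>

lemma mult_rel_cong:
 assumes "!!x. x \<in> SS ==> f x = f' x" "!!x. x \<in> SS ==> h x = h' x" shows "mult_rel \<beta> f h = mult_rel \<beta> f' h'"
proof -
 have "(\<integral>S x. f x * Y x) = (\<integral>S x. f' x * Y x)" "(\<integral>S x. h x * Y x) = (\<integral>S x. h' x * Y x)" for Y
  by (rule LINT_cong; simp add: assms)+
 moreover have "integrable sigmaS f = integrable sigmaS f'" "integrable sigmaS h = integrable sigmaS h'"
  by (rule LINT_integrable_cong; simp add: assms)+
 ultimately show ?thesis by (simp add: mult_rel_def)
qed

abbreviation "suc_mult \<equiv> mult_rel (%l. real l + 1)"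

lemma suc_mult_inverse: "suc_mult g h \<longleftrightarrow> mult_rel (%l. 1 / (real l + 1)) h g"
 using mult_rel_inverse[of "%l. real l + 1" g h "%l. 1 / (real l + 1)"] mult_rel_inverse[of "%l. 1 / (real l + 1)" h g "%l. real l + 1"]
 by auto

lemma suc_mult_exists:
 assumes p: "1 < p" and h: "LL p h" obtains g where "LL p g" "nL p g <= nL p h" "suc_mult g h"
proof -
 have "contractive p (%l. 1 / (real l + 1))" using contractive_recip[of p 1] p by simp
 from contractive_extend[OF this p h] show ?thesis using that by (auto simp: suc_mult_inverse)
qed

lemma suc_mult_cong_AE: "suc_mult g h ==> suc_mult g' h' ==> AE x in sigmaS. h x = h' x ==> AE x in sigmaS. g x = g' x"
 unfolding suc_mult_inverse by (rule mult_rel_unique)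

text \<open>The multipliers l + 1 and sqrt (l(l+1)) differ by a contraction, so the two images of g
  differ by a term of norm at most that of g. The 3 counts g itself, h and this difference.\<close>

lemma suc_mult_W1p:
 assumes p: "1 < p" and g: "LL p g" and h: "LL p h" and gh: "suc_mult g h"
 shows "g \<in> W1p p" "nL p g <= nL p h" "nL p h <= W1p_norm p g" "W1p_norm p g <= 3 * nL p h"
proof -
 have p1: "1 <= p" using p by simp
 obtain g' where g': "LL p g'" "nL p g' <= nL p h" "suc_mult g' h" by (rule suc_mult_exists[OF p h])
 have "AE x in sigmaS. g x = g' x" by (rule suc_mult_cong_AE[OF gh g'(3)]) simp
 then have "nL p g = nL p g'" using g g' by (intro Lp_nm_cong_AE in_Lp_measurable)
 then show le: "nL p g <= nL p h" using g' by simp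
 obtain k where k: "LL p k" "nL p k <= nL p g" "mult_rel (%l. real l + 1 - sqrtLap l) g k"
  by (rule contractive_extend[OF contractive_sqrt_defect[OF p1] p g])
 have s: "Lp p (%x. 1 * h x + - 1 * k x) & mult_rel sqrtLap g (%x. 1 * h x + - 1 * k x)"
  using mult_rel_add[OF gh k(3), of 1 "-1"] in_Lp_diff[OF h k(1) p1] by (simp add: Lp_eqs)
 then show "g \<in> W1p p" using g by (auto simp: W1p_def Lp_eqs)
 \<comment> \<open>The representative that \<open>W1p_norm\<close> picks by choice; uniqueness of
   coefficients identifies it with h - k almost everywhere.\<close>
 define s where "s = (SOME h. Lp p h & mult_rel sqrtLap g h)"
 have s2: "LL p s" "mult_rel sqrtLap g s" using someI[of "%h. Lp p h & mult_rel sqrtLap g h", OF s] by (auto simp: s_def Lp_eqs)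
 have W: "W1p_norm p g = nL p g + nL p s" by (simp add: W1p_norm_def s_def Lp_eqs)
 have "mult_rel (%l. real l + 1) g (%x. 1 * s x + 1 * k x)" using mult_rel_add[OF s2(2) k(3), of 1 1] by simp
 from mult_rel_unique[OF gh this] have ae: "AE x in sigmaS. h x = s x + k x" by simp
 have m: "h \<in> borel_measurable sigmaS" "s \<in> borel_measurable sigmaS" "k \<in> borel_measurable sigmaS"
  using h s2 k by (auto intro: in_Lp_measurable)
 have "nL p h = nL p (%x. s x + k x)" by (rule Lp_nm_cong_AE) (use ae m in auto)
 also have "... <= nL p s + nL p k" by (rule Lp_nm_triangle[OF s2(1) k(1) p1])
 finally show "nL p h <= W1p_norm p g" using k(2) by (simp add: W)
 have "nL p s = nL p (%x. h x - k x)" by (rule Lp_nm_cong_AE) (use ae m in auto)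
 also have "... <= nL p h + nL p k" by (rule Lp_nm_triangle_diff[OF h k(1) p1])
 finally show "W1p_norm p g <= 3 * nL p h" using k(2) le by (simp add: W)
qed

lemma W1p_suc_mult:
 assumes p: "1 < p" and g: "g \<in> W1p p" obtains h where "LL p g" "LL p h" "suc_mult g h"
proof -
 have p1: "1 <= p" using p by simp
 obtain s where s: "LL p g" "LL p s" "mult_rel sqrtLap g s" using g by (auto simp: W1p_def Lp_eqs)
 obtain k where k: "LL p k" "nL p k <= nL p g" "mult_rel (%l. real l + 1 - sqrtLap l) g k"
  by (rule contractive_extend[OF contractive_sqrt_defect[OF p1] p s(1)])
 have "suc_mult g (%x. 1 * s x + 1 * k x)" using mult_rel_add[OF s(3) k(3), of 1 1] by simp
 then show ?thesis using that[OF s(1)] in_Lp_add[OF s(2) k(1) p1] by simp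
qed

section \<open>Normal parts, components and radial fields\<close>

lemma LL_inner:
 fixes F V :: "R3 => R3"
 assumes F: "LL p F" and V: "V \<in> borel_measurable sigmaS" "!!x. x \<in> SS ==> norm (V x) <= 1" and p: "1 <= p"
 shows "LL p (%x. F x \<bullet> V x)" "nL p (%x. F x \<bullet> V x) <= nL p F"
proof -
 have m: "F \<in> borel_measurable sigmaS" "(%x. F x \<bullet> V x) \<in> borel_measurable sigmaS" using F V by (auto simp: in_Lp_def)
 have le: "norm (F x \<bullet> V x) <= norm (F x)" if "x \<in> space sigmaS" for x
  using Cauchy_Schwarz_ineq2[of "F x" "V x"] V(2)[of x] that mult_left_mono[of "norm (V x)" 1 "norm (F x)"] by simp
 show "LL p (%x. F x \<bullet> V x)" by (rule in_Lp_bound[OF F m(2)]) (use le p in auto)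
 show "nL p (%x. F x \<bullet> V x) <= nL p F" by (rule Lp_nm_mono[OF F m(2)]) (use le p in auto)
qed

lemma id_meas_norm: "(%x. x) \<in> borel_measurable sigmaS" "x \<in> SS ==> norm x <= 1"
 using sg.id_meas by auto

lemmas LL_normal = LL_inner[OF _ id_meas_norm(1,2)]

lemma LL_nth: "LL p F ==> 1 <= p ==> LL p (%x. F x $ i)" "LL p F ==> 1 <= p ==> nL p (%x. F x $ i) <= nL p F" for F :: "R3 => R3"
 using LL_inner[of p F "%_. axis i 1"] by (auto simp: inner_axis)

lemma LL_radial:
 assumes h: "LL p h" shows "LL p (%x. h x *R x)" "nL p (%x. h x *R x) = nL p h"
proof -
 have e: "norm (h x *R x) powr p = norm (h x) powr p" if "x \<in> space sigmaS" for x using that by simp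
 have [measurable]: "h \<in> borel_measurable sigmaS" "(%x. x) \<in> borel_measurable sigmaS" using h id_meas_norm(1) by (auto simp: in_Lp_def)
 have m: "(%x. h x *R x) \<in> borel_measurable sigmaS" by measurable
 show "LL p (%x. h x *R x)" unfolding in_Lp_def
  using h LINT_integrable_cong[OF refl e, of sigmaS "%x. x"] m by (simp add: in_Lp_def)
 show "nL p (%x. h x *R x) = nL p h" unfolding Lp_nm_def using LINT_cong[OF refl e, of sigmaS "%x. x"] by simp
qed

lemma tendsto_le0: "(!!n. (0::real) <= f n) ==> (!!n. f n <= c * g n) ==> g \<longlonglongrightarrow> 0 ==> f \<longlonglongrightarrow> 0"
 by (rule tendsto_sandwich[OF _ _ tendsto_const tendsto_mult_right_zero[of g _ c]]) auto

text \<open>Weak spherical gradient; the formula is \<open>sphere_ibp\<close> for the product g q.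
  It is linear, closed under L^p limits and determines G almost everywhere, which the existential
  approximants in \<open>sgrad_rel\<close> do not show.\<close>

definition wgrad :: "(R3 => real) => (R3 => R3) => bool" where
 "wgrad g G \<longleftrightarrow> integrable sigmaS g & integrable sigmaS G & (ALL q i. real_polynomial_function q -->
   (\<integral>S x. G x $ i * q x) = (\<integral>S x. g x * (2 * q x * x $ i - sgrad q x $ i)))"

lemma C1g_sgrad_cont: "C1g q (grad q) ==> continuous_on A (sgrad q)"
 unfolding sgrad_def[abs_def] by (intro continuous_intros C1g_cont_grad)

lemma int_nth: "integrable sigmaS G ==> integrable sigmaS (%x. G x $ i :: real)"
 using integrable_bounded_linear[OF bounded_linear_vec_nth] by blast

lemma wgrad_test_cont:
 assumes "real_polynomial_function q" shows "continuous_on SS (%x. 2 * q x * x $ i - sgrad q x $ i)" "continuous_on SS q"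
proof -
 have C: "C1g q (grad q)" using rpf_grad[OF assms] by blast
 show "continuous_on SS (%x. 2 * q x * x $ i - sgrad q x $ i)" "continuous_on SS q"
  by (intro continuous_intros C1g_sgrad_cont[OF C] C1g_cont[OF C])+
qed

lemma wgrad_sgrad:
 assumes C: "C1g f f'" shows "wgrad f (sgrad f)"
proof -
 note Cg = C1g_grad_self[OF C]
 have fc: "continuous_on SS f" "continuous_on SS (sgrad f)" by (rule C1g_cont[OF C] C1g_sgrad_cont[OF Cg])+
 have "(\<integral>S x. sgrad f x $ i * q x) = (\<integral>S x. f x * (2 * q x * x $ i - sgrad q x $ i))"
  if q: "real_polynomial_function q" for q i
 proof -
  have qg: "C1g q (grad q)" using rpf_grad[OF q] by blast
  have qc: "continuous_on SS q" "continuous_on SS (sgrad q)" by (rule C1g_cont[OF qg] C1g_sgrad_cont[OF qg])+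
  have "(\<integral>S x. f x * sgrad q x $ i + sgrad f x $ i * q x)
    = (\<integral>S x. (f x *R grad q x + q x *R grad f x - (x \<bullet> (f x *R grad q x + q x *R grad f x)) *R x) \<bullet> axis i 1)"
   by (rule LINT_cong) (simp_all add: inner_axis sgrad_def algebra_simps inner_add_right)
  also have "... = 2 * (\<integral>S x. f x * q x * (x \<bullet> axis i 1))" by (rule sphere_ibp[OF C1g_mult[OF Cg qg]])
  also have "... = (\<integral>S x. 2 * (f x * q x * (x \<bullet> axis i 1)))" by (rule integral_mult_right_zero[symmetric])
  also have "... = (\<integral>S x. f x * (2 * q x * x $ i))"
   by (rule LINT_cong) (simp_all add: inner_axis)
  finally have "(\<integral>S x. f x * sgrad q x $ i + sgrad f x $ i * q x) = (\<integral>S x. f x * (2 * q x * x $ i))" .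
  moreover have "integrable sigmaS (%x. f x * sgrad q x $ i)" "integrable sigmaS (%x. sgrad f x $ i * q x)"
   "integrable sigmaS (%x. f x * (2 * q x * x $ i))"
   by (rule sg.cont_int, use fc qc in \<open>auto intro!: continuous_intros\<close>)+
  ultimately show ?thesis by (simp add: right_diff_distrib)
 qed
 then show ?thesis using fc by (auto simp: wgrad_def intro: sg.cont_int)
qed

lemma wgrad_lin:
 assumes "wgrad f F" "wgrad g G" shows "wgrad (%x. a * f x + b * g x) (%x. a *R F x + b *R G x)"
 unfolding wgrad_def
proof (intro conjI allI impI)
 have i: "integrable sigmaS f" "integrable sigmaS g" "integrable sigmaS F" "integrable sigmaS G" using assms by (auto simp: wgrad_def)
 then show "integrable sigmaS (%x. a * f x + b * g x)" "integrable sigmaS (%x. a *R F x + b *R G x)" by auto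
 fix q :: "R3 => real" and j assume q: "real_polynomial_function q"
 have "integrable sigmaS (%x. F x $ j * q x)" "integrable sigmaS (%x. G x $ j * q x)"
  "integrable sigmaS (%x. f x * (2 * q x * x $ j - sgrad q x $ j))" "integrable sigmaS (%x. g x * (2 * q x * x $ j - sgrad q x $ j))"
  using i wgrad_test_cont[OF q] by (auto intro!: int_mult_cont int_nth)
 then show "(\<integral>S x. (a *R F x + b *R G x) $ j * q x) = (\<integral>S x. (a * f x + b * g x) * (2 * q x * x $ j - sgrad q x $ j))"
  using assms q by (simp add: wgrad_def distrib_right mult.assoc)
qed

lemma wgrad_unique:
 assumes "wgrad g G" "wgrad g' G'" and ae: "AE x in sigmaS. g x = g' x" shows "AE x in sigmaS. G x = G' x"
proof -
 have i: "integrable sigmaS g" "integrable sigmaS g'" "integrable sigmaS G" "integrable sigmaS G'" using assms by (auto simp: wgrad_def)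
 have "AE x in sigmaS. G x $ j - G' x $ j = 0" for j
 proof (rule coeffs_unique)
  show "integrable sigmaS (%x. G x $ j - G' x $ j)" using i by (auto intro: int_nth)
  fix l Y assume "Y \<in> sph_harm l"
  then have Y: "real_polynomial_function Y" by (rule rpf_sph_harm)
  note c = wgrad_test_cont[OF Y]
  have "(\<integral>S x. g x * (2 * Y x * x $ j - sgrad Y x $ j)) = (\<integral>S x. g' x * (2 * Y x * x $ j - sgrad Y x $ j))"
   by (rule integral_cong_AE) (use i ae int_mult_cont[OF _ c(1)] in \<open>auto intro!: borel_measurable_integrable\<close>)
  then have "(\<integral>S x. G x $ j * Y x) = (\<integral>S x. G' x $ j * Y x)" using assms(1,2) Y by (simp add: wgrad_def)
  moreover have "integrable sigmaS (%x. G x $ j * Y x)" "integrable sigmaS (%x. G' x $ j * Y x)"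
   using i c by (auto intro!: int_mult_cont int_nth)
  ultimately show "(\<integral>S x. (G x $ j - G' x $ j) * Y x) = 0" by (simp add: left_diff_distrib)
 qed
 then have "AE x in sigmaS. ALL j:UNIV. G x $ j - G' x $ j = 0" by (intro AE_finite_allI) auto
 then show ?thesis by eventually_elim (simp add: vec_eq_iff)
qed

lemma pairing_tendsto_LL:
 fixes f :: "nat => R3 => real"
 assumes "!!n. LL p (f n)" "LL p g" "Lconv p f g" "1 < p" "continuous_on SS Y"
 shows "(%n. \<integral>S x. f n x * Y x) \<longlonglongrightarrow> (\<integral>S x. g x * Y x)"
 by (rule pairing_tendsto[OF LL_int[OF assms(1)] LL_int[OF assms(2)] L1_tendsto[OF sg.finite_measure_axioms assms(1,2,4,3)] assms(5)])
   (use assms(4) in auto)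

lemma LL_nth_tendsto:
 fixes F :: "nat => R3 => R3"
 assumes "!!n. LL p (F n)" "LL p G" "Lconv p F G" "1 <= p"
 shows "(%n. nL p (%x. F n x $ i - G x $ i)) \<longlonglongrightarrow> 0"
proof (rule tendsto_le0[OF _ _ assms(3), where c=1])
 show "nL p (%x. F n x $ i - G x $ i) <= 1 * nL p (%x. F n x - G x)" for n
  using LL_nth(2)[OF in_Lp_diff[OF assms(1,2,4)] assms(4), of n i] by simp
qed simp

lemma LL_normal_tendsto:
 fixes F :: "nat => R3 => R3"
 assumes "!!n. LL p (F n)" "LL p G" "Lconv p F G" "1 <= p"
 shows "(%n. nL p (%x. F n x \<bullet> x - G x \<bullet> x)) \<longlonglongrightarrow> 0"
proof (rule tendsto_le0[OF _ _ assms(3), where c=1])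
 show "nL p (%x. F n x \<bullet> x - G x \<bullet> x) <= 1 * nL p (%x. F n x - G x)" for n
  using LL_normal(2)[OF in_Lp_diff[OF assms(1,2,4)] _ assms(4), of n] by (simp add: inner_diff_left)
qed simp

lemma wgrad_limit:
 assumes w: "!!n. wgrad (f n) (F n)" and L: "!!n. LL p (f n)" "LL p g" "!!n. LL p (F n)" "LL p G"
  and lim: "Lconv p f g" "Lconv p F G" and p: "1 < p"
 shows "wgrad g G"
 unfolding wgrad_def
proof (intro conjI allI impI)
 have p1: "1 <= p" using p by simp
 show "integrable sigmaS g" "integrable sigmaS G" using L p1 by (auto intro: LL_int)
 fix q :: "R3 => real" and i assume q: "real_polynomial_function q"
 note c = wgrad_test_cont[OF q]
 have "(%n. \<integral>S x. F n x $ i * q x) \<longlonglongrightarrow> (\<integral>S x. G x $ i * q x)"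
  by (intro pairing_tendsto_LL[of p "%n x. F n x $ i"] LL_nth(1) LL_nth_tendsto L lim(2) p p1 c)
 moreover have "(%n. \<integral>S x. f n x * (2 * q x * x $ i - sgrad q x $ i)) \<longlonglongrightarrow> (\<integral>S x. g x * (2 * q x * x $ i - sgrad q x $ i))"
  by (rule pairing_tendsto_LL[OF L(1,2) lim(1) p c(1)])
 ultimately show "(\<integral>S x. G x $ i * q x) = (\<integral>S x. g x * (2 * q x * x $ i - sgrad q x $ i))"
  using w q by (intro LIMSEQ_unique) (simp_all add: wgrad_def)
qed

text \<open>Convergence in \<open>W1p_norm\<close> contains convergence in L^p, so the weak formula
  passes to the limit. Hence all fields related to g agree almost everywhere.\<close>

lemma sgrad_rel_wgrad:
 assumes s: "sgrad_rel p g G" and g: "LL p g" and p: "1 < p" shows "wgrad g G"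
proof -
 have p1: "1 <= p" using p by simp
 from s obtain \<phi> where \<phi>: "!!n. smooth (\<phi> n)" "(%n. W1p_norm p (%x. \<phi> n x - g x)) \<longlonglongrightarrow> 0" "(%n. nL p (%x. sgrad (\<phi> n) x - G x)) \<longlonglongrightarrow> 0" and G: "LL p G"
  unfolding sgrad_rel_def Lp_eqs by blast
 note C = smooth_C1g[OF \<phi>(1)]
 have L: "LL p (\<phi> n)" "LL p (sgrad (\<phi> n))" for n using p1 by (auto intro!: cont_LL C1g_cont[OF C] C1g_sgrad_cont[OF C])
 have "Lconv p \<phi> g"
  by (rule tendsto_le0[OF _ _ \<phi>(2), where c=1]) (auto simp: W1p_norm_def Lp_eqs)
 from wgrad_limit[OF wgrad_sgrad[OF C] L(1) g L(2) G this \<phi>(3) p] show ?thesis .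
qed

text \<open>A finite sum u of harmonics with its image under L_+: the dense class on which
  everything is computed.\<close>

definition harm_pair :: "(R3 => real) => (R3 => R3) => bool" where
 "harm_pair u F \<longleftrightarrow> (EX Ys N. (ALL l. Ys l \<in> sph_harm l) & u = (%x. \<Sum>l<(N::nat). Ys l x) & F = (%x. \<Sum>l<N. Eplus l (Ys l) x))"

lemma sgrad_normal: "x \<in> SS ==> sgrad u x \<bullet> x = 0"
 by (simp add: sgrad_def inner_diff_left dot_square_norm) (simp add: inner_commute)

lemma harm_pairD:
 assumes "harm_pair u F"
 shows "real_polynomial_function u" "C1g u (grad u)" "continuous_on A F" "F \<in> Eplus_span" "suc_mult u (%x. F x \<bullet> x)"
  "!!x. x \<in> SS ==> F x = (F x \<bullet> x) *R x - sgrad u x" "wgrad u (%x. (F x \<bullet> x) *R x - F x)"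
proof -
 from assms obtain Ys N where Y': "ALL l. Ys l \<in> sph_harm l" and u: "u = (%x. \<Sum>l<(N::nat). Ys l x)" and F: "F = (%x. \<Sum>l<N. Eplus l (Ys l) x)"
  unfolding harm_pair_def by (elim exE conjE)
 note Y = Y'[rule_format]
 have g: "grad u x = (\<Sum>l<N. grad (Ys l) x)" for x unfolding u by (rule C1g_grad[OF harm_sum_C1g[OF Y]])
 show "real_polynomial_function u" unfolding u by (rule real_polynomial_function_sum) (auto intro: rpf_sph_harm Y)
 show C: "C1g u (grad u)" unfolding u by (rule C1g_grad_self[OF harm_sum_C1g[OF Y]])
 show Fc: "continuous_on A F" for A unfolding F Eplus_def
  by (intro continuous_intros sph_harm_cont[OF Y] C1g_sgrad_cont sph_harm_C1g[OF Y])
 show "F \<in> Eplus_span" unfolding Eplus_span_def F using Y' by blast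
 have Fx: "F x \<bullet> x = (\<Sum>l<N. (real l + 1) * Ys l x)" if x: "x \<in> SS" for x
  using x sgrad_normal[OF x] by (simp add: F inner_sum_left Eplus_def inner_diff_left dot_square_norm)
 show "suc_mult u (%x. F x \<bullet> x)"
  using sum_mult_rel[OF Y, of "%l. real l + 1" N] mult_rel_cong[OF _ Fx, of u u] by (simp add: u)
 have sg: "(\<Sum>l<N. sgrad (Ys l) x) = sgrad u x" for x
  by (simp add: sgrad_def g sum_subtractf inner_sum_right scaleR_sum_left)
 show Feq: "F x = (F x \<bullet> x) *R x - sgrad u x" if x: "x \<in> SS" for x
  unfolding Fx[OF x] by (simp add: F Eplus_def sum_subtractf sg scaleR_sum_left)
 have "sgrad u x = (F x \<bullet> x) *R x - F x" if "x \<in> SS" for x using Feq[OF that] by (simp add: algebra_simps)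
 then have "wgrad u (sgrad u) \<longleftrightarrow> wgrad u (%x. (F x \<bullet> x) *R x - F x)"
  unfolding wgrad_def by (intro arg_cong2[where f="(&)"] refl all_cong1 imp_cong arg_cong2[where f="(=)"]
   LINT_integrable_cong LINT_cong) auto
 then show "wgrad u (%x. (F x \<bullet> x) *R x - F x)" using wgrad_sgrad[OF C] by blast
qed

lemma Hsp_potential:
 assumes p: "1 < p"
 shows "EX C>0. ALL q:Hsp. EX u F. harm_pair u F & (ALL x:SS. F x \<bullet> x = q x) & nL p (sgrad u) <= C * nL p q"
proof -
 have p1: "1 <= p" using p by simp
 from Riesz_sgrad[OF p] obtain C where C: "0 < C" "ALL Ys N. (ALL l. Ys l \<in> sph_harm l) -->
  nL p (sgrad (%x. \<Sum>l<N. 1 / (2 * real l + 1) * Ys l x)) <= C * nL p (%x. \<Sum>l<N. Ys l x)" by (elim exE conjE)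
 have "EX u F. harm_pair u F & (ALL x:SS. F x \<bullet> x = q x) & nL p (sgrad u) <= 3 * C * nL p q" if "q \<in> Hsp" for q
 proof -
  from HspE[OF that] obtain Ys N where Y: "ALL l. Ys l \<in> sph_harm l" "ALL x M. x \<in> SS --> N <= M --> q x = (\<Sum>l<M. Ys l x)" by metis
  have qY: "q x = (\<Sum>l<N. Ys l x)" if "x \<in> SS" for x using Y(2) that by simp
  define Zs where "Zs l x = 1 / (real l + 1) * Ys l x" for l x
  have Z: "Zs l \<in> sph_harm l" for l unfolding Zs_def[abs_def] by (rule sph_harm_cmult) (use Y in blast)
  define u where "u x = (\<Sum>l<N. Zs l x)" for x
  define F where "F x = (\<Sum>l<N. Eplus l (Zs l) x)" for x
  have hp: "harm_pair u F" unfolding harm_pair_def u_def[abs_def] F_def[abs_def] using Z by blast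
  have "F x \<bullet> x = q x" if x: "x \<in> SS" for x
   using x sgrad_normal[OF x] by (simp add: F_def inner_sum_left Eplus_def inner_diff_left dot_square_norm qY Zs_def)
  moreover have "nL p (sgrad u) <= 3 * C * nL p q"
  proof -
   \<comment> \<open>W carries the coefficients of 2q - Tq. As (2 - 1/(l+1))/(2l+1) = 1/(l+1), its
     single layer potential is u. Its norm is at most 2 + 1 times that of q, hence the constant 3
     C.\<close>
   define W where "W l x = (2 - 1 / (real l + 1)) * Ys l x" for l x
   have W: "ALL l. W l \<in> sph_harm l" unfolding W_def[abs_def] using Y sph_harm_cmult by blast
   have cf: "1 / (2 * real l + 1) * (2 - 1 / (real l + 1)) = 1 / (real l + 1)" for l by (simp add: divide_simps)
   have "u = (%x. \<Sum>l<N. 1 / (2 * real l + 1) * W l x)" unfolding u_def[abs_def] W_def mult.assoc[symmetric] cf Zs_def ..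
   then have "nL p (sgrad u) <= C * nL p (%x. \<Sum>l<N. W l x)" using mp[OF spec[OF spec[OF C(2), of W], of N] W] by (simp only:)
   also have "(%x. \<Sum>l<N. W l x) = (%x. 2 *R (\<Sum>l<N. Ys l x) - u x)"
    by (simp add: W_def u_def Zs_def left_diff_distrib sum_subtractf sum_distrib_left)
   also have "nL p (%x. 2 *R (\<Sum>l<N. Ys l x) - u x) <= nL p (%x. 2 *R (\<Sum>l<N. Ys l x)) + nL p u"
    unfolding u_def[abs_def]
    by (intro Lp_nm_triangle_diff p1 cont_LL[OF _ p1] continuous_on_scaleR continuous_on_const sum_sph_harm_cont Y(1)[rule_format] Z)
   also have "nL p u <= nL p (%x. \<Sum>l<N. Ys l x)"
    using contractive_recip[OF p1, of 1] Y by (simp add: contractive_def u_def[abs_def] Zs_def)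
   also have "nL p (%x. 2 *R (\<Sum>l<N. Ys l x)) = 2 * nL p (%x. \<Sum>l<N. Ys l x)" using p by (subst Lp_nm_scaleR) auto
   also have "nL p (%x. \<Sum>l<N. Ys l x) = nL p q" by (rule Lp_nm_cong) (simp add: qY)
   finally show ?thesis using C(1) by (simp add: mult.assoc)
  qed
  ultimately show ?thesis using hp by blast
 qed
 moreover have "0 < 3 * C" using C by simp
 ultimately show ?thesis by blast
qed

text \<open>What later limits need about F = L_+ g with normal component h: a bound, the recovery of
  h from F, and simultaneous approximation of g and F by harmonic pairs.\<close>

definition pot_approx :: "real => real => (R3 => real) => (R3 => real) => (R3 => R3) => bool" where
 "pot_approx p C g h F \<longleftrightarrow> LL p F & nL p F <= C * nL p h & (AE x in sigmaS. h x = F x \<bullet> x) & (EX us Fs.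
   (ALL n. harm_pair (us n) (Fs n)) & Lconv p us g & Lconv p Fs F)"

theorem potential:
 assumes p: "1 < p"
 shows "EX C>0. ALL g h. LL p g --> LL p h --> suc_mult g h --> (EX F. pot_approx p C g h F & sgrad_rel p g (%x. h x *R x - F x))"
proof -
 have p1: "1 <= p" using p by simp
 from Hsp_potential[OF p] obtain C where C: "0 < C" "ALL q:Hsp. EX u F. harm_pair u F & (ALL x:SS. F x \<bullet> x = q x) & nL p (sgrad u) <= C * nL p q" by (elim exE conjE)
 have "EX F. pot_approx p (1 + C) g h F & sgrad_rel p g (%x. h x *R x - F x)"
  if g: "LL p g" and h: "LL p h" and gh: "suc_mult g h" for g h
 proof -
  obtain q :: "nat => R3 => real" where q: "!!n. real_polynomial_function (q n)" "!!n. LL p (q n)"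
   "Lconv p q h" using Lp_poly_seq[OF h p1] by blast
  have "ALL n. EX z. harm_pair (fst z) (snd z) & (ALL x:SS. snd z x \<bullet> x = q n x) & nL p (sgrad (fst z)) <= C * nL p (q n)"
   using C(2) Hsp_poly[OF q(1)] by (metis fst_conv snd_conv)
  from choice[OF this] obtain z where z: "ALL n. harm_pair (fst (z n)) (snd (z n)) & (ALL x:SS. snd (z n) x \<bullet> x = q n x) & nL p (sgrad (fst (z n))) <= C * nL p (q n)" ..
  define u F where "u n = fst (z n)" and "F n = snd (z n)" for n
  have hp: "harm_pair (u n) (F n)" and Fq: "!!x. x \<in> SS ==> F n x \<bullet> x = q n x" and sb: "nL p (sgrad (u n)) <= C * nL p (q n)" for n
   using z by (auto simp: u_def F_def)
  note hD = harm_pairD[OF hp]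
  have mq: "suc_mult (u n) (q n)" for n using hD(5) mult_rel_cong[of "u n" "u n" "%x. F n x \<bullet> x" "q n"] Fq by blast
  have uL: "LL p (u n)" "LL p (sgrad (u n))" "LL p (F n)" for n
   using p1 by (auto intro!: cont_LL C1g_cont[OF hD(2)] C1g_sgrad_cont[OF hD(2)] hD(3))
  \<comment> \<open>\<open>Hsp_potential\<close> picks a potential for each polynomial separately.
    The one of \<open>q m - q n\<close> has the coefficients of \<open>u m - u n\<close>, so their
    gradients agree almost everywhere, and the bound for it makes the gradients Cauchy.\<close>
  have cau: "nL p (%x. sgrad (u m) x - sgrad (u n) x) <= C * nL p (%x. q m x - q n x)" for m n
  proof -
   have "(%x. 1 * q m x + - 1 * q n x) \<in> Hsp" by (intro Hsp_lin Hsp_poly q)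
   from bspec[OF C(2) this] obtain u' F' where u': "harm_pair u' F'" "ALL x:SS. F' x \<bullet> x = 1 * q m x + - 1 * q n x"
    "nL p (sgrad u') <= C * nL p (%x. 1 * q m x + - 1 * q n x)" by blast
   note D' = harm_pairD[OF u'(1)]
   have "suc_mult u' (%x. 1 * q m x + - 1 * q n x)"
    using D'(5) mult_rel_cong[of u' u' "%x. F' x \<bullet> x" "%x. 1 * q m x + - 1 * q n x"] u'(2) by blast
   then have "AE x in sigmaS. 1 * u m x + - 1 * u n x = u' x"
    by (rule suc_mult_cong_AE[OF mult_rel_lin[OF mq[of m] mq[of n], of 1 "-1"]]) simp
   from wgrad_unique[OF wgrad_lin[OF wgrad_sgrad[OF hD(2)] wgrad_sgrad[OF hD(2)]] wgrad_sgrad[OF D'(2)] this]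
   have "AE x in sigmaS. sgrad (u m) x - sgrad (u n) x = sgrad u' x" by simp
   then have "nL p (%x. sgrad (u m) x - sgrad (u n) x) = nL p (sgrad u')"
    by (intro Lp_nm_cong_AE in_Lp_measurable[OF in_Lp_diff[OF uL(2) uL(2) p1]] sg.cont_meas C1g_sgrad_cont D'(2))
   then show ?thesis using u'(3) by simp
  qed
  have cG: "EX N. ALL m>=N. ALL n>=N. nL p (%x. sgrad (u m) x - sgrad (u n) x) < e" if "0 < e" for e
  proof -
   from that have "0 < e / C" using C(1) by simp
   from Lp_limit_cauchy[OF q(2) h q(3) p1 this] obtain N where N: "ALL m>=N. ALL n>=N. nL p (%x. q m x - q n x) < e / C" ..
   have "nL p (%x. sgrad (u m) x - sgrad (u n) x) < e" if "N <= m" "N <= n" for m n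
    using cau[of m n] N[rule_format, OF that] C(1) by (simp add: pos_less_divide_eq mult.commute)
   then show ?thesis by blast
  qed
  obtain G where G: "LL p G" "(%n. nL p (%x. sgrad (u n) x - G x)) \<longlonglongrightarrow> 0"
   by (rule Lp_complete[OF uL(2) p1 cG])
  define F0 where "F0 x = h x *R x - G x" for x
  have F0: "LL p F0" unfolding F0_def[abs_def] by (intro in_Lp_diff LL_radial h G p1)
  have FF0: "Lconv p F F0"
  proof (rule tendsto_le0[where c=1])
   fix n
   have "nL p (%x. F n x - F0 x) = nL p (%x. (q n x - h x) *R x - (sgrad (u n) x - G x))"
   proof (rule Lp_nm_cong)
    fix x assume x: "x \<in> space sigmaS"
    then have "F n x = q n x *R x - sgrad (u n) x" using hD(6)[of x n] Fq[of x n] by simp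
    then show "F n x - F0 x = (q n x - h x) *R x - (sgrad (u n) x - G x)" by (simp add: F0_def algebra_simps)
   qed
   also have "... <= nL p (%x. (q n x - h x) *R x) + nL p (%x. sgrad (u n) x - G x)"
    by (intro Lp_nm_triangle_diff LL_radial in_Lp_diff q h uL G p1)
   finally show "nL p (%x. F n x - F0 x) <= 1 * (nL p (%x. q n x - h x) + nL p (%x. sgrad (u n) x - G x))"
    using LL_radial(2)[OF in_Lp_diff[OF q(2) h p1]] by simp
   show "(%n. nL p (%x. q n x - h x) + nL p (%x. sgrad (u n) x - G x)) \<longlonglongrightarrow> 0"
    using tendsto_add[OF q(3) G(2)] by simp
  qed simp
  have dif: "LL p (%x. u n x - g x)" "LL p (%x. q n x - h x)" "suc_mult (%x. u n x - g x) (%x. q n x - h x)" for n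
   using mult_rel_lin[OF mq gh, of 1 n "-1"] by (auto intro!: in_Lp_diff uL q g h p1)
  note dW = suc_mult_W1p[OF p dif]
  have ug: "Lconv p u g" by (rule tendsto_le0[OF _ _ q(3), where c=1]) (use dW(2) in auto)
  have W0: "0 <= W1p_norm p f" for f by (simp add: W1p_norm_def Lp_eqs)
  have "sgrad_rel p g G" unfolding sgrad_rel_def Lp_eqs
   by (intro conjI exI[of _ u] allI rpf_smooth hD(1) G tendsto_le0[OF W0 dW(4) q(3)])
  moreover have "(%x. h x *R x - F0 x) = G" by (simp add: F0_def)
  moreover have "nL p F0 <= (1 + C) * nL p h"
  proof -
   have "nL p G <= C * nL p h"
    by (rule LIMSEQ_le[OF Lp_nm_tendsto[OF uL(2) G(1) p1 G(2)] tendsto_mult[OF tendsto_const Lp_nm_tendsto[OF q(2) h p1 q(3)]]])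
      (use sb in blast)
   moreover have "nL p F0 <= nL p (%x. h x *R x) + nL p G" unfolding F0_def[abs_def]
    by (intro Lp_nm_triangle_diff LL_radial h G p1)
   ultimately show ?thesis using LL_radial(2)[OF h] by (simp add: algebra_simps)
  qed
  moreover have "AE x in sigmaS. h x = F0 x \<bullet> x"
  proof (rule Lp_limit_unique[OF q(2) h LL_normal(1)[OF F0 _ p1] p1 q(3)])
   have "nL p (%x. q n x - F0 x \<bullet> x) = nL p (%x. F n x \<bullet> x - F0 x \<bullet> x)" for n by (rule Lp_nm_cong) (simp add: Fq)
   then show "(%n. nL p (%x. q n x - F0 x \<bullet> x)) \<longlonglongrightarrow> 0" using LL_normal_tendsto[OF uL(3) F0 FF0 p1] by simp
  qed simp
  ultimately show ?thesis unfolding pot_approx_def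
   by (intro exI[of _ F0] conjI exI[of _ u] exI[of _ F] allI hp ug F0 FF0) simp_all
 qed
 moreover have "0 < 1 + C" using C(1) by simp
 ultimately show ?thesis by blast
qed

section \<open>The spaces of boundary values\<close>

lemma sgrad_rel_cong:
 assumes s: "sgrad_rel p g G" and ae: "AE x in sigmaS. G x = G' x" and G': "G' \<in> borel_measurable sigmaS"
 shows "sgrad_rel p g G'"
proof -
 have GL: "LL p G" using s by (simp add: sgrad_rel_def Lp_eqs)
 then have Gm: "G \<in> borel_measurable sigmaS" by (rule in_Lp_measurable)
 have "nL p (%x. sgrad f x - G x) = nL p (%x. sgrad f x - G' x)" if "smooth f" for f
 proof (rule Lp_nm_cong_AE)
  have "sgrad f \<in> borel_measurable sigmaS" using C1g_sgrad_cont[OF smooth_C1g[OF that]] by (rule sg.cont_meas)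
  then show "(%x. sgrad f x - G x) \<in> borel_measurable sigmaS" "(%x. sgrad f x - G' x) \<in> borel_measurable sigmaS" using Gm G' by auto
 qed (use ae in auto)
 note eq = this
 from s obtain \<phi> where \<phi>: "!!n. smooth (\<phi> n)" "(%n. W1p_norm p (%x. \<phi> n x - g x)) \<longlonglongrightarrow> 0" "(%n. nL p (%x. sgrad (\<phi> n) x - G x)) \<longlonglongrightarrow> 0"
  unfolding sgrad_rel_def Lp_eqs by blast
 show ?thesis unfolding sgrad_rel_def Lp_eqs
  using \<phi>(3) unfolding eq[OF \<phi>(1)] by (intro conjI exI[of _ \<phi>] allI \<phi>(1,2) in_Lp_cong_AE[OF GL G' ae])
qed

lemma Lplus_exists:
 assumes p: "1 < p" and g: "LL p g" and h: "LL p h" and gh: "suc_mult g h"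
 shows "EX F. Lplus_rel p g F & LL p F & wgrad g (%x. h x *R x - F x)"
proof -
 obtain F where F: "LL p F" "sgrad_rel p g (%x. h x *R x - F x)" using potential[OF p] g h gh unfolding pot_approx_def by blast
 have "F = (%x. h x *R x - (h x *R x - F x))" by simp
 then have "Lplus_rel p g F" unfolding Lplus_rel_def Lp_eqs using h gh F(2) by blast
 then show ?thesis using F sgrad_rel_wgrad[OF F(2) g p] by blast
qed

text \<open>\<open>Lplus_rel\<close> admits any representatives of h and of the gradient. Uniqueness
  of weak gradients makes every such F agree almost everywhere with the constructed one, so it
  inherits bound and approximation.\<close>

theorem Lplus_approx:
 assumes p: "1 < p"
 shows "EX C>0. ALL g F. LL p g --> Lplus_rel p g F --> (EX h. pot_approx p C g h F & LL p h & suc_mult g h & wgrad g (%x. h x *R x - F x))"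
proof -
 have p1: "1 <= p" using p by simp
 from potential[OF p] obtain C where C: "0 < C" "ALL g h. LL p g --> LL p h --> suc_mult g h --> (EX F. pot_approx p C g h F & sgrad_rel p g (%x. h x *R x - F x))" by (elim exE conjE)
 have "EX h. pot_approx p C g h F & LL p h & suc_mult g h & wgrad g (%x. h x *R x - F x)"
  if g: "LL p g" and R: "Lplus_rel p g F" for g F
 proof -
  from R obtain h G where h: "LL p h" "suc_mult g h" "sgrad_rel p g G" "F = (%x. h x *R x - G x)" unfolding Lplus_rel_def Lp_eqs by blast
  from C(2)[rule_format, OF g h(1,2)] obtain us Fs F1 where D0: "nL p F1 <= C * nL p h" "sgrad_rel p g (%x. h x *R x - F1 x)" "AE x in sigmaS. h x = F1 x \<bullet> x" and D: "ALL n. harm_pair (us n) (Fs n)"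
   "Lconv p us g" "LL p F1" "Lconv p Fs F1"
   unfolding pot_approx_def by (elim exE conjE)
  have w: "wgrad g G" by (rule sgrad_rel_wgrad[OF h(3) g p])
  have "AE x in sigmaS. G x = h x *R x - F1 x"
   by (rule wgrad_unique[OF w sgrad_rel_wgrad[OF D0(2) g p]]) simp
  then have ae: "AE x in sigmaS. F1 x = F x" by eventually_elim (simp add: h(4))
  have "LL p G" using h(3) by (simp add: sgrad_rel_def Lp_eqs)
  then have F: "LL p F" unfolding h(4) by (intro in_Lp_diff LL_radial h(1) p1)
  note m = in_Lp_measurable[OF F] in_Lp_measurable[OF D(3)]
  have Fsm: "Fs n \<in> borel_measurable sigmaS" for n using D(1) harm_pairD(3) by (blast intro: sg.cont_meas)
  have "nL p (%x. Fs n x - F1 x) = nL p (%x. Fs n x - F x)" for n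
   by (rule Lp_nm_cong_AE) (use Fsm[of n] m ae in auto)
  then have l: "Lconv p Fs F" using D(4) by simp
  have n: "nL p F1 = nL p F" by (rule Lp_nm_cong_AE) (use m ae in auto)
  have n': "AE x in sigmaS. h x = F x \<bullet> x" using D0(3) ae by eventually_elim simp
  have "(%x. h x *R x - F x) = G" by (simp add: h(4))
  then show ?thesis using D0(1) w unfolding n pot_approx_def
   by (intro exI[of _ h] conjI exI[of _ us] exI[of _ Fs] allI D(1)[rule_format] D(2) l F h(1,2) n') simp_all
 qed
 then show ?thesis using C(1) by blast
qed

text \<open>F = L_+ g up to null sets, with h and the gradient eliminated in favour of F. In this
  form the relation survives L^p limits and a change of exponent.\<close>

definition plus_field :: "real => (R3 => real) => (R3 => R3) => bool" where
 "plus_field p g F \<longleftrightarrow> LL p g & LL p F & suc_mult g (%x. F x \<bullet> x) & wgrad g (%x. (F x \<bullet> x) *R x - F x)"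

lemma harm_pair_plus_field: "harm_pair u F ==> 1 <= p ==> plus_field p u F"
 unfolding plus_field_def by (intro conjI cont_LL harm_pairD C1g_cont[OF harm_pairD(2)])

lemma Eplus_span_harm_pair: assumes "F \<in> Eplus_span" shows "EX u. harm_pair u F"
proof -
 from assms obtain N Ys where Y: "ALL l<N. Ys l \<in> sph_harm l" "F = (%x. \<Sum>l<N. Eplus l (Ys l) x)" unfolding Eplus_span_def by blast
 define Zs where "Zs l = (if l < N then Ys l else (%x. 0))" for l
 have "ALL l. Zs l \<in> sph_harm l" using Y(1) sph_harm_zero by (simp add: Zs_def)
 moreover have "F = (%x. \<Sum>l<N. Eplus l (Zs l) x)" unfolding Y(2) by (intro ext sum.cong) (auto simp: Zs_def)
 ultimately show ?thesis unfolding harm_pair_def by blast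
qed

text \<open>The range of L_+ is closed: convergence of the fields gives convergence of their normal
  components, and the contraction 1/(l+1) turns these into convergent potentials.\<close>

lemma plus_field_limit:
 assumes f: "!!n. plus_field p (f n) (F n)" and F0: "LL p F0" and lim: "Lconv p F F0" and p: "1 < p"
 shows "EX g. plus_field p g F0"
proof -
 have p1: "1 <= p" using p by simp
 have L: "LL p (f n)" "LL p (F n)" "suc_mult (f n) (%x. F n x \<bullet> x)" "wgrad (f n) (%x. (F n x \<bullet> x) *R x - F n x)" for n
  using f by (auto simp: plus_field_def)
 have a: "LL p (%x. F n x \<bullet> x)" "LL p (%x. F0 x \<bullet> x)" for n by (intro LL_normal L F0 p1; simp)+
 note al = LL_normal_tendsto[OF L(2) F0 lim p1]
 obtain g where g: "LL p g" "nL p g <= nL p (%x. F0 x \<bullet> x)" "suc_mult g (%x. F0 x \<bullet> x)" by (rule suc_mult_exists[OF p a(2)])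
 have fg: "Lconv p f g"
 proof (rule tendsto_le0[OF _ _ al, where c=1])
  fix n
  have "suc_mult (%x. f n x - g x) (%x. F n x \<bullet> x - F0 x \<bullet> x)" using mult_rel_lin[OF L(3)[of n] g(3), of 1 "-1"] by simp
  from suc_mult_W1p(2)[OF p in_Lp_diff[OF L(1) g(1) p1] in_Lp_diff[OF a p1] this]
  show "nL p (%x. f n x - g x) <= 1 * nL p (%x. F n x \<bullet> x - F0 x \<bullet> x)" by simp
 qed simp
 have "wgrad g (%x. (F0 x \<bullet> x) *R x - F0 x)"
 proof (rule wgrad_limit[OF L(4) L(1) g(1) _ _ fg _ p])
  show GL: "LL p (%x. (F n x \<bullet> x) *R x - F n x)" "LL p (%x. (F0 x \<bullet> x) *R x - F0 x)" for n
   by (intro in_Lp_diff LL_radial a L F0 p1)+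
  show "(%n. nL p (%x. (F n x \<bullet> x) *R x - F n x - ((F0 x \<bullet> x) *R x - F0 x))) \<longlonglongrightarrow> 0"
  proof (rule tendsto_le0[OF _ _ tendsto_add_zero[OF al lim], where c=1])
   fix n
   have "nL p (%x. (F n x \<bullet> x) *R x - F n x - ((F0 x \<bullet> x) *R x - F0 x)) = nL p (%x. (F n x \<bullet> x - F0 x \<bullet> x) *R x - (F n x - F0 x))"
    by (rule Lp_nm_cong) (simp add: algebra_simps)
   also have "... <= nL p (%x. (F n x \<bullet> x - F0 x \<bullet> x) *R x) + nL p (%x. F n x - F0 x)"
    by (intro Lp_nm_triangle_diff LL_radial in_Lp_diff a L F0 p1)
   finally show "nL p (%x. (F n x \<bullet> x) *R x - F n x - ((F0 x \<bullet> x) *R x - F0 x)) <= 1 * (nL p (%x. F n x \<bullet> x - F0 x \<bullet> x) + nL p (%x. F n x - F0 x))"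
    using LL_radial(2)[OF in_Lp_diff[OF a p1], of n] by simp
  qed simp
 qed
 then show ?thesis using g F0 unfolding plus_field_def by blast
qed

lemma plus_field_Lplus:
 assumes f: "plus_field p g F" and p: "1 < p"
 shows "EX F'. Lplus_rel p g F' & LL p F' & (AE x in sigmaS. F' x = F x)" "g \<in> W1p p"
proof -
 have p1: "1 <= p" using p by simp
 have L: "LL p g" "LL p F" "suc_mult g (%x. F x \<bullet> x)" "wgrad g (%x. (F x \<bullet> x) *R x - F x)" using f by (auto simp: plus_field_def)
 have a: "LL p (%x. F x \<bullet> x)" by (intro LL_normal L p1; simp)
 from Lplus_exists[OF p L(1) a L(3)] obtain F' where F': "Lplus_rel p g F'" "LL p F'" "wgrad g (%x. (F x \<bullet> x) *R x - F' x)" by blast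
 have "AE x in sigmaS. (F x \<bullet> x) *R x - F' x = (F x \<bullet> x) *R x - F x" by (rule wgrad_unique[OF F'(3) L(4)]) simp
 then have "AE x in sigmaS. F' x = F x" by simp
 then show "EX F'. Lplus_rel p g F' & LL p F' & (AE x in sigmaS. F' x = F x)" using F' by blast
 show "g \<in> W1p p" by (rule suc_mult_W1p(1)[OF p L(1) a L(3)])
qed

section \<open>Orthogonality relations and the projection in L^p\<close>

lemma int_inner_cont:
 fixes F E :: "R3 => R3"
 assumes "integrable sigmaS F" "continuous_on SS E" shows "integrable sigmaS (%x. F x \<bullet> E x)"
 unfolding inner_vec_def inner_real_def
 by (intro Bochner_Integration.integrable_sum int_mult_cont int_nth assms continuous_intros)

text \<open>The left side is what \<open>wgrad\<close> produces with grad Y as test field. Euler's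
  identity for Y and for its partial derivatives turns it into the eigenvalue l(l+1) of the
  spherical Laplacian.\<close>

lemma harm_divergence:
 assumes Y: "Y \<in> sph_harm l"
 shows "(\<Sum>i\<in>UNIV. 2 * grad Y x $ i * x $ i - sgrad (%x. grad Y x $ i) x $ i) = real l * (real l + 1) * Y x"
proof -
 have e: "(\<Sum>i\<in>UNIV. grad Y x $ i * x $ i) = real l * Y x"
  using sph_harm_euler[OF Y, of x] by (simp add: inner_vec_def mult.commute)
 have k: "(x \<bullet> grad (%x. grad Y x $ i) x) = (real l - 1) * grad Y x $ i" for i
 proof (cases l)
  case 0
  have "(%x. grad Y x $ i) = (%x. 0)" using sph_harm_grad_0 Y 0 by auto
  then show ?thesis using sph_harm_euler[OF const_sph_harm[of 0], of x] Y sph_harm_grad_0 0 by simp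
 next
  case (Suc k)
  have "(%x. grad Y x $ i) \<in> sph_harm k" using Y sph_harm_grad_comp unfolding Suc by blast
  from sph_harm_euler[OF this, of x] show ?thesis by (simp add: Suc)
 qed
 have "(\<Sum>i\<in>UNIV. 2 * grad Y x $ i * x $ i - sgrad (%x. grad Y x $ i) x $ i)
  = 2 * (\<Sum>i\<in>UNIV. grad Y x $ i * x $ i) - (\<Sum>m\<in>UNIV. grad (%x. grad Y x $ m) x $ m) + (real l - 1) * (\<Sum>i\<in>UNIV. grad Y x $ i * x $ i)"
  by (simp add: sgrad_def k sum_subtractf sum.distrib sum_distrib_left algebra_simps)
 then show ?thesis unfolding e sph_harm_laplacian[OF Y] by (simp add: algebra_simps)
qed

text \<open>The normal and tangential parts contribute l + 1 and l times the same coefficient of F .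
  x. So the pairings with the fields \<open>Eplus l Y\<close> already determine the normal
  component.\<close>

lemma Eplus_pairing:
 assumes f: "plus_field p g F" and p: "1 <= p" and Y: "Y \<in> sph_harm l"
 shows "(\<integral>S x. F x \<bullet> Eplus l Y x) = (2 * real l + 1) * (\<integral>S x. (F x \<bullet> x) * Y x)"
proof -
 define G where "G x = (F x \<bullet> x) *R x - F x" for x
 have L: "LL p F" "suc_mult g (%x. F x \<bullet> x)" "wgrad g G" using f by (auto simp: plus_field_def G_def[abs_def])
 have gi: "integrable sigmaS g" "integrable sigmaS G" "integrable sigmaS (%x. F x \<bullet> x)" using L by (auto simp: wgrad_def mult_rel_def)
 have qi: "real_polynomial_function (%x. grad Y x $ i)" for i using rpf_grad[OF rpf_sph_harm[OF Y]] by blast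
 note c = wgrad_test_cont[OF qi]
 have I1: "integrable sigmaS (%x. G x $ i * grad Y x $ i)" "integrable sigmaS (%x. g x * (2 * grad Y x $ i * x $ i - sgrad (%x. grad Y x $ i) x $ i))" for i
  by (intro int_mult_cont int_nth gi c)+
 have I2: "integrable sigmaS (%x. (F x \<bullet> x) * Y x)" by (intro int_mult_cont gi sph_harm_cont[OF Y])
 have "F x \<bullet> Eplus l Y x = (real l + 1) * ((F x \<bullet> x) * Y x) + G x \<bullet> grad Y x" for x
  by (simp add: Eplus_def sgrad_def G_def inner_diff_left inner_diff_right algebra_simps)
 then have "(\<integral>S x. F x \<bullet> Eplus l Y x) = (\<integral>S x. (real l + 1) * ((F x \<bullet> x) * Y x) + (\<Sum>i\<in>UNIV. G x $ i * grad Y x $ i))"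
  by (simp add: inner_vec_def)
 also have "... = (real l + 1) * (\<integral>S x. (F x \<bullet> x) * Y x) + (\<Sum>i\<in>UNIV. \<integral>S x. G x $ i * grad Y x $ i)"
  using I1(1) I2 by simp
 also have "(\<Sum>i\<in>UNIV. \<integral>S x. G x $ i * grad Y x $ i) = (\<Sum>i\<in>UNIV. \<integral>S x. g x * (2 * grad Y x $ i * x $ i - sgrad (%x. grad Y x $ i) x $ i))"
  using L(3) qi by (simp add: wgrad_def)
 also have "... = (\<integral>S x. g x * (real l * (real l + 1) * Y x))"
  unfolding harm_divergence[OF Y, symmetric] sum_distrib_left by (rule LINT_sum[symmetric]) (rule I1(2))
 also have "... = real l * ((real l + 1) * (\<integral>S x. g x * Y x))"
  by (simp add: mult.left_commute[of "g _"] mult.assoc)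
 also have "(real l + 1) * (\<integral>S x. g x * Y x) = (\<integral>S x. (F x \<bullet> x) * Y x)" using L(2) Y by (simp add: mult_rel_def)
 finally show ?thesis by (simp add: algebra_simps)
qed

lemma Lp_lower_exponent:
 fixes f :: "R3 => real"
 assumes q: "0 < q" "q < s" and f: "LL s f"
 shows "nL q f <= ((4 * pi) powr (1 - q / s)) powr (1 / q) * nL s f"
proof -
 have e: "norm (\<bar>f x\<bar> powr q) powr (s / q) = norm (f x) powr s" for x using q by (simp add: powr_powr)
 have "f \<in> borel_measurable sigmaS" using f by (simp add: in_Lp_def)
 then have m: "(%x. \<bar>f x\<bar> powr q) \<in> borel_measurable sigmaS" by simp
 have "LL (s / q) (%x. \<bar>f x\<bar> powr q)" using f m unfolding in_Lp_def e by simp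
 then have "(\<integral>S x. norm (\<bar>f x\<bar> powr q)) <= measure sigmaS (space sigmaS) powr (1 - 1 / (s / q)) * nL (s / q) (%x. \<bar>f x\<bar> powr q)"
  by (rule L1_le_Lp[OF sg.finite_measure_axioms]) (use q in simp)
 also have "nL (s / q) (%x. \<bar>f x\<bar> powr q) = nL s f powr q" unfolding Lp_nm_def e using q by (simp add: powr_powr)
 finally have "(\<integral>S x. norm (f x) powr q) powr (1 / q) <= ((4 * pi) powr (1 - q / s) * nL s f powr q) powr (1 / q)"
  using q by (intro powr_mono2) (simp_all add: measure_sigmaS)
 then show ?thesis using q by (simp add: Lp_nm_def powr_mult powr_powr)
qed

text \<open>Membership of a in L^p is the goal, so the test functions are built from bounded
  truncations of a. The hypothesis passes from polynomials to test functions in L^2 because q < 2,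
  and Fatou's lemma removes the truncation.\<close>

lemma Lp_by_duality:
 assumes p: "2 < p" and a: "LL 2 a" and K: "0 <= K"
  and b: "!!\<phi>. real_polynomial_function \<phi> ==> (\<integral>S x. a x * \<phi> x) <= K * nL (p / (p - 1)) \<phi>"
 shows "LL p a"
proof -
 define q where "q = p / (p - 1)"
 have q: "1 < q" "1/p + 1/q = 1" "(p - 1) * q = p" using conjugate_exponent[of p] p by (auto simp: q_def)
 have q2: "q < 2" using p by (simp add: q_def field_simps)
 have am[measurable]: "a \<in> borel_measurable sigmaS" using a by (simp add: in_Lp_def)
 have dual: "(\<integral>S x. a x * \<psi> x) <= K * nL q \<psi>" if \<psi>: "LL 2 \<psi>" for \<psi>
 proof -
  obtain \<phi> :: "nat => R3 => real" where \<phi>: "!!n. real_polynomial_function (\<phi> n)" "!!n. LL 2 (\<phi> n)" "Lconv 2 \<phi> \<psi>"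
   using Lp_poly_seq[OF \<psi>] by auto
  have d: "LL 2 (%x. \<phi> n x - \<psi> x)" for n by (intro in_Lp_diff \<phi> \<psi>) simp
  have Lq: "LL q f" if "LL 2 f" for f :: "R3 => real" by (rule in_Lp_finite_mono[OF sg.finite_measure_axioms that]) (use q q2 in auto)
  have "Lconv q \<phi> \<psi>"
   by (rule tendsto_le0[OF _ _ \<phi>(3)]) (use Lp_lower_exponent[OF _ q2 d] q in auto)
  from Lp_nm_tendsto[OF Lq[OF \<phi>(2)] Lq[OF \<psi>] _ this] have r: "(%n. K * nL q (\<phi> n)) \<longlonglongrightarrow> K * nL q \<psi>" using q by (intro tendsto_intros) auto
  have i: "integrable sigmaS (%x. a x * \<phi> n x)" "integrable sigmaS (%x. a x * \<psi> x)" for n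
   using Holder(1)[OF a \<phi>(2)] Holder(1)[OF a \<psi>] by auto
  have "(%n. (\<integral>S x. a x * \<phi> n x) - (\<integral>S x. a x * \<psi> x)) \<longlonglongrightarrow> 0"
  proof (rule Lim_null_comparison[OF always_eventually], rule allI)
   fix n
   have "(\<integral>S x. a x * \<phi> n x) - (\<integral>S x. a x * \<psi> x) = (\<integral>S x. a x * (\<phi> n x - \<psi> x))"
    using i by (simp add: right_diff_distrib)
   then show "norm ((\<integral>S x. a x * \<phi> n x) - (\<integral>S x. a x * \<psi> x)) <= nL 2 a * nL 2 (%x. \<phi> n x - \<psi> x)"
    using order_trans[OF integral_abs_bound Holder(2)[OF a d, of n]] by simp
   show "(%n. nL 2 a * nL 2 (%x. \<phi> n x - \<psi> x)) \<longlonglongrightarrow> 0" by (rule tendsto_mult_right_zero[OF \<phi>(3)])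
  qed
  then have l: "(%n. \<integral>S x. a x * \<phi> n x) \<longlonglongrightarrow> (\<integral>S x. a x * \<psi> x)" by (rule LIM_zero_cancel)
  show ?thesis by (rule LIMSEQ_le[OF l r]) (use b \<phi>(1) in \<open>auto simp: q_def\<close>)
 qed
 \<comment> \<open>Cutting to 0 instead of clipping makes the product of a with the test function
   exactly |t n|^p.\<close>
 define t where "t n x = (if \<bar>a x\<bar> <= real n then a x else 0)" for n :: nat and x
 have tm[measurable]: "t n \<in> borel_measurable sigmaS" for n unfolding t_def by measurable
 have tb: "\<bar>t n x\<bar> <= real n" for n x by (auto simp: t_def)
 have tL: "LL s (t n)" if "0 < s" for n s using sg.Lp_nm_uniform(1)[of "t n" "real n" s] tb tm that by simp
 have bd: "nL p (t n) <= K" for n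
 proof -
  define \<psi> where "\<psi> x = \<bar>t n x\<bar> powr (p - 2) * t n x" for x
  have \<psi>n: "norm (\<psi> x) = \<bar>t n x\<bar> powr (p - 1)" for x
   by (cases "t n x = 0") (simp_all add: \<psi>_def abs_mult powr_diff powr_numeral power2_eq_square field_simps)
  have "LL 2 \<psi>"
  proof (rule sg.Lp_nm_uniform(1))
   show "norm (\<psi> x) <= real n powr (p - 1)" for x unfolding \<psi>n using tb[of n x] p by (intro powr_mono2) auto
  qed (auto simp: \<psi>_def[abs_def])
  note le = dual[OF this]
  define I where "I = (\<integral>S x. norm (t n x) powr p)"
  have "a x * \<psi> x = norm (t n x) powr p" for x
   by (cases "t n x = 0") (auto simp: \<psi>_def t_def powr_diff powr_numeral power2_eq_square field_simps split: if_splits)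
  moreover have "nL q \<psi> = I powr (1/q)" unfolding Lp_nm_def I_def \<psi>n powr_powr q(3) by simp
  ultimately have le: "I <= K * I powr (1/q)" using le by (simp add: I_def)
  have I0: "0 <= I" by (simp add: I_def)
  show ?thesis using powr_self_bound[OF I0 K q(2) le] by (simp add: Lp_nm_def I_def)
 qed
 show ?thesis
 proof (rule Lp_fatou(1)[OF tL bd])
  show "AE x in sigmaS. (%n. t n x) \<longlonglongrightarrow> a x"
  proof (rule AE_I2, rule tendsto_eventually)
   fix x
   obtain N where N: "\<bar>a x\<bar> <= real N" using real_arch_simple by blast
   show "\<forall>\<^sub>F n in sequentially. t n x = a x"
    by (rule eventually_sequentiallyI[of N]) (use N in \<open>auto simp: t_def\<close>)
  qed
 qed (use p in auto)
qed

text \<open>The projection is given in L^2, which is contained in L^p for p <= 2. For p > 2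
  orthogonality turns the pairing of F . x with a polynomial \<phi> into the pairing of hs with a
  field W whose potential has the coefficients of \<phi> divided by 2l + 1, and W is bounded in
  L^q.\<close>

lemma proj_plus_Lp:
 assumes p: "1 < p" and pr: "proj_plus hs F" and hs: "LL p hs"
 shows "EX g. plus_field p g F"
proof -
 obtain Fs where P: "LL 2 hs" "LL 2 F" "!!n. Fs n \<in> Eplus_span" "Lconv 2 Fs F"
  "!!l Y. Y \<in> sph_harm l ==> (\<integral>S x. (hs x - F x) \<bullet> Eplus l Y x) = 0"
  using pr unfolding proj_plus_def Lp_eqs by blast
 have "ALL n. EX u. harm_pair u (Fs n)" using P(3) Eplus_span_harm_pair by blast
 from choice[OF this] obtain us where us: "ALL n. harm_pair (us n) (Fs n)" ..
 have pf: "plus_field 2 (us n) (Fs n)" for n using us by (intro harm_pair_plus_field) auto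
 from plus_field_limit[OF pf P(2,4)] obtain g where g: "plus_field 2 g F" by auto
 show ?thesis
 proof (cases "p <= 2")
  case True
  have "LL p g" "LL p F" using g p True by (auto simp: plus_field_def intro: in_Lp_finite_mono[OF sg.finite_measure_axioms])
  then show ?thesis using g unfolding plus_field_def by blast
 next
  case False
  define q where "q = p / (p - 1)"
  have q: "1 < q" "1/p + 1/q = 1" using conjugate_exponent[OF p] by (auto simp: q_def)
  have q1: "1 <= q" using q by simp
  from Riesz_sgrad[OF q(1)] obtain C where C: "0 < C" "ALL Ys N. (ALL l. Ys l \<in> sph_harm l) -->
   nL q (sgrad (%x. \<Sum>l<N. 1 / (2 * real l + 1) * Ys l x)) <= C * nL q (%x. \<Sum>l<N. Ys l x)" by (elim exE conjE)
  have Fx: "LL 2 (%x. F x \<bullet> x)" by (intro LL_normal P(2); simp)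
  have Fi: "integrable sigmaS F" "integrable sigmaS hs" "integrable sigmaS (%x. F x \<bullet> x)" using P Fx by (auto intro: LL_int)
  have a: "LL p (%x. F x \<bullet> x)"
  proof (rule Lp_by_duality[OF _ Fx])
   show "2 < p" using False by simp
   show "0 <= nL p hs * (1 + C)" using C(1) by simp
   fix \<phi> :: "R3 => real" assume "real_polynomial_function \<phi>"
   from HspE[OF Hsp_poly[OF this]] obtain Ys N where Y: "ALL l. Ys l \<in> sph_harm l" "ALL x M. x \<in> SS --> N <= M --> \<phi> x = (\<Sum>l<M. Ys l x)" by metis
   have \<phi>Y: "\<phi> x = (\<Sum>l<N. Ys l x)" if "x \<in> SS" for x using Y(2) that by simp
   have n\<phi>: "nL q \<phi> = nL q (%x. \<Sum>l<N. Ys l x)" by (rule Lp_nm_cong) (simp add: \<phi>Y)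
   define Zs where "Zs l x = 1 / (2 * real l + 1) * Ys l x" for l x
   have Z: "Zs l \<in> sph_harm l" for l unfolding Zs_def[abs_def] by (rule sph_harm_cmult) (use Y in blast)
   define u where "u x = (\<Sum>l<N. Zs l x)" for x
   define W where "W x = (\<Sum>l<N. Eplus l (Zs l) x)" for x
   have hp: "harm_pair u W" unfolding harm_pair_def u_def[abs_def] W_def[abs_def] using Z by blast
   note D = harm_pairD[OF hp]
   have Ec: "continuous_on SS (Eplus l (Zs l))" for l unfolding Eplus_def[abs_def]
    by (intro continuous_intros sph_harm_cont[OF Z] C1g_sgrad_cont sph_harm_C1g[OF Z])
   have "(\<integral>S x. (F x \<bullet> x) * \<phi> x) = (\<integral>S x. (\<Sum>l<N. (F x \<bullet> x) * Ys l x))"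
    by (rule LINT_cong) (simp_all add: \<phi>Y sum_distrib_left)
   also have "... = (\<Sum>l<N. \<integral>S x. (F x \<bullet> x) * Ys l x)"
    by (rule LINT_sum) (intro int_mult_cont Fi sph_harm_cont[OF Y(1)[rule_format]])
   also have "... = (\<Sum>l<N. \<integral>S x. hs x \<bullet> Eplus l (Zs l) x)"
   proof (rule sum.cong[OF refl])
    fix l
    have "(\<integral>S x. (F x \<bullet> x) * Ys l x) = (\<integral>S x. (2 * real l + 1) * ((F x \<bullet> x) * Zs l x))"
     by (rule LINT_cong) (auto simp: Zs_def field_simps)
    also have "... = (2 * real l + 1) * (\<integral>S x. (F x \<bullet> x) * Zs l x)" by (rule integral_mult_right_zero)
    also have "... = (\<integral>S x. F x \<bullet> Eplus l (Zs l) x)" using Eplus_pairing[OF g _ Z, of l] by simp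
    also have "... = (\<integral>S x. hs x \<bullet> Eplus l (Zs l) x)"
     using P(5)[OF Z, of l] int_inner_cont[OF Fi(1) Ec] int_inner_cont[OF Fi(2) Ec] by (simp add: inner_diff_left)
    finally show "(\<integral>S x. (F x \<bullet> x) * Ys l x) = (\<integral>S x. hs x \<bullet> Eplus l (Zs l) x)" .
   qed
   also have "... = (\<integral>S x. hs x \<bullet> W x)" unfolding W_def inner_sum_right
    by (rule LINT_sum[symmetric]) (rule int_inner_cont[OF Fi(2) Ec])
   also have "... <= (\<integral>S x. \<bar>norm (hs x) * norm (W x)\<bar>)"
   proof (rule integral_mono)
    show "integrable sigmaS (%x. hs x \<bullet> W x)" by (rule int_inner_cont[OF Fi(2) D(3)])
    show "integrable sigmaS (%x. \<bar>norm (hs x) * norm (W x)\<bar>)"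
     by (intro integrable_abs int_mult_cont integrable_norm Fi continuous_intros D(3))
    show "hs x \<bullet> W x <= \<bar>norm (hs x) * norm (W x)\<bar>" for x using norm_cauchy_schwarz[of "hs x" "W x"] by simp
   qed
   also have "... <= nL p (%x. norm (hs x)) * nL q (%x. norm (W x))"
    by (rule Holder(2)) (use hs p q cont_LL[OF D(3) q1] in \<open>auto simp: in_Lp_def\<close>)
   also have "... = nL p hs * nL q W" by (simp add: Lp_nm_def)
   also have "... <= nL p hs * ((1 + C) * nL q \<phi>)"
   proof (rule mult_left_mono)
    have uL: "LL q (%x. W x \<bullet> x)" "LL q (sgrad u)" by (intro cont_LL q1 continuous_intros D(3) C1g_sgrad_cont D(2))+
    have "nL q W = nL q (%x. (W x \<bullet> x) *R x - sgrad u x)" by (rule Lp_nm_cong) (use D(6) in simp)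
    also have "... <= nL q (%x. (W x \<bullet> x) *R x) + nL q (sgrad u)" by (intro Lp_nm_triangle_diff LL_radial uL q1)
    also have "nL q (%x. (W x \<bullet> x) *R x) = nL q (%x. W x \<bullet> x)" by (rule LL_radial(2)[OF uL(1)])
    \<comment> \<open>The symbol (l+1)/(2l+1) of the normal component is the average of 1 and
      1/(2l+1), both contractive.\<close>
    also have "nL q (%x. W x \<bullet> x) = nL q (%x. \<Sum>l<N. (\<Sum>j<2. 1/2 * (if j = (0::nat) then 1 else 1 / (real (2 * l) + 1))) * Ys l x)"
    proof (rule Lp_nm_cong)
     fix x assume "x \<in> space sigmaS"
     then have x: "x \<in> SS" by simp
     have "W x \<bullet> x = (\<Sum>l<N. (real l + 1) * Zs l x)"
      using x sgrad_normal[OF x] by (simp add: W_def inner_sum_left Eplus_def inner_diff_left dot_square_norm)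
     also have "... = (\<Sum>l<N. (\<Sum>j<2. 1/2 * (if j = (0::nat) then 1 else 1 / (real (2 * l) + 1))) * Ys l x)"
      by (intro sum.cong refl) (auto simp: Zs_def numeral_2_eq_2 divide_simps algebra_simps)
     finally show "W x \<bullet> x = (\<Sum>l<N. (\<Sum>j<2. 1/2 * (if j = (0::nat) then 1 else 1 / (real (2 * l) + 1))) * Ys l x)" .
    qed
    also have "... <= nL q (%x. \<Sum>l<N. Ys l x)"
    proof -
     have "contractive q (%l. \<Sum>j<2. 1/2 * (if j = (0::nat) then 1 else 1 / (real (2 * l) + 1)))"
     proof (rule contractive_sum[where \<beta>="%j l. if j = (0::nat) then 1 else 1 / (real (2 * l) + 1)" and c="%_. 1/2", OF _ _ _ q1])
      show "contractive q (%l. if j = (0::nat) then 1 else 1 / (real (2 * l) + 1))" for j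
       using contractive_const[of 1 q] contractive_recip[of q 2] q1 by (cases "j = 0") simp_all
     qed auto
     then show ?thesis using Y(1) unfolding contractive_def by blast
    qed
    also have "nL q (sgrad u) <= C * nL q (%x. \<Sum>l<N. Ys l x)"
     using mp[OF spec[OF spec[OF C(2), of Ys], of N] Y(1)] by (simp only: u_def[abs_def] Zs_def)
    finally show "nL q W <= (1 + C) * nL q \<phi>" by (simp add: n\<phi> distrib_right)
   qed simp
   finally show "(\<integral>S x. (F x \<bullet> x) * \<phi> x) <= nL p hs * (1 + C) * nL (p / (p - 1)) \<phi>" by (simp add: q_def mult.assoc)
  qed
  \<comment> \<open>With F . x in L^p the potential can be rebuilt there. It has the coefficients of
    g and so equals g almost everywhere, and comparing weak gradients puts F in L^p.\<close>
  obtain g' where g': "LL p g'" "nL p g' <= nL p (%x. F x \<bullet> x)" "suc_mult g' (%x. F x \<bullet> x)" by (rule suc_mult_exists[OF p a])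
  have gg: "suc_mult g (%x. F x \<bullet> x)" "LL 2 g" "wgrad g (%x. (F x \<bullet> x) *R x - F x)" using g by (auto simp: plus_field_def)
  have ae: "AE x in sigmaS. g' x = g x" by (rule suc_mult_cong_AE[OF g'(3) gg(1)]) simp
  from Lplus_exists[OF p g'(1) a g'(3)] obtain F1 where F1: "LL p F1" "wgrad g' (%x. (F x \<bullet> x) *R x - F1 x)" by blast
  from wgrad_unique[OF F1(2) gg(3) ae] have "AE x in sigmaS. F1 x = F x" by simp
  then have "LL p F" by (rule in_Lp_cong_AE[OF F1(1) in_Lp_measurable[OF P(2)]])
  moreover have "LL p g" by (rule in_Lp_cong_AE[OF g'(1) in_Lp_measurable[OF gg(2)] ae])
  ultimately show ?thesis using gg unfolding plus_field_def by blast
 qed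
qed

lemma Lp_plus_plus_field:
 assumes p: "1 < p" and F: "F \<in> Lp_plus p" shows "EX g. plus_field p g F"
proof -
 from F obtain hs Fs where L: "LL p F" "!!n. LL p (hs n)" "!!n. proj_plus (hs n) (Fs n)" "Lconv p Fs F"
  unfolding Lp_plus_def Lp_eqs by blast
 have "ALL n. EX g. plus_field p g (Fs n)" using proj_plus_Lp[OF p L(3) L(2)] by blast
 from choice[OF this] obtain gs where "ALL n. plus_field p (gs n) (Fs n)" ..
 then show ?thesis using plus_field_limit[OF _ L(1,4) p] by blast
qed

text \<open>Fields of harmonic pairs are their own projections, so one sequence serves as both hs
  and Fs in the definition of \<open>Lp_plus\<close>.\<close>

lemma harm_limit_Lp_plus:
 assumes p: "1 < p" and hp: "!!n. harm_pair (us n) (Fs n)" and F: "LL p F" and lim: "Lconv p Fs F"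
 shows "F \<in> Lp_plus p"
proof -
 have L: "LL s (Fs n)" if "1 <= s" for s n by (rule cont_LL[OF harm_pairD(3)[OF hp] that])
 have "proj_plus (Fs n) (Fs n)" for n
  unfolding proj_plus_def Lp_eqs
  by (intro conjI exI[of _ "%_. Fs n"]) (use harm_pairD(4)[OF hp] L in auto)
 then show ?thesis unfolding Lp_plus_def Lp_eqs using F lim L[of p] L[of 2] p
  by (intro CollectI conjI exI[of _ F] exI[of _ Fs]) auto
qed

text \<open>\<open>Lp_plus\<close> is a set of functions, not of classes, whereas the boundary limit
  in (c) fixes F only almost everywhere.\<close>

lemma Lp_plus_cong_AE:
 assumes "F \<in> Lp_plus p" "AE x in sigmaS. F x = F' x" "F' \<in> borel_measurable sigmaS" "1 < p"
 shows "F' \<in> Lp_plus p"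
proof -
 obtain g where "plus_field p g F" using Lp_plus_plus_field[OF assms(4,1)] by blast
 then have g: "LL p g" "LL p F" by (auto simp: plus_field_def)
 from plus_field_Lplus[OF \<open>plus_field p g F\<close> assms(4)] obtain F1 where F1: "Lplus_rel p g F1" "AE x in sigmaS. F1 x = F x" by blast
 obtain us Fs where D: "ALL n. harm_pair (us n) (Fs n)" "Lconv p Fs F1" "LL p F1"
  using Lplus_approx[OF assms(4)] g(1) F1(1) unfolding pot_approx_def by blast
 have ae: "AE x in sigmaS. F1 x = F' x" using F1(2) assms(2) by eventually_elim simp
 have m: "Fs n \<in> borel_measurable sigmaS" for n using D(1) harm_pairD(3) by (blast intro: sg.cont_meas)
 have "nL p (%x. Fs n x - F1 x) = nL p (%x. Fs n x - F' x)" for n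
  by (rule Lp_nm_cong_AE) (use m[of n] in_Lp_measurable[OF D(3)] assms(3) ae in auto)
 then show ?thesis using harm_limit_Lp_plus[OF assms(4) D(1)[rule_format] in_Lp_cong_AE[OF D(3) assms(3) ae]] D(2) by simp
qed

section \<open>Poisson integrals of vector fields\<close>

lemma vec_int_nth: "integrable sigmaS G ==> (\<integral>S x. G x) $ i = (\<integral>S x. (G x $ i :: real))"
 using integral_bounded_linear[OF bounded_linear_vec_nth, of sigmaS G i] by simp

lemma PoissonV_nth:
 assumes F: "integrable sigmaS F" and x: "x \<in> ball 0 1" shows "PoissonV F x $ i = Poisson (%y. F y $ i) x"
proof -
 obtain B where B: "!!y. y \<in> SS ==> norm (Pker x y) <= B" using sg.cont_bound[of "Pker x"] Pker_cont_y[OF x] by auto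
 have [measurable]: "F \<in> borel_measurable sigmaS" "Pker x \<in> borel_measurable sigmaS" using F Pker_cont_y[OF x] by (auto intro: sg.cont_meas)
 have "integrable sigmaS (%y. Pker x y *R F y)"
 proof (rule LINT_bound)
  show "integrable sigmaS (%y. B *R F y)" using F by simp
  show "AE y in sigmaS. norm (Pker x y *R F y) <= norm (B *R F y)"
  proof (rule AE_I2)
   fix y assume "y \<in> space sigmaS"
   then have "\<bar>Pker x y\<bar> <= \<bar>B\<bar>" using B[of y] by simp
   then show "norm (Pker x y *R F y) <= norm (B *R F y)" by (simp add: mult_right_mono)
  qed
 qed measurable
 then show ?thesis unfolding PoissonV_def Poisson_def by (subst vec_int_nth) simp_all
qed

lemma PoissonV_Fatou:
 fixes F :: "R3 => R3"
 assumes F: "integrable sigmaS F"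
 shows "AE x in sigmaS. ((%r. PoissonV F (r *R x)) \<longlongrightarrow> F x) (at_left 1)"
proof -
 have "AE x in sigmaS. ALL i:UNIV. ((%r. Poisson (%y. F y $ i) (r *R x)) \<longlongrightarrow> F x $ i) (at_left 1)"
  by (intro AE_finite_allI Poisson_Fatou int_nth F) simp
 then show ?thesis
 proof (rule AE_mp, intro AE_I2 impI)
  fix x assume x: "x \<in> space sigmaS" and l: "ALL i:UNIV. ((%r. Poisson (%y. F y $ i) (r *R x)) \<longlongrightarrow> F x $ i) (at_left 1)"
  show "((%r. PoissonV F (r *R x)) \<longlongrightarrow> F x) (at_left 1)"
  proof (rule vec_tendstoI)
   fix i
   have "\<forall>\<^sub>F r in at_left 1. Poisson (%y. F y $ i) (r *R x) = PoissonV F (r *R x) $ i"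
    by (rule eventually_mono[OF at_left_ball[of x]]) (use x PoissonV_nth[OF F] in auto)
   then show "((%r. PoissonV F (r *R x) $ i) \<longlongrightarrow> F x $ i) (at_left 1)"
    using l by (auto elim: Lim_transform_eventually[rotated])
  qed
 qed
qed

definition Pfield :: "(R3 => real) => R3 => R3" where
 "Pfield g x = (2 * (x \<bullet> grad (Poisson g) x) + Poisson g x) *R x - (norm x)\<^sup>2 *R grad (Poisson g) x"

text \<open>On the sphere the components of \<open>Eplus l Y\<close> agree with the polynomials of
 \<open>sph_harm_up\<close>, which are harmonic and hence reproduced by the Poisson integral.\<close>

lemma PoissonV_harm:
 assumes hp: "harm_pair u F" and x: "x \<in> ball 0 1" shows "PoissonV F x = Pfield u x"
proof -
 from hp obtain Ys N where Y': "ALL l. Ys l \<in> sph_harm l" and u: "u = (%x. \<Sum>l<(N::nat). Ys l x)" and F: "F = (%x. \<Sum>l<N. Eplus l (Ys l) x)"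
  unfolding harm_pair_def by (elim exE conjE)
 note Y = Y'[rule_format]
 have sum: "Poisson (%y. \<Sum>l<N. Z l y) z = (\<Sum>l<N. Z l z)" if z: "z \<in> ball 0 1" and Z: "!!l. EX m. Z l \<in> sph_harm m" for Z z
 proof -
  have c: "continuous_on SS (Z l)" for l using Z[of l] sph_harm_cont by blast
  have "Poisson (%y. \<Sum>l<N. Z l y) z = (\<Sum>l<N. Poisson (Z l) z)"
   unfolding Poisson_alt sum_distrib_right
   by (rule LINT_sum) (intro int_mult_cont Pker_cont_y z sg.cont_int, simp add: c)
  also have "... = (\<Sum>l<N. Z l z)" using Poisson_sph_harm[OF _ z] Z by (intro sum.cong) blast+
  finally show ?thesis .
 qed
 have Pu: "Poisson u z = u z" if "z \<in> ball 0 1" for z unfolding u by (rule sum[OF that]) (use Y in blast)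
 note C = harm_pairD(2)[OF hp]
 have gu: "grad u x = (\<Sum>l<N. grad (Ys l) x)" unfolding u by (rule C1g_grad[OF harm_sum_C1g[OF Y]])
 have "(u has_derivative (%h. grad u x \<bullet> h)) (at x)" using C by (simp add: C1g_def)
 then have "(Poisson u has_derivative (%h. grad u x \<bullet> h)) (at x)"
  by (rule has_derivative_transform_within_open[where s="ball 0 1"]) (use x Pu in auto)
 then have gP: "grad (Poisson u) x = grad u x" by (rule grad_eqI)
 show ?thesis
 proof (subst vec_eq_iff, rule allI)
  fix i
  define H where "H l y = (2 * real l + 1) * (y $ i * Ys l y) - (y \<bullet> y) * grad (Ys l) y $ i" for l y
  have "PoissonV F x $ i = Poisson (%y. F y $ i) x"
   by (rule PoissonV_nth[OF sg.cont_int x]) (use harm_pairD(3)[OF hp] in auto)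
  also have "... = Poisson (%y. \<Sum>l<N. H l y) x" unfolding Poisson_def
  proof (rule LINT_cong[OF refl])
   fix y assume "y \<in> space sigmaS"
   then have "y \<bullet> y = 1" by (simp add: dot_square_norm)
   then have "Eplus l (Ys l) y $ i = H l y" for l by (simp add: Eplus_def sgrad_def H_def sph_harm_euler[OF Y] algebra_simps)
   then show "Pker x y * F y $ i = Pker x y * (\<Sum>l<N. H l y)" by (simp add: F)
  qed
  also have "... = (\<Sum>l<N. H l x)" by (rule sum[OF x]) (use sph_harm_up[OF Y, of _ i] in \<open>auto simp: H_def[abs_def]\<close>)
  also have "... = Pfield u x $ i"
   unfolding Pfield_def gP Pu[OF x] gu by (simp add: u H_def inner_sum_right sph_harm_euler[OF Y] dot_square_norm
    sum_subtractf sum.distrib sum_distrib_left sum_distrib_right algebra_simps)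
  finally show "PoissonV F x $ i = Pfield u x $ i" .
 qed
qed

text \<open>At a fixed interior x both sides are built from integrals of g and F against continuous
  kernels, hence pass to limits in L^p, and harmonic pairs approximate g and F
  simultaneously.\<close>

theorem PoissonV_Lplus:
 assumes p: "1 < p" and g: "LL p g" and F: "Lplus_rel p g F" and x: "x \<in> ball 0 1"
 shows "PoissonV F x = Pfield g x"
proof -
 have p1: "1 <= p" using p by simp
 obtain us Fs where D: "ALL n. harm_pair (us n) (Fs n)" "Lconv p us g"
  "Lconv p Fs F" "LL p F" using Lplus_approx[OF p] g F unfolding pot_approx_def by blast
 note hp = D(1)[rule_format]
 have L: "LL p (us n)" "LL p (Fs n)" for n by (intro cont_LL p1 harm_pairD(3)[OF hp] C1g_cont[OF harm_pairD(2)[OF hp]])+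
 have Pl: "(%n. Poisson (f n) x) \<longlonglongrightarrow> Poisson f0 x" if "!!n. LL p (f n)" "LL p f0" "Lconv p f f0" for f f0
  unfolding Poisson_alt by (rule pairing_tendsto_LL[OF that p Pker_cont_y[OF x]])
 have gl: "(%n. grad (Poisson (us n)) x) \<longlonglongrightarrow> grad (Poisson g) x"
 proof (rule vec_tendstoI)
  fix i
  have e: "grad (Poisson f) x $ i = (\<integral>S y. f y * gP x y $ i)" if "LL p f" for f
  proof -
   have fi: "integrable sigmaS f" by (rule LL_int[OF that p1])
   have "integrable sigmaS (%y. f y *R gP x y)" by (rule sg.int_bdd_mult[OF _ fi]) (use gP_cont_y[OF x] in simp)
   then show ?thesis unfolding Poisson_deriv(2)[OF x fi] by (subst vec_int_nth) simp_all
  qed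
  show "(%n. grad (Poisson (us n)) x $ i) \<longlonglongrightarrow> grad (Poisson g) x $ i"
   unfolding e[OF L(1)] e[OF g] by (rule pairing_tendsto_LL[OF L(1) g D(2) p]) (intro continuous_intros gP_cont_y[OF x])
 qed
 have "(%n. Pfield (us n) x) \<longlonglongrightarrow> Pfield g x" unfolding Pfield_def by (intro tendsto_intros gl Pl[OF L(1) g D(2)])
 moreover have "(%n. PoissonV (Fs n) x) \<longlonglongrightarrow> PoissonV F x"
 proof (rule vec_tendstoI)
  fix i
  have "(%n. Poisson (%y. Fs n y $ i) x) \<longlonglongrightarrow> Poisson (%y. F y $ i) x"
   by (rule Pl) (intro LL_nth(1) LL_nth_tendsto L D p1)+
  then show "(%n. PoissonV (Fs n) x $ i) \<longlonglongrightarrow> PoissonV F x $ i"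
   using PoissonV_nth[OF LL_int[OF L(2) p1] x] PoissonV_nth[OF LL_int[OF D(4) p1] x] by simp
 qed
 ultimately show ?thesis using PoissonV_harm[OF hp x] LIMSEQ_unique by simp
qed

definition bfield :: "(R3 => real) => R3 => real => R3" where
 "bfield g y = (%r. (2 * ((r *R y) \<bullet> grad (Poisson g) (r *R y)) + Poisson g (r *R y)) *R (r *R y)
   - r^2 *R grad (Poisson g) (r *R y))"

lemma Lplus_boundary:
 assumes p: "1 < p" and g: "LL p g" and F: "Lplus_rel p g F"
 shows "AE y in sigmaS. (bfield g y \<longlongrightarrow> F y) (at_left 1)"
proof -
 have "LL p F" using Lplus_approx[OF p] g F unfolding pot_approx_def by blast
 then have "integrable sigmaS F" by (rule LL_int) (use p in simp)
 from PoissonV_Fatou[OF this] show ?thesis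
 proof (rule AE_mp, intro AE_I2 impI)
  fix y assume y: "y \<in> space sigmaS" and l: "((%r. PoissonV F (r *R y)) \<longlongrightarrow> F y) (at_left 1)"
  have "\<forall>\<^sub>F r in at_left 1. PoissonV F (r *R y) = bfield g y r"
  proof (rule eventually_mono[OF at_left_ball[of y]])
   fix r :: real assume r: "r *R y \<in> ball 0 1 & 0 < r & r < 1"
   have "(norm (r *R y))\<^sup>2 = r\<^sup>2" using y by simp
   then show "PoissonV F (r *R y) = bfield g y r"
    using PoissonV_Lplus[OF p g F, of "r *R y"] r by (simp only: Pfield_def bfield_def)
  qed (use y in simp)
  then show "(bfield g y \<longlongrightarrow> F y) (at_left 1)"
   by (rule Lim_transform_eventually[OF l])
 qed
qed

text \<open>In (c) the measurability of F has to be derived from the boundary limit; the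
  completeness of \<open>sigmaS\<close> provides it.\<close>

lemma sigmaS_measurable_AE:
 fixes F :: "R3 => R3"
 assumes F: "F \<in> borel_measurable sigmaS" and ae: "AE x in sigmaS. F x = F' x" shows "F' \<in> borel_measurable sigmaS"
proof (rule measurableI)
 fix A :: "R3 set" assume A: "A \<in> sets borel"
 have "complete_measure sigmaS" unfolding sigmaS_def by (rule completion.complete_measure_axioms)
 then show "F' -` A \<inter> space sigmaS \<in> sets sigmaS"
 proof (rule complete_measure.in_sets_AE[OF _ _ measurable_sets[OF F A]])
  show "AE x in sigmaS. (x \<in> F -` A \<inter> space sigmaS) = (x \<in> F' -` A \<inter> space sigmaS)" using ae by eventually_elim auto
 qed simp
qed simp

theorem mainTheorem11:
  fixes p :: real
  assumes "1 < p"
  shows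
    \<comment> \<open>(a) L_+ is an isomorphism of W^{1,p} onto L^p_+\<close>
    "((\<forall>g\<in>W1p p. \<exists>F. Lplus_rel p g F)
      \<and> (\<forall>g\<in>W1p p. \<forall>F1 F2. Lplus_rel p g F1 \<longrightarrow> Lplus_rel p g F2 \<longrightarrow>
            (AE x in sigmaS. F1 x = F2 x))
      \<and> (\<forall>g1\<in>W1p p. \<forall>g2\<in>W1p p. \<forall>F1 F2 a b. Lplus_rel p g1 F1 \<longrightarrow> Lplus_rel p g2 F2 \<longrightarrow>
            Lplus_rel p (\<lambda>x. a * g1 x + b * g2 x) (\<lambda>x. a *\<^sub>R F1 x + b *\<^sub>R F2 x))
      \<and> (\<forall>g\<in>W1p p. \<forall>F. Lplus_rel p g F \<longrightarrow> F \<in> Lp_plus p)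
      \<and> (\<exists>C. \<forall>g\<in>W1p p. \<forall>F. Lplus_rel p g F \<longrightarrow> Lpv_norm p F \<le> C * W1p_norm p g)
      \<and> (\<exists>C. \<forall>g\<in>W1p p. \<forall>F. Lplus_rel p g F \<longrightarrow> W1p_norm p g \<le> C * Lpv_norm p F)
      \<and> (\<forall>F\<in>Lp_plus p. \<exists>g\<in>W1p p. \<exists>F'. Lplus_rel p g F' \<and> (AE x in sigmaS. F' x = F x)))
     \<and>
    \<comment> \<open>(b) Poisson integral of L_+ g\<close>
     (\<forall>g\<in>W1p p. \<forall>F. Lplus_rel p g F \<longrightarrow> (\<forall>x\<in>ball 0 1.
        PoissonV F x = (2 * (x \<bullet> grad (Poisson g) x) + Poisson g x) *\<^sub>R x
                       - (norm x)^2 *\<^sub>R grad (Poisson g) x))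
     \<and>
    \<comment> \<open>(c) characterisation of L^p_+ by boundary values\<close>
     (\<forall>F. F \<in> Lp_plus p \<longleftrightarrow>
        (\<exists>g\<in>W1p p. AE y in sigmaS.
           ((\<lambda>r. (2 * ((r *\<^sub>R y) \<bullet> grad (Poisson g) (r *\<^sub>R y)) + Poisson g (r *\<^sub>R y)) *\<^sub>R (r *\<^sub>R y)
                  - r^2 *\<^sub>R grad (Poisson g) (r *\<^sub>R y)) \<longlongrightarrow> F y) (at_left 1)))"
proof -
 note p = assms
 have p1: "1 <= p" using p by simp
 have gL: "LL p g" if "g \<in> W1p p" for g using that by (simp add: W1p_def Lp_eqs)
 from Lplus_approx[OF p] obtain C where C: "0 < C" and A: "ALL g F. LL p g --> Lplus_rel p g F --> (EX h. pot_approx p C g h F & LL p h & suc_mult g h & wgrad g (%x. h x *R x - F x))" by (elim exE conjE)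
 have A': "EX h. LL p F & LL p h & suc_mult g h & (AE x in sigmaS. h x = F x \<bullet> x) & nL p F <= C * nL p h & wgrad g (%x. h x *R x - F x)"
  if "g \<in> W1p p" "Lplus_rel p g F" for g F
  using mp[OF mp[OF spec[OF spec[OF A, of g], of F] gL[OF that(1)]] that(2)] unfolding pot_approx_def by blast
 have ex: "EX F. Lplus_rel p g F" if "g \<in> W1p p" for g
 proof -
  from W1p_suc_mult[OF p that] obtain h where "LL p g" "LL p h" "suc_mult g h" .
  from Lplus_exists[OF p this] show ?thesis by blast
 qed
 have uniq: "AE x in sigmaS. F1 x = F2 x" if g: "g \<in> W1p p" and F: "Lplus_rel p g F1" "Lplus_rel p g F2" for g F1 F2
 proof -
  from A'[OF g F(1)] obtain h where h: "suc_mult g h" "wgrad g (%x. h x *R x - F1 x)" by blast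
  from A'[OF g F(2)] obtain k where k: "suc_mult g k" "wgrad g (%x. k x *R x - F2 x)" by blast
  have "AE x in sigmaS. h x = k x" by (rule mult_rel_unique[OF h(1) k(1)]) simp
  moreover have "AE x in sigmaS. h x *R x - F1 x = k x *R x - F2 x" by (rule wgrad_unique[OF h(2) k(2)]) simp
  ultimately show ?thesis by eventually_elim simp
 qed
 have lin: "Lplus_rel p (%x. a * g1 x + b * g2 x) (%x. a *R F1 x + b *R F2 x)"
  if g: "g1 \<in> W1p p" "g2 \<in> W1p p" and F: "Lplus_rel p g1 F1" "Lplus_rel p g2 F2" for g1 g2 F1 F2 a b
 proof -
  from F(1) obtain h1 G1 where h1: "LL p h1" "suc_mult g1 h1" "sgrad_rel p g1 G1" "F1 = (%x. h1 x *R x - G1 x)" unfolding Lplus_rel_def Lp_eqs by blast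
  from F(2) obtain h2 G2 where h2: "LL p h2" "suc_mult g2 h2" "sgrad_rel p g2 G2" "F2 = (%x. h2 x *R x - G2 x)" unfolding Lplus_rel_def Lp_eqs by blast
  have comb: "LL p (%x. a * u x + b * v x)" if "LL p u" "LL p v" for u v
   using in_Lp_add[OF in_Lp_scaleR[OF that(1), of a] in_Lp_scaleR[OF that(2), of b] p1] by simp
  have m: "suc_mult (%x. a * g1 x + b * g2 x) (%x. a * h1 x + b * h2 x)" by (rule mult_rel_lin[OF h1(2) h2(2)])
  note gc = comb[OF gL[OF g(1)] gL[OF g(2)]] and hc = comb[OF h1(1) h2(1)]
  \<comment> \<open>The relation is wanted for this very representative. Some gradient of the
    combination exists, and it may be exchanged for a G1 + b G2, which agrees with it almost
    everywhere.\<close>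
  from Lplus_exists[OF p gc hc m] obtain F0 where F0: "Lplus_rel p (%x. a * g1 x + b * g2 x) F0" by blast
  then obtain G where G: "sgrad_rel p (%x. a * g1 x + b * g2 x) G" unfolding Lplus_rel_def by blast
  have "AE x in sigmaS. G x = a *R G1 x + b *R G2 x"
   by (rule wgrad_unique[OF sgrad_rel_wgrad[OF G gc p] wgrad_lin[OF sgrad_rel_wgrad[OF h1(3) gL[OF g(1)] p] sgrad_rel_wgrad[OF h2(3) gL[OF g(2)] p]]]) simp
  moreover have "(%x. a *R G1 x + b *R G2 x) \<in> borel_measurable sigmaS"
   using h1(3) h2(3) by (auto simp: sgrad_rel_def Lpv_def)
  ultimately have "sgrad_rel p (%x. a * g1 x + b * g2 x) (%x. a *R G1 x + b *R G2 x)" by (rule sgrad_rel_cong[OF G])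
  moreover have "(%x. a *R F1 x + b *R F2 x) = (%x. (a * h1 x + b * h2 x) *R x - (a *R G1 x + b *R G2 x))"
   by (simp add: h1(4) h2(4) fun_eq_iff algebra_simps)
  ultimately show ?thesis unfolding Lplus_rel_def Lp_eqs using hc m by blast
 qed
 have mem: "F \<in> Lp_plus p" if g: "g \<in> W1p p" and F: "Lplus_rel p g F" for g F
  using mp[OF mp[OF spec[OF spec[OF A, of g], of F] gL[OF g]] F] harm_limit_Lp_plus[OF p] unfolding pot_approx_def by blast
 have up: "nL p F <= (C + 3) * W1p_norm p g" if g: "g \<in> W1p p" and F: "Lplus_rel p g F" for g F
 proof -
  obtain h where h: "LL p h" "suc_mult g h" "nL p F <= C * nL p h" using A'[OF g F] by blast
  have "C * nL p h <= (C + 3) * W1p_norm p g" using suc_mult_W1p(3)[OF p gL[OF g] h(1,2)] C by (intro mult_mono) auto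
  then show ?thesis using h(3) by simp
 qed
 have low: "W1p_norm p g <= (C + 3) * nL p F" if g: "g \<in> W1p p" and F: "Lplus_rel p g F" for g F
 proof -
  obtain h where h: "LL p F" "LL p h" "suc_mult g h" "AE x in sigmaS. h x = F x \<bullet> x" using A'[OF g F] by blast
  note n = LL_normal[OF h(1) _ p1]
  have "nL p h = nL p (%x. F x \<bullet> x)" by (rule Lp_nm_cong_AE[OF in_Lp_measurable[OF h(2)] in_Lp_measurable[OF n(1)] h(4)]) simp
  then have "W1p_norm p g <= 3 * nL p F" using suc_mult_W1p(4)[OF p gL[OF g] h(2,3)] n(2) by simp
  also have "... <= (C + 3) * nL p F" using C by (intro mult_right_mono) auto
  finally show ?thesis .
 qed
 have sur: "EX g:W1p p. EX F'. Lplus_rel p g F' & (AE x in sigmaS. F' x = F x)" if "F \<in> Lp_plus p" for F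
 proof -
  from Lp_plus_plus_field[OF p that] obtain g where "plus_field p g F" ..
  from plus_field_Lplus[OF this p] show ?thesis by blast
 qed
 note bdry = Lplus_boundary[OF p gL]
 have c1: "EX g:W1p p. AE y in sigmaS. (bfield g y \<longlongrightarrow> F y) (at_left 1)" if "F \<in> Lp_plus p" for F
 proof -
  from sur[OF that] obtain g F' where g: "g \<in> W1p p" "Lplus_rel p g F'" "AE x in sigmaS. F' x = F x" by blast
  show ?thesis by (rule bexI[OF _ g(1)], use bdry[OF g(1,2)] g(3) in eventually_elim) simp
 qed
 have c2: "F \<in> Lp_plus p" if g: "g \<in> W1p p" and ae: "AE y in sigmaS. (bfield g y \<longlongrightarrow> F y) (at_left 1)" for F g
 proof -
  from ex[OF g] obtain F' where F': "Lplus_rel p g F'" ..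
  have e: "AE x in sigmaS. F' x = F x"
   using bdry[OF g F'] ae by eventually_elim (erule (1) tendsto_unique[OF trivial_limit_at_left_real])
  have "F' \<in> borel_measurable sigmaS" using A'[OF g F'] unfolding in_Lp_def by blast
  from Lp_plus_cong_AE[OF mem[OF g F'] e sigmaS_measurable_AE[OF this e] p] show ?thesis .
 qed
 \<comment> \<open>C + 3 dominates both constants, C of the upper and 3 of the lower bound, so one
   witness fills both existential quantifiers.\<close>
 show ?thesis
  unfolding Lp_eqs
  by (intro conjI ballI allI impI exI[of _ "C + 3"] iffI)
    ((rule ex uniq lin mem up low sur PoissonV_Lplus[OF p gL, unfolded Pfield_def] c1[unfolded bfield_def]; assumption)
     | (elim bexE, rule c2[unfolded bfield_def], assumption, assumption))+
qed

end
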